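(* The set of singular critical points of $A$ is finite.
   Context: Setting. Let $a>0$ and let $w,p,q:\mathbb R\to\mathbb R$ be measurable and $a$-periodic, with $w,q,p^{-1}$ integrable over $(0,a)$, $w\neq0$ a.e. and $p>0$ a.e. Put $\mathfrak a(f):=\frac1w\big(-(pf')'+qf\big)$. $L^2_{|w|}(\mathbb R)$ has scalar product $(f,g)=\int_{\mathbb R}f\overline g|w|\,dx$. The maximal operator $A$ is $Af:=\mathfrak a(f)$, $\operatorname{dom}A=\{f\in L^2_{|w|}(\mathbb R): f,pf'\in AC_{\rm loc}(\mathbb R),\ \mathfrak a(f)\in L^2_{|w|}(\mathbb R)\}$. Let $\mathcal H_a:=L^2_{|w|}(0,a)$ (scalar product $\int_0^af\overline g|w|\,dx$), and for $t\in\mathbb R$ let $A(t)f:=\mathfrak a(f)$ with $\operatorname{dom}A(t)=\{f\in\mathcal H_a: f,pf'\in AC([0,a]),\ \mathfrak a(f)\in\mathcal H_a,\ f(a)=e^{it}f(0),\ (pf')(a)=e^{it}(pf')(0)\}$. Discriminant. For $\lambda\in\mathbb C$, $\varphi_\lambda,\psi_\lambda$ are the solutions of $\mathfrak a(u)=\lambda u$ with $\varphi_\lambda(0)=1$, $(p\varphi_\lambda')(0)=0$, $\psi_\lambda(0)=0$, $(p\psi_\lambda')(0)=1$. The Floquet discriminant is the entire function $D(\lambda)=\varphi_\lambda(a)+(p\psi_\lambda')(a)$ and $\dot D$ is its derivative. One has $\sigma(A)=\{\lambda: D(\lambda)\in[-2,2]\}$. The set of critical points of $A$ is $c(A):=\{\lambda\in\sigma(A):\dot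 D(\lambda)=0\}$. Curves. A curve is a continuous map $\gamma:\mathcal J\to\mathbb C$ on a real interval $\mathcal J$, identified with its image; it is analytic if it is injective and analytic at each interior point of $\mathcal J$. A regular spectral curve of $A$ is an analytic curve $\gamma:\mathcal J\to\sigma(A)$ with $\dot D\neq0$ on $\gamma$. $\mathfrak B_0(\gamma)$ is the system of Borel subsets of $\gamma$ whose closure is contained in $\gamma$. Spectral function. With $\mathcal I:=[-\pi,\pi]$, the Gelfand transform $\mathcal G:L^2_{|w|}(\mathbb R)\to L^2(\mathcal I,\mathcal H_a)$, $(\mathcal Gf)(t)=\lim_{N\to\infty}\frac1{\sqrt{2\pi}}\sum_{n=-N}^Ne^{-int}f(\cdot+na)$ (limit in $L^2(\mathcal I,\mathcal H_a)$), is unitary. For $\Delta\in\mathfrak B_0(\gamma)$, $\gamma$ a regular spectral curve, the value $E(\Delta)$ of the spectral function of $A$ is $E(\Delta)=\mathcal G^{-1}\widetilde E(\Delta)\mathcal G$, where $(\widetilde E(\Delta)F)(t)=E(t;\Delta)F(t)$ and $E(t;\Delta)$ is the Riesz–Dunford spectral projection of $A(t)$ corresponding to $\sigma(A(t))\cap\Delta$ (and $0$ if this set is empty). Singular critical point. A critical point $\lambda_0$ of $A$ is called regular if for some domain $\mathcal U\subset\mathbb C$ with $\lambda_0\in\mathcal U$ and $\overline{\mathcal U}\cap c(A)=\{\lambda_0\}$ one has $\sup_\gamma\sup_{\Delta\subset\mathcal U,\,\Delta\in\mathfrak B_0(\gamma)}\|E(\Delta)\|<\infty$, the first supremum running over all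 regular spectral curves $\gamma$ of $A$ with $\lambda_0$ in the boundary of $\gamma$ relative to $\sigma(A)$. Otherwise it is called singular. *)

theory Defs
  imports "HOL-Complex_Analysis.Complex_Analysis"
begin

section \<open>Absolutely continuous functions\<close>

definition abs_cont_on :: "real \<Rightarrow> real \<Rightarrow> (real \<Rightarrow> complex) \<Rightarrow> bool" where
  "abs_cont_on c d f \<longleftrightarrow>
     (\<forall>\<epsilon>>0. \<exists>\<delta>>0. \<forall>P. finite P \<longrightarrow>
        (\<forall>(s, t)\<in>P. c \<le> s \<and> s < t \<and> t \<le> d) \<longrightarrow>
        pairwise (\<lambda>(s, t) (s', t'). disjnt {s<..<t} {s'<..<t'}) P \<longrightarrow>
        (\<Sum>(s, t)\<in>P. t - s) < \<delta> \<longrightarrow>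
        (\<Sum>(s, t)\<in>P. norm (f t - f s)) < \<epsilon>)"

definition loc_abs_cont :: "(real \<Rightarrow> complex) \<Rightarrow> bool" where
  "loc_abs_cont f \<longleftrightarrow> (\<forall>c d. abs_cont_on c d f)"


section \<open>Square integrable functions and unbounded operators\<close>

text \<open>
  The elements of the Hilbert space \<open>L\<^sup>2(M)\<close> are represented by functions; equality in
  \<open>L\<^sup>2(M)\<close> is equality almost everywhere with respect to \<open>M\<close>.
\<close>

definition L2 :: "real measure \<Rightarrow> (real \<Rightarrow> complex) set" where
  "L2 M = {f \<in> borel_measurable M. integrable M (\<lambda>x. (norm (f x))\<^sup>2)}"

definition L2_inner :: "real measure \<Rightarrow> (real \<Rightarrow> complex) \<Rightarrow> (real \<Rightarrow> complex) \<Rightarrow> complex" where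
  "L2_inner M f g = (\<integral>x. f x * cnj (g x) \<partial>M)"

definition L2_norm :: "real measure \<Rightarrow> (real \<Rightarrow> complex) \<Rightarrow> real" where
  "L2_norm M f = sqrt (\<integral>x. (norm (f x))\<^sup>2 \<partial>M)"

text \<open>The operator norm on \<open>L\<^sup>2(M)\<close>, with value \<open>\<infinity>\<close> for unbounded operators.\<close>

definition L2_opnorm :: "real measure \<Rightarrow> ((real \<Rightarrow> complex) \<Rightarrow> (real \<Rightarrow> complex)) \<Rightarrow> ennreal" where
  "L2_opnorm M S = (SUP f\<in>{f \<in> L2 M. L2_norm M f \<le> 1}. ennreal (L2_norm M (S f)))"

text \<open>
  An operator \<open>T\<close> in \<open>L\<^sup>2(M)\<close> is given by (representatives of) its graph.  The resolvent
  set consists of all \<open>z\<close> such that \<open>T - z\<close> is a bijection from the domain onto \<open>L\<^sup>2(M)\<close>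
  with bounded inverse; injectivity is part of the lower bound.
\<close>

type_synonym graph = "((real \<Rightarrow> complex) \<times> (real \<Rightarrow> complex)) set"

definition resolvent_set :: "real measure \<Rightarrow> graph \<Rightarrow> complex set" where
  "resolvent_set M T =
     {z. (\<forall>h\<in>L2 M. \<exists>(f, g)\<in>T. AE x in M. g x - z * f x = h x) \<and>
         (\<exists>C. \<forall>(f, g)\<in>T. L2_norm M f \<le> C * L2_norm M (\<lambda>x. g x - z * f x))}"

definition op_spectrum :: "real measure \<Rightarrow> graph \<Rightarrow> complex set" where
  "op_spectrum M T = - resolvent_set M T"

definition op_resolvent ::
  "real measure \<Rightarrow> graph \<Rightarrow> complex \<Rightarrow> (real \<Rightarrow> complex) \<Rightarrow> (real \<Rightarrow> complex)" where
  "op_resolvent M T z h = (SOME f. \<exists>g. (f, g) \<in> T \<and> (AE x in M. g x - z * f x = h x))"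

text \<open>
  A cycle, given as a list of closed paths, which lies in the resolvent set, surrounds the part
  \<open>S\<close> of the spectrum once in the positive sense, and does not surround the rest of the spectrum.
\<close>

definition separating_cycle :: "real measure \<Rightarrow> graph \<Rightarrow> complex set \<Rightarrow> (real \<Rightarrow> complex) list \<Rightarrow> bool" where
  "separating_cycle M T S \<Gamma> \<longleftrightarrow>
     (\<forall>\<gamma>\<in>set \<Gamma>. valid_path \<gamma> \<and> pathfinish \<gamma> = pathstart \<gamma> \<and> path_image \<gamma> \<subseteq> resolvent_set M T) \<and>
     (\<forall>z\<in>S. (\<Sum>\<gamma>\<leftarrow>\<Gamma>. winding_number \<gamma> z) = 1) \<and>
     (\<forall>z\<in>op_spectrum M T - S. (\<Sum>\<gamma>\<leftarrow>\<Gamma>. winding_number \<gamma> z) = 0)"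

text \<open>
  The Riesz-Dunford projection \<open>- 1 / (2 \<pi> i) \<integral>\<^sub>\<Gamma> (T - z)\<^sup>-\<^sup>1 dz\<close> corresponding to the part \<open>S\<close>
  of the spectrum of \<open>T\<close>.  The vector-valued contour integral is determined by its scalar
  products with the elements of \<open>L\<^sup>2(M)\<close>.  For empty \<open>S\<close> one can take the empty cycle, so that
  the projection is zero.
\<close>

definition riesz_projection ::
  "real measure \<Rightarrow> graph \<Rightarrow> complex set \<Rightarrow> (real \<Rightarrow> complex) \<Rightarrow> (real \<Rightarrow> complex)" where
  "riesz_projection M T S f =
     (SOME g. g \<in> L2 M \<and>
        (\<exists>\<Gamma>. separating_cycle M T S \<Gamma> \<and>
          (\<forall>h\<in>L2 M. L2_inner M g h =
             - 1 / (2 * of_real pi * \<i>) *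
               (\<Sum>\<gamma>\<leftarrow>\<Gamma>. contour_integral \<gamma> (\<lambda>z. L2_inner M (op_resolvent M T z f) h)))))"


section \<open>Curves\<close>

definition real_analytic_at :: "(real \<Rightarrow> complex) \<Rightarrow> real \<Rightarrow> bool" where
  "real_analytic_at \<gamma> s \<longleftrightarrow>
     (\<exists>c. \<exists>r>0. \<forall>x. \<bar>x - s\<bar> < r \<longrightarrow> (\<lambda>n. c n * of_real (x - s) ^ n) sums \<gamma> x)"

definition analytic_curve :: "real set \<Rightarrow> (real \<Rightarrow> complex) \<Rightarrow> bool" where
  "analytic_curve J \<gamma> \<longleftrightarrow>
     is_interval J \<and> continuous_on J \<gamma> \<and> inj_on \<gamma> J \<and> (\<forall>s\<in>interior J. real_analytic_at \<gamma> s)"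

text \<open>The system \<open>\<BB>\<^sub>0\<close> of a curve with image \<open>X\<close>.\<close>

definition borel_subsets0 :: "complex set \<Rightarrow> complex set set" where
  "borel_subsets0 X = {\<Delta> \<in> sets borel. \<Delta> \<subseteq> X \<and> closure \<Delta> \<subseteq> X}"


section \<open>Periodic Sturm-Liouville operators\<close>

context
  fixes a :: real and w p q :: "real \<Rightarrow> real"
begin

definition line_measure :: "real measure" where
  "line_measure = density lebesgue (\<lambda>x. ennreal \<bar>w x\<bar>)"

definition period_measure :: "real measure" where
  "period_measure = density (lebesgue_on {0<..<a}) (\<lambda>x. ennreal \<bar>w x\<bar>)"

text \<open>
  \<open>sl_expr X f u g\<close> expresses \<open>u = p f'\<close> and \<open>g = (1/w) (- (p f')' + q f)\<close> almost everywhere on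
  \<open>X\<close>.  The function \<open>u\<close> is needed because \<open>p f'\<close> is determined only almost everywhere, whereas
  the conditions on \<open>p f'\<close> below refer to its absolutely continuous representative.
\<close>

definition sl_expr :: "real set \<Rightarrow> (real \<Rightarrow> complex) \<Rightarrow> (real \<Rightarrow> complex) \<Rightarrow> (real \<Rightarrow> complex) \<Rightarrow> bool" where
  "sl_expr X f u g \<longleftrightarrow>
     (AE x in lebesgue_on X. \<exists>f' u'.
        (f has_vector_derivative f') (at x) \<and> (u has_vector_derivative u') (at x) \<and>
        u x = of_real (p x) * f' \<and>
        g x = 1 / of_real (w x) * (- u' + of_real (q x) * f x))"

definition maximal_op :: graph where
  "maximal_op =
     {(f, g). f \<in> L2 line_measure \<and> g \<in> L2 line_measure \<and>
        (\<exists>u. loc_abs_cont f \<and> loc_abs_cont u \<and> sl_expr UNIV f u g)}"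

definition fibre_op :: "real \<Rightarrow> graph" where
  "fibre_op t =
     {(f, g). f \<in> L2 period_measure \<and> g \<in> L2 period_measure \<and>
        (\<exists>u. abs_cont_on 0 a f \<and> abs_cont_on 0 a u \<and> sl_expr {0<..<a} f u g \<and>
             f a = exp (\<i> * of_real t) * f 0 \<and> u a = exp (\<i> * of_real t) * u 0)}"

abbreviation spectrum_A :: "complex set" where
  "spectrum_A \<equiv> op_spectrum line_measure maximal_op"

subsection \<open>Floquet discriminant and critical points\<close>

text \<open>
  The pair \<open>(y, p y')\<close> for the solution \<open>y\<close> of \<open>\<aa>(y) = z y\<close> with \<open>y(0) = c\<close>, \<open>(p y')(0) = d\<close>.
\<close>

definition sl_solution :: "complex \<Rightarrow> complex \<Rightarrow> complex \<Rightarrow> (real \<Rightarrow> complex) \<times> (real \<Rightarrow> complex)" where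
  "sl_solution z c d =
     (THE (y, u). loc_abs_cont y \<and> loc_abs_cont u \<and> sl_expr UNIV y u (\<lambda>x. z * y x) \<and>
        y 0 = c \<and> u 0 = d)"

definition discriminant :: "complex \<Rightarrow> complex" where
  "discriminant z = fst (sl_solution z 1 0) a + snd (sl_solution z 0 1) a"

definition critical_points :: "complex set" where
  "critical_points = {z \<in> spectrum_A. deriv discriminant z = 0}"

definition regular_spectral_curve :: "real set \<Rightarrow> (real \<Rightarrow> complex) \<Rightarrow> bool" where
  "regular_spectral_curve J \<gamma> \<longleftrightarrow>
     analytic_curve J \<gamma> \<and> \<gamma> ` J \<subseteq> spectrum_A \<and> (\<forall>z\<in>\<gamma> ` J. deriv discriminant z \<noteq> 0)"

subsection \<open>Gelfand transform and spectral function\<close>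

text \<open>
  The Bochner space \<open>L\<^sup>2([-\<pi>, \<pi>], L\<^sup>2(0, a))\<close>: strongly measurable functions, that is,
  almost everywhere norm limits of simple functions, with square integrable norm.
\<close>

definition L2_fibres :: "(real \<Rightarrow> real \<Rightarrow> complex) set" where
  "L2_fibres =
     {F. (\<forall>t\<in>{-pi..pi}. F t \<in> L2 period_measure) \<and>
         (\<exists>S. (\<forall>n. simple_function (lebesgue_on {-pi..pi}) (S n) \<and>
                    (\<forall>t\<in>{-pi..pi}. S n t \<in> L2 period_measure)) \<and>
              (AE t in lebesgue_on {-pi..pi}.
                 (\<lambda>n. L2_norm period_measure (\<lambda>x. S n t x - F t x)) \<longlonglongrightarrow> 0)) \<and>
         (\<integral>\<^sup>+t. ennreal ((L2_norm period_measure (F t))\<^sup>2) \<partial>lebesgue_on {-pi..pi}) < \<infinity>}"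

definition gelfand_partial_sum :: "nat \<Rightarrow> (real \<Rightarrow> complex) \<Rightarrow> real \<Rightarrow> real \<Rightarrow> complex" where
  "gelfand_partial_sum N f t x =
     1 / of_real (sqrt (2 * pi)) *
       (\<Sum>n\<in>{- int N..int N}. exp (- \<i> * of_int n * of_real t) * f (x + of_int n * a))"

definition gelfand :: "(real \<Rightarrow> complex) \<Rightarrow> real \<Rightarrow> real \<Rightarrow> complex" where
  "gelfand f =
     (SOME F. F \<in> L2_fibres \<and>
        (\<lambda>N. \<integral>\<^sup>+t. ennreal ((L2_norm period_measure (\<lambda>x. gelfand_partial_sum N f t x - F t x))\<^sup>2)
               \<partial>lebesgue_on {-pi..pi}) \<longlonglongrightarrow> 0)"

definition gelfand_inv :: "(real \<Rightarrow> real \<Rightarrow> complex) \<Rightarrow> (real \<Rightarrow> complex)" where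
  "gelfand_inv F =
     (SOME f. f \<in> L2 line_measure \<and>
        (AE t in lebesgue_on {-pi..pi}. AE x in period_measure. gelfand f t x = F t x))"

definition fibre_projection :: "complex set \<Rightarrow> real \<Rightarrow> (real \<Rightarrow> complex) \<Rightarrow> (real \<Rightarrow> complex)" where
  "fibre_projection \<Delta> t =
     riesz_projection period_measure (fibre_op t)
       (op_spectrum period_measure (fibre_op t) \<inter> \<Delta>)"

text \<open>
  For unbounded \<open>\<Delta>\<close> the set \<open>\<sigma>(A(t)) \<inter> \<Delta>\<close> may be infinite, in which case there is no Riesz-Dunford
  projection and \<open>spectral_function \<Delta>\<close> is unspecified.  This does not affect the notion of a regular
  critical point: its neighbourhood can always be replaced by a bounded one.
\<close>

definition spectral_function :: "complex set \<Rightarrow> (real \<Rightarrow> complex) \<Rightarrow> (real \<Rightarrow> complex)" where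
  "spectral_function \<Delta> f = gelfand_inv (\<lambda>t. fibre_projection \<Delta> t (gelfand f t))"

subsection \<open>Singular critical points\<close>

definition regular_critical_point :: "complex \<Rightarrow> bool" where
  "regular_critical_point z0 \<longleftrightarrow> z0 \<in> critical_points \<and>
     (\<exists>U. open U \<and> connected U \<and> z0 \<in> U \<and> closure U \<inter> critical_points = {z0} \<and>
        (SUP (J, \<gamma>)\<in>{(J, \<gamma>). regular_spectral_curve J \<gamma> \<and>
                               z0 \<in> top_of_set spectrum_A frontier_of (\<gamma> ` J)}.
           SUP \<Delta>\<in>{\<Delta> \<in> borel_subsets0 (\<gamma> ` J). \<Delta> \<subseteq> U}.
             L2_opnorm line_measure (spectral_function \<Delta>)) < \<infinity>)"

definition singular_critical_points :: "complex set" where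
  "singular_critical_points = {z0 \<in> critical_points. \<not> regular_critical_point z0}"

end

end

theory Submission
  imports Defs
begin

text \<open>
  The self-adjoint operator generated by \<open>p\<close>, \<open>q\<close> and the weight \<open>\<bar>w\<bar>\<close> is bounded from below, so that
  a solution \<open>f\<close> of \<open>(A(t) - z) f = h\<close> which is large compared with \<open>h\<close> has its energy
  \<open>\<integral> p \<bar>f'\<bar>\<^sup>2\<close> bounded by a multiple of \<open>\<parallel>f\<parallel>\<^sup>2\<close>.  Testing the equation with a smooth approximation
  of \<open>sgn w\<close> then bounds \<open>\<bar>z\<bar>\<close>.  Hence \<open>\<bar>Im z\<bar> \<parallel>(A(t) - z)\<^sup>-\<^sup>1\<parallel> \<le> 2 \<bar>z\<bar>\<close> for all \<open>t\<close> and all nonreal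
  \<open>z\<close> outside a disc, and all spectrum outside this disc is real.

  Since the resolvent grows at most like \<open>1 / \<bar>Im z\<bar>\<close>, its residues at the eigenvalues near a point
  \<open>z\<^sub>0\<close> outside the disc are bounded uniformly in \<open>t\<close>, and the number of these eigenvalues, which
  are zeros of \<open>D - 2 cos t\<close>, is bounded uniformly as well.  So the Riesz-Dunford projections of the
  fibres are uniformly bounded near \<open>z\<^sub>0\<close>, and by the isometry of the Gelfand transform so are the
  values of the spectral function: all critical points outside the disc are regular.  Inside the
  disc the nonconstant entire function \<open>D\<close> has only finitely many critical points.
\<close>

text \<open>Since \<open>w\<close> may change sign, A(t) is symmetric only with respect to the
  indefinite form \<integral> w f cnj g, and testing the equation with \<open>cnj f\<close> gives z
  \<integral> w |f|^2, which may vanish for f \<noteq> 0. This is why the resolvent estimate has two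
  stages: if it fails, the imaginary part of the tested equation makes z \<integral> w |f|^2 small,
  which bounds the energy; only then a second test, with a function close to sgn w, brings in
  \<integral> |w| |f|^2 = \<parallel>f\<parallel>^2. The same estimates with another test function
  show that \<open>D\<close> is not constant, on which both the count of eigenvalues and the
  finiteness of the critical points in a disc depend. Projections and transforms are selected by
  Hilbert choice, so that a fixed but unknown value has to be allowed for whenever no witness
  exists; the bounds therefore carry an additional constant. Measurability in t is established for
  norms of Gelfand transforms only, and the integrals over t are compared through measurable
  versions of these norms.\<close>

hide_const (open) Polynomial.content

section \<open>Absolutely continuous functions\<close>

lemma sum_integral_disjoint_intervals_le:
  fixes h :: "real \<Rightarrow> real"
  assumes P: "finite P" "\<forall>(s, t)\<in>P. {s<..<t} \<subseteq> T"
    and dis: "pairwise (\<lambda>(s, t) (s', t'). disjnt {s<..<t} {s'<..<t'}) P"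
    and h: "h integrable_on T" "\<And>x. x \<in> T \<Longrightarrow> 0 \<le> h x"
  shows "(\<Sum>(s, t)\<in>P. integral {s<..<t} h) \<le> integral T h"
proof -
  have ab: "h absolutely_integrable_on T"
    using h by (simp add: nonnegative_absolutely_integrable_1)
  have sub: "h integrable_on {fst i<..<snd i}" if "i \<in> P" for i
    using that P(2) by (intro set_lebesgue_integral_eq_integral(1) set_integrable_subset[OF ab]) (auto split: prod.splits)
  have "(h has_integral (\<Sum>i\<in>P. integral {fst i<..<snd i} h)) (\<Union>i\<in>P. {fst i<..<snd i})"
  proof (rule has_integral_UN[OF P(1)])
    show "pairwise (\<lambda>i i'. negligible ({fst i<..<snd i} \<inter> {fst i'<..<snd i'})) P"
    proof (rule pairwiseI)
      fix i j assume "i \<in> P" "j \<in> P" "i \<noteq> j"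
      then have "{fst i<..<snd i} \<inter> {fst j<..<snd j} = {}"
        using dis by (auto simp: pairwise_def disjnt_def split_beta simp del: greaterThanLessThan_iff Int_greaterThanLessThan)
      then show "negligible ({fst i<..<snd i} \<inter> {fst j<..<snd j})"
        by (simp only: negligible_empty)
    qed
  qed (use sub in \<open>auto simp: integrable_integral\<close>)
  then have "(\<Sum>i\<in>P. integral {fst i<..<snd i} h) \<le> integral T h"
    by (rule has_integral_subset_le[OF _ _ integrable_integral[OF h(1)], rotated]) (use P h in \<open>fastforce+\<close>)
  then show ?thesis
    by (simp add: split_beta)
qed

lemma sum_lengths_le_measure:
  assumes P: "finite P" "\<forall>(s, t)\<in>P. s \<le> t \<and> {s<..<t} \<subseteq> T"
    and dis: "pairwise (\<lambda>(s, t) (s', t'). disjnt {s<..<t} {s'<..<t'}) P"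
    and T: "T \<in> lmeasurable"
  shows "(\<Sum>(s, t)\<in>P. t - s) \<le> measure lebesgue T"
proof -
  have "(\<Sum>(s, t)\<in>P. integral {s<..<t} (\<lambda>x. 1::real)) \<le> integral T (\<lambda>x. 1)"
    by (rule sum_integral_disjoint_intervals_le) (use P dis T in \<open>auto simp: integrable_on_const\<close>)
  moreover have "(\<Sum>(s, t)\<in>P. integral {s<..<t} (\<lambda>x. 1::real)) = (\<Sum>(s, t)\<in>P. t - s)"
    using P by (intro sum.cong) (auto simp: integral_open_interval_real[symmetric])
  ultimately show ?thesis
    using T by (simp add: lmeasure_integral)
qed

lemma abs_cont_onD:
  assumes "abs_cont_on c d f" "\<epsilon> > 0"
  obtains \<delta> where "\<delta> > 0"
    "\<And>P. finite P \<Longrightarrow> (\<And>s t. (s, t) \<in> P \<Longrightarrow> c \<le> s \<and> s < t \<and> t \<le> d) \<Longrightarrow>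
        pairwise (\<lambda>(s, t) (s', t'). disjnt {s<..<t} {s'<..<t'}) P \<Longrightarrow>
        (\<Sum>(s, t)\<in>P. t - s) < \<delta> \<Longrightarrow> (\<Sum>(s, t)\<in>P. norm (f t - f s)) < \<epsilon>"
proof -
  from assms obtain \<delta> where "\<delta> > 0" and \<delta>: "\<forall>P. finite P \<longrightarrow>
        (\<forall>(s, t)\<in>P. c \<le> s \<and> s < t \<and> t \<le> d) \<longrightarrow>
        pairwise (\<lambda>(s, t) (s', t'). disjnt {s<..<t} {s'<..<t'}) P \<longrightarrow>
        (\<Sum>(s, t)\<in>P. t - s) < \<delta> \<longrightarrow>
        (\<Sum>(s, t)\<in>P. norm (f t - f s)) < \<epsilon>"
    unfolding abs_cont_on_def by blast
  show thesis
    by (rule that[OF \<open>\<delta> > 0\<close>]) (use \<delta> in \<open>auto split: prod.splits\<close>)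
qed

text \<open>The gauge treats two kinds of tags separately. At a tag outside \<open>N\<close> it
  enforces the linear approximation given by the derivative; at a tag in \<open>N\<close> it
  confines the interval to an open set of measure below \<open>\<theta>\<close>, and absolute
  continuity makes the total increment of \<open>F\<close> over these intervals small. Setting the
  integrand to 0 on \<open>N\<close> removes its contribution to the Riemann sum.\<close>

theorem abs_cont_fundamental_theorem:
  fixes F :: "real \<Rightarrow> complex"
  assumes "c \<le> d" and ac: "abs_cont_on c d F" and N: "negligible N"
    and der: "\<And>x. x \<in> {c..d} - N \<Longrightarrow> (F has_vector_derivative f x) (at x within {c..d})"
  shows "(f has_integral (F d - F c)) {c..d}"
proof -
  define f0 where "f0 x = (if x \<in> N then 0 else f x)" for x
  have "(f0 has_integral (F d - F c)) (cbox c d)"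
    unfolding has_integral
  proof (intro allI impI)
    fix e :: real
    assume e: "e > 0"
    \<comment> \<open>The summand 1 keeps the denominator positive for c = d and makes the total
      error strictly less than e / 2.\<close>
    define \<eta> where "\<eta> = e / (2 * (d - c + 1))"
    have \<eta>: "\<eta> > 0" "\<eta> * (d - c) < e / 2"
      using e \<open>c \<le> d\<close> by (auto simp: \<eta>_def field_simps)
    have "\<exists>\<delta>>0. x \<in> {c..d} - N \<longrightarrow>
         (\<forall>y\<in>{c..d}. norm (y-x) < \<delta> \<longrightarrow> norm (F y - F x - (y-x) *\<^sub>R f x) \<le> \<eta> * norm (y-x))" for x
    proof (cases "x \<in> {c..d} - N")
      case True
      from der[OF this, unfolded has_vector_derivative_def has_derivative_within_alt] \<eta>(1)
      show ?thesis by blast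
    qed (use zero_less_one in blast)
    then obtain \<delta> where \<delta>: "\<And>x. 0 < \<delta> x"
      "\<And>x y. x \<in> {c..d} - N \<Longrightarrow> y \<in> {c..d} \<Longrightarrow> norm (y-x) < \<delta> x \<Longrightarrow>
          norm (F y - F x - (y-x) *\<^sub>R f x) \<le> \<eta> * norm (y-x)"
      by metis
    obtain \<theta> where "\<theta> > 0" and \<theta>: "\<And>P. finite P \<Longrightarrow>
        (\<And>s t. (s, t) \<in> P \<Longrightarrow> c \<le> s \<and> s < t \<and> t \<le> d) \<Longrightarrow>
        pairwise (\<lambda>(s, t) (s', t'). disjnt {s<..<t} {s'<..<t'}) P \<Longrightarrow>
        (\<Sum>(s, t)\<in>P. t - s) < \<theta> \<Longrightarrow> (\<Sum>(s, t)\<in>P. norm (F t - F s)) < e / 2"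
      using abs_cont_onD[OF ac, of "e / 2"] e by (metis half_gt_zero)
    have "N \<in> sets lebesgue" "emeasure lebesgue N = 0"
      using N negligible_iff_null_sets by auto
    then obtain O' where O': "open O'" "N \<subseteq> O'" "O' \<in> lmeasurable" "measure lebesgue O' < \<theta>"
    proof -
      obtain T where T: "open T" "N \<subseteq> T" "(T - N) \<in> lmeasurable" "emeasure lebesgue (T - N) < ennreal \<theta>"
        using sets_lebesgue_outer_open[OF \<open>N \<in> sets lebesgue\<close> \<open>\<theta> > 0\<close>] by metis
      have Tm: "T \<in> lmeasurable"
        using T(2) fmeasurable.Un[OF T(3) negligible_imp_measurable[OF N]] by (simp add: Un_absorb2)
      moreover have "measure lebesgue T = measure lebesgue (T - N)"
        using N Tm by (metis measure_Diff_null_set negligible_iff_null_sets fmeasurableD)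
      moreover have "measure lebesgue (T - N) < \<theta>"
        using T(3,4) \<open>\<theta> > 0\<close> by (metis emeasure_eq_measure2 ennreal_less_iff measure_nonneg)
      ultimately show thesis using that T by metis
    qed
    define \<gamma> where "\<gamma> x = (if x \<in> N then O' else ball x (\<delta> x))" for x
    have "gauge \<gamma>"
      using O' \<delta>(1) by (auto simp: gauge_def \<gamma>_def)
    moreover have "norm ((\<Sum>(x, k)\<in>p. content k *\<^sub>R f0 x) - (F d - F c)) < e"
      if p: "p tagged_division_of cbox c d" and fine: "\<gamma> fine p" for p
    proof -
      have fin: "finite p" using p by blast
      have Fdc: "F d - F c = (\<Sum>(x,K)\<in>p. F(Sup K) - F(Inf K))" and dc: "d - c = (\<Sum>(x,K)\<in>p. Sup K - Inf K)"
        using additive_tagged_division_1[OF \<open>c \<le> d\<close>, where f=F] additive_tagged_division_1[OF \<open>c \<le> d\<close>, where f="\<lambda>x. x"] p by auto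
      have K: "\<exists>u v. K = {u..v} \<and> u \<le> v \<and> c \<le> u \<and> v \<le> d \<and> x \<in> {u..v} \<and> K \<subseteq> \<gamma> x
          \<and> Inf K = u \<and> Sup K = v \<and> content K = v - u" if xK: "(x, K) \<in> p" for x K
      proof -
        obtain u v where uv: "K = cbox u v" "x \<in> K" "K \<subseteq> cbox c d"
          using tagged_division_ofD(2,3,4)[OF p xK] by metis
        moreover have "K \<subseteq> \<gamma> x" using fine xK by blast
        moreover have "u \<le> v" using uv(1,2) by (metis box_real(2) atLeastatMost_empty_iff empty_iff)
        ultimately show ?thesis
          by (intro exI[of _ u] exI[of _ v]) (simp add: cInf_atLeastAtMost cSup_atLeastAtMost)
      qed
      define p1 where "p1 = {i \<in> p. fst i \<in> N}"
      define p2 where "p2 = {i \<in> p. fst i \<notin> N}"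
      have pp: "p = p1 \<union> p2" "p1 \<inter> p2 = {}" "finite p1" "finite p2"
        using fin by (auto simp: p1_def p2_def)
      have eq: "(\<Sum>(x, k)\<in>p. content k *\<^sub>R f0 x) - (F d - F c) =
        (\<Sum>i\<in>p2. content (snd i) *\<^sub>R f (fst i) - (F (Sup (snd i)) - F (Inf (snd i))))
        - (\<Sum>i\<in>p1. (F (Sup (snd i)) - F (Inf (snd i))))"
      proof -
        have "(\<Sum>(x, k)\<in>p. content k *\<^sub>R f0 x) - (F d - F c)
            = (\<Sum>i\<in>p. content (snd i) *\<^sub>R f0 (fst i) - (F (Sup (snd i)) - F (Inf (snd i))))"
          unfolding Fdc by (simp add: split_beta sum_subtractf)
        also have "\<dots> = (\<Sum>i\<in>p1. content (snd i) *\<^sub>R f0 (fst i) - (F (Sup (snd i)) - F (Inf (snd i))))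
            + (\<Sum>i\<in>p2. content (snd i) *\<^sub>R f0 (fst i) - (F (Sup (snd i)) - F (Inf (snd i))))"
          unfolding pp(1) using pp by (intro sum.union_disjoint)
        also have "(\<Sum>i\<in>p1. content (snd i) *\<^sub>R f0 (fst i) - (F (Sup (snd i)) - F (Inf (snd i))))
           = - (\<Sum>i\<in>p1. (F (Sup (snd i)) - F (Inf (snd i))))"
          unfolding sum_negf[symmetric] by (intro sum.cong) (auto simp: f0_def p1_def)
        also have "(\<Sum>i\<in>p2. content (snd i) *\<^sub>R f0 (fst i) - (F (Sup (snd i)) - F (Inf (snd i))))
          = (\<Sum>i\<in>p2. content (snd i) *\<^sub>R f (fst i) - (F (Sup (snd i)) - F (Inf (snd i))))"
          by (intro sum.cong) (auto simp: f0_def p2_def)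
        finally show ?thesis by simp
      qed
      have "norm (\<Sum>i\<in>p2. content (snd i) *\<^sub>R f (fst i) - (F (Sup (snd i)) - F (Inf (snd i))))
          \<le> (\<Sum>i\<in>p2. \<eta> * (Sup (snd i) - Inf (snd i)))"
      proof (rule sum_norm_le)
        fix i assume "i \<in> p2"
        then obtain x K where i: "i = (x, K)" "(x, K) \<in> p" "x \<notin> N" by (cases i) (auto simp: p2_def)
        obtain u v where uv: "K = {u..v}" "u \<le> v" "c \<le> u" "v \<le> d" "x \<in> {u..v}" "K \<subseteq> \<gamma> x"
          "Inf K = u" "Sup K = v" "content K = v - u" using K[OF i(2)] by blast
        have b: "u \<in> ball x (\<delta> x)" "v \<in> ball x (\<delta> x)"
          using uv i atLeastAtMost_iff by (auto simp: \<gamma>_def simp del: mem_ball dest: subsetD)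
        have b1: "norm (F u - F x - (u-x) *\<^sub>R f x) \<le> \<eta> * norm (u-x)"
          and b2: "norm (F v - F x - (v-x) *\<^sub>R f x) \<le> \<eta> * norm (v-x)"
          using \<delta>(2)[of x u] \<delta>(2)[of x v] b uv i by (auto simp: dist_real_def)
        have eqn: "content K *\<^sub>R f x - (F v - F u) = (F u - F x - (u-x) *\<^sub>R f x) - (F v - F x - (v-x) *\<^sub>R f x)"
          using uv by (simp add: algebra_simps)
        have "norm (content K *\<^sub>R f x - (F v - F u)) \<le> \<eta> * norm (u-x) + \<eta> * norm (v-x)"
          unfolding eqn by (rule norm_triangle_le_diff[OF add_mono[OF b1 b2]])
        also have "\<dots> = \<eta> * (v - u)" using uv by (simp add: algebra_simps)
        finally show "norm (content (snd i) *\<^sub>R f (fst i) - (F (Sup (snd i)) - F (Inf (snd i)))) \<le> \<eta> * (Sup (snd i) - Inf (snd i))"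
          using uv i by simp
      qed
      also have "\<dots> \<le> (\<Sum>i\<in>p. \<eta> * (Sup (snd i) - Inf (snd i)))"
      proof (intro sum_mono2 fin)
        fix i assume "i \<in> p - p2"
        then have "(fst i, snd i) \<in> p" by simp
        from K[OF this] have "Inf (snd i) \<le> Sup (snd i)" by blast
        then show "0 \<le> \<eta> * (Sup (snd i) - Inf (snd i))" using \<eta>(1) by simp
      qed (auto simp: p2_def)
      also have "\<dots> = \<eta> * (d - c)"
        unfolding dc by (simp add: sum_distrib_left split_beta)
      finally have 1: "norm (\<Sum>i\<in>p2. content (snd i) *\<^sub>R f (fst i) - (F (Sup (snd i)) - F (Inf (snd i)))) < e / 2"
        using \<eta>(2) by linarith
      \<comment> \<open>Absolute continuity concerns intervals with s < t. Degenerate intervals of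
        the division have no increment and are dropped, which also makes \<open>\<iota>\<close>
        injective.\<close>
      define p3 where "p3 = {i \<in> p1. Inf (snd i) < Sup (snd i)}"
      define \<iota> where "\<iota> i = (Inf (snd i), Sup (snd i))" for i :: "real \<times> real set"
      have disj: "disjnt {Inf (snd i)<..<Sup (snd i)} {Inf (snd j)<..<Sup (snd j)}" if "i \<in> p" "j \<in> p" "i \<noteq> j" for i j
      proof -
        have "interior (snd i) \<inter> interior (snd j) = {}"
          using p that tagged_division_ofD(5)[OF p, of "fst i" "snd i" "fst j" "snd j"] by simp
        moreover have "interior (snd i) = {Inf (snd i)<..<Sup (snd i)}" if "i \<in> p" for i
          using K[of "fst i" "snd i"] that interior_atLeastAtMost_real by (metis prod.collapse)
        ultimately show ?thesis using that by (simp add: disjnt_def)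
      qed
      have inj: "inj_on \<iota> p3"
      proof (rule inj_onI, rule ccontr)
        fix i j assume ij: "i \<in> p3" "j \<in> p3" "\<iota> i = \<iota> j" "i \<noteq> j"
        then have "disjnt {Inf (snd i)<..<Sup (snd i)} {Inf (snd j)<..<Sup (snd j)}"
          by (intro disj) (auto simp: p3_def p1_def)
        then show False using ij by (auto simp: p3_def \<iota>_def disjnt_def)
      qed
      have pw: "pairwise (\<lambda>(s, t) (s', t'). disjnt {s<..<t} {s'<..<t'}) (\<iota> ` p3)"
      proof (rule pairwiseI)
        fix a b assume "a \<in> \<iota> ` p3" "b \<in> \<iota> ` p3" "a \<noteq> b"
        then obtain i j where ij: "i \<in> p3" "j \<in> p3" "a = \<iota> i" "b = \<iota> j" "i \<noteq> j" by blast
        then have "disjnt {Inf (snd i)<..<Sup (snd i)} {Inf (snd j)<..<Sup (snd j)}"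
          by (intro disj) (simp_all add: p3_def p1_def)
        then show "(case a of (s, t) \<Rightarrow> \<lambda>(s', t'). disjnt {s<..<t} {s'<..<t'}) b"
          by (simp add: ij \<iota>_def)
      qed
      have "(\<Sum>(s, t)\<in>\<iota> ` p3. norm (F t - F s)) < e / 2"
      proof (rule \<theta>)
        show "finite (\<iota> ` p3)" using pp by (simp add: p3_def)
        show "c \<le> s \<and> s < t \<and> t \<le> d" if "(s, t) \<in> \<iota> ` p3" for s t
        proof -
          obtain i where "i \<in> p3" "(s, t) = \<iota> i" using \<open>(s, t) \<in> \<iota> ` p3\<close> by (rule imageE)
          moreover obtain x L where "i = (x, L)" by (cases i)
          ultimately have "(x, L) \<in> p" "s = Inf L" "t = Sup L" "s < t"
            by (simp_all add: p3_def p1_def \<iota>_def)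
          moreover obtain u v where "c \<le> u" "v \<le> d" "Inf L = u" "Sup L = v"
            using K[OF \<open>(x, L) \<in> p\<close>] by metis
          ultimately show ?thesis by simp
        qed
        have "(\<Sum>(s, t)\<in>\<iota> ` p3. t - s) \<le> measure lebesgue O'"
        proof (rule sum_lengths_le_measure[OF _ _ pw O'(3)])
          show "finite (\<iota> ` p3)" using pp by (simp add: p3_def)
          have "{Inf L<..<Sup L} \<subseteq> O'" if "(x, L) \<in> p3" for x L
          proof -
            have "L \<subseteq> O'" "{Inf L<..<Sup L} \<subseteq> L"
              using K[of x L] that by (auto simp: p3_def p1_def \<gamma>_def)
            then show ?thesis by blast
          qed
          then show "\<forall>(s, t)\<in>\<iota> ` p3. s \<le> t \<and> {s<..<t} \<subseteq> O'"
            unfolding \<iota>_def by (auto simp: p3_def)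
        qed
        then show "(\<Sum>(s, t)\<in>\<iota> ` p3. t - s) < \<theta>" using O' by linarith
      qed (rule pw)
      also have "(\<Sum>(s, t)\<in>\<iota> ` p3. norm (F t - F s)) = (\<Sum>i\<in>p3. norm (F (Sup (snd i)) - F (Inf (snd i))))"
        unfolding sum.reindex[OF inj] by (simp add: \<iota>_def)
      also have "\<dots> = (\<Sum>i\<in>p1. norm (F (Sup (snd i)) - F (Inf (snd i))))"
      proof (rule sum.mono_neutral_left)
        show "\<forall>i\<in>p1 - p3. norm (F (Sup (snd i)) - F (Inf (snd i))) = 0"
        proof
          fix i assume i: "i \<in> p1 - p3"
          then have "(fst i, snd i) \<in> p" by (simp add: p1_def)
          from K[OF this] have "Inf (snd i) = Sup (snd i)"
            using i by (auto simp: p3_def)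
          then show "norm (F (Sup (snd i)) - F (Inf (snd i))) = 0" by simp
        qed
      qed (use pp in \<open>auto simp: p3_def\<close>)
      finally have 2: "norm (\<Sum>i\<in>p1. (F (Sup (snd i)) - F (Inf (snd i)))) < e / 2"
        using norm_sum[of "\<lambda>i. F (Sup (snd i)) - F (Inf (snd i))" p1] by linarith
      show ?thesis
        unfolding eq
        by (rule le_less_trans[OF norm_triangle_ineq4]) (rule less_le_trans[OF add_strict_mono[OF 1 2]], simp)
    qed
    ultimately show "\<exists>\<gamma>. gauge \<gamma> \<and>
      (\<forall>\<D>. \<D> tagged_division_of (cbox c d) \<and> \<gamma> fine \<D> \<longrightarrow>
        norm ((\<Sum>(x, k)\<in>\<D>. content k *\<^sub>R f0 x) - (F d - F c)) < e)"
      by (intro exI[of _ \<gamma>] conjI allI impI) (assumption, elim conjE)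
  qed
  then show ?thesis
    unfolding box_real by (rule has_integral_spike[OF N, rotated]) (simp add: f0_def)
qed

lemma absolutely_integrable_interval_subset:
  fixes f :: "real \<Rightarrow> 'a::euclidean_space"
  assumes "f absolutely_integrable_on {c..d}" "{s..t} \<subseteq> {c..d}"
  shows "f absolutely_integrable_on {s..t}"
  using assms by (auto intro: set_integrable_subset)

lemma integral_interval_diff:
  fixes f :: "real \<Rightarrow> 'a::euclidean_space"
  assumes f: "f integrable_on {c..d}" and "c \<le> s" "s \<le> t" "t \<le> d"
  shows "integral {c..t} f - integral {c..s} f = integral {s..t} f"
proof -
  have "f integrable_on {c..t}"
    using f assms by (auto intro: integrable_subinterval_real)
  from Henstock_Kurzweil_Integration.integral_combine[OF _ _ this, of s] assms show ?thesis
    by (auto simp: algebra_simps)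
qed

text \<open>Lebesgue differentiation for the gauge integral. At a point of \<open>E k\<close> there
  are arbitrarily short intervals with this endpoint on which the Riemann term misses the integral
  by more than length / (k + 1). The Vitali covering theorem selects disjoint intervals of this kind
  that cover almost all of \<open>E k\<close>, and Henstock's lemma bounds the sum of their errors,
  hence their total length.\<close>

theorem indefinite_integral_has_derivative:
  fixes f :: "real \<Rightarrow> complex"
  assumes f: "f integrable_on {c..d}"
  obtains N where "negligible N"
    "\<And>x. x \<in> {c<..<d} - N \<Longrightarrow> ((\<lambda>x. integral {c..x} f) has_vector_derivative f x) (at x)"
proof -
  define F where "F x = integral {c..x} f" for x
  define I where "I x y = {min x y..max x y}" for x y :: real
  define bad where "bad k x y \<longleftrightarrow> y \<noteq> x \<and> \<bar>y - x\<bar> / Suc k < norm (content (I x y) *\<^sub>R f x - integral (I x y) f)"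
    for k :: nat and x y
  define E where "E k = {x \<in> {c<..<d}. \<forall>\<delta>>0. \<exists>y\<in>{c..d}. \<bar>y - x\<bar> < \<delta> \<and> bad k x y}" for k
  have "negligible (E k)" for k
    unfolding negligible_outer_le
  proof (intro allI impI)
    fix e :: real assume "e > 0"
    \<comment> \<open>Passing from error to length loses a factor k + 1, which this choice
      compensates.\<close>
    define \<epsilon> where "\<epsilon> = e / Suc k"
    have "\<epsilon> > 0" using \<open>e > 0\<close> by (simp add: \<epsilon>_def)
    obtain \<gamma> where "gauge \<gamma>" and \<gamma>: "\<And>p. p tagged_partial_division_of (cbox c d) \<Longrightarrow> \<gamma> fine p \<Longrightarrow>
        (\<Sum>(x,k)\<in>p. norm (content k *\<^sub>R f x - integral k f)) < \<epsilon>"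
      by (rule Henstock_lemma[OF f[folded box_real(2)] \<open>\<epsilon> > 0\<close>]) (rule that)
    define K where "K = {(x, y). x \<in> E k \<and> y \<in> {c..d} \<and> bad k x y \<and> I x y \<subseteq> \<gamma> x}"
    \<comment> \<open>The Vitali theorem speaks of balls, so each interval \<open>I x y\<close> is
      rewritten through its midpoint and half its length.\<close>
    define m where "m i = (case i of (x, y) \<Rightarrow> (x + y) / 2)" for i :: "real \<times> real"
    define r where "r i = (case i of (x, y) \<Rightarrow> \<bar>y - x\<bar> / 2)" for i :: "real \<times> real"
    have cb: "cball (m i) (r i) = I (fst i) (snd i)" for i
    proof (cases "fst i \<le> snd i")
      case True
      then show ?thesis
        unfolding cball_eq_atLeastAtMost m_def r_def I_def by (simp add: split_beta min_def max_def field_simps)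
    next
      case False
      then show ?thesis
        unfolding cball_eq_atLeastAtMost m_def r_def I_def by (simp add: split_beta min_def max_def field_simps)
    qed
    obtain C where C: "countable C" "C \<subseteq> K"
      "pairwise (\<lambda>i j. disjnt (cball (m i) (r i)) (cball (m j) (r j))) C"
      "negligible (E k - (\<Union>i\<in>C. cball (m i) (r i)))"
    proof (rule Vitali_covering_theorem_cballs[of K r "E k" m])
      show "0 < r i" if "i \<in> K" for i
        using that by (auto simp: r_def K_def bad_def)
      fix x \<delta> assume x: "x \<in> E k" and "(0::real) < \<delta>"
      have "open (\<gamma> x)" "x \<in> \<gamma> x" using \<open>gauge \<gamma>\<close> by (auto simp: gauge_def)
      then obtain \<rho> where \<rho>: "\<rho> > 0" "ball x \<rho> \<subseteq> \<gamma> x" by (meson openE)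
      have "min \<delta> \<rho> > 0" using \<rho> \<open>\<delta> > 0\<close> by simp
      then obtain y where y: "y \<in> {c..d}" "\<bar>y - x\<bar> < min \<delta> \<rho>" "bad k x y"
        using x unfolding E_def by blast
      have "I x y \<subseteq> ball x \<rho>"
        using y by (auto simp: I_def dist_real_def)
      then have "(x, y) \<in> K" using x y \<rho> by (auto simp: K_def)
      moreover have "x \<in> cball (m (x, y)) (r (x, y))" unfolding cb by (auto simp: I_def)
      moreover have "r (x, y) < \<delta>" using y \<open>\<delta> > 0\<close> by (auto simp: r_def)
      ultimately show "\<exists>i. i \<in> K \<and> x \<in> cball (m i) (r i) \<and> r i < \<delta>" by blast
    qed
    have bound: "measure lebesgue (\<Union>i\<in>C'. cball (m i) (r i)) \<le> e" if C': "C' \<subseteq> C" "finite C'" for C'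
    proof -
      define p where "p = (\<lambda>i. (fst i, cball (m i) (r i))) ` C'"
      have ne: "r i > 0" if "i \<in> C" for i
        using that C by (auto simp: r_def K_def bad_def)
      have inj: "inj_on (\<lambda>i. (fst i, cball (m i) (r i))) C'"
      proof (rule inj_onI, rule ccontr)
        fix i j assume ij: "i \<in> C'" "j \<in> C'" "(fst i, cball (m i) (r i)) = (fst j, cball (m j) (r j))" "i \<noteq> j"
        then have "disjnt (cball (m i) (r i)) (cball (m j) (r j))"
          using C(3) C' unfolding pairwise_def by blast
        moreover have "0 < r i" using ne ij C' by blast
        then have "m i \<in> cball (m i) (r i)" by simp
        ultimately show False using ij(3) unfolding disjnt_def by (metis Int_absorb empty_iff prod.inject)
      qed
      have pd: "p tagged_partial_division_of (cbox c d)"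
        unfolding tagged_partial_division_of_def
      proof (intro conjI allI impI)
        show "finite p" using C' by (simp add: p_def)
        fix x L assume "(x, L) \<in> p"
        then obtain i where i: "i \<in> C'" "x = fst i" "L = I (fst i) (snd i)" by (auto simp: p_def cb)
        then have "i \<in> K" using C C' by auto
        then show "x \<in> L" "L \<subseteq> cbox c d" "\<exists>a b. L = cbox a b"
          using i by (auto simp: I_def K_def E_def intro: exI)
      next
        fix x1 L1 x2 L2 assume a: "(x1, L1) \<in> p \<and> (x2, L2) \<in> p \<and> (x1, L1) \<noteq> (x2, L2)"
        then obtain i j where "i \<in> C'" "j \<in> C'" "i \<noteq> j" "L1 = cball (m i) (r i)" "L2 = cball (m j) (r j)"
          by (auto simp: p_def)
        then have "L1 \<inter> L2 = {}" using C(3) C' by (auto simp: pairwise_def disjnt_def)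
        then show "interior L1 \<inter> interior L2 = {}"
          using interior_subset by blast
      qed
      have fine: "\<gamma> fine p"
      proof (rule fineI)
        fix x L assume "(x, L) \<in> p"
        then obtain i where i: "i \<in> C'" "x = fst i" "L = I (fst i) (snd i)" by (auto simp: p_def cb)
        then have "i \<in> K" using C C' by auto
        then show "L \<subseteq> \<gamma> x" using i by (auto simp: K_def)
      qed
      have "measure lebesgue (\<Union>i\<in>C'. cball (m i) (r i)) \<le> (\<Sum>i\<in>C'. measure lebesgue (cball (m i) (r i)))"
        using C' by (intro measure_UNION_le) auto
      also have "\<dots> \<le> (\<Sum>i\<in>C'. Suc k * norm (content (cball (m i) (r i)) *\<^sub>R f (fst i) - integral (cball (m i) (r i)) f))"
      proof (rule sum_mono)
        fix i assume "i \<in> C'"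
        then have "i \<in> K" using C C' by auto
        then have "bad k (fst i) (snd i)" by (auto simp: K_def)
        moreover have "measure lebesgue (cball (m i) (r i)) = \<bar>snd i - fst i\<bar>"
          by (simp add: cb I_def min_def max_def)
        ultimately show "measure lebesgue (cball (m i) (r i)) \<le> Suc k * norm (content (cball (m i) (r i)) *\<^sub>R f (fst i) - integral (cball (m i) (r i)) f)"
          by (simp add: bad_def cb field_simps del: measure_lborel_Icc)
      qed
      also have "\<dots> = Suc k * (\<Sum>(x,k)\<in>p. norm (content k *\<^sub>R f x - integral k f))"
        unfolding p_def by (simp add: sum.reindex[OF inj] sum_distrib_left)
      also have "\<dots> \<le> Suc k * \<epsilon>"
        using \<gamma>[OF pd fine] by (intro mult_left_mono) auto
      also have "\<dots> = e" by (simp add: \<epsilon>_def)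
      finally show ?thesis .
    qed
    let ?U = "\<Union>i\<in>C. cball (m i) (r i)"
    have U: "?U \<in> lmeasurable" "measure lebesgue ?U \<le> e"
      by (rule fmeasurable_UN_bound[OF C(1) _ bound] measure_UN_bound[OF C(1) _ bound]; auto)+
    have "E k \<subseteq> ?U \<union> (E k - ?U)" by blast
    moreover have "?U \<union> (E k - ?U) \<in> lmeasurable"
      using U(1) negligible_imp_measurable[OF C(4)] by (rule fmeasurable.Un)
    moreover have "measure lebesgue (?U \<union> (E k - ?U)) \<le> e"
      using U(2) measure_Un_le[OF fmeasurableD[OF U(1)] fmeasurableD[OF negligible_imp_measurable[OF C(4)]]]
        negligible_imp_measure0[OF C(4)]
      by linarith
    ultimately show "\<exists>T. E k \<subseteq> T \<and> T \<in> lmeasurable \<and> measure lebesgue T \<le> e" by blast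
  qed
  then have neg: "negligible (\<Union>k. E k)"
    by (intro negligible_countable_Union) auto
  show thesis
  proof (rule that[OF neg])
    fix x assume x: "x \<in> {c<..<d} - (\<Union>k. E k)"
    have "((\<lambda>x. integral {c..x} f) has_vector_derivative f x) (at x within {c<..<d})"
      unfolding has_vector_derivative_def has_derivative_within_alt
    proof (intro conjI bounded_linear_scaleR_left allI impI)
      fix e :: real assume "e > 0"
      then obtain k where k: "1 / Suc k < e" by (metis nat_approx_posE)
      obtain \<delta> where \<delta>: "\<delta> > 0" "\<And>y. y \<in> {c..d} \<Longrightarrow> \<bar>y - x\<bar> < \<delta> \<Longrightarrow> \<not> bad k x y"
        using x unfolding E_def by blast
      have "norm (integral {c..y} f - integral {c..x} f - (y - x) *\<^sub>R f x) \<le> e * norm (y - x)"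
        if y: "y \<in> {c<..<d}" "norm (y - x) < \<delta>" for y
      proof -
        have "\<not> bad k x y" using y by (intro \<delta>(2)) auto
        then have "norm (content (I x y) *\<^sub>R f x - integral (I x y) f) \<le> \<bar>y - x\<bar> / Suc k"
          by (cases "y = x") (auto simp: bad_def I_def)
        moreover have "integral {c..y} f - integral {c..x} f - (y - x) *\<^sub>R f x
            = (if x \<le> y then - (content (I x y) *\<^sub>R f x - integral (I x y) f) else content (I x y) *\<^sub>R f x - integral (I x y) f)"
          using x y integral_interval_diff[OF f, of x y] integral_interval_diff[OF f, of y x]
          by (auto simp: I_def min_def max_def algebra_simps)
        ultimately have "norm (integral {c..y} f - integral {c..x} f - (y - x) *\<^sub>R f x) \<le> \<bar>y - x\<bar> / Suc k"
          by (cases "x \<le> y") (simp_all only: norm_minus_cancel if_True if_False)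
        also have "\<dots> = (1 / Suc k) * norm (y - x)" by simp
        also have "\<dots> \<le> e * norm (y - x)" using k by (intro mult_right_mono) auto
        finally show ?thesis .
      qed
      then show "\<exists>d'>0. \<forall>y\<in>{c<..<d}. norm (y - x) < d' \<longrightarrow>
        norm (integral {c..y} f - integral {c..x} f - (y - x) *\<^sub>R f x) \<le> e * norm (y - x)"
        using \<delta>(1) by blast
    qed
    then show "((\<lambda>x. integral {c..x} f) has_vector_derivative f x) (at x)"
      using x by (subst (asm) has_vector_derivative_within_open) auto
  qed
qed

section \<open>Absolutely continuous functions as indefinite integrals\<close>

definition nonoverlapping :: "real \<Rightarrow> real \<Rightarrow> (real \<times> real) set \<Rightarrow> bool" where
  "nonoverlapping c d P \<longleftrightarrow> finite P \<and> (\<forall>(s, t)\<in>P. c \<le> s \<and> s < t \<and> t \<le> d) \<and>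
     pairwise (\<lambda>(s, t) (s', t'). disjnt {s<..<t} {s'<..<t'}) P"

lemma abs_cont_on_iff:
  "abs_cont_on c d f \<longleftrightarrow> (\<forall>e>0. \<exists>\<delta>>0. \<forall>P. nonoverlapping c d P \<longrightarrow> (\<Sum>(s, t)\<in>P. t - s) < \<delta> \<longrightarrow>
     (\<Sum>(s, t)\<in>P. norm (f t - f s)) < e)"
  unfolding abs_cont_on_def nonoverlapping_def imp_conjL ..

lemma abs_cont_on_subinterval:
  assumes "abs_cont_on c d f" "c \<le> s" "t \<le> d"
  shows "abs_cont_on s t f"
proof -
  have "nonoverlapping c d P" if "nonoverlapping s t P" for P
    using that assms(2,3) unfolding nonoverlapping_def by fastforce
  then show ?thesis
    using assms(1) unfolding abs_cont_on_iff by meson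
qed

lemma abs_cont_on_imp_continuous_on:
  assumes "abs_cont_on c d f"
  shows "continuous_on {c..d} f"
  unfolding continuous_on_iff
proof (intro ballI allI impI)
  fix x e :: real assume x: "x \<in> {c..d}" and "e > 0"
  obtain \<delta> where "\<delta> > 0" and \<delta>: "\<And>P. nonoverlapping c d P \<Longrightarrow> (\<Sum>(s, t)\<in>P. t - s) < \<delta> \<Longrightarrow>
      (\<Sum>(s, t)\<in>P. norm (f t - f s)) < e"
    using assms(1) \<open>e > 0\<close> unfolding abs_cont_on_iff by meson
  have *: "dist (f t) (f s) < e" if "c \<le> s" "s < t" "t \<le> d" "t - s < \<delta>" for s t
    using \<delta>[of "{(s, t)}"] that by (simp add: dist_norm nonoverlapping_def)
  have "dist (f y) (f x) < e" if "y \<in> {c..d}" "dist y x < \<delta>" for y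
    using *[of x y] *[of y x] that x \<open>e > 0\<close> by (cases x y rule: linorder_cases) (auto simp: dist_real_def dist_commute)
  then show "\<exists>d'>0. \<forall>x'\<in>{c..d}. dist x' x < d' \<longrightarrow> dist (f x') (f x) < e"
    using \<open>\<delta> > 0\<close> by blast
qed

lemma abs_cont_on_mult:
  assumes f: "abs_cont_on c d f" and g: "abs_cont_on c d g"
  shows "abs_cont_on c d (\<lambda>x. f x * g x)"
  unfolding abs_cont_on_iff
proof (intro allI impI)
  fix e :: real assume e: "e > 0"
  obtain B where B: "B > 0" "\<And>x. x \<in> {c..d} \<Longrightarrow> norm (f x) \<le> B" "\<And>x. x \<in> {c..d} \<Longrightarrow> norm (g x) \<le> B"
  proof -
    have "bounded (f ` {c..d} \<union> g ` {c..d})"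
      using abs_cont_on_imp_continuous_on[OF f] abs_cont_on_imp_continuous_on[OF g]
      by (simp add: compact_continuous_image compact_imp_bounded)
    then obtain B where "B > 0" "\<forall>y\<in>f ` {c..d} \<union> g ` {c..d}. norm y \<le> B"
      unfolding bounded_pos by blast
    then show thesis by (intro that[of B]) auto
  qed
  have e': "e / (2 * B) > 0" using e B by simp
  obtain \<delta>1 where "\<delta>1 > 0" and \<delta>1: "\<And>P. nonoverlapping c d P \<Longrightarrow> (\<Sum>(s, t)\<in>P. t - s) < \<delta>1 \<Longrightarrow>
      (\<Sum>(s, t)\<in>P. norm (f t - f s)) < e / (2 * B)"
    using f e' unfolding abs_cont_on_iff by meson
  obtain \<delta>2 where "\<delta>2 > 0" and \<delta>2: "\<And>P. nonoverlapping c d P \<Longrightarrow> (\<Sum>(s, t)\<in>P. t - s) < \<delta>2 \<Longrightarrow>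
      (\<Sum>(s, t)\<in>P. norm (g t - g s)) < e / (2 * B)"
    using g e' unfolding abs_cont_on_iff by meson
  have main: "(\<Sum>(s, t)\<in>P. norm (f t * g t - f s * g s)) < e"
    if P0: "nonoverlapping c d P" and P4: "(\<Sum>(s, t)\<in>P. t - s) < min \<delta>1 \<delta>2" for P
  proof -
    have P: "finite P" "\<forall>(s, t)\<in>P. c \<le> s \<and> s < t \<and> t \<le> d"
      "pairwise (\<lambda>(s, t) (s', t'). disjnt {s<..<t} {s'<..<t'}) P" "(\<Sum>(s, t)\<in>P. t - s) < min \<delta>1 \<delta>2"
      using P0 P4 by (auto simp: nonoverlapping_def)
    have P': "\<And>s t. (s, t) \<in> P \<Longrightarrow> c \<le> s \<and> s < t \<and> t \<le> d" using P(2) by blast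
    have "(\<Sum>(s, t)\<in>P. norm (f t * g t - f s * g s)) \<le> (\<Sum>(s, t)\<in>P. B * norm (f t - f s) + B * norm (g t - g s))"
    proof (rule sum_mono, clarify)
      fix s t assume "(s, t) \<in> P"
      then have st: "s \<in> {c..d}" "t \<in> {c..d}" using P' by force+
      have "f t * g t - f s * g s = (f t - f s) * g t + f s * (g t - g s)" by (simp add: algebra_simps)
      also have "norm \<dots> \<le> norm (f t - f s) * norm (g t) + norm (f s) * norm (g t - g s)"
        by (metis norm_mult norm_triangle_ineq)
      also have "\<dots> \<le> norm (f t - f s) * B + B * norm (g t - g s)"
        using B st by (intro add_mono mult_mono) auto
      finally show "norm (f t * g t - f s * g s) \<le> B * norm (f t - f s) + B * norm (g t - g s)"
        by (simp add: mult.commute)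
    qed
    also have "\<dots> = B * (\<Sum>(s, t)\<in>P. norm (f t - f s)) + B * (\<Sum>(s, t)\<in>P. norm (g t - g s))"
      by (simp add: sum.distrib sum_distrib_left split_beta)
    also have "\<dots> < B * (e / (2 * B)) + B * (e / (2 * B))"
    proof (intro add_strict_mono mult_strict_left_mono B)
      show "(\<Sum>(s, t)\<in>P. norm (f t - f s)) < e / (2 * B)" using P0 P4 by (intro \<delta>1) auto
      show "(\<Sum>(s, t)\<in>P. norm (g t - g s)) < e / (2 * B)" using P0 P4 by (intro \<delta>2) auto
    qed
    also have "\<dots> = e" using B by (simp add: field_simps)
    finally show ?thesis .
  qed
  show "\<exists>\<delta>>0. \<forall>P. nonoverlapping c d P \<longrightarrow>
        (\<Sum>(s, t)\<in>P. t - s) < \<delta> \<longrightarrow> (\<Sum>(s, t)\<in>P. norm (f t * g t - f s * g s)) < e"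
    by (rule exI[of _ "min \<delta>1 \<delta>2"]) (use \<open>\<delta>1 > 0\<close> \<open>\<delta>2 > 0\<close> main in simp)
qed

text \<open>Absolute continuity in integrated form, with the derivative given as data. The
  differential equation is mainly handled as a pair of such integral formulas; derivatives almost
  everywhere enter in the product rule and in the translation from and to the original
  definitions.\<close>

definition prim :: "real \<Rightarrow> real \<Rightarrow> (real \<Rightarrow> 'a::euclidean_space) \<Rightarrow> (real \<Rightarrow> 'a) \<Rightarrow> bool" where
  "prim c d F f \<longleftrightarrow> f absolutely_integrable_on {c..d} \<and> (\<forall>x\<in>{c..d}. F x = F c + integral {c..x} f)"

lemma prim_absolutely_integrable: "prim c d F f \<Longrightarrow> f absolutely_integrable_on {c..d}"
  by (simp add: prim_def)

lemma prim_integrable: "prim c d F f \<Longrightarrow> f integrable_on {c..d}"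
  by (simp add: prim_def absolutely_integrable_on_def)

lemma primD: "prim c d F f \<Longrightarrow> c \<le> x \<Longrightarrow> x \<le> d \<Longrightarrow> F x = F c + integral {c..x} f"
  unfolding prim_def by (meson atLeastAtMost_iff)

lemma prim_eq: "prim c d F f \<Longrightarrow> c \<le> d \<Longrightarrow> integral {c..d} f = F d - F c"
  using primD[of c d F f d] by (simp add: algebra_simps)

lemma prim_diff:
  assumes "prim c d F f" "c \<le> s" "s \<le> t" "t \<le> d"
  shows "F t - F s = integral {s..t} f"
  using integral_interval_diff[OF prim_integrable[OF assms(1)] assms(2-4)]
    primD[OF assms(1), of s] primD[OF assms(1), of t] assms(2-4)
  by (simp add: algebra_simps)

lemma prim_continuous_on:
  assumes "prim c d F f"
  shows "continuous_on {c..d} F"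
proof (rule continuous_on_eq)
  show "continuous_on {c..d} (\<lambda>x. F c + integral {c..x} f)"
    by (intro continuous_intros indefinite_integral_continuous_1 prim_integrable[OF assms])
  show "F c + integral {c..x} f = F x" if "x \<in> {c..d}" for x
    using primD[OF assms, of x] that by (simp only: atLeastAtMost_iff)
qed

text \<open>Truncation: on an interval the increment of \<open>F\<close> is at most the integral of
  the part of |f| above the level n plus n times the length. The first part is small in total for
  large n by dominated convergence, the second for small total length.\<close>

lemma prim_abs_cont_on:
  fixes F :: "real \<Rightarrow> complex"
  assumes "prim c d F f"
  shows "abs_cont_on c d F"
  unfolding abs_cont_on_iff
proof (intro allI impI)
  fix e :: real assume e: "e > 0"
  define h where "h n x = norm (f x) - min (norm (f x)) (real n)" for n x
  note fa = prim_absolutely_integrable[OF assms]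
  have nf: "(\<lambda>x. norm (f x)) absolutely_integrable_on {c..d}" by (rule absolutely_integrable_norm[OF fa, unfolded o_def])
  have mf: "(\<lambda>x. min (norm (f x)) (real n)) absolutely_integrable_on {c..d}" for n
    by (rule absolutely_integrable_min_1[OF nf]) simp
  have hi: "h n absolutely_integrable_on {c..d}" for n
    unfolding h_def using nf mf by (rule set_integral_diff)
  have "(\<lambda>n. integral {c..d} (h n)) \<longlonglongrightarrow> integral {c..d} (\<lambda>x. 0)"
  proof (rule dominated_convergence(2)[where h="\<lambda>x. norm (f x)"])
    show "(\<lambda>n. h n x) \<longlonglongrightarrow> 0" for x
    proof (rule tendsto_eventually)
      obtain N where "norm (f x) \<le> real N" using real_arch_simple by blast
      then show "\<forall>\<^sub>F n in sequentially. h n x = 0"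
        by (intro eventually_sequentiallyI[of N]) (auto simp: h_def min_def)
    qed
  qed (use hi nf in \<open>auto simp: h_def absolutely_integrable_on_def\<close>)
  then have "\<forall>\<^sub>F n in sequentially. integral {c..d} (h n) < e / 2"
    using e by (intro order_tendstoD(2)) auto
  then obtain n where n: "integral {c..d} (h n) < e / 2"
    by (metis eventually_sequentially order_refl)
  define \<delta> where "\<delta> = e / (2 * (real n + 1))"
  have \<delta>: "\<delta> > 0" using e by (simp add: \<delta>_def)
  have main: "(\<Sum>(s, t)\<in>P. norm (F t - F s)) < e"
    if P0: "nonoverlapping c d P" and P4: "(\<Sum>(s, t)\<in>P. t - s) < \<delta>" for P
  proof -
    have P: "finite P" "\<forall>(s, t)\<in>P. c \<le> s \<and> s < t \<and> t \<le> d"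
      "pairwise (\<lambda>(s, t) (s', t'). disjnt {s<..<t} {s'<..<t'}) P" "(\<Sum>(s, t)\<in>P. t - s) < \<delta>"
      using P0 P4 by (auto simp: nonoverlapping_def)
    have "(\<Sum>(s, t)\<in>P. norm (F t - F s)) \<le> (\<Sum>(s, t)\<in>P. integral {s<..<t} (h n) + real n * (t - s))"
    proof (rule sum_mono, clarify)
      fix s t assume "(s, t) \<in> P"
      then have st: "c \<le> s" "s < t" "t \<le> d" using P(2) by blast+
      have sub: "{s..t} \<subseteq> {c..d}" using st by auto
      note I = absolutely_integrable_interval_subset[OF _ sub]
      have "norm (F t - F s) = norm (integral {s..t} f)"
        using prim_diff[OF assms, of s t] st by simp
      also have "\<dots> \<le> integral {s..t} (\<lambda>x. norm (f x))"
        by (rule integral_norm_bound_integral) (use I[OF fa] I[OF nf] in \<open>auto simp: absolutely_integrable_on_def\<close>)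
      also have "\<dots> = integral {s..t} (\<lambda>x. h n x + min (norm (f x)) (real n))"
        by (simp add: h_def)
      also have "\<dots> = integral {s..t} (h n) + integral {s..t} (\<lambda>x. min (norm (f x)) (real n))"
        using I[OF hi] I[OF mf] by (intro integral_add) (auto simp: absolutely_integrable_on_def)
      also have "integral {s..t} (\<lambda>x. min (norm (f x)) (real n)) \<le> integral {s..t} (\<lambda>x. real n)"
        using I[OF mf] by (intro integral_le) (auto simp: absolutely_integrable_on_def)
      also have "\<dots> = real n * (t - s)" using st by simp
      finally show "norm (F t - F s) \<le> integral {s<..<t} (h n) + real n * (t - s)"
        by (simp add: integral_open_interval_real)
    qed
    also have "\<dots> = (\<Sum>(s, t)\<in>P. integral {s<..<t} (h n)) + real n * (\<Sum>(s, t)\<in>P. t - s)"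
      by (simp add: sum.distrib sum_distrib_left split_beta)
    also have "(\<Sum>(s, t)\<in>P. integral {s<..<t} (h n)) \<le> integral {c..d} (h n)"
    proof (rule sum_integral_disjoint_intervals_le[OF P(1) _ P(3)])
      show "\<forall>(s, t)\<in>P. {s<..<t} \<subseteq> {c..d}" using P(2) by fastforce
    qed (use hi[of n] in \<open>auto simp: h_def absolutely_integrable_on_def\<close>)
    also have "real n * (\<Sum>(s, t)\<in>P. t - s) \<le> real n * \<delta>"
      using P(4) by (intro mult_left_mono) auto
    also have "real n * \<delta> \<le> e / 2" using e by (simp add: \<delta>_def field_simps)
    finally show ?thesis using n by linarith
  qed
  show "\<exists>\<delta>>0. \<forall>P. nonoverlapping c d P \<longrightarrow>
        (\<Sum>(s, t)\<in>P. t - s) < \<delta> \<longrightarrow> (\<Sum>(s, t)\<in>P. norm (F t - F s)) < e"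
    by (rule exI[of _ \<delta>]) (use \<delta> main in simp)
qed

lemma prim_has_derivative:
  fixes F :: "real \<Rightarrow> complex"
  assumes "prim c d F f"
  obtains N where "negligible N" "\<And>x. x \<in> {c<..<d} - N \<Longrightarrow> (F has_vector_derivative f x) (at x)"
proof -
  obtain N where N: "negligible N"
    "\<And>x. x \<in> {c<..<d} - N \<Longrightarrow> ((\<lambda>x. integral {c..x} f) has_vector_derivative f x) (at x)"
    by (rule indefinite_integral_has_derivative[OF prim_integrable[OF assms]]) (rule that)
  have "(F has_vector_derivative f x) (at x)" if x: "x \<in> {c<..<d} - N" for x
  proof (rule has_vector_derivative_transform_within_open[where S="{c<..<d}"])
    show "((\<lambda>x. F c + integral {c..x} f) has_vector_derivative f x) (at x)"
      using has_vector_derivative_add[OF has_vector_derivative_const N(2)[OF x], of "F c"] by simp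
    show "F c + integral {c..y} f = F y" if "y \<in> {c<..<d}" for y
      using primD[OF assms, of y] that by simp
  qed (use x in auto)
  then show thesis using that N(1) by blast
qed

text \<open>Together with \<open>prim_abs_cont_on\<close> and \<open>prim_has_derivative\<close>
  this translates between the \<epsilon>-\<delta> definition of absolute continuity and indefinite
  integrals, by the fundamental theorem applied on every initial interval.\<close>

lemma primI_abs_cont:
  fixes F :: "real \<Rightarrow> complex"
  assumes ac: "abs_cont_on c d F" and f: "f absolutely_integrable_on {c..d}"
    and N: "negligible N" "\<And>x. x \<in> {c<..<d} - N \<Longrightarrow> (F has_vector_derivative f x) (at x)"
  shows "prim c d F f"
  unfolding prim_def
proof (intro conjI ballI f)
  fix x assume x: "x \<in> {c..d}"
  have "(f has_integral (F x - F c)) {c..x}"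
  \<comment> \<open>The derivative is known on the open interval only, so both endpoints join the
    exceptional set.\<close>
  proof (rule abs_cont_fundamental_theorem[where N="N \<union> {c, d}"])
    show "abs_cont_on c x F" using x by (intro abs_cont_on_subinterval[OF ac]) auto
    show "(F has_vector_derivative f y) (at y within {c..x})" if "y \<in> {c..x} - (N \<union> {c, d})" for y
      by (rule has_vector_derivative_at_within, rule N(2)) (use that x in auto)
  qed (use x N(1) in auto)
  then show "F x = F c + integral {c..x} f" by (simp add: integral_unique)
qed

lemma absolutely_integrable_continuous_mult:
  fixes f g :: "real \<Rightarrow> 'a::{euclidean_space, real_normed_algebra}"
  assumes f: "continuous_on {c..d} f" and g: "g absolutely_integrable_on {c..d}"
  shows "(\<lambda>x. f x * g x) absolutely_integrable_on {c..d}"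
proof (rule absolutely_integrable_bounded_measurable_product[OF bilinear_conv_bounded_bilinear[THEN iffD2, OF bounded_bilinear_mult] _ _ _ g])
  show "f \<in> borel_measurable (lebesgue_on {c..d})"
    by (rule continuous_imp_measurable_on_sets_lebesgue[OF f]) auto
  show "bounded (f ` {c..d})"
    by (rule compact_imp_bounded[OF compact_continuous_image[OF f]]) auto
qed auto

text \<open>Integration by parts: products stay absolutely continuous, and the product rule holds
  off a null set. The Wronskian and the energy identity rest on it.\<close>

lemma prim_mult:
  fixes F G :: "real \<Rightarrow> complex"
  assumes F: "prim c d F f" and G: "prim c d G g"
  shows "prim c d (\<lambda>x. F x * G x) (\<lambda>x. F x * g x + f x * G x)"
proof -
  obtain N where N: "negligible N" "\<And>x. x \<in> {c<..<d} - N \<Longrightarrow> (F has_vector_derivative f x) (at x)"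
    by (rule prim_has_derivative[OF F]) (rule that)
  obtain M where M: "negligible M" "\<And>x. x \<in> {c<..<d} - M \<Longrightarrow> (G has_vector_derivative g x) (at x)"
    by (rule prim_has_derivative[OF G]) (rule that)
  show ?thesis
  proof (rule primI_abs_cont[where N="N \<union> M"])
    show "abs_cont_on c d (\<lambda>x. F x * G x)"
      by (intro abs_cont_on_mult prim_abs_cont_on[OF F] prim_abs_cont_on[OF G])
    have "(\<lambda>x. F x * g x + G x * f x) absolutely_integrable_on {c..d}"
      by (intro set_integral_add absolutely_integrable_continuous_mult prim_continuous_on[OF F] prim_continuous_on[OF G]
          prim_absolutely_integrable[OF F] prim_absolutely_integrable[OF G])
    then show "(\<lambda>x. F x * g x + f x * G x) absolutely_integrable_on {c..d}" by (simp add: mult.commute)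
    show "((\<lambda>x. F x * G x) has_vector_derivative F x * g x + f x * G x) (at x)"
      if "x \<in> {c<..<d} - (N \<union> M)" for x
      using that N(2)[of x] M(2)[of x] by (intro has_vector_derivative_mult) auto
  qed (use N(1) M(1) in auto)
qed

lemma prim_bounded_linear:
  assumes "prim c d F f" "bounded_linear h"
  shows "prim c d (\<lambda>x. h (F x)) (\<lambda>x. h (f x))"
  unfolding prim_def
proof (intro conjI ballI)
  show "(\<lambda>x. h (f x)) absolutely_integrable_on {c..d}"
    using absolutely_integrable_linear[OF prim_absolutely_integrable[OF assms(1)] assms(2)] by (simp add: o_def)
  fix x assume x: "x \<in> {c..d}"
  have "f integrable_on {c..x}" using x prim_integrable[OF assms(1)] by (auto intro: integrable_subinterval_real)
  then have "integral {c..x} (\<lambda>x. h (f x)) = h (integral {c..x} f)"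
    using integral_linear[OF _ assms(2), of f "{c..x}"] by (simp add: o_def)
  then show "h (F x) = h (F c) + integral {c..x} (\<lambda>x. h (f x))"
    using primD[OF assms(1), of x] x linear_simps(1)[OF assms(2)] by auto
qed

lemma prim_cong_AE:
  assumes "prim c d F f" "negligible N" "\<And>x. x \<in> {c..d} - N \<Longrightarrow> g x = f x" "\<And>x. x \<in> {c..d} \<Longrightarrow> G x = F x"
  shows "prim c d G g"
  unfolding prim_def
proof (intro conjI ballI)
  show "g absolutely_integrable_on {c..d}"
    by (rule absolutely_integrable_spike[OF prim_absolutely_integrable[OF assms(1)] assms(2)]) (use assms(3) in auto)
  fix x assume x: "x \<in> {c..d}"
  have "integral {c..x} g = integral {c..x} f"
    by (rule integral_spike[OF assms(2)]) (use assms(3)[symmetric] x in auto)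
  then show "G x = G c + integral {c..x} g" using primD[OF assms(1), of x] assms(4)[of x] assms(4)[of c] x by auto
qed

section \<open>Linear Volterra equations\<close>

definition loc_int :: "(real \<Rightarrow> 'a::euclidean_space) \<Rightarrow> bool" where
  "loc_int f \<longleftrightarrow> (\<forall>c d. f absolutely_integrable_on {c..d})"

text \<open>The oriented integral from 0 to x: one formula serves both half-lines when an initial
  value problem at 0 is solved on the whole line.\<close>

definition sint :: "(real \<Rightarrow> 'a::euclidean_space) \<Rightarrow> real \<Rightarrow> 'a" where
  "sint f x = integral {0..x} f - integral {x..0} f"

lemma loc_int_integrable: "loc_int f \<Longrightarrow> f integrable_on {c..d}"
  by (simp add: loc_int_def absolutely_integrable_on_def)

lemma sint_0 [simp]: "sint f 0 = 0"
  by (simp add: sint_def)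

lemma sint_nonneg_eq: "0 \<le> x \<Longrightarrow> sint f x = integral {0..x} f"
  by (cases "x = 0") (auto simp: sint_def)

lemma sint_nonpos_eq: "x \<le> 0 \<Longrightarrow> sint f x = - integral {x..0} f"
  by (cases "x = 0") (auto simp: sint_def)

lemma sint_diff:
  assumes "loc_int f" "s \<le> t"
  shows "sint f t - sint f s = integral {s..t} f"
proof -
  consider "0 \<le> s" | "t \<le> 0" | "s \<le> 0" "0 \<le> t" using assms by linarith
  then show ?thesis
  proof cases
    case 1
    then show ?thesis using assms integral_interval_diff[OF loc_int_integrable[OF assms(1)], of 0 s t t]
      by (simp add: sint_nonneg_eq)
  next
    case 2
    have "integral {s..t} f + integral {t..0} f = integral {s..0} f"
      using 2 assms by (intro Henstock_Kurzweil_Integration.integral_combine loc_int_integrable) auto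
    then show ?thesis using 2 assms by (simp add: sint_nonpos_eq algebra_simps)
  next
    case 3
    have "integral {s..0} f + integral {0..t} f = integral {s..t} f"
      using 3 assms by (intro Henstock_Kurzweil_Integration.integral_combine loc_int_integrable) auto
    then show ?thesis using 3 by (simp add: sint_nonneg_eq sint_nonpos_eq add.commute)
  qed
qed

lemma prim_sint:
  assumes "loc_int f" "\<And>x. x \<in> {c..d} \<Longrightarrow> F x = K + sint f x"
  shows "prim c d F f"
  unfolding prim_def
proof (intro conjI ballI)
  show "f absolutely_integrable_on {c..d}" using assms(1) by (simp add: loc_int_def)
  fix x assume "x \<in> {c..d}"
  then show "F x = F c + integral {c..x} f"
    using assms(2)[of x] assms(2)[of c] sint_diff[OF assms(1), of c x] by (simp add: algebra_simps)
qed

lemma bounded_interval_bound: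
  fixes f :: "real \<Rightarrow> 'a::real_normed_vector"
  assumes "bounded (f ` {-X..X})"
  obtains K where "\<forall>x. \<bar>x\<bar> \<le> X \<longrightarrow> norm (f x) \<le> K"
proof -
  obtain K where K: "\<forall>y\<in>f ` {-X..X}. norm y \<le> K" using assms unfolding bounded_iff by blast
  have "norm (f x) \<le> K" if "\<bar>x\<bar> \<le> X" for x
  proof -
    have "x \<in> {-X..X}" using that by (auto simp: abs_le_iff)
    then show ?thesis using K by blast
  qed
  then show thesis using that by blast
qed

lemma sint_prim:
  assumes "\<And>c d. prim c d F f"
  shows "F x = F 0 + sint f x"
  using prim_diff[OF assms[of 0 x], of 0 x] prim_diff[OF assms[of x 0], of x 0]
  by (cases "0 \<le> x") (auto simp: sint_nonneg_eq sint_nonpos_eq algebra_simps)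

lemma loc_int_prim: "(\<And>c d. prim c d F f) \<Longrightarrow> loc_int f"
  by (simp add: prim_def loc_int_def)

lemma prim_continuous_on_UNIV:
  assumes "\<And>c d. prim c d F f"
  shows "continuous_on UNIV F"
proof -
  have "isCont F x" for x
    using prim_continuous_on[OF assms, of "x - 1" "x + 1"]
    by (rule continuous_on_interior) (simp add: interior_atLeastAtMost_real)
  then show ?thesis by (simp add: continuous_on_eq_continuous_at)
qed

lemma loc_int_add: "loc_int f \<Longrightarrow> loc_int g \<Longrightarrow> loc_int (\<lambda>x. f x + g x)"
  by (auto simp: loc_int_def intro!: set_integral_add)

lemma loc_int_diff: "loc_int f \<Longrightarrow> loc_int g \<Longrightarrow> loc_int (\<lambda>x. f x - g x)"
  by (auto simp: loc_int_def intro!: set_integral_diff)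

lemma sint_add: "loc_int f \<Longrightarrow> loc_int g \<Longrightarrow> sint (\<lambda>x. f x + g x) x = sint f x + sint g x"
  by (simp add: sint_def integral_add loc_int_integrable)

lemma sint_minus: "loc_int f \<Longrightarrow> loc_int g \<Longrightarrow> sint (\<lambda>x. f x - g x) x = sint f x - sint g x"
  by (simp add: sint_def Henstock_Kurzweil_Integration.integral_diff loc_int_integrable)

lemma sint_cmult: "sint (\<lambda>x. c * f x) x = c * sint f x" for f :: "real \<Rightarrow> real"
  by (simp add: sint_def algebra_simps)

lemma norm_sint_le:
  assumes "loc_int f" "loc_int g" "\<And>s. \<bar>s\<bar> \<le> \<bar>x\<bar> \<Longrightarrow> norm (f s) \<le> g s"
  shows "norm (sint f x) \<le> \<bar>sint g x\<bar>"
proof (cases "0 \<le> x")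
  case True
  have "norm (integral {0..x} f) \<le> integral {0..x} g"
    using True assms by (intro integral_norm_bound_integral loc_int_integrable) auto
  then show ?thesis using True by (simp add: sint_nonneg_eq)
next
  case False
  have "norm (integral {x..0} f) \<le> integral {x..0} g"
    using False assms by (intro integral_norm_bound_integral loc_int_integrable) auto
  then show ?thesis using False by (simp add: sint_nonpos_eq)
qed

lemma continuous_on_sint: "loc_int f \<Longrightarrow> continuous_on UNIV (sint f)"
proof -
  assume f: "loc_int f"
  have "isCont (sint f) x" for x
  proof -
    have "continuous_on {x - 1..x + 1} (sint f)"
      by (rule prim_continuous_on[OF prim_sint[OF f, of _ _ _ 0]]) simp
    then show ?thesis
      by (rule continuous_on_interior) (simp add: interior_atLeastAtMost_real)
  qed
  then show ?thesis by (simp add: continuous_on_eq_continuous_at)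
qed

lemma loc_int_continuous_mult:
  fixes f g :: "real \<Rightarrow> 'a::{euclidean_space, real_normed_algebra}"
  assumes "continuous_on UNIV f" "loc_int g"
  shows "loc_int (\<lambda>x. f x * g x)"
  using assms unfolding loc_int_def
  by (auto intro!: absolutely_integrable_continuous_mult intro: continuous_on_subset)

lemma loc_int_cmult: "loc_int g \<Longrightarrow> loc_int (\<lambda>x. c * g x)" for c :: "'a::{euclidean_space, real_normed_algebra}"
  by (rule loc_int_continuous_mult) auto

text \<open>With m = \<open>sint \<kappa>\<close> the integrand is, up to sign, m' m^n, the
  derivative of m^(n+1) / (n+1), and m has constant sign on each half-line because \<kappa> \<ge> 0.
  Iteration produces the factorials in the Picard and Gronwall estimates.\<close>

lemma sint_power:
  assumes \<kappa>: "loc_int \<kappa>" "\<And>x. 0 \<le> \<kappa> x"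
  shows "\<bar>sint (\<lambda>s. \<kappa> s * \<bar>sint \<kappa> s\<bar> ^ n) x\<bar> = \<bar>sint \<kappa> x\<bar> ^ Suc n / (real n + 1)"
proof -
  define m where "m = sint \<kappa>"
  \<comment> \<open>The product rule \<open>prim_mult\<close> is stated for complex functions, hence
    the embedding.\<close>
  have p1: "prim c d (\<lambda>x. complex_of_real (m x)) (\<lambda>x. complex_of_real (\<kappa> x))" for c d
    by (rule prim_bounded_linear[OF prim_sint[OF \<kappa>(1), of _ _ m 0] bounded_linear_of_real]) (simp add: m_def)
  have pn: "prim c d (\<lambda>x. complex_of_real (m x) ^ Suc n) (\<lambda>x. complex_of_real ((real n + 1) * (m x ^ n * \<kappa> x)))" for c d n
  proof (induction n)
    case 0 then show ?case using p1 by simp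
  next
    case (Suc n)
    show ?case
      by (rule prim_cong_AE[OF prim_mult[OF p1 Suc] negligible_empty]) (auto simp: algebra_simps)
  qed
  have sg: "m x \<ge> 0" if "x \<ge> 0" for x
    using that \<kappa> by (simp add: m_def sint_nonneg_eq integral_nonneg loc_int_integrable)
  have sl: "m x \<le> 0" if "x \<le> 0" for x
    using that \<kappa> by (simp add: m_def sint_nonpos_eq integral_nonneg loc_int_integrable)
  have cr: "(\<lambda>x. m x ^ n * \<kappa> x) integrable_on {c..d}" for c d
    using \<kappa> by (intro loc_int_integrable loc_int_continuous_mult) (auto simp: m_def intro!: continuous_intros continuous_on_sint)
  have ci: "(\<lambda>x. (real n + 1) * (m x ^ n * \<kappa> x)) integrable_on {c..d}" for c d
    using \<kappa> by (intro loc_int_integrable loc_int_cmult loc_int_continuous_mult) (auto simp: m_def intro!: continuous_intros continuous_on_sint)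
  have real: "(real n + 1) * integral {c..d} (\<lambda>x. m x ^ n * \<kappa> x) = m d ^ Suc n - m c ^ Suc n" if "c \<le> d" for c d
  proof -
    have "complex_of_real (integral {c..d} (\<lambda>x. (real n + 1) * (m x ^ n * \<kappa> x))) = integral {c..d} (\<lambda>x. complex_of_real ((real n + 1) * (m x ^ n * \<kappa> x)))"
      using integral_linear[OF ci bounded_linear_of_real[where 'a=complex]] unfolding o_def by (rule sym)
    also have "\<dots> = complex_of_real (m d ^ Suc n - m c ^ Suc n)"
      using prim_eq[OF pn that] by simp
    finally show ?thesis by (simp only: of_real_eq_iff integral_mult_right)
  qed
  have ab: "\<bar>integral {c..d} (\<lambda>s. \<kappa> s * \<bar>m s\<bar> ^ n)\<bar> = \<bar>integral {c..d} (\<lambda>x. m x ^ n * \<kappa> x)\<bar>"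
    if "(\<forall>x\<in>{c..d}. m x \<ge> 0) \<or> (\<forall>x\<in>{c..d}. m x \<le> 0)" for c d
  proof (cases "\<forall>x\<in>{c..d}. m x \<ge> 0")
    case True
    then have "integral {c..d} (\<lambda>s. \<kappa> s * \<bar>m s\<bar> ^ n) = integral {c..d} (\<lambda>x. m x ^ n * \<kappa> x)"
      by (intro Henstock_Kurzweil_Integration.integral_cong) (auto simp: mult.commute)
    then show ?thesis by simp
  next
    case False
    then have "\<forall>x\<in>{c..d}. m x \<le> 0" using that by blast
    then have "integral {c..d} (\<lambda>s. \<kappa> s * \<bar>m s\<bar> ^ n) = integral {c..d} (\<lambda>x. (-1) ^ n * (m x ^ n * \<kappa> x))"
      by (intro Henstock_Kurzweil_Integration.integral_cong) (auto simp: power_minus[of "m _"] abs_of_nonpos)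
    then show ?thesis by (simp only: integral_mult_right abs_mult power_abs) simp
  qed
  have m0: "m 0 = 0" by (simp add: m_def)
  have "(real n + 1) * \<bar>sint (\<lambda>s. \<kappa> s * \<bar>m s\<bar> ^ n) x\<bar> = \<bar>m x\<bar> ^ Suc n"
  proof (cases "0 \<le> x")
    case True
    have "(real n + 1) * \<bar>integral {0..x} (\<lambda>s. \<kappa> s * \<bar>m s\<bar> ^ n)\<bar> = \<bar>(real n + 1) * integral {0..x} (\<lambda>x. m x ^ n * \<kappa> x)\<bar>"
      using sg by (subst ab) (auto simp: abs_mult)
    then show ?thesis using True real[OF True] by (simp add: sint_nonneg_eq m0 power_abs abs_mult)
  next
    case False
    have "(real n + 1) * \<bar>integral {x..0} (\<lambda>s. \<kappa> s * \<bar>m s\<bar> ^ n)\<bar> = \<bar>(real n + 1) * integral {x..0} (\<lambda>x. m x ^ n * \<kappa> x)\<bar>"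
      using sl by (subst ab) (auto simp: abs_mult)
    then show ?thesis using False real[of x 0] by (simp add: sint_nonpos_eq m0 power_abs abs_mult)
  qed
  then show ?thesis unfolding m_def[symmetric] by (simp add: field_simps)
qed

text \<open>The inequality is substituted into itself n times. This multiplies \<open>C\<close> by a
  partial sum of the exponential series in |m| and leaves the remainder K |m|^n / n!, where
  \<open>K\<close> is a bound of \<open>v\<close>; the remainder tends to 0. Both sides of 0 are
  treated at once.\<close>

lemma gronwall:
  fixes v \<kappa> :: "real \<Rightarrow> real"
  assumes \<kappa>: "loc_int \<kappa>" "\<And>x. 0 \<le> \<kappa> x" and v: "continuous_on UNIV v" and "C \<ge> 0"
    and le: "\<And>x. \<bar>x\<bar> \<le> X \<Longrightarrow> \<bar>v x\<bar> \<le> C + \<bar>sint (\<lambda>s. \<kappa> s * \<bar>v s\<bar>) x\<bar>" and x: "\<bar>x\<bar> \<le> X"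
  shows "\<bar>v x\<bar> \<le> C * exp \<bar>sint \<kappa> x\<bar>"
proof -
  define m where "m = sint \<kappa>"
  have "bounded (v ` {-X..X})"
    by (intro compact_imp_bounded compact_continuous_image continuous_on_subset[OF v]) auto
  then obtain K where "\<forall>x. \<bar>x\<bar> \<le> X \<longrightarrow> norm (v x) \<le> K"
    by (rule bounded_interval_bound)
  then have K: "\<And>x. \<bar>x\<bar> \<le> X \<Longrightarrow> \<bar>v x\<bar> \<le> K" by simp
  have K0: "K \<ge> 0" using K[OF x] by linarith
  have cm: "continuous_on UNIV m" unfolding m_def by (rule continuous_on_sint[OF \<kappa>(1)])
  have li: "loc_int (\<lambda>s. \<kappa> s * \<bar>m s\<bar> ^ k)" for k
    using loc_int_continuous_mult[OF continuous_on_power[OF continuous_on_rabs[OF cm]] \<kappa>(1), of k] by (simp add: mult.commute)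
  have liv: "loc_int (\<lambda>s. \<kappa> s * \<bar>v s\<bar>)"
    using loc_int_continuous_mult[of "\<lambda>s. \<bar>v s\<bar>" \<kappa>] \<kappa> v by (auto simp: mult.commute intro!: continuous_intros)
  have lisum: "loc_int (\<lambda>s. \<Sum>k<n. A k * (\<kappa> s * \<bar>m s\<bar> ^ k)) \<and>
      \<bar>sint (\<lambda>s. \<Sum>k<n. A k * (\<kappa> s * \<bar>m s\<bar> ^ k)) x\<bar> \<le> (\<Sum>k<n. A k * (\<bar>m x\<bar> ^ Suc k / (real k + 1)))"
    if A: "\<And>k. A k \<ge> 0" for A n x
  proof (induction n)
    case 0 show ?case by (simp add: loc_int_def sint_def)
  next
    case (Suc n)
    have "\<bar>sint (\<lambda>s. A n * (\<kappa> s * \<bar>m s\<bar> ^ n)) x\<bar> = A n * (\<bar>m x\<bar> ^ Suc n / (real n + 1))"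
      using sint_power[OF \<kappa>, of n x] A[of n] by (simp add: sint_cmult abs_mult m_def)
    moreover have l: "loc_int (\<lambda>s. A n * (\<kappa> s * \<bar>m s\<bar> ^ n))" by (rule loc_int_cmult[OF li])
    ultimately show ?case using Suc loc_int_add[OF _ l] sint_add[OF _ l, of _ x]
        abs_triangle_ineq[of "sint (\<lambda>s. \<Sum>k<n. A k * (\<kappa> s * \<bar>m s\<bar> ^ k)) x" "sint (\<lambda>s. A n * (\<kappa> s * \<bar>m s\<bar> ^ n)) x"]
      by auto
  qed
  have step: "\<bar>v x\<bar> \<le> C * (\<Sum>k<n. \<bar>m x\<bar> ^ k / fact k) + K * (\<bar>m x\<bar> ^ n / fact n)" if "\<bar>x\<bar> \<le> X" for n x
    using that
  proof (induction n arbitrary: x)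
    case 0 then show ?case using K by simp
  next
    case (Suc n)
    \<comment> \<open>The partial sum coming from \<open>C\<close> and the remainder coming from
      \<open>K\<close> are written as one sum, which \<open>lisum\<close> integrates
      termwise.\<close>
    define A where "A k = (if k < n then C / fact k else K / fact n)" for k
    have A0: "A k \<ge> 0" for k using \<open>C \<ge> 0\<close> K0 by (simp add: A_def)
    have sumA: "(\<Sum>k<Suc n. A k * h k) = C * (\<Sum>k<n. h k / fact k) + K * (h n / fact n)" for h :: "nat \<Rightarrow> real"
      by (simp add: A_def sum_distrib_left)
    have "\<bar>sint (\<lambda>s. \<kappa> s * \<bar>v s\<bar>) x\<bar> \<le> \<bar>sint (\<lambda>s. \<Sum>k<Suc n. A k * (\<kappa> s * \<bar>m s\<bar> ^ k)) x\<bar>"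
    proof (rule norm_sint_le[OF liv, unfolded real_norm_def])
      show "loc_int (\<lambda>s. \<Sum>k<Suc n. A k * (\<kappa> s * \<bar>m s\<bar> ^ k))" using lisum[of A, OF A0] by blast
      fix s assume "\<bar>s\<bar> \<le> \<bar>x\<bar>"
      then have "\<bar>v s\<bar> \<le> C * (\<Sum>k<n. \<bar>m s\<bar> ^ k / fact k) + K * (\<bar>m s\<bar> ^ n / fact n)"
        using Suc by auto
      also have "\<dots> = (\<Sum>k<Suc n. A k * \<bar>m s\<bar> ^ k)" by (rule sumA[symmetric])
      finally have "\<kappa> s * \<bar>v s\<bar> \<le> \<kappa> s * (\<Sum>k<Suc n. A k * \<bar>m s\<bar> ^ k)"
        using \<kappa>(2) by (intro mult_left_mono)
      also have "\<dots> = (\<Sum>k<Suc n. A k * (\<kappa> s * \<bar>m s\<bar> ^ k))"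
        unfolding sum_distrib_left by (intro sum.cong) auto
      finally show "\<bar>\<kappa> s * \<bar>v s\<bar>\<bar> \<le> (\<Sum>k<Suc n. A k * (\<kappa> s * \<bar>m s\<bar> ^ k))"
        using \<kappa>(2)[of s] by (simp add: abs_mult del: sum.lessThan_Suc)
    qed
    also have "\<dots> \<le> (\<Sum>k<Suc n. A k * (\<bar>m x\<bar> ^ Suc k / (real k + 1)))"
      using lisum[of A, OF A0] by blast
    also have "\<dots> = C * (\<Sum>k<n. \<bar>m x\<bar> ^ Suc k / fact (Suc k)) + K * (\<bar>m x\<bar> ^ Suc n / fact (Suc n))"
      unfolding sumA by (simp add: field_simps)
    finally have "\<bar>v x\<bar> \<le> C + (C * (\<Sum>k<n. \<bar>m x\<bar> ^ Suc k / fact (Suc k)) + K * (\<bar>m x\<bar> ^ Suc n / fact (Suc n)))"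
      using le[OF Suc.prems] by linarith
    also have "\<dots> = C * (\<Sum>k<Suc n. \<bar>m x\<bar> ^ k / fact k) + K * (\<bar>m x\<bar> ^ Suc n / fact (Suc n))"
      unfolding sum.lessThan_Suc_shift by (simp add: algebra_simps)
    finally show ?case .
  qed
  have "(\<lambda>n. \<bar>m x\<bar> ^ n / fact n) sums exp \<bar>m x\<bar>"
    using exp_converges[of "\<bar>m x\<bar>"] by (simp add: field_simps)
  then have "(\<lambda>n. C * (\<Sum>k<n. \<bar>m x\<bar> ^ k / fact k) + K * (\<bar>m x\<bar> ^ n / fact n)) \<longlonglongrightarrow> C * exp \<bar>m x\<bar> + K * 0"
    by (intro tendsto_intros) (auto simp: sums_def summable_LIMSEQ_zero sums_summable)
  then have "\<bar>v x\<bar> \<le> C * exp \<bar>m x\<bar> + K * 0"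
    by (rule LIMSEQ_le_const) (use step[OF x] in blast)
  then show ?thesis by (simp add: m_def)
qed

text \<open>Picard iteration. By \<open>sint_power\<close> the n-th correction is at most K |m|^n /
  n! on a bounded interval, so the iterates converge uniformly there and the limit may be taken
  inside the integral.\<close>

theorem volterra_solution:
  fixes G :: "real \<Rightarrow> 'b::euclidean_space \<Rightarrow> 'b"
  assumes \<kappa>: "loc_int \<kappa>" "\<And>x. 0 \<le> \<kappa> x"
    and G: "\<And>Y. continuous_on UNIV Y \<Longrightarrow> loc_int (\<lambda>s. G s (Y s))"
    and lip: "\<And>s y y'. norm (G s y - G s y') \<le> \<kappa> s * norm (y - y')"
  shows "\<exists>Y. continuous_on UNIV Y \<and> (\<forall>x. Y x = Y0 + sint (\<lambda>s. G s (Y s)) x)"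
proof -
  define m where "m = sint \<kappa>"
  define Z where "Z = rec_nat (\<lambda>_. Y0) (\<lambda>_ Y x. Y0 + sint (\<lambda>s. G s (Y s)) x)"
  have Z0: "Z 0 = (\<lambda>_. Y0)" and ZS: "Z (Suc n) = (\<lambda>x. Y0 + sint (\<lambda>s. G s (Z n s)) x)" for n
    by (simp_all add: Z_def)
  have Zc: "continuous_on UNIV (Z n)" for n
    by (induction n) (auto simp: Z0 ZS intro!: continuous_intros continuous_on_sint G)
  have cm: "continuous_on UNIV m" unfolding m_def by (rule continuous_on_sint[OF \<kappa>(1)])
  have li: "loc_int (\<lambda>s. \<kappa> s * \<bar>m s\<bar> ^ k)" for k
    using loc_int_continuous_mult[OF continuous_on_power[OF continuous_on_rabs[OF cm]] \<kappa>(1), of k] by (simp add: mult.commute)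
  define f where "f n x = Z (Suc n) x - Z n x" for n x
  define Y where "Y x = Y0 + (\<Sum>n. f n x)" for x
  have Zsum: "Z n x = Y0 + (\<Sum>k<n. f k x)" for n x
    by (induction n) (auto simp: Z0 f_def)
  have unif: "uniform_limit {-X..X} Z Y sequentially" for X
  proof -
    have "bounded (f 0 ` {-X..X})"
      unfolding f_def
      by (intro compact_imp_bounded compact_continuous_image continuous_on_diff continuous_on_subset[OF Zc]) auto
    then obtain K0 where "\<forall>x. \<bar>x\<bar> \<le> X \<longrightarrow> norm (f 0 x) \<le> K0"
      by (rule bounded_interval_bound)
    then have K0: "\<And>x. x \<in> {-X..X} \<Longrightarrow> norm (f 0 x) \<le> K0"
      by (simp add: abs_le_iff)
    define K where "K = max K0 0"
    have K: "K \<ge> 0" "\<And>x. x \<in> {-X..X} \<Longrightarrow> norm (f 0 x) \<le> K" using K0 by (force simp: K_def)+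
    have fb: "norm (f n x) \<le> K * (\<bar>m x\<bar> ^ n / fact n)" if "x \<in> {-X..X}" for n x
      using that
    proof (induction n arbitrary: x)
      case 0 then show ?case using K by simp
    next
      case (Suc n)
      have "f (Suc n) x = sint (\<lambda>s. G s (Z (Suc n) s)) x - sint (\<lambda>s. G s (Z n s)) x"
        unfolding f_def ZS[of "Suc n"] ZS[of n] by simp
      also have "\<dots> = sint (\<lambda>s. G s (Z (Suc n) s) - G s (Z n s)) x"
        by (rule sint_minus[symmetric]) (intro G Zc)+
      finally have eq: "f (Suc n) x = sint (\<lambda>s. G s (Z (Suc n) s) - G s (Z n s)) x" .
      have "norm (f (Suc n) x) \<le> \<bar>sint (\<lambda>s. (K / fact n) * (\<kappa> s * \<bar>m s\<bar> ^ n)) x\<bar>"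
        unfolding eq
      proof (rule norm_sint_le)
        fix s assume "\<bar>s\<bar> \<le> \<bar>x\<bar>"
        then have s: "s \<in> {-X..X}" using Suc.prems by auto
        have "norm (G s (Z (Suc n) s) - G s (Z n s)) \<le> \<kappa> s * norm (f n s)"
          unfolding f_def by (rule lip)
        also have "\<dots> \<le> \<kappa> s * (K * (\<bar>m s\<bar> ^ n / fact n))"
          using Suc.IH[OF s] \<kappa>(2) by (intro mult_left_mono)
        finally show "norm (G s (Z (Suc n) s) - G s (Z n s)) \<le> K / fact n * (\<kappa> s * \<bar>m s\<bar> ^ n)"
          by (simp add: field_simps)
      qed (intro loc_int_diff G Zc loc_int_cmult li)+
      also have "\<dots> = K / fact n * (\<bar>m x\<bar> ^ Suc n / (real n + 1))"
        using sint_power[OF \<kappa>, of n x] K(1) unfolding sint_cmult m_def abs_mult by simp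
      also have "\<dots> = K * (\<bar>m x\<bar> ^ Suc n / fact (Suc n))" by (simp add: field_simps)
      finally show ?case .
    qed
    have "bounded (m ` {-X..X})"
      by (intro compact_imp_bounded compact_continuous_image continuous_on_subset[OF cm]) auto
    then obtain M where "\<forall>x. \<bar>x\<bar> \<le> X \<longrightarrow> norm (m x) \<le> M"
      by (rule bounded_interval_bound)
    then have M: "\<And>x. x \<in> {-X..X} \<Longrightarrow> \<bar>m x\<bar> \<le> M"
      by (simp add: abs_le_iff)
    have "uniform_limit {-X..X} (\<lambda>n x. \<Sum>i<n. f i x) (\<lambda>x. \<Sum>i. f i x) sequentially"
    proof (rule Weierstrass_m_test)
      show "norm (f n x) \<le> K * (M ^ n / fact n)" if "x \<in> {-X..X}" for n x
        using fb[OF that, of n] M[OF that] K(1)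
        by (smt (verit) divide_right_mono fact_ge_zero mult_left_mono power_mono abs_ge_zero)
      have "summable (\<lambda>n. M ^ n / fact n)"
        using summable_exp[of M] by (simp add: field_simps)
      then show "summable (\<lambda>n. K * (M ^ n / fact n))" by (rule summable_mult)
    qed
    from uniform_limit_add[OF uniform_limit_const this, of "\<lambda>_. Y0"] show ?thesis
      unfolding Zsum Y_def .
  qed
  have Yc: "continuous_on UNIV Y"
  proof -
    have "isCont Y x" for x
    proof -
      have "continuous_on {-(\<bar>x\<bar>+1)..\<bar>x\<bar>+1} Y"
        by (rule uniform_limit_theorem[OF _ unif]) (auto intro!: always_eventually continuous_on_subset[OF Zc])
      then show ?thesis
        by (rule continuous_on_interior) (auto simp: interior_atLeastAtMost_real)
    qed
    then show ?thesis by (simp add: continuous_on_eq_continuous_at)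
  qed
  have "Y x = Y0 + sint (\<lambda>s. G s (Y s)) x" for x
  proof -
    let ?X = "{-\<bar>x\<bar>..\<bar>x\<bar>}"
    have "(\<lambda>n. sint (\<lambda>s. G s (Z n s)) x) \<longlonglongrightarrow> sint (\<lambda>s. G s (Y s)) x"
    proof (rule LIMSEQ_I)
      fix e :: real assume e: "e > 0"
      define \<epsilon> where "\<epsilon> = e / (\<bar>m x\<bar> + 1)"
      have \<epsilon>: "\<epsilon> > 0" using e by (simp add: \<epsilon>_def add_nonneg_pos)
      have "\<forall>\<^sub>F n in sequentially. \<forall>s\<in>?X. dist (Z n s) (Y s) < \<epsilon>"
        using unif[of "\<bar>x\<bar>"] \<epsilon> by (auto simp: uniform_limit_iff)
      then obtain N where N: "\<And>n s. n \<ge> N \<Longrightarrow> s \<in> ?X \<Longrightarrow> dist (Z n s) (Y s) < \<epsilon>"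
        unfolding eventually_sequentially by blast
      have "norm (sint (\<lambda>s. G s (Z n s)) x - sint (\<lambda>s. G s (Y s)) x) < e" if "n \<ge> N" for n
      proof -
        have "sint (\<lambda>s. G s (Z n s)) x - sint (\<lambda>s. G s (Y s)) x = sint (\<lambda>s. G s (Z n s) - G s (Y s)) x"
          by (rule sint_minus[symmetric]) (intro G Zc Yc)+
        also have "norm \<dots> \<le> \<bar>sint (\<lambda>s. \<epsilon> * \<kappa> s) x\<bar>"
        proof (rule norm_sint_le)
          fix s assume "\<bar>s\<bar> \<le> \<bar>x\<bar>"
          then have "s \<in> ?X" unfolding atLeastAtMost_iff by linarith
          then have "norm (Z n s - Y s) \<le> \<epsilon>" using N[OF that, of s] by (simp add: dist_norm)
          then have "\<kappa> s * norm (Z n s - Y s) \<le> \<kappa> s * \<epsilon>" using \<kappa>(2) by (intro mult_left_mono)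
          then show "norm (G s (Z n s) - G s (Y s)) \<le> \<epsilon> * \<kappa> s"
            using lip[of s "Z n s" "Y s"] by (simp add: mult.commute)
        qed (intro loc_int_diff G Zc Yc loc_int_cmult \<kappa>)+
        also have "\<dots> = \<epsilon> * \<bar>m x\<bar>" using \<epsilon> by (simp add: sint_cmult abs_mult m_def)
        also have "\<dots> < e" using e by (simp add: \<epsilon>_def field_simps)
        finally show ?thesis .
      qed
      then show "\<exists>no. \<forall>n\<ge>no. norm (sint (\<lambda>s. G s (Z n s)) x - sint (\<lambda>s. G s (Y s)) x) < e" by blast
    qed
    then have "(\<lambda>n. Z (Suc n) x) \<longlonglongrightarrow> Y0 + sint (\<lambda>s. G s (Y s)) x"
      unfolding ZS by (intro tendsto_intros)
    moreover have "(\<lambda>n. Z n x) \<longlonglongrightarrow> Y x"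
      by (rule tendsto_uniform_limitI[OF unif[of "\<bar>x\<bar>"]]) auto
    then have "(\<lambda>n. Z (Suc n) x) \<longlonglongrightarrow> Y x" by (rule LIMSEQ_Suc)
    ultimately show ?thesis using LIMSEQ_unique by blast
  qed
  then show ?thesis using Yc by blast
qed

section \<open>Null sets, periodic functions and rules for indefinite integrals\<close>

lemma AE_lebesgueE:
  assumes "AE x in lebesgue. P x"
  obtains N where "negligible N" "\<forall>x. x \<notin> N \<longrightarrow> P x"
proof -
  obtain N where "{x \<in> space lebesgue. \<not> P x} \<subseteq> N" "emeasure lebesgue N = 0" "N \<in> sets lebesgue"
    using AE_E[OF assms] by blast
  then show thesis by (intro that[of N]) (auto simp: negligible_iff_null_sets null_sets_def)
qed

lemma AE_lebesgueI:
  assumes "negligible N" "\<And>x. x \<notin> N \<Longrightarrow> P x"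
  shows "AE x in lebesgue. P x"
  by (rule AE_I'[of N]) (use assms in \<open>auto simp: negligible_iff_null_sets\<close>)

lemma absolutely_integrable_shift:
  fixes f :: "real \<Rightarrow> real"
  assumes "f absolutely_integrable_on {c..d}"
  shows "(\<lambda>x. f (x + h)) absolutely_integrable_on {c - h..d - h}"
  using assms integrable_shift_real_ivl[of f c d h] integrable_shift_real_ivl[of "\<lambda>x. norm (f x)" c d h]
  by (simp add: absolutely_integrable_on_def)

text \<open>Integrability is carried from one period to [0, (n+1) a] period by period, and to the
  left by translating a sufficiently long interval by n periods.\<close>

lemma periodic_loc_int:
  fixes f :: "real \<Rightarrow> real"
  assumes "a > 0" and per: "\<And>x. f (x + a) = f x" and f: "set_integrable lebesgue {0<..<a} f"
  shows "loc_int f"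
proof -
  have 0: "f absolutely_integrable_on {0..a}"
    using f absolutely_integrable_on_open_interval[where f=f and a=0 and b=a] by simp
  have pern: "f (x + real n * a) = f x" for x n
  proof (induction n arbitrary: x)
    case (Suc n)
    have "f (x + real (Suc n) * a) = f ((x + real n * a) + a)" by (simp add: algebra_simps)
    then show ?case using Suc per by simp
  qed simp
  have R: "f absolutely_integrable_on {0..real (Suc n) * a}" for n
  proof (induction n)
    case (Suc n)
    let ?h = "real (Suc n) * a"
    have "(\<lambda>x. f (x + - ?h + ?h)) absolutely_integrable_on {0 + ?h..a + ?h}"
      using absolutely_integrable_shift[OF 0, of "- ?h"] pern[of "_ + - ?h" "Suc n"] by (simp add: algebra_simps)
    then have "f absolutely_integrable_on {?h..a + ?h}" by simp
    from absolutely_integrable_Un[OF Suc this]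
    have "f absolutely_integrable_on ({0..?h} \<union> {?h..a + ?h})" .
    moreover have "{0..?h} \<union> {?h..a + ?h} = {0..real (Suc (Suc n)) * a}"
    proof -
      have "0 \<le> ?h" "a + ?h = real (Suc (Suc n)) * a" using \<open>a > 0\<close> by (simp_all add: algebra_simps)
      moreover have "{0..?h} \<union> {?h..a + ?h} = {0..a + ?h}"
        using \<open>a > 0\<close> \<open>0 \<le> ?h\<close> by (intro ivl_disj_un_two_touch) auto
      ultimately show ?thesis by simp
    qed
    ultimately show ?case by simp
  qed (use 0 in simp)
  show ?thesis
    unfolding loc_int_def
  proof (intro allI)
    fix c d :: real
    obtain n where n: "(\<bar>c\<bar> + \<bar>d\<bar>) / a \<le> real n" using real_arch_simple by blast
    then have n': "\<bar>c\<bar> + \<bar>d\<bar> \<le> real n * a" using \<open>a > 0\<close> by (simp add: field_simps)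
    have "(\<lambda>x. f (x + real n * a)) absolutely_integrable_on {0 - real n * a..real (Suc (2 * n)) * a - real n * a}"
      by (rule absolutely_integrable_shift[OF R])
    then have "f absolutely_integrable_on {- (real n * a)..real n * a + a}"
      unfolding pern by (simp add: algebra_simps)
    then show "f absolutely_integrable_on {c..d}"
      using n' \<open>a > 0\<close> by (elim absolutely_integrable_interval_subset) auto
  qed
qed

lemma prim_add:
  assumes "prim c d F f" "prim c d G g"
  shows "prim c d (\<lambda>x. F x + G x) (\<lambda>x. f x + g x)"
  unfolding prim_def
proof (intro conjI ballI)
  show "(\<lambda>x. f x + g x) absolutely_integrable_on {c..d}"
    using assms by (intro set_integral_add prim_absolutely_integrable)
  fix x assume x: "x \<in> {c..d}"
  then have "f integrable_on {c..x}" "g integrable_on {c..x}"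
    using assms[THEN prim_integrable] by (auto intro: integrable_subinterval_real)
  then show "F x + G x = F c + G c + integral {c..x} (\<lambda>x. f x + g x)"
    using primD[OF assms(1), of x] primD[OF assms(2), of x] x by (simp add: integral_add)
qed

lemma prim_cmult: "prim c d F f \<Longrightarrow> prim c d (\<lambda>x. k * F x) (\<lambda>x. k * f x)" for k :: complex
  by (rule prim_bounded_linear[OF _ bounded_linear_mult_right])

lemma abs_int_of_real: "f absolutely_integrable_on S \<Longrightarrow> (\<lambda>x. complex_of_real (f x)) absolutely_integrable_on S"
  using absolutely_integrable_linear[OF _ bounded_linear_of_real[where 'a=complex]] by (simp add: o_def)

lemma loc_int_of_real: "loc_int f \<Longrightarrow> loc_int (\<lambda>x. complex_of_real (f x))"
  by (simp add: loc_int_def abs_int_of_real)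

lemma loc_int_norm: "loc_int f \<Longrightarrow> loc_int (\<lambda>x. norm (f x))"
  by (simp add: loc_int_def absolutely_integrable_norm[unfolded o_def])

lemma loc_int_Pair: "loc_int f \<Longrightarrow> loc_int g \<Longrightarrow> loc_int (\<lambda>x. (f x, g x))"
proof -
  assume fg: "loc_int f" "loc_int g"
  have bl: "bounded_linear (\<lambda>x::'a. (x, 0::'b))" "bounded_linear (\<lambda>y::'b. (0::'a, y))"
    by (auto intro!: bounded_linear_Pair bounded_linear_ident bounded_linear_zero)
  have "loc_int (\<lambda>x. (f x, 0::'b))" "loc_int (\<lambda>x. (0::'a, g x))"
    using fg unfolding loc_int_def
    by (blast intro: absolutely_integrable_linear[OF _ bl(1), unfolded o_def] absolutely_integrable_linear[OF _ bl(2), unfolded o_def])+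
  then have "loc_int (\<lambda>x. (f x, 0) + (0, g x))" by (rule loc_int_add)
  then show ?thesis by simp
qed

lemma norm_add_leD1: "norm x + norm y \<le> C \<Longrightarrow> norm x \<le> C"
  and norm_add_leD2: "norm x + norm y \<le> C \<Longrightarrow> norm y \<le> C"
  using norm_ge_zero[of x] norm_ge_zero[of y] by linarith+

section \<open>Solutions of the Sturm-Liouville equation\<close>

text \<open>A remainder of second order yields differentiability together with the derivative. It is
  applied to solutions and resolvents as functions of the spectral parameter, where a candidate for
  the derivative is at hand.\<close>

lemma quadratic_remainder_derivative:
  fixes f :: "complex \<Rightarrow> complex"
  assumes "d > 0" and f: "\<And>z. norm (z - z0) \<le> d \<Longrightarrow> norm (f z - f z0 - (z - z0) * f') \<le> K * norm (z - z0) ^ 2"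
  shows "(f has_field_derivative f') (at z0)"
  unfolding has_field_derivative_iff
proof (rule Lim_null_comparison[THEN Lim_null[THEN iffD2]])
  have "\<forall>\<^sub>F z in at z0. z \<noteq> z0 \<and> norm (z - z0) \<le> d"
    unfolding eventually_at by (rule exI[of _ d]) (use assms(1) in \<open>auto simp: dist_norm\<close>)
  then show "\<forall>\<^sub>F z in at z0. norm ((f z - f z0) / (z - z0) - f') \<le> K * norm (z - z0)"
  proof eventually_elim
    case (elim z)
    have "(f z - f z0) / (z - z0) - f' = (f z - f z0 - (z - z0) * f') / (z - z0)"
      using elim by (simp add: field_simps)
    then have "norm ((f z - f z0) / (z - z0) - f') = norm (f z - f z0 - (z - z0) * f') / norm (z - z0)"
      by (simp add: norm_divide)
    also have "\<dots> \<le> K * norm (z - z0) ^ 2 / norm (z - z0)"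
      using f elim by (intro divide_right_mono) auto
    finally show ?case using elim by (simp add: power2_eq_square)
  qed
  show "((\<lambda>z. K * norm (z - z0)) \<longlongrightarrow> 0) (at z0)"
    by (intro tendsto_mult_right_zero) (simp add: LIM_zero tendsto_norm_zero)
qed

locale hill =
  fixes a :: real and w p q :: "real \<Rightarrow> real"
  assumes a_pos: "a > 0"
    and w_meas: "w \<in> borel_measurable lebesgue"
    and p_meas: "p \<in> borel_measurable lebesgue"
    and q_meas: "q \<in> borel_measurable lebesgue"
    and w_per: "\<forall>x. w (x + a) = w x"
    and p_per: "\<forall>x. p (x + a) = p x"
    and q_per: "\<forall>x. q (x + a) = q x"
    and w_int: "set_integrable lebesgue {0<..<a} w"
    and q_int: "set_integrable lebesgue {0<..<a} q"
    and p_int: "set_integrable lebesgue {0<..<a} (\<lambda>x. inverse (p x))"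
    and w_nz: "AE x in lebesgue. w x \<noteq> 0"
    and p_pos: "AE x in lebesgue. p x > 0"
begin

lemma loc_w: "loc_int w" and loc_q: "loc_int q" and loc_p: "loc_int (\<lambda>x. inverse (p x))"
  using a_pos w_per p_per q_per w_int q_int p_int by (auto intro!: periodic_loc_int)

text \<open>The equation (1/w)(-(p y')' + q y) = g as the first order system y' = u / p, u' = q y -
  w g in integrated form, with u the quasi-derivative p y'. No derivative of a coefficient
  occurs.\<close>

definition eqn :: "real \<Rightarrow> real \<Rightarrow> (real \<Rightarrow> complex) \<Rightarrow> (real \<Rightarrow> complex) \<Rightarrow> (real \<Rightarrow> complex) \<Rightarrow> bool" where
  "eqn c d g y u \<longleftrightarrow> prim c d y (\<lambda>x. of_real (inverse (p x)) * u x) \<and>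
     prim c d u (\<lambda>x. of_real (q x) * y x - of_real (w x) * g x)"

text \<open>Since p > 0 and w \<noteq> 0 almost everywhere, the pointwise relations can be solved
  for both derivatives; these are integrable because \<open>y\<close> and \<open>u\<close> are
  continuous and 1/p, q and w g are integrable.\<close>

lemma eqn_I:
  assumes y: "abs_cont_on c d y" and u: "abs_cont_on c d u"
    and e: "AE x in lebesgue. x \<in> {c<..<d} \<longrightarrow> (\<exists>f' u'. (y has_vector_derivative f') (at x) \<and> (u has_vector_derivative u') (at x) \<and>
        u x = of_real (p x) * f' \<and> g x = 1 / of_real (w x) * (- u' + of_real (q x) * y x))"
    and g: "(\<lambda>x. of_real (w x) * g x) absolutely_integrable_on {c..d}"
  shows "eqn c d g y u"
proof -
  have "AE x in lebesgue. x \<in> {c<..<d} \<longrightarrow> (y has_vector_derivative of_real (inverse (p x)) * u x) (at x) \<and>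
      (u has_vector_derivative (of_real (q x) * y x - of_real (w x) * g x)) (at x)"
    using e w_nz p_pos
  proof eventually_elim
    case (elim x)
    show ?case
    proof
      assume "x \<in> {c<..<d}"
      then obtain f' u' where d: "(y has_vector_derivative f') (at x)" "(u has_vector_derivative u') (at x)"
        and eq: "u x = of_real (p x) * f'" "g x = 1 / of_real (w x) * (- u' + of_real (q x) * y x)"
        using elim(1) by blast
      have "f' = of_real (inverse (p x)) * u x" "u' = of_real (q x) * y x - of_real (w x) * g x"
        using elim eq by (simp_all add: field_simps)
      then show "(y has_vector_derivative of_real (inverse (p x)) * u x) (at x) \<and>
          (u has_vector_derivative (of_real (q x) * y x - of_real (w x) * g x)) (at x)" using d by simp
    qed
  qed
  then obtain N where N: "negligible N"
    "\<forall>x. x \<notin> N \<longrightarrow> x \<in> {c<..<d} \<longrightarrow> (y has_vector_derivative of_real (inverse (p x)) * u x) (at x) \<and>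
      (u has_vector_derivative (of_real (q x) * y x - of_real (w x) * g x)) (at x)"
    by (rule AE_lebesgueE)
  have ap: "(\<lambda>x. u x * of_real (inverse (p x))) absolutely_integrable_on {c..d}"
    using loc_int_of_real[OF loc_p] abs_cont_on_imp_continuous_on[OF u]
    by (intro absolutely_integrable_continuous_mult) (auto simp: loc_int_def)
  have aq: "(\<lambda>x. y x * of_real (q x)) absolutely_integrable_on {c..d}"
    using loc_int_of_real[OF loc_q] abs_cont_on_imp_continuous_on[OF y]
    by (intro absolutely_integrable_continuous_mult) (auto simp: loc_int_def)
  have 1: "prim c d y (\<lambda>x. of_real (inverse (p x)) * u x)"
    by (rule primI_abs_cont[OF y _ N(1)]) (use ap N(2) in \<open>auto simp: mult.commute\<close>)
  have 2: "prim c d u (\<lambda>x. of_real (q x) * y x - of_real (w x) * g x)"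
    by (rule primI_abs_cont[OF u _ N(1)]) (use aq g N(2) in \<open>auto simp: mult.commute intro!: set_integral_diff\<close>)
  show ?thesis using 1 2 by (simp add: eqn_def)
qed

lemma eqn_D:
  assumes "eqn c d g y u"
  shows "abs_cont_on c d y" "abs_cont_on c d u"
    "AE x in lebesgue. x \<in> {c<..<d} \<longrightarrow> (\<exists>f' u'. (y has_vector_derivative f') (at x) \<and> (u has_vector_derivative u') (at x) \<and>
        u x = of_real (p x) * f' \<and> g x = 1 / of_real (w x) * (- u' + of_real (q x) * y x))"
proof -
  have 1: "prim c d y (\<lambda>x. of_real (inverse (p x)) * u x)" and 2: "prim c d u (\<lambda>x. of_real (q x) * y x - of_real (w x) * g x)"
    using assms by (auto simp: eqn_def)
  show "abs_cont_on c d y" "abs_cont_on c d u" using prim_abs_cont_on[OF 1] prim_abs_cont_on[OF 2] .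
  obtain N where N: "negligible N" "\<And>x. x \<in> {c<..<d} - N \<Longrightarrow> (y has_vector_derivative of_real (inverse (p x)) * u x) (at x)"
    by (rule prim_has_derivative[OF 1]) (rule that)
  obtain M where M: "negligible M" "\<And>x. x \<in> {c<..<d} - M \<Longrightarrow> (u has_vector_derivative of_real (q x) * y x - of_real (w x) * g x) (at x)"
    by (rule prim_has_derivative[OF 2]) (rule that)
  have "AE x in lebesgue. x \<notin> N \<union> M"
    by (rule AE_lebesgueI[of "N \<union> M"]) (use N(1) M(1) in auto)
  then show "AE x in lebesgue. x \<in> {c<..<d} \<longrightarrow> (\<exists>f' u'. (y has_vector_derivative f') (at x) \<and> (u has_vector_derivative u') (at x) \<and>
        u x = of_real (p x) * f' \<and> g x = 1 / of_real (w x) * (- u' + of_real (q x) * y x))"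
    using w_nz p_pos
  proof eventually_elim
    case (elim x)
    show ?case
    proof
      assume x: "x \<in> {c<..<d}"
      have "(y has_vector_derivative of_real (inverse (p x)) * u x) (at x)"
        by (rule N(2)) (use elim x in auto)
      moreover have "(u has_vector_derivative of_real (q x) * y x - of_real (w x) * g x) (at x)"
        by (rule M(2)) (use elim x in auto)
      moreover have "u x = of_real (p x) * (of_real (inverse (p x)) * u x)" using elim by simp
      moreover have "g x = 1 / of_real (w x) * (- (of_real (q x) * y x - of_real (w x) * g x) + of_real (q x) * y x)"
        using elim by simp
      ultimately show "\<exists>f' u'. (y has_vector_derivative f') (at x) \<and> (u has_vector_derivative u') (at x) \<and>
        u x = of_real (p x) * f' \<and> g x = 1 / of_real (w x) * (- u' + of_real (q x) * y x)" by blast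
    qed
  qed
qed

lemma eqn_continuous: "eqn c d g y u \<Longrightarrow> continuous_on {c..d} y" "eqn c d g y u \<Longrightarrow> continuous_on {c..d} u"
  by (auto simp: eqn_def intro: prim_continuous_on)

lemma eqn_combine:
  assumes "eqn c d g1 y1 u1" "eqn c d g2 y2 u2"
  shows "eqn c d (\<lambda>x. k * g1 x + l * g2 x) (\<lambda>x. k * y1 x + l * y2 x) (\<lambda>x. k * u1 x + l * u2 x)"
proof -
  have *: "(\<lambda>x. of_real (inverse (p x)) * (k * u1 x + l * u2 x)) = (\<lambda>x. k * (of_real (inverse (p x)) * u1 x) + l * (of_real (inverse (p x)) * u2 x))"
    "(\<lambda>x. of_real (q x) * (k * y1 x + l * y2 x) - of_real (w x) * (k * g1 x + l * g2 x))
     = (\<lambda>x. k * (of_real (q x) * y1 x - of_real (w x) * g1 x) + l * (of_real (q x) * y2 x - of_real (w x) * g2 x))"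
    by (auto simp: algebra_simps)
  show ?thesis
    using assms unfolding eqn_def * by (intro conjI prim_add prim_cmult) auto
qed

lemma eqn_cong:
  assumes "eqn c d g y u" "\<And>x. x \<in> {c..d} \<Longrightarrow> g' x = g x" "\<And>x. x \<in> {c..d} \<Longrightarrow> y' x = y x" "\<And>x. x \<in> {c..d} \<Longrightarrow> u' x = u x"
  shows "eqn c d g' y' u'"
  unfolding eqn_def
proof
  have P: "prim c d y (\<lambda>x. of_real (inverse (p x)) * u x)" "prim c d u (\<lambda>x. of_real (q x) * y x - of_real (w x) * g x)"
    using assms(1) by (auto simp: eqn_def)
  show "prim c d y' (\<lambda>x. of_real (inverse (p x)) * u' x)"
    by (rule prim_cong_AE[OF P(1) negligible_empty]) (use assms(2-4) in auto)
  show "prim c d u' (\<lambda>x. of_real (q x) * y' x - of_real (w x) * g' x)"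
    by (rule prim_cong_AE[OF P(2) negligible_empty]) (use assms(2-4) in auto)
qed

text \<open>Lipschitz constant at x of the right-hand side of the first order system, common to all
  z with |z| \<le> r. Its local integrability is what the Volterra and Gronwall arguments
  require.\<close>

definition \<kappa> :: "real \<Rightarrow> real \<Rightarrow> real" where
  "\<kappa> r x = \<bar>inverse (p x)\<bar> + \<bar>q x\<bar> + r * \<bar>w x\<bar>"

lemma \<kappa>_nonneg: "r \<ge> 0 \<Longrightarrow> \<kappa> r x \<ge> 0"
  by (simp add: \<kappa>_def)

lemma loc_\<kappa>: "loc_int (\<kappa> r)"
  unfolding \<kappa>_def using loc_int_norm[OF loc_p] loc_int_norm[OF loc_q] loc_int_norm[OF loc_w]
  by (intro loc_int_add loc_int_cmult) (auto simp: real_norm_def)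

lemma solution_exists:
  assumes h: "loc_int (\<lambda>x. of_real (w x) * h x)"
  obtains y u where "y 0 = c" "u 0 = d" "\<forall>s t. eqn s t (\<lambda>x. z * y x + h x) y u"
proof -
  define G where "G x Y = (of_real (inverse (p x)) * snd Y, of_real (q x) * fst Y - of_real (w x) * (z * fst Y + h x))"
    for x and Y :: "complex \<times> complex"
  have Gloc: "loc_int (\<lambda>s. G s (Y s))" if Y: "continuous_on UNIV Y" for Y
  proof -
    have "continuous_on UNIV (\<lambda>s. snd (Y s))" "continuous_on UNIV (\<lambda>s. fst (Y s))" using Y by (auto intro: continuous_intros)
    then have "loc_int (\<lambda>s. snd (Y s) * of_real (inverse (p s)))" "loc_int (\<lambda>s. fst (Y s) * of_real (q s))"
       "loc_int (\<lambda>s. z * (fst (Y s) * of_real (w s)))"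
      using loc_w loc_q loc_p by (auto intro!: loc_int_cmult loc_int_continuous_mult[OF _ loc_int_of_real] simp del: of_real_inverse)
    then have "loc_int (\<lambda>s. (snd (Y s) * of_real (inverse (p s)), fst (Y s) * of_real (q s) - (z * (fst (Y s) * of_real (w s)) + of_real (w s) * h s)))"
      using h by (intro loc_int_Pair loc_int_diff[OF _ loc_int_add])
    then show ?thesis by (simp add: G_def algebra_simps)
  qed
  have "\<exists>Y. continuous_on UNIV Y \<and> (\<forall>x. Y x = (c, d) + sint (\<lambda>s. G s (Y s)) x)"
  proof (rule volterra_solution[where \<kappa>="\<kappa> (norm z)", OF loc_\<kappa> \<kappa>_nonneg[OF norm_ge_zero] Gloc], assumption)
    fix s y y'
    show "norm (G s y - G s y') \<le> \<kappa> (norm z) s * norm (y - y')"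
    proof -
      define f g where "f = fst y - fst y'" and "g = snd y - snd y'"
      have fg: "norm f \<le> norm (y - y')" "norm g \<le> norm (y - y')"
        by (cases y; cases y'; simp add: f_def g_def norm_fst_le norm_snd_le)+
      have "G s y - G s y' = (of_real (inverse (p s)) * g, of_real (q s) * f - of_real (w s) * (z * f))"
        by (simp add: G_def f_def g_def algebra_simps)
      also have "norm \<dots> \<le> norm (of_real (inverse (p s)) * g) + norm (of_real (q s) * f - of_real (w s) * (z * f))"
        by (rule norm_Pair_le)
      also have "norm (of_real (q s) * f - of_real (w s) * (z * f)) \<le> \<bar>q s\<bar> * norm f + norm z * \<bar>w s\<bar> * norm f"
        by (rule order_trans[OF norm_triangle_ineq4]) (simp add: norm_mult)
      also have "norm (of_real (inverse (p s)) * g) = \<bar>inverse (p s)\<bar> * norm g"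
        by (simp only: norm_mult norm_of_real)
      also have "\<bar>inverse (p s)\<bar> * norm g + (\<bar>q s\<bar> * norm f + norm z * \<bar>w s\<bar> * norm f)
          \<le> \<bar>inverse (p s)\<bar> * norm (y - y') + (\<bar>q s\<bar> * norm (y - y') + norm z * \<bar>w s\<bar> * norm (y - y'))"
        by (intro add_mono mult_left_mono fg) auto
      also have "\<dots> = \<kappa> (norm z) s * norm (y - y')" by (simp add: \<kappa>_def algebra_simps)
      finally show ?thesis by simp
    qed
  qed
  then obtain Y where Y: "continuous_on UNIV Y" "\<And>x. Y x = (c, d) + sint (\<lambda>s. G s (Y s)) x" by blast
  have P: "prim s t Y (\<lambda>s. G s (Y s))" for s t
    by (rule prim_sint[OF Gloc[OF Y(1)] Y(2)])
  have "eqn s t (\<lambda>x. z * fst (Y x) + h x) (\<lambda>x. fst (Y x)) (\<lambda>x. snd (Y x))" for s t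
    using prim_bounded_linear[OF P bounded_linear_fst, of s t] prim_bounded_linear[OF P bounded_linear_snd, of s t]
    unfolding eqn_def by (simp add: G_def)
  moreover have "Y 0 = (c, d)" using Y(2)[of 0] by simp
  ultimately show thesis using that[of "\<lambda>x. fst (Y x)" "\<lambda>x. snd (Y x)"] by simp
qed

lemma system_norm_le:
  fixes U Y H :: complex
  assumes "norm z \<le> r"
  shows "norm (of_real (inverse (p s)) * U) + norm (of_real (q s) * Y - of_real (w s) * (z * Y + H))
    \<le> \<kappa> r s * (norm Y + norm U) + norm (of_real (w s) * H)"
proof -
  have "norm (of_real (q s) * Y - of_real (w s) * (z * Y + H)) \<le> norm (of_real (q s) * Y) + norm (of_real (w s) * (z * Y + H))"
    by (rule norm_triangle_ineq4)
  also have "norm (of_real (w s) * (z * Y + H)) \<le> norm (of_real (w s) * (z * Y)) + norm (of_real (w s) * H)"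
    unfolding distrib_left by (rule norm_triangle_ineq)
  finally have 1: "norm (of_real (q s) * Y - of_real (w s) * (z * Y + H))
      \<le> \<bar>q s\<bar> * norm Y + norm z * (\<bar>w s\<bar> * norm Y) + norm (of_real (w s) * H)"
    by (simp add: norm_mult algebra_simps)
  have 2: "norm z * (\<bar>w s\<bar> * norm Y) \<le> r * (\<bar>w s\<bar> * norm Y)"
    using assms by (intro mult_right_mono) auto
  have r: "r \<ge> 0" using assms norm_ge_zero order_trans by blast
  have "\<bar>inverse (p s)\<bar> * norm U + \<bar>q s\<bar> * norm Y + r * (\<bar>w s\<bar> * norm Y) \<le> \<kappa> r s * (norm Y + norm U)"
    using r by (simp add: \<kappa>_def algebra_simps)
  moreover have "norm (of_real (inverse (p s)) * U) = \<bar>inverse (p s)\<bar> * norm U"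
    by (simp only: norm_mult norm_of_real)
  ultimately show ?thesis using 1 2 by linarith
qed

text \<open>The Gronwall factor over one period, common to all z with |z| \<le> r.\<close>

definition growth :: "real \<Rightarrow> real" where
  "growth r = exp (integral {0..a} (\<kappa> r))"

lemma growth_pos: "growth r > 0" by (simp add: growth_def)

text \<open>Gronwall's inequality for |y| + |u|; the source enters only through the integral of |w
  h|. The uniformity in |z| \<le> r is used for the differentiability of solutions in z.\<close>

lemma solution_bound:
  assumes e: "eqn 0 a g y u" and g: "\<And>x. x \<in> {0..a} \<Longrightarrow> g x = z * y x + h x"
    and h: "(\<lambda>x. of_real (w x) * h x) absolutely_integrable_on {0..a}" and r: "norm z \<le> r" and x: "x \<in> {0..a}"
  shows "norm (y x) + norm (u x) \<le> (norm (y 0) + norm (u 0) + integral {0..a} (\<lambda>x. norm (of_real (w x) * h x))) * growth r"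
proof -
  \<comment> \<open>Clamping to [0, a] extends |y| + |u| to a continuous function on the line, as
    \<open>gronwall\<close> expects.\<close>
  define cl where "cl x = max 0 (min a x)" for x
  have cl: "cl x \<in> {0..a}" "x \<in> {0..a} \<Longrightarrow> cl x = x" for x using a_pos by (auto simp: cl_def)
  define v where "v x = norm (y (cl x)) + norm (u (cl x))" for x
  have r0: "r \<ge> 0" using r norm_ge_zero order_trans by blast
  have P: "prim 0 a y (\<lambda>x. of_real (inverse (p x)) * u x)" "prim 0 a u (\<lambda>x. of_real (q x) * y x - of_real (w x) * g x)"
    using e by (auto simp: eqn_def)
  have vc: "continuous_on UNIV v"
  proof -
    have "continuous_on UNIV cl" unfolding cl_def by (intro continuous_intros)
    moreover have "cl ` UNIV \<subseteq> {0..a}" using cl by auto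
    ultimately have "continuous_on UNIV (\<lambda>x. y (cl x))" "continuous_on UNIV (\<lambda>x. u (cl x))"
      using eqn_continuous[OF e] continuous_on_compose2 by blast+
    then show ?thesis unfolding v_def by (intro continuous_intros)
  qed
  let ?H = "integral {0..a} (\<lambda>x. norm (of_real (w x) * h x))"
  have hn: "(\<lambda>x. norm (of_real (w x) * h x)) absolutely_integrable_on {0..a}"
    using absolutely_integrable_norm[OF h] by (simp add: o_def)
  have H0: "?H \<ge> 0" using hn by (intro integral_nonneg) (auto simp: absolutely_integrable_on_def)
  define C where "C = norm (y 0) + norm (u 0) + ?H"
  have C0: "C \<ge> 0" using H0 by (simp add: C_def)
  have kv: "loc_int (\<lambda>s. \<kappa> r s * \<bar>v s\<bar>)"
    using loc_int_continuous_mult[OF continuous_on_rabs[OF vc] loc_\<kappa>[of r]] by (simp add: mult.commute)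
  have "\<bar>v x\<bar> \<le> C * exp \<bar>sint (\<kappa> r) x\<bar>"
  proof (rule gronwall[OF loc_\<kappa> \<kappa>_nonneg[OF r0] vc C0])
    show "\<bar>x\<bar> \<le> a" using x by auto
    fix x :: real assume xa: "\<bar>x\<bar> \<le> a"
    show "\<bar>v x\<bar> \<le> C + \<bar>sint (\<lambda>s. \<kappa> r s * \<bar>v s\<bar>) x\<bar>"
    proof (cases "x \<ge> 0")
      case False
      then have "v x = norm (y 0) + norm (u 0)" using a_pos by (simp add: v_def cl_def)
      then show ?thesis using H0 by (simp add: C_def)
    next
      case True
      then have x: "x \<in> {0..a}" using xa by auto
      then have sub: "{0..x} \<subseteq> {0..a}" by auto
      note I = absolutely_integrable_interval_subset[OF _ sub]
      let ?f1 = "\<lambda>x. of_real (inverse (p x)) * u x" and ?f2 = "\<lambda>x. of_real (q x) * y x - of_real (w x) * g x"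
      have ai: "?f1 absolutely_integrable_on {0..x}" "?f2 absolutely_integrable_on {0..x}"
        using P[THEN prim_absolutely_integrable] by (auto intro: I)
      have n: "(\<lambda>s. norm (?f1 s)) integrable_on {0..x}" "(\<lambda>s. norm (?f2 s)) integrable_on {0..x}"
        using ai unfolding absolutely_integrable_on_def by auto
      have hx: "(\<lambda>x. norm (of_real (w x) * h x)) integrable_on {0..x}"
        using I[OF hn] unfolding absolutely_integrable_on_def by auto
      have "norm (y x) \<le> norm (y 0) + norm (integral {0..x} ?f1)"
        using primD[OF P(1), of x] x norm_triangle_ineq[of "y 0"] by simp
      moreover have "norm (integral {0..x} ?f1) \<le> integral {0..x} (\<lambda>s. norm (?f1 s))"
        by (rule integral_norm_bound_integral) (use ai n in \<open>auto simp: absolutely_integrable_on_def\<close>)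
      moreover have "norm (u x) \<le> norm (u 0) + norm (integral {0..x} ?f2)"
        using primD[OF P(2), of x] x norm_triangle_ineq[of "u 0"] by simp
      moreover have "norm (integral {0..x} ?f2) \<le> integral {0..x} (\<lambda>s. norm (?f2 s))"
        by (rule integral_norm_bound_integral) (use ai n in \<open>auto simp: absolutely_integrable_on_def\<close>)
      moreover have "integral {0..x} (\<lambda>s. norm (?f1 s)) + integral {0..x} (\<lambda>s. norm (?f2 s))
          = integral {0..x} (\<lambda>s. norm (?f1 s) + norm (?f2 s))"
        by (rule integral_add[symmetric, OF n])
      moreover have "integral {0..x} (\<lambda>s. norm (?f1 s) + norm (?f2 s))
          \<le> integral {0..x} (\<lambda>s. \<kappa> r s * \<bar>v s\<bar> + norm (of_real (w s) * h s))"
      proof (rule integral_le)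
        show "(\<lambda>s. norm (?f1 s) + norm (?f2 s)) integrable_on {0..x}" by (rule integrable_add[OF n])
        show "(\<lambda>s. \<kappa> r s * \<bar>v s\<bar> + norm (of_real (w s) * h s)) integrable_on {0..x}"
          by (rule integrable_add[OF loc_int_integrable[OF kv] hx])
        fix s assume "s \<in> {0..x}"
        then have s: "s \<in> {0..a}" using x by auto
        show "norm (?f1 s) + norm (?f2 s) \<le> \<kappa> r s * \<bar>v s\<bar> + norm (of_real (w s) * h s)"
          using system_norm_le[OF r, of s "u s" "y s" "h s"] g[OF s] cl(2)[OF s] by (simp add: v_def)
      qed
      moreover have "integral {0..x} (\<lambda>s. \<kappa> r s * \<bar>v s\<bar> + norm (of_real (w s) * h s))
         = integral {0..x} (\<lambda>s. \<kappa> r s * \<bar>v s\<bar>) + integral {0..x} (\<lambda>s. norm (of_real (w s) * h s))"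
        by (rule integral_add[OF loc_int_integrable[OF kv] hx])
      moreover have "integral {0..x} (\<lambda>s. norm (of_real (w s) * h s)) \<le> ?H"
        by (rule integral_subset_le[OF sub hx]) (use hn in \<open>auto simp: absolutely_integrable_on_def\<close>)
      moreover have "integral {0..x} (\<lambda>s. \<kappa> r s * \<bar>v s\<bar>) = sint (\<lambda>s. \<kappa> r s * \<bar>v s\<bar>) x"
        using True by (simp add: sint_nonneg_eq)
      moreover have "\<bar>v x\<bar> = norm (y x) + norm (u x)" using cl(2)[OF x] by (simp add: v_def)
      ultimately show ?thesis unfolding C_def by linarith
    qed
  qed
  also have "\<dots> \<le> C * growth r"
  proof (rule mult_left_mono[OF _ C0])
    have "integral {0..x} (\<kappa> r) \<le> integral {0..a} (\<kappa> r)"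
      using x \<kappa>_nonneg[OF r0] by (intro integral_subset_le loc_int_integrable loc_\<kappa>) auto
    moreover have "sint (\<kappa> r) x \<ge> 0"
      using x \<kappa>_nonneg[OF r0] by (simp add: sint_nonneg_eq integral_nonneg loc_int_integrable loc_\<kappa>)
    ultimately show "exp \<bar>sint (\<kappa> r) x\<bar> \<le> growth r"
      using x by (simp add: growth_def sint_nonneg_eq)
  qed
  finally show ?thesis using cl(2)[OF x] by (simp add: v_def C_def)
qed

text \<open>Zero initial values give Gronwall's inequality with the constant 0, on either side of
  0.\<close>

lemma global_unique:
  assumes e: "\<And>s t. eqn s t (\<lambda>x. z * y x) y u" and "y 0 = 0" "u 0 = 0"
  shows "y x = 0 \<and> u x = 0"
proof -
  define v where "v x = norm (y x) + norm (u x)" for x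
  let ?f1 = "\<lambda>x. of_real (inverse (p x)) * u x" and ?f2 = "\<lambda>x. of_real (q x) * y x - of_real (w x) * (z * y x)"
  have P: "prim s t y ?f1" "prim s t u ?f2" for s t using e by (auto simp: eqn_def)
  have c: "continuous_on UNIV y" "continuous_on UNIV u"
    by (rule prim_continuous_on_UNIV[OF P(1)], rule prim_continuous_on_UNIV[OF P(2)])
  have vc: "continuous_on UNIV v" unfolding v_def by (intro continuous_intros c)
  have kv: "loc_int (\<lambda>s. \<kappa> (norm z) s * \<bar>v s\<bar>)"
    using loc_int_continuous_mult[OF continuous_on_rabs[OF vc] loc_\<kappa>[of "norm z"]] by (simp add: mult.commute)
  have l: "loc_int ?f1" "loc_int ?f2" using loc_int_prim[OF P(1)] loc_int_prim[OF P(2)] .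
  have "\<bar>v x\<bar> \<le> 0 * exp \<bar>sint (\<kappa> (norm z)) x\<bar>"
  proof (rule gronwall[OF loc_\<kappa> \<kappa>_nonneg vc, where X="\<bar>x\<bar>"])
    fix x
    have ln: "loc_int (\<lambda>s. norm (?f1 s) + norm (?f2 s))" by (intro loc_int_add loc_int_norm l)
    have "norm (y x) \<le> \<bar>sint (\<lambda>s. norm (?f1 s)) x\<bar>" "norm (u x) \<le> \<bar>sint (\<lambda>s. norm (?f2 s)) x\<bar>"
      using sint_prim[OF P(1), of x] sint_prim[OF P(2), of x] norm_sint_le[OF l(1) loc_int_norm[OF l(1)], of x]
        norm_sint_le[OF l(2) loc_int_norm[OF l(2)], of x] assms(2,3) by auto
    moreover have "\<bar>sint (\<lambda>s. norm (?f1 s)) x\<bar> + \<bar>sint (\<lambda>s. norm (?f2 s)) x\<bar> = \<bar>sint (\<lambda>s. norm (?f1 s) + norm (?f2 s)) x\<bar>"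
    proof -
      have nn: "0 \<le> integral {c..d} (\<lambda>s. norm (?f1 s))" "0 \<le> integral {c..d} (\<lambda>s. norm (?f2 s))" for c d
        by (intro integral_nonneg loc_int_integrable loc_int_norm l; simp)+
      show ?thesis
        unfolding sint_add[OF loc_int_norm[OF l(1)] loc_int_norm[OF l(2)]]
        using nn[of 0 x] nn[of x 0] by (cases "x \<ge> 0") (simp_all add: sint_nonneg_eq sint_nonpos_eq)
    qed
    moreover have "norm (sint (\<lambda>s. norm (?f1 s) + norm (?f2 s)) x) \<le> \<bar>sint (\<lambda>s. \<kappa> (norm z) s * \<bar>v s\<bar>) x\<bar>"
    proof (rule norm_sint_le[OF ln kv])
      show "norm (norm (?f1 s) + norm (?f2 s)) \<le> \<kappa> (norm z) s * \<bar>v s\<bar>" for s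
        using system_norm_le[OF order_refl, of s "u s" "y s" z 0] by (simp add: v_def)
    qed
    ultimately show "\<bar>v x\<bar> \<le> 0 + \<bar>sint (\<lambda>s. \<kappa> (norm z) s * \<bar>v s\<bar>) x\<bar>" by (simp add: v_def)
  qed auto
  then have "norm (y x) + norm (u x) \<le> 0" by (simp add: v_def)
  then show ?thesis using norm_ge_zero[of "y x"] norm_ge_zero[of "u x"] by (metis add_nonneg_eq_0_iff antisym norm_eq_zero add_nonneg_nonneg)
qed

lemma loc_int_w_continuous: "continuous_on UNIV y \<Longrightarrow> loc_int (\<lambda>x. of_real (w x) * y x)" for y :: "real \<Rightarrow> complex"
  using loc_int_continuous_mult[OF _ loc_int_of_real[OF loc_w]] by (simp add: mult.commute)

lemma sl_expr_UNIV_iff: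
  "(loc_abs_cont y \<and> loc_abs_cont u \<and> sl_expr w p q UNIV y u (\<lambda>x. z * y x)) \<longleftrightarrow> (\<forall>c d. eqn c d (\<lambda>x. z * y x) y u)"
  (is "?L \<longleftrightarrow> ?R")
proof
  assume L: ?L
  show ?R
  proof (intro allI eqn_I)
    fix c d
    show ac: "abs_cont_on c d y" "abs_cont_on c d u" using L by (auto simp: loc_abs_cont_def)
    show "AE x in lebesgue. x \<in> {c<..<d} \<longrightarrow> (\<exists>f' u'. (y has_vector_derivative f') (at x) \<and> (u has_vector_derivative u') (at x) \<and>
        u x = of_real (p x) * f' \<and> z * y x = 1 / of_real (w x) * (- u' + of_real (q x) * y x))"
    proof -
      have "AE x in lebesgue. (\<exists>f' u'. (y has_vector_derivative f') (at x) \<and> (u has_vector_derivative u') (at x) \<and>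
        u x = of_real (p x) * f' \<and> z * y x = 1 / of_real (w x) * (- u' + of_real (q x) * y x))"
        using L unfolding sl_expr_def lebesgue_on_UNIV_eq by blast
      then show ?thesis by eventually_elim blast
    qed
    have "(\<lambda>x. (z * y x) * of_real (w x)) absolutely_integrable_on {c..d}"
      using loc_int_of_real[OF loc_w] abs_cont_on_imp_continuous_on[OF ac(1)]
      by (intro absolutely_integrable_continuous_mult continuous_intros) (auto simp: loc_int_def)
    then show "(\<lambda>x. of_real (w x) * (z * y x)) absolutely_integrable_on {c..d}" by (simp add: mult.commute)
  qed
next
  assume R: ?R
  then have e: "eqn c d (\<lambda>x. z * y x) y u" for c d by blast
  \<comment> \<open>Countably many bounded intervals exhaust the line, so that one null set serves
    for all of them.\<close>
  have "AE x in lebesgue. \<forall>n::nat. x \<in> {- real n<..<real n} \<longrightarrow> (\<exists>f' u'. (y has_vector_derivative f') (at x) \<and> (u has_vector_derivative u') (at x) \<and>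
        u x = of_real (p x) * f' \<and> z * y x = 1 / of_real (w x) * (- u' + of_real (q x) * y x))"
    unfolding AE_all_countable using eqn_D(3)[OF e] by blast
  then have "sl_expr w p q UNIV y u (\<lambda>x. z * y x)"
    unfolding sl_expr_def lebesgue_on_UNIV_eq
  proof eventually_elim
    case (elim x)
    obtain n where "\<bar>x\<bar> < real n" using reals_Archimedean2 by blast
    then have "x \<in> {- real n<..<real n}" by auto
    then show ?case using elim by blast
  qed
  then show ?L using eqn_D[OF e] by (auto simp: loc_abs_cont_def)
qed

section \<open>Fundamental solutions, the discriminant and Floquet solutions\<close>

definition sol_y :: "complex \<Rightarrow> complex \<Rightarrow> complex \<Rightarrow> real \<Rightarrow> complex" where
  "sol_y z c d = fst (sl_solution w p q z c d)"

definition sol_u :: "complex \<Rightarrow> complex \<Rightarrow> complex \<Rightarrow> real \<Rightarrow> complex" where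
  "sol_u z c d = snd (sl_solution w p q z c d)"

text \<open>Existence from the Volterra equation and uniqueness from Gronwall's inequality show that
  the definite description in \<open>sl_solution\<close> denotes.\<close>

lemma sol: "eqn s t (\<lambda>x. z * sol_y z c d x) (sol_y z c d) (sol_u z c d)"
    "sol_y z c d 0 = c" "sol_u z c d 0 = d"
proof -
  have "loc_int (\<lambda>x. of_real (w x) * (\<lambda>_. 0::complex) x)" by (simp add: loc_int_def)
  then obtain y u where yu: "y 0 = c" "u 0 = d" "\<forall>s t. eqn s t (\<lambda>x. z * y x + (\<lambda>_. 0) x) y u"
    by (rule solution_exists)
  then have yu3: "\<And>s t. eqn s t (\<lambda>x. z * y x) y u" by simp
  define S where "S = (\<lambda>(y, u). loc_abs_cont y \<and> loc_abs_cont u \<and> sl_expr w p q UNIV y u (\<lambda>x. z * y x) \<and> y 0 = c \<and> u 0 = d)"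
  have S: "S (y, u) \<longleftrightarrow> (\<forall>s t. eqn s t (\<lambda>x. z * y x) y u) \<and> y 0 = c \<and> u 0 = d" for y u
    using sl_expr_UNIV_iff[of y u z] by (auto simp: S_def)
  have 1: "S (y, u)" using yu yu3 by (simp add: S)
  have uniq: "Y = (y, u)" if "S Y" for Y
  proof -
    obtain y' u' where Y: "Y = (y', u')" by (cases Y)
    have e': "\<And>s t. eqn s t (\<lambda>x. z * y' x) y' u'" "y' 0 = c" "u' 0 = d" using that by (auto simp: Y S)
    have e2: "eqn s t (\<lambda>x. z * (1 * y' x + (-1) * y x)) (\<lambda>x. 1 * y' x + (-1) * y x) (\<lambda>x. 1 * u' x + (-1) * u x)" for s t
      by (rule eqn_cong[OF eqn_combine[OF e'(1) yu3, of s t 1 "-1"]]) (auto simp: algebra_simps)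
    have "1 * y' x + (-1) * y x = 0 \<and> 1 * u' x + (-1) * u x = 0" for x
      by (rule global_unique[OF e2]) (use e' yu in auto)
    then show ?thesis using Y by (simp add: fun_eq_iff)
  qed
  have "sl_solution w p q z c d = (THE Y. S Y)"
    unfolding sl_solution_def S_def ..
  also have "\<dots> = (y, u)" by (rule the_equality[of S, OF 1 uniq])
  finally have "sol_y z c d = y" "sol_u z c d = u" by (simp_all add: sol_y_def sol_u_def)
  then show "eqn s t (\<lambda>x. z * sol_y z c d x) (sol_y z c d) (sol_u z c d)" "sol_y z c d 0 = c" "sol_u z c d 0 = d"
    using yu yu3 by auto
qed

text \<open>The difference of both sides solves the homogeneous equation with zero initial values,
  so \<open>solution_bound\<close> makes it vanish.\<close>

lemma sol_unique:
  assumes e: "eqn 0 a (\<lambda>x. z * y x) y u" and x: "x \<in> {0..a}"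
  shows "y x = y 0 * sol_y z 1 0 x + u 0 * sol_y z 0 1 x" "u x = y 0 * sol_u z 1 0 x + u 0 * sol_u z 0 1 x"
proof -
  let ?y = "\<lambda>x. 1 * y x + (-1) * (y 0 * sol_y z 1 0 x + u 0 * sol_y z 0 1 x)"
  let ?u = "\<lambda>x. 1 * u x + (-1) * (y 0 * sol_u z 1 0 x + u 0 * sol_u z 0 1 x)"
  have e2: "eqn 0 a (\<lambda>x. z * ?y x) ?y ?u"
    by (rule eqn_cong[OF eqn_combine[OF e eqn_combine[OF sol(1)[of 0 a z 1 0] sol(1)[of 0 a z 0 1], where k="y 0" and l="u 0"], where k=1 and l="-1"]])
       (auto simp: algebra_simps)
  have "norm (?y x) + norm (?u x) \<le> (norm (?y 0) + norm (?u 0) + integral {0..a} (\<lambda>x. norm (of_real (w x) * (0::complex)))) * growth (norm z)"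
    by (rule solution_bound[OF e2 _ _ order_refl x, where h="\<lambda>_. 0"]) auto
  also have "\<dots> = 0" by (simp add: sol)
  finally have "norm (?y x) + norm (?u x) \<le> 0" .
  from norm_add_leD1[OF this] norm_add_leD2[OF this] have "?y x = 0" "?u x = 0" by (simp_all only: norm_le_zero_iff)
  then show "y x = y 0 * sol_y z 1 0 x + u 0 * sol_y z 0 1 x" "u x = y 0 * sol_u z 1 0 x + u 0 * sol_u z 0 1 x"
    by algebra+
qed

text \<open>By the product rule the derivative of the Wronskian vanishes, so it keeps its value 1
  from x = 0. Thus the monodromy matrix has determinant 1; its trace is the discriminant.\<close>

lemma wronskian: "sol_y z 1 0 a * sol_u z 0 1 a - sol_y z 0 1 a * sol_u z 1 0 a = 1"
proof -
  let ?y = "sol_y z 1 0" and ?u = "sol_u z 1 0" and ?Y = "sol_y z 0 1" and ?U = "sol_u z 0 1"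
  have P: "prim 0 a ?y (\<lambda>x. of_real (inverse (p x)) * ?u x)" "prim 0 a ?u (\<lambda>x. of_real (q x) * ?y x - of_real (w x) * (z * ?y x))"
     "prim 0 a ?Y (\<lambda>x. of_real (inverse (p x)) * ?U x)" "prim 0 a ?U (\<lambda>x. of_real (q x) * ?Y x - of_real (w x) * (z * ?Y x))"
    using sol(1)[of 0 a z 1 0] sol(1)[of 0 a z 0 1] by (auto simp: eqn_def)
  have "prim 0 a (\<lambda>x. ?y x * ?U x + (-1) * (?Y x * ?u x)) (\<lambda>x. 0)"
    by (rule prim_cong_AE[OF prim_add[OF prim_mult[OF P(1) P(4)] prim_cmult[OF prim_mult[OF P(3) P(2)], of "-1"]] negligible_empty])
       (auto simp: algebra_simps)
  from primD[OF this, of a] show ?thesis using a_pos by (simp add: sol)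
qed

definition D :: "complex \<Rightarrow> complex" where
  "D z = sol_y z 1 0 a + sol_u z 0 1 a"

lemma D_discriminant: "discriminant a w p q = D"
  by (auto simp: fun_eq_iff discriminant_def D_def sol_y_def sol_u_def)

text \<open>The candidate derivative solves the equation differentiated in z: its source is
  \<open>sol_y z0 c d\<close> and its initial values are 0. What remains of the difference after the
  linear term solves an inhomogeneous equation whose source is z - z0 times the difference of two
  solutions, itself of order z - z0.\<close>

lemma sol_differentiable:
  "(\<lambda>z. sol_y z c d a) field_differentiable (at z0)" "(\<lambda>z. sol_u z c d a) field_differentiable (at z0)"
proof -
  let ?r = "norm z0 + 1"
  let ?E = "growth ?r"
  let ?W = "integral {0..a} (\<lambda>x. \<bar>w x\<bar>)"
  have E: "?E > 0" by (rule growth_pos)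
  have W: "?W \<ge> 0" "(\<lambda>x. \<bar>w x\<bar>) integrable_on {0..a}"
    using loc_int_integrable[OF loc_int_norm[OF loc_w]] by (auto intro: integral_nonneg)
  have intw: "integral {0..a} (\<lambda>x. norm (of_real (w x) * h x)) \<le> B * ?W"
    and wint: "(\<lambda>x. of_real (w x) * h x) absolutely_integrable_on {0..a}"
    if h: "continuous_on {0..a} h" and B: "\<And>x. x \<in> {0..a} \<Longrightarrow> norm (h x) \<le> B" for h :: "real \<Rightarrow> complex" and B
  proof -
    have "(\<lambda>x. h x * of_real (w x)) absolutely_integrable_on {0..a}"
      using loc_int_of_real[OF loc_w] by (intro absolutely_integrable_continuous_mult h) (auto simp: loc_int_def)
    then show ai: "(\<lambda>x. of_real (w x) * h x) absolutely_integrable_on {0..a}" by (simp add: mult.commute)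
    have "integral {0..a} (\<lambda>x. norm (of_real (w x) * h x)) \<le> integral {0..a} (\<lambda>x. B * \<bar>w x\<bar>)"
    proof (rule integral_le)
      show "norm (of_real (w x) * h x) \<le> B * \<bar>w x\<bar>" if "x \<in> {0..a}" for x
        using mult_right_mono[OF B[OF that], of "\<bar>w x\<bar>"] by (simp add: norm_mult mult.commute)
    qed (use ai loc_int_integrable[OF loc_int_cmult[OF loc_int_norm[OF loc_w]]] in \<open>auto simp: absolutely_integrable_on_def\<close>)
    then show "integral {0..a} (\<lambda>x. norm (of_real (w x) * h x)) \<le> B * ?W" by simp
  qed
  have solc: "continuous_on {0..a} (sol_y z c d)" for z by (rule eqn_continuous(1)[OF sol(1)])
  let ?C = "(norm c + norm d) * ?E"
  have b0: "norm (sol_y z c d x) \<le> ?C" if "norm (z - z0) \<le> 1" "x \<in> {0..a}" for z x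
  proof -
    have "norm z \<le> ?r" using that(1) norm_triangle_sub[of z z0] by linarith
    then have "norm (sol_y z c d x) + norm (sol_u z c d x) \<le> (norm (sol_y z c d 0) + norm (sol_u z c d 0) + integral {0..a} (\<lambda>x. norm (of_real (w x) * (0::complex)))) * ?E"
      using that by (intro solution_bound[OF sol(1), where h="\<lambda>_. 0" and z=z]) auto
    also have "\<dots> = ?C" by (simp add: sol)
    finally show ?thesis by (rule norm_add_leD1)
  qed
  have "loc_int (\<lambda>x. of_real (w x) * sol_y z0 c d x)"
  proof -
    have "continuous_on UNIV (sol_y z0 c d)"
      by (rule prim_continuous_on_UNIV[where f="\<lambda>x. of_real (inverse (p x)) * sol_u z0 c d x"])
        (use sol(1)[of _ _ z0 c d] in \<open>unfold eqn_def, blast\<close>)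
    then show ?thesis by (rule loc_int_w_continuous)
  qed
  then obtain Y U where YU: "Y 0 = 0" "U 0 = 0" "\<forall>s t. eqn s t (\<lambda>x. z0 * Y x + sol_y z0 c d x) Y U"
    by (rule solution_exists)
  \<comment> \<open>\<open>?C\<close> bounds the solutions for |z - z0| \<le> 1. Each factor
    \<open>?W * ?E\<close> comes from one application of \<open>solution_bound\<close>, first to the
    difference of the solutions and then to the remainder.\<close>
  let ?K = "?C * ?W * ?E * ?W * ?E"
  have K: "norm (sol_y z c d a - sol_y z0 c d a - (z - z0) * Y a) + norm (sol_u z c d a - sol_u z0 c d a - (z - z0) * U a) \<le> ?K * norm (z - z0) ^ 2"
    if z: "norm (z - z0) \<le> 1" for z
  proof -
    let ?y = "\<lambda>x. 1 * sol_y z c d x + (-1) * sol_y z0 c d x" and ?u = "\<lambda>x. 1 * sol_u z c d x + (-1) * sol_u z0 c d x"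
    have e1: "eqn 0 a (\<lambda>x. z0 * ?y x + (z - z0) * sol_y z c d x) ?y ?u"
      by (rule eqn_cong[OF eqn_combine[OF sol(1)[of 0 a z c d] sol(1)[of 0 a z0 c d], of 1 "-1"]]) (auto simp: algebra_simps)
    have b1: "norm (?y x) \<le> norm (z - z0) * ?C * ?W * ?E" if x: "x \<in> {0..a}" for x
    proof -
      have hb: "norm ((z - z0) * sol_y z c d x) \<le> norm (z - z0) * ?C" if "x \<in> {0..a}" for x
        unfolding norm_mult using b0[OF z that] by (rule mult_left_mono) auto
      have hc: "continuous_on {0..a} (\<lambda>x. (z - z0) * sol_y z c d x)" by (intro continuous_intros solc)
      have "norm (?y x) + norm (?u x) \<le> (norm (?y 0) + norm (?u 0) + integral {0..a} (\<lambda>x. norm (of_real (w x) * ((z - z0) * sol_y z c d x)))) * ?E"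
        by (rule solution_bound[OF e1 _ wint[OF hc hb] _ x]) auto
      also have "\<dots> \<le> (0 + 0 + norm (z - z0) * ?C * ?W) * ?E"
        using intw[OF hc hb] E by (intro mult_right_mono add_mono) (auto simp: sol)
      also have "\<dots> = norm (z - z0) * ?C * ?W * ?E" by simp
      finally show ?thesis by (rule norm_add_leD1)
    qed
    let ?Y = "\<lambda>x. 1 * ?y x + (- (z - z0)) * Y x" and ?U = "\<lambda>x. 1 * ?u x + (- (z - z0)) * U x"
    have e2: "eqn 0 a (\<lambda>x. z0 * ?Y x + (z - z0) * ?y x) ?Y ?U"
      by (rule eqn_cong[OF eqn_combine[OF e1 YU(3)[rule_format], of 1 "-(z - z0)"]]) (auto simp: algebra_simps)
    have hb: "norm ((z - z0) * ?y x) \<le> norm (z - z0) * (norm (z - z0) * ?C * ?W * ?E)" if "x \<in> {0..a}" for x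
      unfolding norm_mult[of "z - z0"] using b1[OF that] by (rule mult_left_mono) auto
    have hc: "continuous_on {0..a} (\<lambda>x. (z - z0) * ?y x)" by (intro continuous_intros solc)
    have "norm (?Y a) + norm (?U a) \<le> (norm (?Y 0) + norm (?U 0) + integral {0..a} (\<lambda>x. norm (of_real (w x) * ((z - z0) * ?y x)))) * ?E"
      by (rule solution_bound[OF e2 _ wint[OF hc hb]]) (use a_pos in auto)
    also have "\<dots> \<le> (0 + 0 + norm (z - z0) * (norm (z - z0) * ?C * ?W * ?E) * ?W) * ?E"
      using intw[OF hc hb] E by (intro mult_right_mono add_mono) (auto simp: sol YU)
    also have "\<dots> = ?K * norm (z - z0) ^ 2" by (simp add: power2_eq_square algebra_simps)
    finally show ?thesis by (simp add: algebra_simps)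
  qed
  have "((\<lambda>z. sol_y z c d a) has_field_derivative Y a) (at z0)"
    by (rule quadratic_remainder_derivative[OF zero_less_one], rule norm_add_leD1, rule K)
  then show "(\<lambda>z. sol_y z c d a) field_differentiable (at z0)" by (auto simp: field_differentiable_def)
  have "((\<lambda>z. sol_u z c d a) has_field_derivative U a) (at z0)"
    by (rule quadratic_remainder_derivative[OF zero_less_one], rule norm_add_leD2, rule K)
  then show "(\<lambda>z. sol_u z c d a) field_differentiable (at z0)" by (auto simp: field_differentiable_def)
qed

lemma D_holomorphic: "D holomorphic_on S"
  unfolding holomorphic_on_def D_def
  using field_differentiable_at_within[OF field_differentiable_add[OF sol_differentiable]] by blast

text \<open>Trace \<rho> + 1/\<rho> and determinant 1 make \<rho> an eigenvalue of the monodromy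
  matrix; an eigenvector supplies the initial values.\<close>

lemma floquet_solution_exists:
  assumes "D z = \<rho> + 1 / \<rho>" "\<rho> \<noteq> 0"
  obtains y u where "eqn 0 a (\<lambda>x. z * y x) y u" "y a = \<rho> * y 0" "u a = \<rho> * u 0" "y 0 \<noteq> 0 \<or> u 0 \<noteq> 0"
proof -
  let ?ya = "sol_y z 1 0 a" and ?ua = "sol_u z 1 0 a" and ?Ya = "sol_y z 0 1 a" and ?Ua = "sol_u z 0 1 a"
  have det: "(?ya - \<rho>) * (?Ua - \<rho>) = ?Ya * ?ua"
  proof -
    have "(?ya - \<rho>) * (?Ua - \<rho>) = (?ya * ?Ua - ?Ya * ?ua) + ?Ya * ?ua - \<rho> * D z + \<rho> * \<rho>"
      by (simp add: D_def algebra_simps)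
    also have "\<rho> * D z = 1 + \<rho> * \<rho>" using assms by (simp add: field_simps)
    also have "(?ya * ?Ua - ?Ya * ?ua) + ?Ya * ?ua - (1 + \<rho> * \<rho>) + \<rho> * \<rho> = ?Ya * ?ua"
      unfolding wronskian by simp
    finally show ?thesis .
  qed
  \<comment> \<open>In a singular matrix a vector annihilated by a nonzero row is annihilated by the
    other row as well; if both rows vanish, every vector is.\<close>
  have "\<exists>c d. (c \<noteq> 0 \<or> d \<noteq> 0) \<and> c * ?ya + d * ?Ya = \<rho> * c \<and> c * ?ua + d * ?Ua = \<rho> * d"
  proof (cases "?Ya = 0 \<and> ?ya - \<rho> = 0")
    case False
    then show ?thesis
      using det by (intro exI[of _ "?Ya"] exI[of _ "\<rho> - ?ya"]) (auto simp: algebra_simps)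
  next
    case True
    show ?thesis
    proof (cases "?ua = 0 \<and> ?Ua - \<rho> = 0")
      case False
      then show ?thesis using True by (intro exI[of _ "\<rho> - ?Ua"] exI[of _ "?ua"]) (auto simp: algebra_simps)
    next
      case True': True
      then show ?thesis using True by (intro exI[of _ 1] exI[of _ 0]) auto
    qed
  qed
  then obtain c d where cd: "c \<noteq> 0 \<or> d \<noteq> 0" "c * ?ya + d * ?Ya = \<rho> * c" "c * ?ua + d * ?Ua = \<rho> * d" by blast
  show thesis
  proof (rule that)
    let ?y = "\<lambda>x. c * sol_y z 1 0 x + d * sol_y z 0 1 x" and ?u = "\<lambda>x. c * sol_u z 1 0 x + d * sol_u z 0 1 x"
    show "eqn 0 a (\<lambda>x. z * ?y x) ?y ?u"
      by (rule eqn_cong[OF eqn_combine[OF sol(1)[of 0 a z 1 0] sol(1)[of 0 a z 0 1], of c d]]) (auto simp: algebra_simps)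
    show "?y a = \<rho> * ?y 0" "?u a = \<rho> * ?u 0" "?y 0 \<noteq> 0 \<or> ?u 0 \<noteq> 0" using cd by (simp_all add: sol)
  qed
qed

end

section \<open>The space of square integrable functions\<close>

lemma L2_measurable: "f \<in> L2 M \<Longrightarrow> f \<in> borel_measurable M"
  by (simp add: L2_def)

lemma L2_integrable: "f \<in> L2 M \<Longrightarrow> integrable M (\<lambda>x. (norm (f x))\<^sup>2)"
  by (simp add: L2_def)

lemma L2_norm_nonneg: "0 \<le> L2_norm M f"
  by (simp add: L2_norm_def)

lemma L2_norm_sq: "(L2_norm M f)\<^sup>2 = (\<integral>x. (norm (f x))\<^sup>2 \<partial>M)"
  by (simp add: L2_norm_def)

lemma L2_cmult: "f \<in> L2 M \<Longrightarrow> (\<lambda>x. k * f x) \<in> L2 M"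
  by (auto simp: L2_def norm_mult power_mult_distrib)

lemma L2_add:
  assumes "f \<in> L2 M" "g \<in> L2 M"
  shows "(\<lambda>x. f x + g x) \<in> L2 M"
proof -
  have m: "f \<in> borel_measurable M" "g \<in> borel_measurable M" using assms by (auto simp: L2_def)
  have "integrable M (\<lambda>x. 2 * (norm (f x))\<^sup>2 + 2 * (norm (g x))\<^sup>2)"
    using assms by (intro Bochner_Integration.integrable_add integrable_mult_right) (auto simp: L2_def)
  then have "integrable M (\<lambda>x. (norm (f x + g x))\<^sup>2)"
  proof (rule Bochner_Integration.integrable_bound)
    show "(\<lambda>x. (norm (f x + g x))\<^sup>2) \<in> borel_measurable M" using m by measurable
    have "(norm (f x + g x))\<^sup>2 \<le> 2 * (norm (f x))\<^sup>2 + 2 * (norm (g x))\<^sup>2" for x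
    proof -
      have "(norm (f x + g x))\<^sup>2 \<le> (norm (f x) + norm (g x))\<^sup>2" by (intro power_mono norm_triangle_ineq) auto
      also have "\<dots> \<le> 2 * (norm (f x))\<^sup>2 + 2 * (norm (g x))\<^sup>2"
        using zero_le_power2[of "norm (f x) - norm (g x)"] by (simp add: power2_eq_square algebra_simps)
      finally show ?thesis .
    qed
    then show "AE x in M. norm ((norm (f x + g x))\<^sup>2) \<le> norm (2 * (norm (f x))\<^sup>2 + 2 * (norm (g x))\<^sup>2)" by simp
  qed
  then show ?thesis using m by (simp add: L2_def)
qed

lemma L2_diff: "f \<in> L2 M \<Longrightarrow> g \<in> L2 M \<Longrightarrow> (\<lambda>x. f x - g x) \<in> L2 M"
  using L2_add[of f M "\<lambda>x. (-1) * g x"] L2_cmult[of g M "-1"] by simp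

text \<open>The weight s = sqrt (B / A) would be optimal; adding e to both roots avoids division by
  0 and disappears in the limit. This gives the Cauchy-Schwarz inequality for Bochner and for gauge
  integrals alike.\<close>

lemma sqrt_mult_le_of_weighted:
  fixes A B I :: real
  assumes "A \<ge> 0" "B \<ge> 0" and le: "\<And>s. s > 0 \<Longrightarrow> 2 * I \<le> s * A + B / s"
  shows "I \<le> sqrt A * sqrt B"
proof -
  define x y where "x = sqrt A" and "y = sqrt B"
  have xy: "x \<ge> 0" "y \<ge> 0" "A = x * x" "B = y * y" using assms by (auto simp: x_def y_def)
  have "2 * I \<le> 2 * (x * y) + e * (x + y)" if "e > 0" for e
  proof -
    have 1: "(y + e) / (x + e) * A \<le> (y + e) * x"
      using xy \<open>e > 0\<close> by (simp add: field_simps mult_left_mono)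
    have 2: "B / ((y + e) / (x + e)) \<le> (x + e) * y"
      using xy \<open>e > 0\<close> by (simp add: field_simps mult_left_mono)
    have "2 * I \<le> (y + e) * x + (x + e) * y"
      using le[of "(y + e) / (x + e)"] 1 2 xy \<open>e > 0\<close> by (simp add: divide_pos_pos add_nonneg_pos)
    then show ?thesis by (simp add: algebra_simps)
  qed
  note * = this
  have "2 * I \<le> 2 * (x * y)"
  proof (rule field_le_epsilon)
    fix e :: real assume "e > 0"
    have "e / (x + y + 1) * (x + y) \<le> e"
      using xy \<open>e > 0\<close> by (simp add: field_simps)
    moreover have "e / (x + y + 1) > 0" using xy \<open>e > 0\<close> by simp
    ultimately show "2 * I \<le> 2 * (x * y) + e" using *[of "e / (x + y + 1)"] by linarith
  qed
  then show ?thesis by (simp add: x_def y_def)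
qed

lemma L2_Cauchy_Schwarz:
  assumes f: "f \<in> L2 M" and g: "g \<in> L2 M"
  shows "integrable M (\<lambda>x. norm (f x) * norm (g x))"
    "(\<integral>x. norm (f x) * norm (g x) \<partial>M) \<le> L2_norm M f * L2_norm M g"
proof -
  have m: "f \<in> borel_measurable M" "g \<in> borel_measurable M" using assms by (auto simp: L2_def)
  have amgm: "2 * (norm (f x) * norm (g x)) \<le> s * (norm (f x))\<^sup>2 + (norm (g x))\<^sup>2 / s" if "s > 0" for s x
  proof -
    have "0 \<le> (s * norm (f x) - norm (g x))\<^sup>2 / s" using that by simp
    also have "\<dots> = s * (norm (f x))\<^sup>2 + (norm (g x))\<^sup>2 / s - 2 * (norm (f x) * norm (g x))"
      using that by (simp add: field_simps power2_eq_square)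
    finally show ?thesis by linarith
  qed
  have i: "integrable M (\<lambda>x. s * (norm (f x))\<^sup>2 + (norm (g x))\<^sup>2 / s)" for s
    using L2_integrable[OF f] L2_integrable[OF g] by simp
  show int: "integrable M (\<lambda>x. norm (f x) * norm (g x))"
  proof (rule Bochner_Integration.integrable_bound[OF i[of 1]])
    show "(\<lambda>x. norm (f x) * norm (g x)) \<in> borel_measurable M" using m by measurable
    have "norm (norm (f x) * norm (g x)) \<le> norm (1 * (norm (f x))\<^sup>2 + (norm (g x))\<^sup>2 / 1)" for x
    proof -
      have "0 \<le> norm (f x) * norm (g x)" by simp
      then have "norm (f x) * norm (g x) \<le> 1 * (norm (f x))\<^sup>2 + (norm (g x))\<^sup>2 / 1" using amgm[of 1 x] by linarith
      then show ?thesis by simp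
    qed
    then show "AE x in M. norm (norm (f x) * norm (g x)) \<le> norm (1 * (norm (f x))\<^sup>2 + (norm (g x))\<^sup>2 / 1)" by simp
  qed
  show "(\<integral>x. norm (f x) * norm (g x) \<partial>M) \<le> L2_norm M f * L2_norm M g"
    unfolding L2_norm_def
  proof (rule sqrt_mult_le_of_weighted)
    fix s :: real assume "s > 0"
    have "2 * (\<integral>x. norm (f x) * norm (g x) \<partial>M) = (\<integral>x. 2 * (norm (f x) * norm (g x)) \<partial>M)"
      using int by simp
    also have "\<dots> \<le> (\<integral>x. s * (norm (f x))\<^sup>2 + (norm (g x))\<^sup>2 / s \<partial>M)"
      using int i amgm[OF \<open>s > 0\<close>] by (intro integral_mono) auto
    also have "\<dots> = s * (\<integral>x. (norm (f x))\<^sup>2 \<partial>M) + (\<integral>x. (norm (g x))\<^sup>2 \<partial>M) / s"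
      using L2_integrable[OF f] L2_integrable[OF g] by simp
    finally show "2 * (\<integral>x. norm (f x) * norm (g x) \<partial>M) \<le> s * (\<integral>x. (norm (f x))\<^sup>2 \<partial>M) + (\<integral>x. (norm (g x))\<^sup>2 \<partial>M) / s" .
  qed auto
qed

lemma cnj_borel_measurable: "f \<in> borel_measurable M \<Longrightarrow> (\<lambda>x. cnj (f x)) \<in> borel_measurable M"
  by (rule measurable_compose[OF _ borel_measurable_continuous_onI]) (auto intro: continuous_intros)

lemma L2_inner_integrable: "f \<in> L2 M \<Longrightarrow> g \<in> L2 M \<Longrightarrow> integrable M (\<lambda>x. f x * cnj (g x))"
  by (rule Bochner_Integration.integrable_bound[OF L2_Cauchy_Schwarz(1)[of f M g]])
     (auto simp: norm_mult L2_def intro!: borel_measurable_times cnj_borel_measurable)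

lemma L2_inner_norm_le: "f \<in> L2 M \<Longrightarrow> g \<in> L2 M \<Longrightarrow> norm (L2_inner M f g) \<le> L2_norm M f * L2_norm M g"
  unfolding L2_inner_def
  by (rule order_trans[OF integral_norm_bound order_trans[OF _ L2_Cauchy_Schwarz(2)[of f M g]]])
     (simp_all add: norm_mult)

lemma L2_inner_self: "f \<in> L2 M \<Longrightarrow> L2_inner M f f = of_real ((L2_norm M f)\<^sup>2)"
proof -
  assume "f \<in> L2 M"
  have "L2_inner M f f = (\<integral>x. complex_of_real ((norm (f x))\<^sup>2) \<partial>M)"
    unfolding L2_inner_def by (simp only: complex_norm_square)
  also have "\<dots> = of_real (\<integral>x. (norm (f x))\<^sup>2 \<partial>M)" by (rule integral_complex_of_real)
  finally show ?thesis by (simp add: L2_norm_sq)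
qed

lemma L2_norm_triangle:
  assumes f: "f \<in> L2 M" and g: "g \<in> L2 M"
  shows "L2_norm M (\<lambda>x. f x + g x) \<le> L2_norm M f + L2_norm M g"
proof (rule power2_le_imp_le)
  have "(L2_norm M (\<lambda>x. f x + g x))\<^sup>2 = (\<integral>x. (norm (f x + g x))\<^sup>2 \<partial>M)" by (rule L2_norm_sq)
  also have "\<dots> \<le> (\<integral>x. (norm (f x))\<^sup>2 + 2 * (norm (f x) * norm (g x)) + (norm (g x))\<^sup>2 \<partial>M)"
  proof (rule integral_mono)
    show "integrable M (\<lambda>x. (norm (f x + g x))\<^sup>2)" using L2_integrable[OF L2_add[OF f g]] .
    show "integrable M (\<lambda>x. (norm (f x))\<^sup>2 + 2 * (norm (f x) * norm (g x)) + (norm (g x))\<^sup>2)"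
      using L2_integrable[OF f] L2_integrable[OF g] L2_Cauchy_Schwarz(1)[OF f g] by simp
    fix x
    have "(norm (f x + g x))\<^sup>2 \<le> (norm (f x) + norm (g x))\<^sup>2" by (intro power_mono norm_triangle_ineq) auto
    then show "(norm (f x + g x))\<^sup>2 \<le> (norm (f x))\<^sup>2 + 2 * (norm (f x) * norm (g x)) + (norm (g x))\<^sup>2"
      by (simp add: power2_eq_square algebra_simps)
  qed
  also have "\<dots> = (L2_norm M f)\<^sup>2 + 2 * (\<integral>x. norm (f x) * norm (g x) \<partial>M) + (L2_norm M g)\<^sup>2"
    using L2_integrable[OF f] L2_integrable[OF g] L2_Cauchy_Schwarz(1)[OF f g] by (simp add: L2_norm_sq)
  also have "\<dots> \<le> (L2_norm M f)\<^sup>2 + 2 * (L2_norm M f * L2_norm M g) + (L2_norm M g)\<^sup>2"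
    using L2_Cauchy_Schwarz(2)[OF f g] by simp
  also have "\<dots> = (L2_norm M f + L2_norm M g)\<^sup>2" by (simp add: power2_eq_square algebra_simps)
  finally show "(L2_norm M (\<lambda>x. f x + g x))\<^sup>2 \<le> (L2_norm M f + L2_norm M g)\<^sup>2" .
qed (use L2_norm_nonneg in \<open>simp add: add_nonneg_nonneg\<close>)

lemma L2_norm_cmult: "L2_norm M (\<lambda>x. k * f x) = norm k * L2_norm M f"
  by (simp add: L2_norm_def norm_mult power_mult_distrib real_sqrt_mult)

lemma L2_norm_cong_AE:
  assumes "f \<in> borel_measurable M" "g \<in> borel_measurable M" "AE x in M. f x = g x"
  shows "L2_norm M f = L2_norm M g"
  unfolding L2_norm_def using assms by (intro arg_cong[where f=sqrt] integral_cong_AE) auto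

section \<open>The fibre operators\<close>

context hill begin

abbreviation "PM \<equiv> period_measure a w"
abbreviation "LA \<equiv> lebesgue_on {0<..<a}"

lemma LA_integrable_iff: "integrable LA F \<longleftrightarrow> F absolutely_integrable_on {0..a}" for F :: "real \<Rightarrow> 'b::euclidean_space"
  using absolutely_integrable_on_open_interval[where f=F and a=0 and b=a]
  by (simp add: integrable_restrict_space set_integrable_def)

lemma LA_integral: "integrable LA F \<Longrightarrow> integral\<^sup>L LA F = integral {0..a} F" for F :: "real \<Rightarrow> 'b::euclidean_space"
proof -
  assume "integrable LA F"
  then have "F absolutely_integrable_on {0<..<a}"
    by (simp add: integrable_restrict_space set_integrable_def)
  then have "integral\<^sup>L LA F = integral {0<..<a} F"
    by (simp add: integral_restrict_space set_lebesgue_integral_eq_integral(2)[symmetric] set_lebesgue_integral_def)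
  then show ?thesis by (simp add: integral_open_interval_real)
qed

lemma PM_measurable [simp]: "borel_measurable PM = borel_measurable LA"
  by (rule measurable_cong_sets) (simp_all add: period_measure_def)

lemma w_LA: "w \<in> borel_measurable LA"
  using w_meas by (rule measurable_restrict_space1)

lemma PM_integrable_iff:
  fixes F :: "real \<Rightarrow> 'b::euclidean_space"
  assumes "F \<in> borel_measurable LA"
  shows "integrable PM F \<longleftrightarrow> (\<lambda>x. \<bar>w x\<bar> *\<^sub>R F x) absolutely_integrable_on {0..a}"
  unfolding period_measure_def using assms w_LA by (subst integrable_density) (auto simp: LA_integrable_iff)

lemma PM_integral:
  fixes F :: "real \<Rightarrow> 'b::euclidean_space"
  assumes "F \<in> borel_measurable LA" "integrable PM F"
  shows "integral\<^sup>L PM F = integral {0..a} (\<lambda>x. \<bar>w x\<bar> *\<^sub>R F x)"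
proof -
  have "integral\<^sup>L PM F = integral\<^sup>L LA (\<lambda>x. \<bar>w x\<bar> *\<^sub>R F x)"
    unfolding period_measure_def using assms(1) w_LA by (subst integral_density) auto
  also have "\<dots> = integral {0..a} (\<lambda>x. \<bar>w x\<bar> *\<^sub>R F x)"
    using assms PM_integrable_iff[OF assms(1)] by (intro LA_integral) (simp add: LA_integrable_iff)
  finally show ?thesis .
qed

definition W :: real where "W = integral {0..a} (\<lambda>x. \<bar>w x\<bar>)"

lemma abs_w: "(\<lambda>x. \<bar>w x\<bar>) absolutely_integrable_on {0..a}"
  using loc_int_norm[OF loc_w] by (simp add: loc_int_def)

lemma W_nonneg: "W \<ge> 0"
  unfolding W_def by (rule integral_nonneg) (use abs_w in \<open>auto simp: absolutely_integrable_on_def\<close>)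

lemma one_L2: "(\<lambda>x. 1) \<in> L2 PM" "L2_norm PM (\<lambda>x. 1) = sqrt W"
proof -
  have i: "integrable PM (\<lambda>x. 1::real)" using abs_w by (subst PM_integrable_iff) auto
  then show "(\<lambda>x. 1) \<in> L2 PM" by (simp add: L2_def)
  show "L2_norm PM (\<lambda>x. 1) = sqrt W"
    using PM_integral[OF _ i] by (simp add: L2_norm_def W_def)
qed

text \<open>Cauchy-Schwarz with the constant function 1, as |w| has finite mass over a period.
  Square integrable sources are thus admissible in the integral equations.\<close>

lemma L2_integrable1:
  assumes h: "h \<in> L2 PM"
  shows "(\<lambda>x. of_real (w x) * h x) absolutely_integrable_on {0..a}"
    "integral {0..a} (\<lambda>x. norm (of_real (w x) * h x)) \<le> sqrt W * L2_norm PM h"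
proof -
  have hm: "h \<in> borel_measurable LA" using L2_measurable[OF h] by simp
  have n: "integrable PM (\<lambda>x. norm (h x))"
    using L2_Cauchy_Schwarz(1)[OF one_L2(1) h] by simp
  have eq: "(\<lambda>x. \<bar>w x\<bar> *\<^sub>R norm (h x)) = (\<lambda>x. norm (of_real (w x) * h x))" by (simp add: norm_mult)
  have nm: "(\<lambda>x. norm (h x)) \<in> borel_measurable LA" using hm by measurable
  have ni: "(\<lambda>x. norm (of_real (w x) * h x)) absolutely_integrable_on {0..a}"
    using n PM_integrable_iff[OF nm] eq by simp
  have "integrable LA (\<lambda>x. of_real (w x) * h x)"
  proof (rule Bochner_Integration.integrable_bound)
    show "integrable LA (\<lambda>x. norm (of_real (w x) * h x))" using ni by (simp add: LA_integrable_iff)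
    show "(\<lambda>x. of_real (w x) * h x) \<in> borel_measurable LA" using hm w_LA by measurable
  qed auto
  then show "(\<lambda>x. of_real (w x) * h x) absolutely_integrable_on {0..a}" by (simp add: LA_integrable_iff)
  have "integral {0..a} (\<lambda>x. norm (of_real (w x) * h x)) = integral\<^sup>L PM (\<lambda>x. norm (1::complex) * norm (h x))"
    using PM_integral[OF nm n] eq by simp
  also have "\<dots> \<le> sqrt W * L2_norm PM h"
    using L2_Cauchy_Schwarz(2)[OF one_L2(1) h] by (simp add: one_L2(2))
  finally show "integral {0..a} (\<lambda>x. norm (of_real (w x) * h x)) \<le> sqrt W * L2_norm PM h" .
qed

lemma continuous_LA: "continuous_on {0..a} f \<Longrightarrow> f \<in> borel_measurable LA" for f :: "real \<Rightarrow> 'b::euclidean_space"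
proof -
  assume "continuous_on {0..a} f"
  then have "continuous_on {0<..<a} f" by (rule continuous_on_subset) auto
  then show ?thesis by (rule continuous_imp_measurable_on_sets_lebesgue) auto
qed

lemma continuous_L2:
  assumes f: "continuous_on {0..a} f" and B: "\<And>x. x \<in> {0..a} \<Longrightarrow> norm (f x) \<le> B"
  shows "f \<in> L2 PM" "L2_norm PM f \<le> B * sqrt W"
proof -
  have B0: "B \<ge> 0" using B[of 0] a_pos by (metis atLeastAtMost_iff less_imp_le norm_ge_zero order_refl order_trans)
  have fm: "f \<in> borel_measurable LA" by (rule continuous_LA[OF f])
  have sm: "(\<lambda>x. (norm (f x))\<^sup>2) \<in> borel_measurable LA" using fm by measurable
  have "(\<lambda>x. (norm (f x))\<^sup>2 * \<bar>w x\<bar>) absolutely_integrable_on {0..a}"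
    by (intro absolutely_integrable_continuous_mult abs_w continuous_intros f)
  then have i: "(\<lambda>x. \<bar>w x\<bar> *\<^sub>R (norm (f x))\<^sup>2) absolutely_integrable_on {0..a}" by (simp add: mult.commute)
  then have I: "integrable PM (\<lambda>x. (norm (f x))\<^sup>2)" by (simp add: PM_integrable_iff[OF sm])
  then show "f \<in> L2 PM" using fm by (simp add: L2_def)
  have "(L2_norm PM f)\<^sup>2 = integral {0..a} (\<lambda>x. \<bar>w x\<bar> *\<^sub>R (norm (f x))\<^sup>2)"
    unfolding L2_norm_sq by (rule PM_integral[OF sm I])
  also have "\<dots> \<le> integral {0..a} (\<lambda>x. B\<^sup>2 * \<bar>w x\<bar>)"
  proof (rule integral_le)
    show "\<bar>w x\<bar> *\<^sub>R (norm (f x))\<^sup>2 \<le> B\<^sup>2 * \<bar>w x\<bar>" if "x \<in> {0..a}" for x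
      using mult_right_mono[OF power_mono[OF B[OF that] norm_ge_zero, of 2], of "\<bar>w x\<bar>"] by (simp add: mult.commute)
    show "(\<lambda>x. B\<^sup>2 * \<bar>w x\<bar>) integrable_on {0..a}"
      using loc_int_integrable[OF loc_int_cmult[OF loc_int_norm[OF loc_w]], of "B\<^sup>2" 0 a] by simp
  qed (use i in \<open>auto simp: absolutely_integrable_on_def\<close>)
  also have "\<dots> = B\<^sup>2 * W" by (simp add: W_def)
  also have "\<dots> = (B * sqrt W)\<^sup>2" using W_nonneg by (simp add: power_mult_distrib)
  finally show "L2_norm PM f \<le> B * sqrt W"
    by (rule power2_le_imp_le) (use B0 W_nonneg in auto)
qed

lemma continuous_L2': "continuous_on {0..a} f \<Longrightarrow> f \<in> L2 PM"
proof -
  assume f: "continuous_on {0..a} f"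
  have "bounded (f ` {0..a})" by (intro compact_imp_bounded compact_continuous_image f) auto
  then obtain B where "\<forall>y\<in>f ` {0..a}. norm y \<le> B" unfolding bounded_iff by blast
  then show ?thesis using continuous_L2(1)[OF f, of B] by blast
qed

text \<open>Square integrability of \<open>g\<close> makes w g integrable, so the definition of the
  fibre operator reduces to the integral equations.\<close>

lemma fibre_iff:
  "(f, g) \<in> fibre_op a w p q t \<longleftrightarrow> f \<in> L2 PM \<and> g \<in> L2 PM \<and>
     (\<exists>u. eqn 0 a g f u \<and> f a = exp (\<i> * of_real t) * f 0 \<and> u a = exp (\<i> * of_real t) * u 0)"
proof -
  have ae: "sl_expr w p q {0<..<a} f u g \<longleftrightarrow> (AE x in lebesgue. x \<in> {0<..<a} \<longrightarrow> (\<exists>f' u'. (f has_vector_derivative f') (at x) \<and> (u has_vector_derivative u') (at x) \<and>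
        u x = of_real (p x) * f' \<and> g x = 1 / of_real (w x) * (- u' + of_real (q x) * f x)))" for u
    unfolding sl_expr_def by (subst AE_restrict_space_iff) auto
  have "abs_cont_on 0 a f \<and> abs_cont_on 0 a u \<and> sl_expr w p q {0<..<a} f u g \<longleftrightarrow> eqn 0 a g f u" if g: "g \<in> L2 PM" for u
    unfolding ae using eqn_I[of 0 a f u g] eqn_D[of 0 a g f u] L2_integrable1(1)[OF g] by blast
  then show ?thesis unfolding fibre_op_def by auto
qed

lemma zero_if_AE_zero:
  fixes f :: "real \<Rightarrow> complex"
  assumes f: "continuous_on {0..a} f" and ae: "AE x in lebesgue. x \<in> {0<..<a} \<longrightarrow> f x = 0" and x: "x \<in> {0..a}"
  shows "f x = 0"
proof -
  let ?S = "{0<..<a} \<inter> f -` (- {0})"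
  have "open ?S"
    by (rule continuous_open_preimage) (auto intro: continuous_on_subset[OF f])
  moreover obtain N where "negligible N" "\<forall>x. x \<notin> N \<longrightarrow> x \<in> {0<..<a} \<longrightarrow> f x = 0"
    using ae by (rule AE_lebesgueE)
  then have "negligible ?S" by (elim negligible_subset) auto
  ultimately have "?S = {}" using open_not_negligible by blast
  then have z: "\<And>x. x \<in> {0<..<a} \<Longrightarrow> f x = 0" by auto
  have cl: "closure {0<..<a} = {0..a}" using a_pos by simp
  show ?thesis
    by (rule continuous_constant_on_closure[of "{0<..<a}" f 0]) (use f z x cl in auto)
qed

text \<open>As w \<noteq> 0 almost everywhere, \<open>y\<close> vanishes almost everywhere and by
  continuity everywhere; then y' = 0 forces u = p y' to vanish. This excludes eigenfunctions of norm
  0.\<close>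

lemma norm_zero_imp_zero:
  assumes e: "eqn 0 a g y u" and n: "L2_norm PM y = 0"
  shows "y 0 = 0" "u 0 = 0"
proof -
  note c = eqn_continuous[OF e]
  have y2: "y \<in> L2 PM" by (rule continuous_L2'[OF c(1)])
  have "integral\<^sup>L PM (\<lambda>x. (norm (y x))\<^sup>2) = 0" using n L2_norm_sq[of PM y] by simp
  then have "AE x in PM. (norm (y x))\<^sup>2 = 0"
    by (subst (asm) integral_nonneg_eq_0_iff_AE[OF L2_integrable[OF y2]]) auto
  then have "AE x in LA. 0 < ennreal \<bar>w x\<bar> \<longrightarrow> (norm (y x))\<^sup>2 = 0"
    unfolding period_measure_def using w_LA by (subst (asm) AE_density) auto
  then have "AE x in lebesgue. x \<in> {0<..<a} \<longrightarrow> 0 < ennreal \<bar>w x\<bar> \<longrightarrow> (norm (y x))\<^sup>2 = 0"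
    by (subst (asm) AE_restrict_space_iff) auto
  then have ae: "AE x in lebesgue. x \<in> {0<..<a} \<longrightarrow> y x = 0"
    using w_nz by eventually_elim auto
  have y0: "y x = 0" if "x \<in> {0..a}" for x by (rule zero_if_AE_zero[OF c(1) ae that])
  then show "y 0 = 0" using a_pos by simp
  have "AE x in lebesgue. x \<in> {0<..<a} \<longrightarrow> u x = 0"
    using eqn_D(3)[OF e] w_nz p_pos
  proof eventually_elim
    case (elim x)
    show ?case
    proof
      assume x: "x \<in> {0<..<a}"
      then obtain f' where f': "(y has_vector_derivative f') (at x)" "u x = of_real (p x) * f'" using elim by blast
      have "((\<lambda>x. 0) has_vector_derivative f') (at x)"
        by (rule has_vector_derivative_transform_within_open[OF f'(1) open_greaterThanLessThan x]) (use y0 in auto)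
      then have "f' = 0" using has_vector_derivative_const vector_derivative_unique_at by blast
      then show "u x = 0" using f' by simp
    qed
  qed
  then show "u 0 = 0" by (rule zero_if_AE_zero[OF c(2)]) (use a_pos in auto)
qed

section \<open>The inhomogeneous problem with quasi-periodic boundary conditions\<close>

lemma particular_solution:
  assumes h: "(\<lambda>x. of_real (w x) * h x) absolutely_integrable_on {0..a}"
  obtains y u where "eqn 0 a (\<lambda>x. z * y x + h x) y u" "y 0 = 0" "u 0 = 0"
    "norm (y a) + norm (u a) \<le> integral {0..a} (\<lambda>x. norm (of_real (w x) * h x)) * growth (norm z)"
proof -
  \<comment> \<open>Extension by zero turns a source on one period into a locally integrable source
    on the line.\<close>
  define h0 where "h0 x = (if x \<in> {0..a} then h x else 0)" for x
  have "loc_int (\<lambda>x. of_real (w x) * h0 x)"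
    unfolding loc_int_def
  proof (intro allI)
    fix c d
    have "(\<lambda>x. if x \<in> {0..a} then of_real (w x) * h x else 0) absolutely_integrable_on UNIV"
      using h unfolding absolutely_integrable_restrict_UNIV .
    then have "(\<lambda>x. of_real (w x) * h0 x) absolutely_integrable_on UNIV"
      by (simp add: h0_def if_distrib cong: if_cong)
    then show "(\<lambda>x. of_real (w x) * h0 x) absolutely_integrable_on {c..d}"
      by (rule set_integrable_subset) auto
  qed
  then obtain y u where yu: "y 0 = 0" "u 0 = 0" "\<forall>s t. eqn s t (\<lambda>x. z * y x + h0 x) y u"
    by (rule solution_exists)
  have e: "eqn 0 a (\<lambda>x. z * y x + h x) y u"
    by (rule eqn_cong[OF yu(3)[rule_format]]) (auto simp: h0_def)
  have "norm (y a) + norm (u a) \<le> (norm (y 0) + norm (u 0) + integral {0..a} (\<lambda>x. norm (of_real (w x) * h x))) * growth (norm z)"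
    by (rule solution_bound[OF e refl h order_refl]) (use a_pos in auto)
  then show thesis using that e yu by simp
qed

text \<open>Subtracting the particular solution leaves a homogeneous solution with the same initial
  values, which is evaluated at the end of the period.\<close>

lemma boundary_system:
  assumes e: "eqn 0 a (\<lambda>x. z * f x + h x) f u" and ep: "eqn 0 a (\<lambda>x. z * y x + h x) y v" "y 0 = 0" "v 0 = 0"
  shows "f a = f 0 * sol_y z 1 0 a + u 0 * sol_y z 0 1 a + y a" "u a = f 0 * sol_u z 1 0 a + u 0 * sol_u z 0 1 a + v a"
proof -
  have e2: "eqn 0 a (\<lambda>x. z * (1 * f x + (-1) * y x)) (\<lambda>x. 1 * f x + (-1) * y x) (\<lambda>x. 1 * u x + (-1) * v x)"
    by (rule eqn_cong[OF eqn_combine[OF e ep(1), of 1 "-1"]]) (auto simp: algebra_simps)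
  show "f a = f 0 * sol_y z 1 0 a + u 0 * sol_y z 0 1 a + y a" "u a = f 0 * sol_u z 1 0 a + u 0 * sol_u z 0 1 a + v a"
    using sol_unique[OF e2, of a] a_pos ep(2,3) by (simp_all add: algebra_simps)
qed

text \<open>Characteristic polynomial of the monodromy matrix at \<rho>, that is, the determinant of
  the linear system which the quasi-periodic boundary conditions impose on the initial
  values.\<close>

definition bdet :: "complex \<Rightarrow> complex \<Rightarrow> complex" where
  "bdet z \<rho> = (sol_y z 1 0 a - \<rho>) * (sol_u z 0 1 a - \<rho>) - sol_y z 0 1 a * sol_u z 1 0 a"

lemma bdet_eq: "bdet z \<rho> = 1 - \<rho> * D z + \<rho> * \<rho>"
proof -
  have "bdet z \<rho> = (sol_y z 1 0 a * sol_u z 0 1 a - sol_y z 0 1 a * sol_u z 1 0 a) - \<rho> * D z + \<rho> * \<rho>"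
    by (simp add: bdet_def D_def algebra_simps)
  then show ?thesis by (simp only: wronskian)
qed

lemma bdet_nonzero: "\<rho> \<noteq> 0 \<Longrightarrow> D z \<noteq> \<rho> + 1 / \<rho> \<Longrightarrow> bdet z \<rho> \<noteq> 0"
  by (auto simp: bdet_eq field_simps)

text \<open>Cramer's rule bounds the initial values by the source, with the nonzero determinant in
  the denominator; Gronwall's inequality carries the bound over the period. \<open>K\<close> depends
  on z and \<rho> but not on the source.\<close>

lemma floquet_bound:
  assumes \<rho>: "\<rho> \<noteq> 0" "D z \<noteq> \<rho> + 1 / \<rho>"
  obtains K where "\<forall>f u h. eqn 0 a (\<lambda>x. z * f x + h x) f u \<longrightarrow> f a = \<rho> * f 0 \<longrightarrow> u a = \<rho> * u 0 \<longrightarrow>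
     (\<lambda>x. of_real (w x) * h x) absolutely_integrable_on {0..a} \<longrightarrow>
     (\<forall>x\<in>{0..a}. norm (f x) \<le> K * integral {0..a} (\<lambda>x. norm (of_real (w x) * h x)))"
proof -
  let ?ya = "sol_y z 1 0 a" and ?ua = "sol_u z 1 0 a" and ?Ya = "sol_y z 0 1 a" and ?Ua = "sol_u z 0 1 a"
  let ?\<Delta> = "bdet z \<rho>" and ?G = "growth (norm z)"
  have \<Delta>: "?\<Delta> \<noteq> 0" by (rule bdet_nonzero[OF \<rho>])
  define m where "m = norm (?ya - \<rho>) + norm (?Ua - \<rho>) + norm ?Ya + norm ?ua"
  define K where "K = (2 * (m * ?G / norm ?\<Delta>) + 1) * ?G"
  have G: "?G > 0" by (rule growth_pos)
  show thesis
  proof (rule that[of K], intro allI impI ballI)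
    fix f u h x
    assume e: "eqn 0 a (\<lambda>x. z * f x + h x) f u" and bc: "f a = \<rho> * f 0" "u a = \<rho> * u 0"
      and h: "(\<lambda>x. of_real (w x) * h x) absolutely_integrable_on {0..a}" and x: "x \<in> {0..a}"
    let ?H = "integral {0..a} (\<lambda>x. norm (of_real (w x) * h x))"
    have H: "?H \<ge> 0"
      by (rule integral_nonneg) (use h in \<open>auto simp: absolutely_integrable_on_def\<close>)
    obtain y v where yv: "eqn 0 a (\<lambda>x. z * y x + h x) y v" "y 0 = 0" "v 0 = 0" "norm (y a) + norm (v a) \<le> ?H * ?G"
      by (rule particular_solution[OF h])
    note b = boundary_system[OF e yv(1-3)]
    \<comment> \<open>Numerators of Cramer's rule; the coefficients are entries of the adjugate
      matrix.\<close>
    have f0: "?\<Delta> * f 0 = ?Ya * v a - (?Ua - \<rho>) * y a"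
      using b bc unfolding bdet_def by algebra
    have u0: "?\<Delta> * u 0 = ?ua * y a - (?ya - \<rho>) * v a"
      using b bc unfolding bdet_def by algebra
    have m: "norm ?Ya \<le> m" "norm (?Ua - \<rho>) \<le> m" "norm ?ua \<le> m" "norm (?ya - \<rho>) \<le> m" "m \<ge> 0" by (simp_all add: m_def)
    have bd: "norm (A * s - B * r) \<le> m * (?H * ?G)" if "norm A \<le> m" "norm B \<le> m" "norm s + norm r \<le> ?H * ?G" for A B s r :: complex
    proof -
      have "norm (A * s - B * r) \<le> norm A * norm s + norm B * norm r"
        by (metis norm_mult norm_triangle_ineq4)
      also have "\<dots> \<le> m * norm s + m * norm r" using that by (intro add_mono mult_right_mono) auto
      also have "\<dots> \<le> m * (?H * ?G)" using that m by (simp flip: distrib_left add: mult_left_mono)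
      finally show ?thesis .
    qed
    have "norm ?\<Delta> * norm (f 0) \<le> m * (?H * ?G)"
      unfolding norm_mult[symmetric] f0 by (rule bd) (use m yv(4) in auto)
    then have 1: "norm (f 0) \<le> m * (?H * ?G) / norm ?\<Delta>" using \<Delta> by (simp add: field_simps)
    have "norm ?\<Delta> * norm (u 0) \<le> m * (?H * ?G)"
      unfolding norm_mult[symmetric] u0 by (rule bd) (use m yv(4) in auto)
    then have 2: "norm (u 0) \<le> m * (?H * ?G) / norm ?\<Delta>" using \<Delta> by (simp add: field_simps)
    have "norm (f x) + norm (u x) \<le> (norm (f 0) + norm (u 0) + ?H) * ?G"
      by (rule solution_bound[OF e refl h order_refl x])
    also have "\<dots> \<le> (m * (?H * ?G) / norm ?\<Delta> + m * (?H * ?G) / norm ?\<Delta> + ?H) * ?G"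
      using 1 2 G by (intro mult_right_mono add_mono) auto
    also have "\<dots> = K * ?H" by (simp add: K_def algebra_simps)
    finally show "norm (f x) \<le> K * ?H" by (rule norm_add_leD1)
  qed
qed

lemma exp_floquet: "exp (\<i> * of_real t) \<noteq> 0" "exp (\<i> * of_real t) + 1 / exp (\<i> * of_real t) = complex_of_real (2 * cos t)"
proof -
  have "exp (\<i> * of_real t) + 1 / exp (\<i> * of_real t) = cis t + cis (- t)"
    by (simp add: cis_conv_exp exp_minus inverse_eq_divide)
  also have "\<dots> = complex_of_real (2 * cos t)" by (simp add: complex_eq_iff)
  finally show "exp (\<i> * of_real t) + 1 / exp (\<i> * of_real t) = complex_of_real (2 * cos t)" .
qed simp

text \<open>If D z = 2 cos t, a Floquet solution with multiplier e^(it) violates the lower bound.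
  Otherwise the boundary conditions determine the initial values for every source, and
  \<open>floquet_bound\<close> bounds the inverse.\<close>

lemma fibre_resolvent_iff: "z \<in> resolvent_set PM (fibre_op a w p q t) \<longleftrightarrow> D z \<noteq> complex_of_real (2 * cos t)"
proof
  assume z: "z \<in> resolvent_set PM (fibre_op a w p q t)"
  show "D z \<noteq> complex_of_real (2 * cos t)"
  proof
    assume "D z = complex_of_real (2 * cos t)"
    then have "D z = exp (\<i> * of_real t) + 1 / exp (\<i> * of_real t)" by (simp only: exp_floquet)
    then obtain y u where yu: "eqn 0 a (\<lambda>x. z * y x) y u" "y a = exp (\<i> * of_real t) * y 0" "u a = exp (\<i> * of_real t) * u 0" "y 0 \<noteq> 0 \<or> u 0 \<noteq> 0"
      using exp_floquet(1) by (rule floquet_solution_exists)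
    have "y \<in> L2 PM" by (rule continuous_L2'[OF eqn_continuous(1)[OF yu(1)]])
    then have "(y, \<lambda>x. z * y x) \<in> fibre_op a w p q t"
      unfolding fibre_iff using yu L2_cmult by blast
    moreover obtain C where "\<forall>(f, g)\<in>fibre_op a w p q t. L2_norm PM f \<le> C * L2_norm PM (\<lambda>x. g x - z * f x)"
      using z unfolding resolvent_set_def by blast
    ultimately have "L2_norm PM y \<le> C * L2_norm PM (\<lambda>x. z * y x - z * y x)" by fastforce
    moreover have "L2_norm PM (\<lambda>x. z * y x - z * y x) = 0" by (simp add: L2_norm_def)
    ultimately have "L2_norm PM y = 0" using L2_norm_nonneg[of PM y] by simp
    then show False using norm_zero_imp_zero[OF yu(1)] yu(4) by blast
  qed
next
  define \<rho> where "\<rho> = exp (\<i> * of_real t)"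
  assume "D z \<noteq> complex_of_real (2 * cos t)"
  then have Dz: "D z \<noteq> \<rho> + 1 / \<rho>" unfolding \<rho>_def exp_floquet(2) .
  have \<rho>: "\<rho> \<noteq> 0" by (simp add: \<rho>_def)
  let ?ya = "sol_y z 1 0 a" and ?ua = "sol_u z 1 0 a" and ?Ya = "sol_y z 0 1 a" and ?Ua = "sol_u z 0 1 a"
  let ?\<Delta> = "bdet z \<rho>"
  have \<Delta>: "?\<Delta> \<noteq> 0" by (rule bdet_nonzero[OF \<rho> Dz])
  have surj: "\<exists>(f, g)\<in>fibre_op a w p q t. AE x in PM. g x - z * f x = h x" if h: "h \<in> L2 PM" for h
  proof -
    obtain y v where yv: "eqn 0 a (\<lambda>x. z * y x + h x) y v" "y 0 = 0" "v 0 = 0"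
      by (rule particular_solution[OF L2_integrable1(1)[OF h]])
    \<comment> \<open>Initial values of the homogeneous solution that corrects the particular one so
      as to meet the boundary conditions.\<close>
    define c where "c = (?Ya * v a - (?Ua - \<rho>) * y a) / ?\<Delta>"
    define d where "d = (?ua * y a - (?ya - \<rho>) * v a) / ?\<Delta>"
    have cd: "?\<Delta> * c = ?Ya * v a - (?Ua - \<rho>) * y a" "?\<Delta> * d = ?ua * y a - (?ya - \<rho>) * v a"
      using \<Delta> by (simp_all add: c_def d_def)
    let ?f = "\<lambda>x. 1 * (c * sol_y z 1 0 x + d * sol_y z 0 1 x) + 1 * y x"
    let ?u = "\<lambda>x. 1 * (c * sol_u z 1 0 x + d * sol_u z 0 1 x) + 1 * v x"
    have e: "eqn 0 a (\<lambda>x. z * ?f x + h x) ?f ?u"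
      by (rule eqn_cong[OF eqn_combine[OF eqn_combine[OF sol(1)[of 0 a z 1 0] sol(1)[of 0 a z 0 1], of c d] yv(1), of 1 1]])
         (auto simp: algebra_simps)
    have "?\<Delta> * (?f a - \<rho> * ?f 0) = 0"
      using cd yv(2,3) unfolding sol bdet_def by algebra
    then have 1: "?f a = \<rho> * ?f 0" using \<Delta> by simp
    have "?\<Delta> * (?u a - \<rho> * ?u 0) = 0"
      using cd yv(2,3) unfolding sol bdet_def by algebra
    then have 2: "?u a = \<rho> * ?u 0" using \<Delta> by simp
    have f2: "?f \<in> L2 PM" by (rule continuous_L2'[OF eqn_continuous(1)[OF e]])
    have "(?f, \<lambda>x. z * ?f x + h x) \<in> fibre_op a w p q t"
      unfolding fibre_iff using e 1 2 f2 L2_add[OF L2_cmult[OF f2] h] by (auto simp: \<rho>_def)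
    then show ?thesis by (rule bexI[rotated]) simp
  qed
  obtain K where K: "\<forall>f u h. eqn 0 a (\<lambda>x. z * f x + h x) f u \<longrightarrow> f a = \<rho> * f 0 \<longrightarrow> u a = \<rho> * u 0 \<longrightarrow>
     (\<lambda>x. of_real (w x) * h x) absolutely_integrable_on {0..a} \<longrightarrow>
     (\<forall>x\<in>{0..a}. norm (f x) \<le> K * integral {0..a} (\<lambda>x. norm (of_real (w x) * h x)))"
    by (rule floquet_bound[OF \<rho> Dz])
  have bound: "L2_norm PM f \<le> max K 0 * W * L2_norm PM (\<lambda>x. g x - z * f x)"
    if fg: "(f, g) \<in> fibre_op a w p q t" for f g
  proof -
    let ?h = "\<lambda>x. g x - z * f x"
    obtain u where u: "eqn 0 a g f u" "f a = \<rho> * f 0" "u a = \<rho> * u 0" and fg2: "f \<in> L2 PM" "g \<in> L2 PM"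
      using fg unfolding fibre_iff \<rho>_def by blast
    have h2: "?h \<in> L2 PM" by (rule L2_diff[OF fg2(2) L2_cmult[OF fg2(1)]])
    have e: "eqn 0 a (\<lambda>x. z * f x + ?h x) f u" using u(1) by simp
    let ?I = "integral {0..a} (\<lambda>x. norm (of_real (w x) * ?h x))"
    have I: "0 \<le> ?I" "?I \<le> sqrt W * L2_norm PM ?h"
      using L2_integrable1[OF h2] by (auto intro!: integral_nonneg simp: absolutely_integrable_on_def)
    have "norm (f x) \<le> max K 0 * (sqrt W * L2_norm PM ?h)" if "x \<in> {0..a}" for x
    proof -
      have "norm (f x) \<le> K * ?I" using K[rule_format, OF e u(2,3) L2_integrable1(1)[OF h2] that] .
      also have "\<dots> \<le> max K 0 * (sqrt W * L2_norm PM ?h)" using I by (intro mult_mono) auto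
      finally show ?thesis .
    qed
    from continuous_L2(2)[OF eqn_continuous(1)[OF u(1)] this]
    have "L2_norm PM f \<le> max K 0 * (sqrt W * L2_norm PM ?h) * sqrt W" .
    also have "\<dots> = max K 0 * (sqrt W * sqrt W) * L2_norm PM ?h" by (simp only: ac_simps)
    finally show ?thesis using W_nonneg by simp
  qed
  show "z \<in> resolvent_set PM (fibre_op a w p q t)"
    unfolding resolvent_set_def using surj bound by blast
qed

section \<open>Energy estimates on one period\<close>

abbreviation "ip x \<equiv> inverse (p x)"

lemma integral_pos_interval:
  fixes k :: "real \<Rightarrow> real"
  assumes k: "k absolutely_integrable_on {c..d}" and nz: "AE x in lebesgue. k x \<noteq> 0" and "c < d"
  shows "0 < integral {c..d} (\<lambda>x. \<bar>k x\<bar>)"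
proof -
  have ka: "(\<lambda>x. \<bar>k x\<bar>) absolutely_integrable_on {c..d}" using absolutely_integrable_norm[OF k] by (simp add: o_def)
  have nn: "0 \<le> integral {c..d} (\<lambda>x. \<bar>k x\<bar>)"
    by (rule integral_nonneg) (use ka in \<open>auto simp: absolutely_integrable_on_def\<close>)
  moreover have "integral {c..d} (\<lambda>x. \<bar>k x\<bar>) \<noteq> 0"
  proof
    assume "integral {c..d} (\<lambda>x. \<bar>k x\<bar>) = 0"
    then have "integral\<^sup>L lebesgue (\<lambda>x. indicator {c..d} x *\<^sub>R \<bar>k x\<bar>) = 0"
      using set_lebesgue_integral_eq_integral(2)[OF ka] by (simp add: set_lebesgue_integral_def)
    then have "AE x in lebesgue. indicator {c..d} x *\<^sub>R \<bar>k x\<bar> = 0"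
      using ka unfolding set_integrable_def by (subst (asm) integral_nonneg_eq_0_iff_AE) auto
    then have "AE x in lebesgue. x \<notin> {c..d}"
      using nz by eventually_elim (auto simp: indicator_def split: if_splits)
    then obtain N where "negligible N" "\<forall>x. x \<notin> N \<longrightarrow> x \<notin> {c..d}" by (rule AE_lebesgueE)
    then have "negligible (cbox c d)" by (elim negligible_subset) auto
    then have "box c d = {}" using negligible_interval(1) by blast
    then show False using \<open>c < d\<close> by simp
  qed
  ultimately show ?thesis by linarith
qed

lemma abs_int_ip: "ip absolutely_integrable_on {c..d}" "(\<lambda>x. \<bar>ip x\<bar>) absolutely_integrable_on {c..d}"
  using loc_p loc_int_norm[OF loc_p] by (simp_all add: loc_int_def)

lemma abs_int_q: "q absolutely_integrable_on {c..d}" "(\<lambda>x. \<bar>q x\<bar>) absolutely_integrable_on {c..d}"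
  using loc_q loc_int_norm[OF loc_q] by (simp_all add: loc_int_def)

lemma abs_int_w: "w absolutely_integrable_on {c..d}" "(\<lambda>x. \<bar>w x\<bar>) absolutely_integrable_on {c..d}"
  using loc_w loc_int_norm[OF loc_w] by (simp_all add: loc_int_def)

lemma ip_nz: "AE x in lebesgue. ip x \<noteq> 0"
  using p_pos by eventually_elim auto

lemma ip_pos: "AE x in lebesgue. \<bar>ip x\<bar> = ip x"
  using p_pos by eventually_elim auto

lemma int_mult_cont:
  fixes k :: "real \<Rightarrow> real"
  assumes "k absolutely_integrable_on {c..d}" "continuous_on {c..d} f"
  shows "(\<lambda>x. k x * f x) absolutely_integrable_on {c..d}" "(\<lambda>x. k x * f x) integrable_on {c..d}"
  using absolutely_integrable_continuous_mult[OF assms(2,1)] by (simp_all add: mult.commute absolutely_integrable_on_def)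

text \<open>With u = p f' this is \<integral> p |f'|^2, written without the derivative of f.\<close>

definition energy :: "(real \<Rightarrow> complex) \<Rightarrow> real" where
  "energy u = integral {0..a} (\<lambda>x. \<bar>ip x\<bar> * (norm (u x))\<^sup>2)"

definition sqnorm :: "(real \<Rightarrow> complex) \<Rightarrow> real" where
  "sqnorm f = integral {0..a} (\<lambda>x. \<bar>w x\<bar> * (norm (f x))\<^sup>2)"

definition Ip :: real where "Ip = integral {0..a} (\<lambda>x. \<bar>ip x\<bar>)"
definition Iq :: real where "Iq = integral {0..a} (\<lambda>x. \<bar>q x\<bar>)"

lemma weighted_nonneg: "k absolutely_integrable_on {c..d} \<Longrightarrow> (\<And>x. 0 \<le> k x) \<Longrightarrow> 0 \<le> integral {c..d} k" for k :: "real \<Rightarrow> real"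
  by (rule integral_nonneg) (auto simp: absolutely_integrable_on_def)

lemma Ip_pos: "Ip > 0"
  unfolding Ip_def by (rule integral_pos_interval[OF abs_int_ip(1) ip_nz a_pos])

lemma Iq_nonneg: "Iq \<ge> 0"
  unfolding Iq_def by (rule weighted_nonneg[OF abs_int_q(2)]) auto

lemma sq_cont: "continuous_on S f \<Longrightarrow> continuous_on S (\<lambda>x. (norm (f x))\<^sup>2)"
  by (intro continuous_intros)

lemma energy_nonneg: "continuous_on {0..a} u \<Longrightarrow> energy u \<ge> 0"
  unfolding energy_def by (rule weighted_nonneg[OF int_mult_cont(1)[OF abs_int_ip(2) sq_cont]]) auto

lemma sqnorm_nonneg: "continuous_on {0..a} f \<Longrightarrow> sqnorm f \<ge> 0"
  unfolding sqnorm_def by (rule weighted_nonneg[OF int_mult_cont(1)[OF abs_int_w(2) sq_cont]]) auto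

lemma sqnorm_L2: 
  assumes f: "continuous_on {0..a} f"
  shows "sqnorm f = (L2_norm PM f)\<^sup>2"
proof -
  have m: "(\<lambda>x. (norm (f x))\<^sup>2) \<in> borel_measurable LA" by (rule continuous_LA[OF sq_cont[OF f]])
  show ?thesis
    unfolding L2_norm_sq sqnorm_def using PM_integral[OF m L2_integrable[OF continuous_L2'[OF f]]] by simp
qed

text \<open>The period is cut into pieces on which \<integral> 1/p is at most \<epsilon>/2. On one
  piece f varies by at most \<integral> |u| / p, whose square is at most the energy times
  \<epsilon>/2 by Cauchy-Schwarz. Averaging |f|^2 over the piece against |w| then replaces the value
  at a point by the weighted norm. This works because |w| has positive mass on every piece;
  \<open>m\<close> is the least of these masses.\<close>

lemma sup_bound:
  assumes "\<epsilon> > 0"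
  obtains C where "C \<ge> 0" "\<forall>f u g. eqn 0 a g f u \<longrightarrow> (\<forall>x\<in>{0..a}. (norm (f x))\<^sup>2 \<le> \<epsilon> * energy u + C * sqnorm f)"
proof -
  define P where "P x = integral {0..x} (\<lambda>x. \<bar>ip x\<bar>)" for x
  have "uniformly_continuous_on {0..a} P"
    unfolding P_def by (intro compact_uniformly_continuous indefinite_integral_continuous_1) (use abs_int_ip(2) in \<open>auto simp: absolutely_integrable_on_def\<close>)
  then obtain \<delta> where \<delta>: "\<delta> > 0" "\<And>x y. x \<in> {0..a} \<Longrightarrow> y \<in> {0..a} \<Longrightarrow> dist y x < \<delta> \<Longrightarrow> dist (P y) (P x) < \<epsilon> / 2"
    unfolding uniformly_continuous_on_def using \<open>\<epsilon> > 0\<close> by (metis half_gt_zero)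
  obtain N0 where "a / \<delta> < real N0" using reals_Archimedean2 by blast
  define N where "N = Suc N0"
  have N: "a / real N < \<delta>" "N > 0"
  proof -
    have "a / \<delta> < real N" using \<open>a / \<delta> < real N0\<close> by (simp add: N_def)
    then show "a / real N < \<delta>" using \<delta>(1) a_pos by (simp add: N_def field_simps)
  qed (simp add: N_def)
  define l r where "l j = real j * a / real N" and "r j = real (Suc j) * a / real N" for j
  define \<mu> where "\<mu> j = integral {l j..r j} (\<lambda>x. \<bar>w x\<bar>)" for j
  have lr: "0 \<le> l j" "l j < r j" "r j \<le> a" "r j - l j = a / real N" if "j < N" for j
  proof -
    have "real (Suc j) * a \<le> real N * a" using that a_pos by (intro mult_right_mono) auto
    then show "r j \<le> a" using N by (simp add: r_def field_simps)
  qed (use that N a_pos in \<open>auto simp: l_def r_def field_simps\<close>)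
  have \<mu>: "\<mu> j > 0" if "j < N" for j
    unfolding \<mu>_def by (rule integral_pos_interval[OF abs_int_w(1) w_nz lr(2)[OF that]])
  define m where "m = Min (\<mu> ` {..<N})"
  have m: "m > 0" "\<And>j. j < N \<Longrightarrow> m \<le> \<mu> j"
    using \<mu> N by (auto simp: m_def Min_gr_iff lessThan_empty_iff)
  have cover: "\<exists>j<N. x \<in> {l j..r j}" if "x \<in> {0..a}" for x
  proof -
    have Nr: "real N > 0" using N by simp
    have "0 \<le> x * real N / a" "x * real N / a \<le> real N"
      using that a_pos mult_right_mono[of x a "real N"] by (auto simp: field_simps)
    show ?thesis
    proof (cases "x = a")
      case True
      then show ?thesis using a_pos N by (intro exI[of _ "N - 1"]) (auto simp: l_def r_def field_simps of_nat_diff)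
    next
      case False
      define j where "j = nat \<lfloor>x * real N / a\<rfloor>"
      have "real j \<le> x * real N / a" "x * real N / a < real j + 1"
        using \<open>0 \<le> x * real N / a\<close> by (auto simp: j_def)
      moreover have "x * real N / a < real N" using that False a_pos Nr by (simp add: field_simps)
      moreover from calculation have "j < N" by linarith
      ultimately have "j < N" "x \<in> {l j..r j}" using a_pos Nr by (auto simp: l_def r_def field_simps)
      then show ?thesis by blast
    qed
  qed
  show thesis
  proof (rule that[of "2 / m", rotated], intro allI impI ballI)
    fix f u g x assume e: "eqn 0 a g f u" and x: "x \<in> {0..a}"
    obtain j where j: "j < N" "x \<in> {l j..r j}" using cover[OF x] by blast
    note c = eqn_continuous[OF e]
    note lr = lr[OF j(1)]
    have sub: "{l j..r j} \<subseteq> {0..a}" using lr by auto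
    have cu: "continuous_on {l j..r j} u" and cf: "continuous_on {l j..r j} f" using c sub by (auto intro: continuous_on_subset)
    let ?J = "integral {l j..r j} (\<lambda>x. \<bar>ip x\<bar> * norm (u x))"
    let ?A = "integral {l j..r j} (\<lambda>x. \<bar>ip x\<bar> * (norm (u x))\<^sup>2)" and ?B = "integral {l j..r j} (\<lambda>x. \<bar>ip x\<bar>)"
    have iA: "(\<lambda>x. \<bar>ip x\<bar> * (norm (u x))\<^sup>2) absolutely_integrable_on {l j..r j}"
      by (rule int_mult_cont(1)[OF abs_int_ip(2) sq_cont[OF cu]])
    have iJ: "(\<lambda>x. \<bar>ip x\<bar> * norm (u x)) absolutely_integrable_on {l j..r j}"
      by (rule int_mult_cont(1)[OF abs_int_ip(2) continuous_on_norm[OF cu]])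
    have hk: "(\<lambda>x. \<bar>ip x\<bar> * (norm (u x))\<^sup>2) integrable_on {l j..r j}" "(\<lambda>x. \<bar>ip x\<bar> * norm (u x)) integrable_on {l j..r j}"
       "(\<lambda>x. \<bar>ip x\<bar>) integrable_on {l j..r j}"
      using iA iJ abs_int_ip(2) by (auto simp: absolutely_integrable_on_def)
    have A0: "?A \<ge> 0" "?B \<ge> 0" by (rule weighted_nonneg[OF iA], simp, rule weighted_nonneg[OF abs_int_ip(2)], simp)
    have J0: "?J \<ge> 0" by (rule weighted_nonneg[OF iJ]) simp
    \<comment> \<open>Cauchy-Schwarz with respect to the measure dx / p on the piece.\<close>
    have "?J \<le> sqrt ?A * sqrt ?B"
    proof (rule sqrt_mult_le_of_weighted[OF A0])
      fix s :: real assume s: "s > 0"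
      have "2 * ?J = integral {l j..r j} (\<lambda>x. 2 * (\<bar>ip x\<bar> * norm (u x)))" by simp
      also have "\<dots> \<le> integral {l j..r j} (\<lambda>x. s * (\<bar>ip x\<bar> * (norm (u x))\<^sup>2) + (1 / s) * \<bar>ip x\<bar>)"
      proof (rule integral_le)
        fix x
        have "0 \<le> \<bar>ip x\<bar> * ((s * norm (u x) - 1)\<^sup>2 / s)" using s by simp
        also have "(s * norm (u x) - 1)\<^sup>2 / s = s * (norm (u x))\<^sup>2 + 1 / s - 2 * norm (u x)"
          using s by (simp add: field_simps power2_eq_square)
        also have "\<bar>ip x\<bar> * (s * (norm (u x))\<^sup>2 + 1 / s - 2 * norm (u x))
            = s * (\<bar>ip x\<bar> * (norm (u x))\<^sup>2) + (1 / s) * \<bar>ip x\<bar> - 2 * (\<bar>ip x\<bar> * norm (u x))"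
          by (simp only: distrib_left right_diff_distrib ac_simps)
        finally show "2 * (\<bar>ip x\<bar> * norm (u x)) \<le> s * (\<bar>ip x\<bar> * (norm (u x))\<^sup>2) + (1 / s) * \<bar>ip x\<bar>" by linarith
      qed (intro integrable_add integrable_on_mult_right hk)+
      also have "\<dots> = s * ?A + (1 / s) * ?B"
        using hk by (simp only: integral_add integrable_on_mult_right integral_mult_right)
      finally show "2 * ?J \<le> s * ?A + ?B / s" by simp
    qed
    then have "?J\<^sup>2 \<le> (sqrt ?A * sqrt ?B)\<^sup>2" using J0 by (rule power_mono)
    then have J2: "?J\<^sup>2 \<le> ?A * ?B" using A0 by (simp add: power_mult_distrib)
    have "?A \<le> energy u"
      unfolding energy_def using int_mult_cont(2)[OF abs_int_ip(2) sq_cont[OF c(2)]] hk(1)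
      by (intro integral_subset_le sub) auto
    moreover have "?B \<le> \<epsilon> / 2"
    proof -
      have "?B = P (r j) - P (l j)"
        unfolding P_def by (rule integral_interval_diff[symmetric, of _ 0 a]) (use lr abs_int_ip(2) in \<open>auto simp: absolutely_integrable_on_def\<close>)
      also have "\<dots> \<le> dist (P (r j)) (P (l j))" by (simp add: dist_real_def)
      also have "\<dots> < \<epsilon> / 2" by (rule \<delta>(2)) (use lr N in \<open>auto simp: dist_real_def\<close>)
      finally show ?thesis by simp
    qed
    ultimately have J3: "?J\<^sup>2 \<le> energy u * (\<epsilon> / 2)"
      using J2 mult_mono[of ?A "energy u" ?B "\<epsilon> / 2"] A0 energy_nonneg[OF c(2)] by linarith
    have fd: "norm (f x - f y) \<le> ?J" if y: "y \<in> {l j..r j}" for y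
    proof -
      have P: "prim 0 a f (\<lambda>x. of_real (ip x) * u x)" using e by (simp add: eqn_def)
      have *: "norm (f t - f s) \<le> ?J" if "l j \<le> s" "s \<le> t" "t \<le> r j" for s t
      proof -
        have st: "{s..t} \<subseteq> {l j..r j}" "0 \<le> s" "t \<le> a" using that lr by auto
        have i: "(\<lambda>x. of_real (ip x) * u x) absolutely_integrable_on {s..t}"
          by (rule absolutely_integrable_interval_subset[OF prim_absolutely_integrable[OF P]]) (use st in auto)
        have n: "(\<lambda>x. \<bar>ip x\<bar> * norm (u x)) integrable_on {s..t}"
          using absolutely_integrable_interval_subset[OF iJ st(1)] by (simp add: absolutely_integrable_on_def)
        have "norm (f t - f s) = norm (integral {s..t} (\<lambda>x. of_real (ip x) * u x))"
          using prim_diff[OF P, of s t] st that by simp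
        also have "\<dots> \<le> integral {s..t} (\<lambda>x. \<bar>ip x\<bar> * norm (u x))"
        proof (rule integral_norm_bound_integral[OF _ n])
          show "(\<lambda>x. of_real (ip x) * u x) integrable_on {s..t}" using i by (simp add: absolutely_integrable_on_def)
        qed (simp only: norm_mult norm_of_real order_refl)
        also have "\<dots> \<le> ?J" by (rule integral_subset_le[OF st(1) n hk(2)]) simp
        finally show ?thesis .
      qed
      show ?thesis using *[of x y] *[of y x] y j(2) by (cases "x \<le> y") (auto simp: norm_minus_commute)
    qed
    have key: "(norm (f x))\<^sup>2 \<le> 2 * (norm (f y))\<^sup>2 + energy u * \<epsilon>" if y: "y \<in> {l j..r j}" for y
    proof -
      have "norm (f x) \<le> norm (f y) + ?J" using fd[OF y] norm_triangle_sub[of "f x" "f y"] by linarith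
      then have "(norm (f x))\<^sup>2 \<le> (norm (f y) + ?J)\<^sup>2" by (rule power_mono) simp
      \<comment> \<open>The factor 2 that arises here is the reason for the bound \<epsilon>/2 on
        the integral of 1/p.\<close>
      also have "\<dots> \<le> 2 * (norm (f y))\<^sup>2 + 2 * ?J\<^sup>2"
        using zero_le_power2[of "norm (f y) - ?J"] by (simp add: power2_eq_square algebra_simps)
      finally show ?thesis using J3 by linarith
    qed
    have iw: "(\<lambda>y. \<bar>w y\<bar> * (norm (f y))\<^sup>2) integrable_on {l j..r j}" by (rule int_mult_cont(2)[OF abs_int_w(2) sq_cont[OF cf]])
    have iw0: "(\<lambda>y. \<bar>w y\<bar>) integrable_on {l j..r j}" using abs_int_w(2) by (simp add: absolutely_integrable_on_def)
    \<comment> \<open>The pointwise inequality is integrated in y against |w| and afterwards divided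
      by the mass of the piece.\<close>
    have "(norm (f x))\<^sup>2 * \<mu> j = integral {l j..r j} (\<lambda>y. (norm (f x))\<^sup>2 * \<bar>w y\<bar>)"
      by (simp add: \<mu>_def)
    also have "\<dots> \<le> integral {l j..r j} (\<lambda>y. 2 * (\<bar>w y\<bar> * (norm (f y))\<^sup>2) + (energy u * \<epsilon>) * \<bar>w y\<bar>)"
    proof (rule integral_le)
      show "(norm (f x))\<^sup>2 * \<bar>w y\<bar> \<le> 2 * (\<bar>w y\<bar> * (norm (f y))\<^sup>2) + (energy u * \<epsilon>) * \<bar>w y\<bar>" if "y \<in> {l j..r j}" for y
        using mult_right_mono[OF key[OF that], of "\<bar>w y\<bar>"] by (simp add: algebra_simps)
    qed (intro integrable_add integrable_on_mult_right iw iw0)+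
    also have "\<dots> = 2 * integral {l j..r j} (\<lambda>y. \<bar>w y\<bar> * (norm (f y))\<^sup>2) + energy u * \<epsilon> * \<mu> j"
      unfolding \<mu>_def using iw iw0 by (subst integral_add) (auto intro: integrable_on_mult_right)
    also have "integral {l j..r j} (\<lambda>y. \<bar>w y\<bar> * (norm (f y))\<^sup>2) \<le> sqnorm f"
      unfolding sqnorm_def using int_mult_cont(2)[OF abs_int_w(2) sq_cont[OF c(1)]] iw
      by (intro integral_subset_le sub) auto
    finally have "((norm (f x))\<^sup>2 - energy u * \<epsilon>) * \<mu> j \<le> 2 * sqnorm f" by (simp add: algebra_simps)
    then have "(norm (f x))\<^sup>2 - energy u * \<epsilon> \<le> 2 * sqnorm f / \<mu> j" using \<mu>[OF j(1)] by (simp add: field_simps)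
    also have "\<dots> \<le> 2 * sqnorm f / m"
      using m(1) m(2)[OF j(1)] sqnorm_nonneg[OF c(1)] by (intro divide_left_mono) auto
    finally show "(norm (f x))\<^sup>2 \<le> \<epsilon> * energy u + 2 / m * sqnorm f" by (simp add: algebra_simps)
  qed (use m in simp)
qed

text \<open>By \<open>sup_bound\<close> the supremum of |f|^2 costs only a small multiple of the
  energy, which is absorbed on the left: \<epsilon> is chosen with B \<epsilon> \<le> 1/2.\<close>

lemma energy_bound:
  assumes "B \<ge> 0"
  obtains C where "C \<ge> 0" "\<forall>f u g. eqn 0 a g f u \<longrightarrow>
     (\<forall>S. (\<forall>x\<in>{0..a}. (norm (f x))\<^sup>2 \<le> S) \<longrightarrow> energy u \<le> B * (sqnorm f + S)) \<longrightarrow> energy u \<le> C * sqnorm f"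
proof -
  define \<epsilon> where "\<epsilon> = 1 / (2 * (B + 1))"
  have \<epsilon>: "\<epsilon> > 0" using assms by (simp add: \<epsilon>_def)
  have B\<epsilon>: "B * \<epsilon> \<le> 1 / 2" using assms by (simp add: \<epsilon>_def field_simps)
  obtain C where C: "C \<ge> 0" "\<forall>f u g. eqn 0 a g f u \<longrightarrow> (\<forall>x\<in>{0..a}. (norm (f x))\<^sup>2 \<le> \<epsilon> * energy u + C * sqnorm f)"
    by (rule sup_bound[OF \<epsilon>])
  show thesis
  proof (rule that[of "2 * B * (1 + C)", rotated], intro allI impI)
    fix f u g assume e: "eqn 0 a g f u" and S: "\<forall>S. (\<forall>x\<in>{0..a}. (norm (f x))\<^sup>2 \<le> S) \<longrightarrow> energy u \<le> B * (sqnorm f + S)"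
    have "energy u \<le> B * (sqnorm f + (\<epsilon> * energy u + C * sqnorm f))" using S C(2) e by blast
    also have "\<dots> = (B * \<epsilon>) * energy u + B * (1 + C) * sqnorm f" by (simp add: algebra_simps)
    also have "\<dots> \<le> 1 / 2 * energy u + B * (1 + C) * sqnorm f"
      using B\<epsilon> energy_nonneg[OF eqn_continuous(2)[OF e]] by (intro add_right_mono mult_right_mono)
    finally show "energy u \<le> 2 * B * (1 + C) * sqnorm f" by simp
  qed (use assms C in simp)
qed

text \<open>
  The second function is \<open>p g'\<close>.  Its continuity makes the term \<open>\<integral> g' p f' cnj f\<close>, which arises when
  the equation is tested with \<open>g\<close>, controllable by the energy and \<open>\<parallel>f\<parallel>\<close>.
\<close>

definition test_function :: "(real \<Rightarrow> real) \<Rightarrow> (real \<Rightarrow> real) \<Rightarrow> bool" where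
  "test_function g k \<longleftrightarrow> continuous_on {0..a} k \<and> prim 0 a (\<lambda>x. complex_of_real (g x)) (\<lambda>x. of_real (ip x * k x))"

lemma test_function_continuous: "test_function g k \<Longrightarrow> continuous_on {0..a} g"
proof -
  assume "test_function g k"
  then have "continuous_on {0..a} (\<lambda>x. Re (complex_of_real (g x)))"
    unfolding test_function_def by (intro continuous_intros prim_continuous_on) auto
  then show ?thesis by simp
qed

lemma test_function_add: "test_function g k \<Longrightarrow> test_function h l \<Longrightarrow> test_function (\<lambda>x. g x + h x) (\<lambda>x. k x + l x)"
  unfolding test_function_def using prim_add[of 0 a "\<lambda>x. complex_of_real (g x)" _ "\<lambda>x. complex_of_real (h x)"]
  by (auto simp: distrib_left intro!: continuous_intros)

lemma test_function_mult:
  assumes "test_function g k" "test_function h l" shows "test_function (\<lambda>x. g x * h x) (\<lambda>x. g x * l x + k x * h x)"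
  unfolding test_function_def
proof
  show "continuous_on {0..a} (\<lambda>x. g x * l x + k x * h x)"
    using assms test_function_continuous[OF assms(1)] test_function_continuous[OF assms(2)] by (auto simp: test_function_def intro!: continuous_intros)
  have "prim 0 a (\<lambda>x. complex_of_real (g x)) (\<lambda>x. of_real (ip x * k x))" "prim 0 a (\<lambda>x. complex_of_real (h x)) (\<lambda>x. of_real (ip x * l x))"
    using assms by (auto simp: test_function_def)
  from prim_mult[OF this] show "prim 0 a (\<lambda>x. complex_of_real (g x * h x)) (\<lambda>x. of_real (ip x * (g x * l x + k x * h x)))"
    by (rule prim_cong_AE[OF _ negligible_empty]) (auto simp: algebra_simps)
qed

lemma test_function_const: "test_function (\<lambda>x. c) (\<lambda>x. 0)"
  by (simp add: test_function_def prim_def)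

text \<open>p P' = 1, so this is the simplest nonconstant test function. Being strictly increasing,
  it separates points for the Stone-Weierstrass theorem; it also serves to adjust boundary
  values.\<close>

definition P :: "real \<Rightarrow> real" where "P x = integral {0..x} ip"

lemma test_function_P: "test_function P (\<lambda>x. 1)"
proof -
  have "prim 0 a P ip"
    by (rule prim_sint[OF loc_p, of _ _ P 0]) (simp add: P_def sint_nonneg_eq)
  from prim_bounded_linear[OF this bounded_linear_of_real[where 'a=complex]]
  show ?thesis by (simp add: test_function_def)
qed

lemma P_strict_mono: "0 \<le> x \<Longrightarrow> x < y \<Longrightarrow> y \<le> a \<Longrightarrow> P x < P y"
proof -
  assume xy: "0 \<le> x" "x < y" "y \<le> a"
  have "P y - P x = integral {x..y} ip"
    unfolding P_def by (rule integral_interval_diff[of _ 0 a]) (use xy abs_int_ip(1) in \<open>auto simp: absolutely_integrable_on_def\<close>)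
  also obtain N where "negligible N" "\<forall>x. x \<notin> N \<longrightarrow> \<bar>ip x\<bar> = ip x" by (rule AE_lebesgueE[OF ip_pos])
  then have "integral {x..y} ip = integral {x..y} (\<lambda>x. \<bar>ip x\<bar>)"
    by (intro integral_spike[of N]) auto
  also have "\<dots> > 0" by (rule integral_pos_interval[OF abs_int_ip(1) ip_nz xy(2)])
  finally show ?thesis by simp
qed

lemma P_0: "P 0 = 0" and P_a: "P a > 0"
  using P_strict_mono[of 0 a] a_pos by (auto simp: P_def)

text \<open>Continuous functions converge almost everywhere to sgn w; clamped to [-1, 1] and cut off
  near the endpoints, they converge in L^1(|w|) by dominated convergence. Test functions form an
  algebra, so one of them is uniformly close to such a continuous function. The zero boundary values
  remove the boundary terms of the energy identity, whatever boundary conditions f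
  satisfies.\<close>

lemma test_function_approx_sgn:
  assumes "\<epsilon> > 0"
  obtains g k where "test_function g k" "g 0 = 0" "g a = 0" "integral {0..a} (\<lambda>x. \<bar>\<bar>w x\<bar> - w x * g x\<bar>) \<le> \<epsilon>"
proof -
  have "(\<lambda>x. sgn (w x)) \<in> borel_measurable lebesgue" using w_meas by measurable
  then have "(\<lambda>x. sgn (w x)) measurable_on UNIV"
    by (rule lebesgue_measurable_imp_measurable_on_real) auto
  then obtain N c where N: "negligible N" and cc: "\<And>n. continuous_on UNIV (c n)" and lim: "\<And>x. x \<notin> N \<Longrightarrow> (\<lambda>n. c n x) \<longlonglongrightarrow> sgn (w x)"
    unfolding measurable_on_def by auto
  \<comment> \<open>The last two factors vanish at 0 and a respectively and tend to 1 in
    between.\<close>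
  define b where "b n x = max (-1) (min 1 (c n x)) * min 1 (real n * x) * min 1 (real n * (a - x))" for n x
  have bc: "continuous_on {0..a} (b n)" for n
    unfolding b_def by (intro continuous_intros continuous_on_subset[OF cc]) auto
  have b1: "\<bar>b n x\<bar> \<le> 1" if "x \<in> {0..a}" for n x
  proof -
    have 1: "\<bar>max (-1) (min 1 (c n x))\<bar> \<le> 1" by auto
    have 2: "\<bar>min 1 (real n * x)\<bar> \<le> 1" "\<bar>min 1 (real n * (a - x))\<bar> \<le> 1"
      using mult_nonneg_nonneg[of "real n" x] mult_nonneg_nonneg[of "real n" "a - x"] that by (auto simp: min_def)
    have "\<bar>A * B * C\<bar> \<le> 1" if "\<bar>A\<bar> \<le> 1" "\<bar>B\<bar> \<le> 1" "\<bar>C\<bar> \<le> 1" for A B C :: real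
      using that by (simp add: abs_mult mult_le_one)
    then show ?thesis unfolding b_def using 1 2 by blast
  qed
  have bl: "(\<lambda>n. b n x) \<longlonglongrightarrow> sgn (w x)" if x: "x \<in> {0<..<a} - N" for x
  proof -
    have ev: "\<forall>\<^sub>F n in sequentially. min 1 (real n * y) = 1" if "y > 0" for y
    proof -
      obtain n0 where "1 / y < real n0" using reals_Archimedean2 by blast
      then have "1 \<le> real n * y" if "n \<ge> n0" for n
      proof -
        have "1 / y < real n" using \<open>1 / y < real n0\<close> that by (meson less_le_trans of_nat_le_iff)
        then show ?thesis using \<open>y > 0\<close> by (simp add: field_simps)
      qed
      then show ?thesis by (intro eventually_sequentiallyI[of n0]) (simp add: min_def)
    qed
    have "(\<lambda>n. max (-1) (min 1 (c n x))) \<longlonglongrightarrow> max (-1) (min 1 (sgn (w x)))"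
      by (intro tendsto_intros lim) (use x in auto)
    moreover have "max (-1) (min 1 (sgn (w x))) = sgn (w x)" by (auto simp: sgn_if)
    moreover have "\<forall>\<^sub>F n in sequentially. max (-1) (min 1 (c n x)) = b n x"
    proof -
      have "\<forall>\<^sub>F n in sequentially. min 1 (real n * x) = 1" "\<forall>\<^sub>F n in sequentially. min 1 (real n * (a - x)) = 1"
        using ev[of x] ev[of "a - x"] x by auto
      then show ?thesis by eventually_elim (simp only: b_def mult_1_right)
    qed
    ultimately show ?thesis using Lim_transform_eventually by fastforce
  qed
  have absw: "\<bar>w x\<bar> = w x * sgn (w x)" for x by (simp add: abs_sgn)
  have wb: "(\<lambda>x. \<bar>\<bar>w x\<bar> - w x * h x\<bar>) absolutely_integrable_on {0..a}" if "continuous_on {0..a} h" for h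
    using absolutely_integrable_norm[OF set_integral_diff(1)[OF abs_int_w(2) int_mult_cont(1)[OF abs_int_w(1) that]]]
    by (simp add: o_def)
  \<comment> \<open>At the endpoints the cut-off spoils the convergence to sgn w; there and on
    \<open>N\<close> the value is set to 0.\<close>
  define F where "F n x = (if x \<in> N \<union> {0, a} then 0 else \<bar>\<bar>w x\<bar> - w x * b n x\<bar>)" for n x
  have NN: "negligible (N \<union> {0, a})" using N by simp
  have Fi: "integral {0..a} (F n) = integral {0..a} (\<lambda>x. \<bar>\<bar>w x\<bar> - w x * b n x\<bar>)" for n
    by (rule integral_spike[OF NN]) (auto simp: F_def)
  have "(\<lambda>n. integral {0..a} (F n)) \<longlonglongrightarrow> integral {0..a} (\<lambda>x. 0::real)"
  proof (rule dominated_convergence(2)[where h="\<lambda>x. 2 * \<bar>w x\<bar>"])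
    show "F n integrable_on {0..a}" for n
    proof (rule integrable_spike[OF _ NN])
      show "(\<lambda>x. \<bar>\<bar>w x\<bar> - w x * b n x\<bar>) integrable_on {0..a}"
        using wb[OF bc[of n]] by (simp add: absolutely_integrable_on_def)
    qed (simp add: F_def)
    show "(\<lambda>x. 2 * \<bar>w x\<bar>) integrable_on {0..a}"
      using abs_int_w(2) by (intro integrable_on_mult_right) (simp add: absolutely_integrable_on_def)
    show "norm (F n x) \<le> 2 * \<bar>w x\<bar>" if "x \<in> {0..a}" for n x
    proof -
      have "\<bar>\<bar>w x\<bar> - w x * b n x\<bar> \<le> \<bar>w x\<bar> + \<bar>w x\<bar> * \<bar>b n x\<bar>" by (rule order_trans[OF abs_triangle_ineq4]) (simp add: abs_mult)
      also have "\<dots> \<le> \<bar>w x\<bar> + \<bar>w x\<bar> * 1" using b1[OF that] by (intro add_left_mono mult_left_mono) auto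
      finally show ?thesis by (simp add: F_def)
    qed
    show "(\<lambda>n. F n x) \<longlonglongrightarrow> 0" if "x \<in> {0..a}" for x
    proof (cases "x \<in> N \<union> {0, a}")
      case False
      then have "(\<lambda>n. \<bar>\<bar>w x\<bar> - w x * b n x\<bar>) \<longlonglongrightarrow> \<bar>\<bar>w x\<bar> - w x * sgn (w x)\<bar>"
        using that by (intro tendsto_intros bl) auto
      then show ?thesis using False absw[of x] by (simp add: F_def)
    qed (simp add: F_def)
  qed
  then have "\<forall>\<^sub>F n in sequentially. integral {0..a} (F n) < \<epsilon> / 2"
    using assms by (intro order_tendstoD(2)) auto
  then obtain n where n: "integral {0..a} (\<lambda>x. \<bar>\<bar>w x\<bar> - w x * b n x\<bar>) < \<epsilon> / 2"
    unfolding Fi eventually_sequentially by blast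
  interpret function_ring_on "{g. \<exists>k. test_function g k}" "{0..a}"
  proof
    show "\<exists>f\<in>{g. \<exists>k. test_function g k}. f x \<noteq> f y" if "x \<in> {0..a}" "y \<in> {0..a}" "x \<noteq> y" for x y
      using test_function_P that P_strict_mono[of x y] P_strict_mono[of y x] by (intro bexI[of _ P]) (auto simp: neq_iff)
  qed (use test_function_continuous test_function_add test_function_mult test_function_const in blast)+
  \<comment> \<open>\<open>g\<close> will differ from \<open>b n\<close> by at most 4 \<eta>, and 4
    \<eta> W \<le> \<epsilon> / 2.\<close>
  define \<eta> where "\<eta> = \<epsilon> / (8 * (W + 1))"
  have \<eta>: "\<eta> > 0" using assms W_nonneg by (simp add: \<eta>_def)
  obtain h l where h: "test_function h l" "\<And>x. x \<in> {0..a} \<Longrightarrow> \<bar>b n x - h x\<bar> < \<eta>"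
    using Stone_Weierstrass_basic[OF bc[of n] \<eta>] by blast
  \<comment> \<open>Subtracting the function affine in \<open>P\<close> with the boundary values of
    \<open>h\<close> gives zero boundary values at a cost of at most 3 \<eta>.\<close>
  define g where "g x = (h x + (- h 0)) + (- (h a - h 0) / P a) * P x" for x
  have g: "test_function g (\<lambda>x. (l x + 0) + ((- (h a - h 0) / P a) * 1 + 0 * P x))"
    unfolding g_def by (intro test_function_add test_function_mult test_function_const h test_function_P)
  have b0: "b n 0 = 0" "b n a = 0" by (simp_all add: b_def)
  have h0: "\<bar>h 0\<bar> < \<eta>" "\<bar>h a\<bar> < \<eta>" using h(2)[of 0] h(2)[of a] a_pos b0 by auto
  have gb: "\<bar>b n x - g x\<bar> \<le> 4 * \<eta>" if x: "x \<in> {0..a}" for x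
  proof -
    have "0 \<le> P x" "P x \<le> P a"
      using P_strict_mono[of 0 x] P_strict_mono[of x a] x P_0 by (cases "x = 0"; cases "x = a"; auto)+
    then have "\<bar>P x / P a\<bar> \<le> 1" using P_a by simp
    then have "\<bar>h a - h 0\<bar> * \<bar>P x / P a\<bar> \<le> (2 * \<eta>) * 1"
      using h0 by (intro mult_mono) auto
    moreover have "b n x - g x = (b n x - h x) + h 0 + (h a - h 0) * (P x / P a)"
      using P_a by (simp add: g_def field_simps)
    ultimately show ?thesis
      using h(2)[OF x] h0 unfolding abs_mult[symmetric] by linarith
  qed
  have "integral {0..a} (\<lambda>x. \<bar>\<bar>w x\<bar> - w x * g x\<bar>) \<le> integral {0..a} (\<lambda>x. \<bar>\<bar>w x\<bar> - w x * b n x\<bar> + (4 * \<eta>) * \<bar>w x\<bar>)"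
  proof (rule integral_le)
    show "(\<lambda>x. \<bar>\<bar>w x\<bar> - w x * g x\<bar>) integrable_on {0..a}" using wb[OF test_function_continuous[OF g]] by (simp add: absolutely_integrable_on_def)
    show "(\<lambda>x. \<bar>\<bar>w x\<bar> - w x * b n x\<bar> + (4 * \<eta>) * \<bar>w x\<bar>) integrable_on {0..a}"
      using wb[OF bc[of n]] abs_int_w(2) by (intro integrable_add integrable_on_mult_right) (auto simp: absolutely_integrable_on_def)
    fix x assume x: "x \<in> {0..a}"
    have "\<bar>w x * (b n x - g x)\<bar> \<le> (4 * \<eta>) * \<bar>w x\<bar>"
      unfolding abs_mult using mult_left_mono[OF gb[OF x], of "\<bar>w x\<bar>"] by (simp add: mult.commute)
    moreover have "\<bar>w x\<bar> - w x * g x = (\<bar>w x\<bar> - w x * b n x) + w x * (b n x - g x)" by (simp add: algebra_simps)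
    ultimately show "\<bar>\<bar>w x\<bar> - w x * g x\<bar> \<le> \<bar>\<bar>w x\<bar> - w x * b n x\<bar> + (4 * \<eta>) * \<bar>w x\<bar>" by linarith
  qed
  also have "\<dots> = integral {0..a} (\<lambda>x. \<bar>\<bar>w x\<bar> - w x * b n x\<bar>) + (4 * \<eta>) * W"
    unfolding W_def using wb[OF bc[of n]] abs_int_w(2)
    by (subst integral_add) (auto simp: absolutely_integrable_on_def intro: integrable_on_mult_right)
  also have "(4 * \<eta>) * W \<le> \<epsilon> / 2" using assms W_nonneg by (simp add: \<eta>_def field_simps)
  finally have "integral {0..a} (\<lambda>x. \<bar>\<bar>w x\<bar> - w x * g x\<bar>) \<le> \<epsilon>" using n by linarith
  moreover have "g 0 = 0" "g a = 0" using P_0 P_a by (simp_all add: g_def)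
  ultimately show thesis using that[OF g] by blast
qed

text \<open>The equation is multiplied by \<phi> cnj f and integrated. The product rule for \<phi> u
  cnj f turns the left side into integrals and boundary terms, which cancel by assumption. The third
  integral, with k = p \<phi>', is the price of a nonconstant test function.\<close>

lemma energy_identity:
  assumes e: "eqn 0 a (\<lambda>x. z * f x + h x) f u" and t: "test_function \<phi> k"
    and bc: "of_real (\<phi> a) * (u a * cnj (f a)) = of_real (\<phi> 0) * (u 0 * cnj (f 0))"
    and h: "(\<lambda>x. of_real (w x) * h x) absolutely_integrable_on {0..a}"
  shows "of_real (integral {0..a} (\<lambda>x. \<bar>ip x\<bar> * (\<phi> x * (norm (u x))\<^sup>2))) + of_real (integral {0..a} (\<lambda>x. q x * (\<phi> x * (norm (f x))\<^sup>2)))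
      + integral {0..a} (\<lambda>x. of_real (ip x) * (of_real (k x) * (u x * cnj (f x))))
     = z * of_real (integral {0..a} (\<lambda>x. w x * (\<phi> x * (norm (f x))\<^sup>2)))
       + integral {0..a} (\<lambda>x. (of_real (\<phi> x) * cnj (f x)) * (of_real (w x) * h x))" (is "of_real ?E + of_real ?Q + ?K = z * of_real ?I + ?X")
proof -
  note c = eqn_continuous[OF e]
  note ct = test_function_continuous[OF t]
  have ck: "continuous_on {0..a} k" using t by (simp add: test_function_def)
  have P1: "prim 0 a f (\<lambda>x. of_real (ip x) * u x)" and P2: "prim 0 a u (\<lambda>x. of_real (q x) * f x - of_real (w x) * (z * f x + h x))"
    and P3: "prim 0 a (\<lambda>x. complex_of_real (\<phi> x)) (\<lambda>x. of_real (ip x * k x))"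
    using e t by (auto simp: eqn_def test_function_def)
  note Pm = prim_mult[OF P3 prim_mult[OF P2 prim_bounded_linear[OF P1 bounded_linear_cnj]]]
  have r: "(\<lambda>x. complex_of_real (v x * y x)) absolutely_integrable_on {0..a}" "(\<lambda>x. v x * y x) integrable_on {0..a}"
    if "v absolutely_integrable_on {0..a}" "continuous_on {0..a} y" for v y :: "real \<Rightarrow> real"
    using abs_int_of_real[OF int_mult_cont(1)[OF that]] int_mult_cont(2)[OF that] by auto
  have cr: "(\<lambda>x. complex_of_real (v x) * y x) absolutely_integrable_on {0..a}"
    if "v absolutely_integrable_on {0..a}" "continuous_on {0..a} y" for v and y :: "real \<Rightarrow> complex"
    using absolutely_integrable_continuous_mult[OF that(2) abs_int_of_real[OF that(1)]] by (simp add: mult.commute)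
  have cE: "continuous_on {0..a} (\<lambda>x. \<phi> x * (norm (u x))\<^sup>2)" and cQ: "continuous_on {0..a} (\<lambda>x. \<phi> x * (norm (f x))\<^sup>2)"
    and cK: "continuous_on {0..a} (\<lambda>x. of_real (k x) * (u x * cnj (f x)))" and cX: "continuous_on {0..a} (\<lambda>x. of_real (\<phi> x) * cnj (f x))"
    by (intro continuous_intros c ct ck)+
  let ?e = "\<lambda>x. complex_of_real (\<bar>ip x\<bar> * (\<phi> x * (norm (u x))\<^sup>2))"
  let ?q = "\<lambda>x. complex_of_real (q x * (\<phi> x * (norm (f x))\<^sup>2))"
  let ?i = "\<lambda>x. z * complex_of_real (w x * (\<phi> x * (norm (f x))\<^sup>2))"
  let ?k = "\<lambda>x. of_real (ip x) * (of_real (k x) * (u x * cnj (f x)))"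
  let ?x = "\<lambda>x. (of_real (\<phi> x) * cnj (f x)) * (of_real (w x) * h x)"
  have I: "?e integrable_on {0..a}" "?q integrable_on {0..a}" "?i integrable_on {0..a}" "?k integrable_on {0..a}" "?x integrable_on {0..a}"
    using r(1)[OF abs_int_ip(2) cE] r(1)[OF abs_int_q(1) cQ] r(1)[OF abs_int_w(1) cQ] cr[OF abs_int_ip(1) cK]
      absolutely_integrable_continuous_mult[OF cX h] unfolding absolutely_integrable_on_def
    by (auto intro: integrable_on_mult_right)
  \<comment> \<open>The energy involves |1/p|, which agrees with 1/p off a null set.\<close>
  obtain N where N: "negligible N" "\<forall>x. x \<notin> N \<longrightarrow> \<bar>ip x\<bar> = ip x" by (rule AE_lebesgueE[OF ip_pos])
  have "integral {0..a} (\<lambda>x. ?e x + ?q x + ?k x - ?i x - ?x x) = integral {0..a} (\<lambda>x. complex_of_real (\<phi> x) *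
        (u x * cnj (of_real (ip x) * u x) + (of_real (q x) * f x - of_real (w x) * (z * f x + h x)) * cnj (f x)) +
       of_real (ip x * k x) * (u x * cnj (f x)))"
  proof (rule integral_spike[OF N(1)])
    fix x assume "x \<in> {0..a} - N"
    then have "\<bar>ip x\<bar> = ip x" using N(2) by blast
    then show "complex_of_real (\<phi> x) *
        (u x * cnj (of_real (ip x) * u x) + (of_real (q x) * f x - of_real (w x) * (z * f x + h x)) * cnj (f x)) +
       of_real (ip x * k x) * (u x * cnj (f x)) = ?e x + ?q x + ?k x - ?i x - ?x x"
      by (simp only: of_real_mult complex_norm_square of_real_power[symmetric] complex_cnj_mult complex_cnj_complex_of_real) (simp add: algebra_simps)
  qed
  also have "\<dots> = 0"
    using prim_eq[OF Pm] a_pos bc by simp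
  finally have "0 = integral {0..a} (\<lambda>x. ?e x + ?q x + ?k x - ?i x - ?x x)" by simp
  also have "\<dots> = integral {0..a} ?e + integral {0..a} ?q + integral {0..a} ?k - integral {0..a} ?i - integral {0..a} ?x"
    using I by (simp only: integral_add Henstock_Kurzweil_Integration.integral_diff integrable_add integrable_diff)
  also have "integral {0..a} ?e = of_real ?E"
    using integral_linear[OF r(2)[OF abs_int_ip(2) cE] bounded_linear_of_real[where 'a=complex]] unfolding o_def .
  also have "integral {0..a} ?q = of_real ?Q"
    using integral_linear[OF r(2)[OF abs_int_q(1) cQ] bounded_linear_of_real[where 'a=complex]] unfolding o_def .
  also have "integral {0..a} ?i = z * of_real ?I"
    using integral_linear[OF r(2)[OF abs_int_w(1) cQ] bounded_linear_of_real[where 'a=complex]] unfolding o_def integral_mult_right by simp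
  finally show ?thesis by (simp add: algebra_simps)
qed

lemma compact_bound:
  fixes g :: "real \<Rightarrow> real"
  assumes "continuous_on {0..a} g"
  obtains G where "G \<ge> 0" "\<forall>x\<in>{0..a}. \<bar>g x\<bar> \<le> G"
proof -
  have "bounded (g ` {0..a})" by (intro compact_imp_bounded compact_continuous_image assms) auto
  then obtain G where G: "\<forall>y\<in>g ` {0..a}. norm y \<le> G" unfolding bounded_iff by blast
  show thesis by (rule that[of "max G 0"]) (use G in auto)
qed

lemma Q_bound:
  assumes f: "continuous_on {0..a} f" and g: "continuous_on {0..a} g" "\<forall>x\<in>{0..a}. \<bar>g x\<bar> \<le> G" "G \<ge> 0"
    and S: "\<forall>x\<in>{0..a}. (norm (f x))\<^sup>2 \<le> S"
  shows "\<bar>integral {0..a} (\<lambda>x. q x * (g x * (norm (f x))\<^sup>2))\<bar> \<le> G * Iq * S"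
proof -
  have "norm (integral {0..a} (\<lambda>x. q x * (g x * (norm (f x))\<^sup>2))) \<le> integral {0..a} (\<lambda>x. (G * S) * \<bar>q x\<bar>)"
  proof (rule integral_norm_bound_integral)
    show "(\<lambda>x. q x * (g x * (norm (f x))\<^sup>2)) integrable_on {0..a}"
      by (intro int_mult_cont abs_int_q continuous_intros f g)
    show "(\<lambda>x. (G * S) * \<bar>q x\<bar>) integrable_on {0..a}"
      using abs_int_q(2) by (intro integrable_on_mult_right) (simp add: absolutely_integrable_on_def)
    fix x assume x: "x \<in> {0..a}"
    have "\<bar>g x\<bar> * (norm (f x))\<^sup>2 \<le> G * S" using g S x by (intro mult_mono) auto
    from mult_left_mono[OF this, of "\<bar>q x\<bar>"] show "norm (q x * (g x * (norm (f x))\<^sup>2)) \<le> (G * S) * \<bar>q x\<bar>"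
      by (simp add: abs_mult mult.commute)
  qed
  then show ?thesis by (simp add: Iq_def algebra_simps)
qed

lemma X_bound:
  assumes f: "continuous_on {0..a} f" and g: "continuous_on {0..a} g" "\<forall>x\<in>{0..a}. \<bar>g x\<bar> \<le> G" "G \<ge> 0" and h: "h \<in> L2 PM"
  shows "norm (integral {0..a} (\<lambda>x. (of_real (g x) * cnj (f x)) * (of_real (w x) * h x))) \<le> G * (L2_norm PM h * L2_norm PM f)"
proof -
  have f2: "f \<in> L2 PM" by (rule continuous_L2'[OF f])
  have m: "(\<lambda>x. norm (h x) * norm (f x)) \<in> borel_measurable LA"
    using L2_measurable[OF h] L2_measurable[OF f2] by (simp add: borel_measurable_times)
  have I: "integrable PM (\<lambda>x. norm (h x) * norm (f x))" by (rule L2_Cauchy_Schwarz(1)[OF h f2])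
  have i: "(\<lambda>x. \<bar>w x\<bar> *\<^sub>R (norm (h x) * norm (f x))) absolutely_integrable_on {0..a}" using I PM_integrable_iff[OF m] by simp
  have "norm (integral {0..a} (\<lambda>x. (of_real (g x) * cnj (f x)) * (of_real (w x) * h x)))
      \<le> integral {0..a} (\<lambda>x. G * (\<bar>w x\<bar> *\<^sub>R (norm (h x) * norm (f x))))"
  proof (rule integral_norm_bound_integral)
    have "(\<lambda>x. (of_real (g x) * cnj (f x)) * (of_real (w x) * h x)) absolutely_integrable_on {0..a}"
      by (intro absolutely_integrable_continuous_mult L2_integrable1[OF h] continuous_intros f g)
    then show "(\<lambda>x. (of_real (g x) * cnj (f x)) * (of_real (w x) * h x)) integrable_on {0..a}"
      by (simp add: absolutely_integrable_on_def)
    show "(\<lambda>x. G * (\<bar>w x\<bar> *\<^sub>R (norm (h x) * norm (f x)))) integrable_on {0..a}"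
      using i by (intro integrable_on_mult_right) (simp add: absolutely_integrable_on_def)
    fix x assume x: "x \<in> {0..a}"
    have "\<bar>g x\<bar> * (\<bar>w x\<bar> * (norm (h x) * norm (f x))) \<le> G * (\<bar>w x\<bar> * (norm (h x) * norm (f x)))"
      using g(2) x by (intro mult_right_mono) auto
    then show "norm ((of_real (g x) * cnj (f x)) * (of_real (w x) * h x)) \<le> G * (\<bar>w x\<bar> *\<^sub>R (norm (h x) * norm (f x)))"
      by (simp add: norm_mult algebra_simps)
  qed
  also have "\<dots> = G * integral\<^sup>L PM (\<lambda>x. norm (h x) * norm (f x))"
    unfolding PM_integral[OF m I] by (rule integral_mult_right)
  also have "\<dots> \<le> G * (L2_norm PM h * L2_norm PM f)"
    by (rule mult_left_mono[OF L2_Cauchy_Schwarz(2)[OF h f2] g(3)])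
  finally show ?thesis .
qed

text \<open>Young's inequality. The free weight \<open>s\<close> decides how large a share of the
  energy the term may consume, so that this share can be absorbed elsewhere.\<close>

lemma K_bound:
  assumes f: "continuous_on {0..a} f" and u: "continuous_on {0..a} u" and k: "continuous_on {0..a} k" "\<forall>x\<in>{0..a}. \<bar>k x\<bar> \<le> K"
    and S: "\<forall>x\<in>{0..a}. (norm (f x))\<^sup>2 \<le> S" and s: "s > 0" "K \<ge> 0"
  shows "norm (integral {0..a} (\<lambda>x. of_real (ip x) * (of_real (k x) * (u x * cnj (f x))))) \<le> s * energy u + K\<^sup>2 / s * Ip * S"
proof -
  have "norm (integral {0..a} (\<lambda>x. of_real (ip x) * (of_real (k x) * (u x * cnj (f x)))))
     \<le> integral {0..a} (\<lambda>x. s * (\<bar>ip x\<bar> * (norm (u x))\<^sup>2) + (K\<^sup>2 / s * S) * \<bar>ip x\<bar>)"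
  proof (rule integral_norm_bound_integral)
    have "(\<lambda>x. (of_real (k x) * (u x * cnj (f x))) * complex_of_real (ip x)) absolutely_integrable_on {0..a}"
      by (intro absolutely_integrable_continuous_mult abs_int_of_real abs_int_ip continuous_intros f u k)
    then show "(\<lambda>x. complex_of_real (ip x) * (of_real (k x) * (u x * cnj (f x)))) integrable_on {0..a}"
      by (simp add: absolutely_integrable_on_def mult.commute)
    show "(\<lambda>x. s * (\<bar>ip x\<bar> * (norm (u x))\<^sup>2) + (K\<^sup>2 / s * S) * \<bar>ip x\<bar>) integrable_on {0..a}"
      using abs_int_ip(2) by (intro integrable_add integrable_on_mult_right int_mult_cont sq_cont u) (simp_all add: absolutely_integrable_on_def)
    fix x assume x: "x \<in> {0..a}"
    let ?u = "norm (u x)" and ?f = "norm (f x)"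
    have "\<bar>k x\<bar> * (?u * ?f) \<le> K * (?u * ?f)" using k x by (intro mult_right_mono) auto
    also have "\<dots> \<le> s * ?u\<^sup>2 + K\<^sup>2 / s * ?f\<^sup>2"
    proof -
      have "0 \<le> (s * ?u - K * ?f)\<^sup>2 / s" using s by simp
      also have "\<dots> = s * ?u\<^sup>2 + K\<^sup>2 / s * ?f\<^sup>2 - 2 * (K * (?u * ?f))"
        using s by (simp add: field_simps power2_eq_square)
      finally have "2 * (K * (?u * ?f)) \<le> s * ?u\<^sup>2 + K\<^sup>2 / s * ?f\<^sup>2" by linarith
      moreover have "0 \<le> K * (?u * ?f)" using s by simp
      ultimately show ?thesis by linarith
    qed
    also have "K\<^sup>2 / s * ?f\<^sup>2 \<le> K\<^sup>2 / s * S" using S x s by (intro mult_left_mono) auto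
    finally have *: "\<bar>k x\<bar> * (?u * ?f) \<le> s * ?u\<^sup>2 + K\<^sup>2 / s * S" by simp
    have "norm (complex_of_real (ip x) * (of_real (k x) * (u x * cnj (f x)))) = \<bar>ip x\<bar> * (\<bar>k x\<bar> * (?u * ?f))"
      by (simp only: norm_mult norm_of_real complex_mod_cnj)
    also have "\<dots> \<le> \<bar>ip x\<bar> * (s * ?u\<^sup>2 + K\<^sup>2 / s * S)" by (rule mult_left_mono[OF *]) simp
    finally show "norm (complex_of_real (ip x) * (of_real (k x) * (u x * cnj (f x)))) \<le> s * (\<bar>ip x\<bar> * ?u\<^sup>2) + (K\<^sup>2 / s * S) * \<bar>ip x\<bar>"
      by (simp only: distrib_left ac_simps)
  qed
  also have "\<dots> = s * energy u + (K\<^sup>2 / s * S) * Ip"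
    unfolding energy_def Ip_def using int_mult_cont(2)[OF abs_int_ip(2) sq_cont[OF u]] abs_int_ip(2)
    by (simp only: integral_add integrable_on_mult_right integral_mult_right absolutely_integrable_on_def)
  finally show ?thesis by (simp add: algebra_simps)
qed

text \<open>The test function g is so close to sgn w that |\<integral> w g |f|^2| \<ge>
  \<parallel>f\<parallel>^2 / 2; closeness in L^1 suffices because the energy bound controls sup
  |f|^2. The other terms of the energy identity are at most multiples of \<parallel>f\<parallel>^2
  and \<parallel>h\<parallel> \<parallel>f\<parallel>. As g vanishes at both ends, no boundary
  condition enters, and the constants are independent of t.\<close>

lemma spectral_parameter_bound:
  assumes "C0 \<ge> 0"
  obtains R G where "R \<ge> 0" "G \<ge> 0" "\<forall>f u h z. eqn 0 a (\<lambda>x. z * f x + h x) f u \<longrightarrow> h \<in> L2 PM \<longrightarrow> energy u \<le> C0 * sqnorm f \<longrightarrow>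
     norm z * sqnorm f \<le> R * sqnorm f + G * (L2_norm PM h * L2_norm PM f)"
proof -
  obtain C1 where C1: "C1 \<ge> 0" "\<forall>f u g. eqn 0 a g f u \<longrightarrow> (\<forall>x\<in>{0..a}. (norm (f x))\<^sup>2 \<le> 1 * energy u + C1 * sqnorm f)"
    by (rule sup_bound[OF zero_less_one])
  \<comment> \<open>sup |f|^2 \<le> C2 \<parallel>f\<parallel>^2 will hold, so an L^1 error of 1 /
    (2 C2) in the weight changes \<integral> |w| |f|^2 by at most half of it.\<close>
  define C2 where "C2 = C0 + C1 + 1"
  have C2: "C2 > 0" using assms C1 by (simp add: C2_def)
  have e0: "1 / (2 * C2) > 0" using C2 by simp
  obtain g k where g: "test_function g k" "g 0 = 0" "g a = 0" "integral {0..a} (\<lambda>x. \<bar>\<bar>w x\<bar> - w x * g x\<bar>) \<le> 1 / (2 * C2)"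
    by (rule test_function_approx_sgn[OF e0])
  have gc: "continuous_on {0..a} g" and kc: "continuous_on {0..a} k" using g test_function_continuous by (auto simp: test_function_def)
  obtain G where G: "G \<ge> 0" "\<forall>x\<in>{0..a}. \<bar>g x\<bar> \<le> G" by (rule compact_bound[OF gc])
  obtain K where K: "K \<ge> 0" "\<forall>x\<in>{0..a}. \<bar>k x\<bar> \<le> K" by (rule compact_bound[OF kc])
  \<comment> \<open>The contributions of the energy term, of the potential and of the term with p
    g', in this order.\<close>
  define R where "R = G * C0 + G * Iq * C2 + (1 * C0 + K\<^sup>2 / 1 * Ip * C2)"
  have R: "R \<ge> 0" using G K assms Iq_nonneg Ip_pos C2 by (simp add: R_def)
  have main: "norm z * sqnorm f \<le> (2 * R) * sqnorm f + (2 * G) * (L2_norm PM h * L2_norm PM f)"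
    if e: "eqn 0 a (\<lambda>x. z * f x + h x) f u" and h: "h \<in> L2 PM" and energy: "energy u \<le> C0 * sqnorm f" for f u h z
  proof -
    note c = eqn_continuous[OF e]
    have n0: "sqnorm f \<ge> 0" by (rule sqnorm_nonneg[OF c(1)])
    have S: "\<forall>x\<in>{0..a}. (norm (f x))\<^sup>2 \<le> C2 * sqnorm f"
    proof
      fix x assume x: "x \<in> {0..a}"
      have "(norm (f x))\<^sup>2 \<le> 1 * energy u + C1 * sqnorm f" using C1(2) e x by blast
      then show "(norm (f x))\<^sup>2 \<le> C2 * sqnorm f" using energy n0 by (simp add: C2_def algebra_simps)
    qed
    define E where "E = integral {0..a} (\<lambda>x. \<bar>ip x\<bar> * (g x * (norm (u x))\<^sup>2))"
    define Q where "Q = integral {0..a} (\<lambda>x. q x * (g x * (norm (f x))\<^sup>2))"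
    define Kt where "Kt = integral {0..a} (\<lambda>x. of_real (ip x) * (of_real (k x) * (u x * cnj (f x))))"
    define I where "I = integral {0..a} (\<lambda>x. w x * (g x * (norm (f x))\<^sup>2))"
    define X where "X = integral {0..a} (\<lambda>x. (of_real (g x) * cnj (f x)) * (of_real (w x) * h x))"
    have id: "of_real E + of_real Q + Kt = z * of_real I + X"
      unfolding E_def Q_def Kt_def I_def X_def by (rule energy_identity[OF e g(1) _ L2_integrable1(1)[OF h]]) (simp add: g)
    have cE: "continuous_on {0..a} (\<lambda>x. g x * (norm (u x))\<^sup>2)" and cI: "continuous_on {0..a} (\<lambda>x. g x * (norm (f x))\<^sup>2)"
      by (intro continuous_intros gc c)+
    have "\<bar>E\<bar> \<le> integral {0..a} (\<lambda>x. G * (\<bar>ip x\<bar> * (norm (u x))\<^sup>2))"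
      unfolding E_def real_norm_def[symmetric]
    proof (rule integral_norm_bound_integral)
      show "(\<lambda>x. norm (ip x) * (g x * (norm (u x))\<^sup>2)) integrable_on {0..a}"
        unfolding real_norm_def by (rule int_mult_cont(2)[OF abs_int_ip(2) cE])
      show "(\<lambda>x. G * (norm (ip x) * (norm (u x))\<^sup>2)) integrable_on {0..a}"
        unfolding real_norm_def by (rule integrable_on_mult_right[OF int_mult_cont(2)[OF abs_int_ip(2) sq_cont[OF c(2)]]])
      fix x assume "x \<in> {0..a}"
      then have "\<bar>g x\<bar> * (\<bar>ip x\<bar> * (norm (u x))\<^sup>2) \<le> G * (\<bar>ip x\<bar> * (norm (u x))\<^sup>2)" using G by (intro mult_right_mono) auto
      then show "norm (norm (ip x) * (g x * (norm (u x))\<^sup>2)) \<le> G * (norm (ip x) * (norm (u x))\<^sup>2)"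
        by (simp add: abs_mult algebra_simps)
    qed
    also have "\<dots> = G * energy u" by (simp only: energy_def integral_mult_right)
    also have "\<dots> \<le> G * (C0 * sqnorm f)" using energy G by (intro mult_left_mono)
    finally have bE: "\<bar>E\<bar> \<le> G * C0 * sqnorm f" by simp
    have bQ: "\<bar>Q\<bar> \<le> G * Iq * (C2 * sqnorm f)"
      unfolding Q_def by (rule Q_bound[OF c(1) gc G(2,1) S])
    have "norm Kt \<le> 1 * energy u + K\<^sup>2 / 1 * Ip * (C2 * sqnorm f)"
      unfolding Kt_def by (rule K_bound[OF c kc K(2) S]) (use K in auto)
    then have bK: "norm Kt \<le> 1 * (C0 * sqnorm f) + K\<^sup>2 / 1 * Ip * (C2 * sqnorm f)" using energy by linarith
    have bX: "norm X \<le> G * (L2_norm PM h * L2_norm PM f)"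
      unfolding X_def by (rule X_bound[OF c(1) gc G(2,1) h])
    have iw: "(\<lambda>x. w x * (g x * (norm (f x))\<^sup>2)) integrable_on {0..a}" "(\<lambda>x. \<bar>w x\<bar> * (norm (f x))\<^sup>2) integrable_on {0..a}"
      by (rule int_mult_cont(2)[OF abs_int_w(1) cI], rule int_mult_cont(2)[OF abs_int_w(2) sq_cont[OF c(1)]])
    have idif: "(\<lambda>x. \<bar>\<bar>w x\<bar> - w x * g x\<bar>) integrable_on {0..a}"
      using absolutely_integrable_norm[OF set_integral_diff(1)[OF abs_int_w(2) int_mult_cont(1)[OF abs_int_w(1) gc]]]
      by (simp add: o_def absolutely_integrable_on_def)
    have "norm (sqnorm f - I) = norm (integral {0..a} (\<lambda>x. \<bar>w x\<bar> * (norm (f x))\<^sup>2 - w x * (g x * (norm (f x))\<^sup>2)))"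
      unfolding sqnorm_def I_def by (subst Henstock_Kurzweil_Integration.integral_diff[OF iw(2,1)]) simp
    also have "\<dots> \<le> integral {0..a} (\<lambda>x. (C2 * sqnorm f) * \<bar>\<bar>w x\<bar> - w x * g x\<bar>)"
    proof (rule integral_norm_bound_integral[OF integrable_diff[OF iw(2,1)] integrable_on_mult_right[OF idif]])
      fix x assume x: "x \<in> {0..a}"
      have "\<bar>w x\<bar> * (norm (f x))\<^sup>2 - w x * (g x * (norm (f x))\<^sup>2) = (norm (f x))\<^sup>2 * (\<bar>w x\<bar> - w x * g x)" by (simp add: algebra_simps)
      then have "norm (\<bar>w x\<bar> * (norm (f x))\<^sup>2 - w x * (g x * (norm (f x))\<^sup>2)) = (norm (f x))\<^sup>2 * \<bar>\<bar>w x\<bar> - w x * g x\<bar>"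
        by (simp add: abs_mult)
      also have "\<dots> \<le> (C2 * sqnorm f) * \<bar>\<bar>w x\<bar> - w x * g x\<bar>" using S x by (intro mult_right_mono) auto
      finally show "norm (\<bar>w x\<bar> * (norm (f x))\<^sup>2 - w x * (g x * (norm (f x))\<^sup>2)) \<le> (C2 * sqnorm f) * \<bar>\<bar>w x\<bar> - w x * g x\<bar>" .
    qed
    also have "\<dots> \<le> (C2 * sqnorm f) * (1 / (2 * C2))"
      unfolding integral_mult_right using g(4) C2 n0 by (intro mult_left_mono) auto
    also have "\<dots> = sqnorm f / 2" using C2 by simp
    finally have I2: "sqnorm f / 2 \<le> \<bar>I\<bar>" by (simp add: abs_if split: if_splits)
    have "norm z * (sqnorm f / 2) \<le> norm z * \<bar>I\<bar>" using I2 by (intro mult_left_mono) auto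
    also have "\<dots> = norm (of_real E + of_real Q + Kt - X)" using id by (simp add: norm_mult)
    also have "\<dots> \<le> \<bar>E\<bar> + \<bar>Q\<bar> + norm Kt + norm X"
      using norm_triangle_ineq4[of "of_real E + of_real Q + Kt" X] norm_triangle_ineq[of "of_real E + of_real Q" Kt]
        norm_triangle_ineq[of "complex_of_real E" "of_real Q"] by simp
    also have "\<dots> \<le> R * sqnorm f + G * (L2_norm PM h * L2_norm PM f)"
      using bE bQ bK bX by (simp add: R_def algebra_simps)
    finally show ?thesis by (simp add: algebra_simps)
  qed
  show thesis
    \<comment> \<open>The factors 2 compensate the factor 1/2 in \<open>I2\<close>.\<close>
    by (rule that[of "2 * R" "2 * G"]) (use R G main in auto)
qed

lemma bc_unit:
  assumes "norm \<rho> = 1" "f a = \<rho> * f 0" "u a = \<rho> * u (0::real)"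
  shows "u a * cnj (f a) = u 0 * cnj (f 0)"
proof -
  have "u a * cnj (f a) = (\<rho> * cnj \<rho>) * (u 0 * cnj (f 0))" using assms by (simp add: algebra_simps)
  also have "\<rho> * cnj \<rho> = 1" using assms(1) by (simp add: complex_norm_square[symmetric])
  finally show ?thesis by simp
qed

text \<open>Suppose that f violates the estimate. Then 2 \<parallel>h\<parallel> <
  \<parallel>f\<parallel>, because |Im z| \<le> |z|. Testing with f, the imaginary part gives |Im z|
  |I| \<le> \<parallel>h\<parallel> \<parallel>f\<parallel> for I = \<integral> w |f|^2, and the
  assumed violation turns this into 2 |z| |I| \<le> \<parallel>f\<parallel>^2. So the real part
  bounds the energy although w is indefinite, and \<open>spectral_parameter_bound\<close>
  contradicts the size of z.\<close>

theorem resolvent_estimate: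
  obtains R where "R > 0" "\<forall>t z f g. norm z > R \<longrightarrow> Im z \<noteq> 0 \<longrightarrow> (f, g) \<in> fibre_op a w p q t \<longrightarrow>
     \<bar>Im z\<bar> * L2_norm PM f \<le> 2 * norm z * L2_norm PM (\<lambda>x. g x - z * f x)"
proof -
  have B0: "max 1 Iq \<ge> 0" by simp
  obtain C0 where C0: "C0 \<ge> 0" "\<forall>f u g. eqn 0 a g f u \<longrightarrow>
     (\<forall>S. (\<forall>x\<in>{0..a}. (norm (f x))\<^sup>2 \<le> S) \<longrightarrow> energy u \<le> max 1 Iq * (sqnorm f + S)) \<longrightarrow> energy u \<le> C0 * sqnorm f"
    by (rule energy_bound[OF B0])
  obtain R G where R: "R \<ge> 0" "G \<ge> 0" "\<forall>f u h z. eqn 0 a (\<lambda>x. z * f x + h x) f u \<longrightarrow> h \<in> L2 PM \<longrightarrow> energy u \<le> C0 * sqnorm f \<longrightarrow>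
     norm z * sqnorm f \<le> R * sqnorm f + G * (L2_norm PM h * L2_norm PM f)"
    by (rule spectral_parameter_bound[OF C0(1)])
  have main: "\<bar>Im z\<bar> * L2_norm PM f \<le> 2 * norm z * L2_norm PM (\<lambda>x. g x - z * f x)"
    if z: "norm z > R + G + 1" "Im z \<noteq> 0" and fg: "(f, g) \<in> fibre_op a w p q t" for t z f g
  proof (rule ccontr)
    define h where "h x = g x - z * f x" for x
    let ?f = "L2_norm PM f" and ?h = "L2_norm PM h"
    assume "\<not> ?thesis"
    then have neg: "2 * norm z * ?h < \<bar>Im z\<bar> * ?f" by (simp add: h_def[abs_def])
    obtain u where u: "eqn 0 a g f u" "f a = exp (\<i> * of_real t) * f 0" "u a = exp (\<i> * of_real t) * u 0" and fg2: "f \<in> L2 PM" "g \<in> L2 PM"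
      using fg unfolding fibre_iff by blast
    have h2: "h \<in> L2 PM" unfolding h_def by (rule L2_diff[OF fg2(2) L2_cmult[OF fg2(1)]])
    have e: "eqn 0 a (\<lambda>x. z * f x + h x) f u" using u(1) by (simp add: h_def)
    note c = eqn_continuous[OF e]
    have n2f: "sqnorm f = ?f\<^sup>2" by (rule sqnorm_L2[OF c(1)])
    have h0: "?h \<ge> 0" "?f \<ge> 0" by (rule L2_norm_nonneg)+
    have z0: "norm z > 0" using z R by linarith
    have f0: "?f > 0"
    proof (rule ccontr)
      assume "\<not> ?f > 0"
      then have "?f = 0" using h0 by simp
      then show False using neg h0 z0 by (simp add: mult_less_0_iff)
    qed
    have "norm z * (2 * ?h) < norm z * ?f"
    proof -
      have "norm z * (2 * ?h) < \<bar>Im z\<bar> * ?f" using neg by (simp add: algebra_simps)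
      also have "\<dots> \<le> norm z * ?f" using abs_Im_le_cmod[of z] h0 by (intro mult_right_mono)
      finally show ?thesis .
    qed
    then have hf: "2 * ?h < ?f" using z0 by simp
    then have hf2: "2 * (?h * ?f) \<le> ?f\<^sup>2" using f0 by (simp add: power2_eq_square)
    define Q where "Q = integral {0..a} (\<lambda>x. q x * (1 * (norm (f x))\<^sup>2))"
    define I where "I = integral {0..a} (\<lambda>x. w x * (1 * (norm (f x))\<^sup>2))"
    define X where "X = integral {0..a} (\<lambda>x. (of_real 1 * cnj (f x)) * (of_real (w x) * h x))"
    \<comment> \<open>The multiplier has modulus 1, so the boundary terms cancel already for the
      constant test function 1.\<close>
    have "norm (exp (\<i> * of_real t)) = 1" by simp
    from bc_unit[of "exp (\<i> * of_real t)" f u, OF this u(2,3)]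
    have id0: "of_real (integral {0..a} (\<lambda>x. \<bar>ip x\<bar> * (1 * (norm (u x))\<^sup>2))) + of_real Q
        + integral {0..a} (\<lambda>x. of_real (ip x) * (of_real 0 * (u x * cnj (f x)))) = z * of_real I + X"
      unfolding Q_def I_def X_def
      by (intro energy_identity[OF e test_function_const[of 1]] L2_integrable1(1)[OF h2]) simp
    have id: "of_real (energy u) + of_real Q = z * of_real I + X"
      using id0 by (simp add: energy_def)
    have bX: "norm X \<le> ?h * ?f"
      unfolding X_def using X_bound[OF c(1) continuous_on_const, of 1 1 h] h2 by simp
    have "Im z * I + Im X = 0" using arg_cong[OF id, of Im] by simp
    then have "\<bar>Im z * I\<bar> = \<bar>Im X\<bar>" by (simp add: eq_neg_iff_add_eq_0[symmetric])
    then have imI: "\<bar>Im z\<bar> * \<bar>I\<bar> \<le> ?h * ?f"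
      using abs_Im_le_cmod[of X] bX by (simp add: abs_mult)
    have "2 * (norm z * \<bar>I\<bar>) * \<bar>Im z\<bar> \<le> 2 * norm z * (?h * ?f)"
      using mult_left_mono[OF imI, of "2 * norm z"] by (simp add: algebra_simps)
    also have "\<dots> = (2 * norm z * ?h) * ?f" by simp
    also have "\<dots> \<le> (\<bar>Im z\<bar> * ?f) * ?f" using neg h0 by (intro mult_right_mono) auto
    finally have "2 * (norm z * \<bar>I\<bar>) * \<bar>Im z\<bar> \<le> ?f\<^sup>2 * \<bar>Im z\<bar>" by (simp add: power2_eq_square algebra_simps)
    then have zI: "2 * (norm z * \<bar>I\<bar>) \<le> ?f\<^sup>2" using z(2) by simp
    have "energy u + Q = Re z * I + Re X" using arg_cong[OF id, of Re] by simp
    moreover have "Re z * I \<le> norm z * \<bar>I\<bar>"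
      using mult_mono[OF abs_Re_le_cmod[of z] order_refl, of "\<bar>I\<bar>"] abs_ge_self[of "Re z * I"] by (simp add: abs_mult)
    moreover have "Re X \<le> ?h * ?f" using complex_Re_le_cmod[of X] bX by linarith
    ultimately have EnQ: "energy u \<le> sqnorm f + \<bar>Q\<bar>" using zI hf2 unfolding n2f by linarith
    have "energy u \<le> max 1 Iq * (sqnorm f + S)" if S: "\<forall>x\<in>{0..a}. (norm (f x))\<^sup>2 \<le> S" for S
    proof -
      have "\<bar>Q\<bar> \<le> 1 * Iq * S" unfolding Q_def by (rule Q_bound[OF c(1) continuous_on_const _ _ S]) auto
      moreover have "S \<ge> 0" using order_trans[OF zero_le_power2 S[rule_format, of 0]] a_pos by simp
      ultimately have "energy u \<le> 1 * sqnorm f + Iq * S" using EnQ by simp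
      also have "\<dots> \<le> max 1 Iq * sqnorm f + max 1 Iq * S"
        using \<open>S \<ge> 0\<close> sqnorm_nonneg[OF c(1)] by (intro add_mono mult_right_mono) auto
      finally show ?thesis by (simp add: distrib_left)
    qed
    then have "energy u \<le> C0 * sqnorm f" using C0(2) e by blast
    then have "norm z * sqnorm f \<le> R * sqnorm f + G * (?h * ?f)" using R(3) e h2 by blast
    also have "G * (?h * ?f) \<le> G * sqnorm f" using hf2 h0 R(2) f0 unfolding n2f
      by (intro mult_left_mono) (auto simp: mult_nonneg_nonneg intro: order_trans[rotated])
    finally have "norm z * sqnorm f \<le> (R + G) * sqnorm f" by (simp add: algebra_simps)
    then have "norm z \<le> R + G" using f0 by (simp add: n2f)
    then show False using z by linarith
  qed
  show thesis by (rule that[of "R + G + 1"]) (use R main in auto)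
qed

section \<open>The discriminant is not constant\<close>

lemma joukowski_root:
  obtains \<rho> :: complex where "norm \<rho> \<ge> 1" "c = \<rho> + 1 / \<rho>"
proof -
  define s where "s = csqrt (c\<^sup>2 - 4)"
  define r where "r = (c + s) / 2"
  have s2: "s * s = c * c - 4" using power2_csqrt[of "c\<^sup>2 - 4"] by (simp add: s_def power2_eq_square)
  have rr: "r * (c - r) = 1" using s2 by (simp add: r_def field_simps)
  then have r0: "r \<noteq> 0" by auto
  have c: "c = r + 1 / r" using rr r0 by (simp add: field_simps)
  show thesis
  proof (cases "norm r \<ge> 1")
    case True then show ?thesis using that c by blast
  next
    case False
    then have "norm (1 / r) \<ge> 1" using r0 by (simp add: norm_divide)
    then show ?thesis using that[of "1 / r"] c r0 by (simp add: add.commute)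
  qed
qed

text \<open>
  If \<open>D\<close> had the constant value \<open>\<rho> + 1 / \<rho>\<close> with \<open>\<bar>\<rho>\<bar> \<ge> 1\<close>, there would be a Floquet solution with multiplier
  \<open>\<rho>\<close> for every \<open>z\<close>.  The test function \<open>\<omega>\<close> decreases from \<open>1\<close> to \<open>1 / \<bar>\<rho>\<bar>\<^sup>2\<close>, so that the boundary terms cancel
  and the energy estimates apply for large imaginary \<open>z\<close>.
\<close>

theorem D_not_constant: "\<exists>z. D z \<noteq> c"
proof (rule ccontr)
  assume "\<not> ?thesis"
  then have Dc: "\<And>z. D z = c" by blast
  obtain \<rho> where \<rho>: "norm \<rho> \<ge> 1" "c = \<rho> + 1 / \<rho>" by (rule joukowski_root)
  have \<rho>0: "\<rho> \<noteq> 0" using \<rho> by auto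
  define m where "m = 1 / (norm \<rho>)\<^sup>2"
  have m: "m > 0" "m \<le> 1" using \<rho> \<rho>0 by (auto simp: m_def field_simps one_le_power)
  define \<kappa>' where "\<kappa>' = - (1 - m) / P a"
  define \<omega> where "\<omega> x = 1 + \<kappa>' * P x" for x
  have t: "test_function \<omega> (\<lambda>x. 0 + (\<kappa>' * 1 + 0 * P x))" unfolding \<omega>_def by (intro test_function_add test_function_mult test_function_const test_function_P)
  have t': "test_function \<omega> (\<lambda>x. \<kappa>')" using t by simp
  have \<omega>0: "\<omega> 0 = 1" "\<omega> a = m" using P_a by (simp_all add: \<omega>_def P_0 \<kappa>'_def)
  have \<omega>b: "m \<le> \<omega> x" "\<bar>\<omega> x\<bar> \<le> 1" if x: "x \<in> {0..a}" for x
  proof -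
    have "0 \<le> P x" "P x \<le> P a"
      using P_strict_mono[of 0 x] P_strict_mono[of x a] x P_0 by (cases "x = 0"; cases "x = a"; auto)+
    then have "0 \<le> P x / P a" "P x / P a \<le> 1" using P_a by simp_all
    moreover have eq: "\<omega> x = 1 - (1 - m) * (P x / P a)"
      using P_a by (simp add: \<omega>_def \<kappa>'_def field_simps)
    ultimately have "0 \<le> (1 - m) * (P x / P a)" "(1 - m) * (P x / P a) \<le> (1 - m) * 1"
      using m mult_left_le[of "P x / P a" "1 - m"] mult_nonneg_nonneg[of "1 - m" "P x / P a"] by auto
    then show "m \<le> \<omega> x" "\<bar>\<omega> x\<bar> \<le> 1" unfolding eq using m by auto
  qed
  \<comment> \<open>Coefficient of S in \<open>K_bound\<close> with weight m / 2: of the lower bound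
    m for \<omega>, half is left after absorbing the energy part of that term.\<close>
  define L where "L = \<bar>\<kappa>'\<bar>\<^sup>2 / (m / 2) * Ip"
  have L: "L \<ge> 0" using m Ip_pos by (simp add: L_def)
  have B0: "(2 / m) * (Iq + L) \<ge> 0" using m L Iq_nonneg by simp
  obtain C0 where C0: "C0 \<ge> 0" "\<forall>f u g. eqn 0 a g f u \<longrightarrow>
     (\<forall>S. (\<forall>x\<in>{0..a}. (norm (f x))\<^sup>2 \<le> S) \<longrightarrow> energy u \<le> (2 / m) * (Iq + L) * (sqnorm f + S)) \<longrightarrow> energy u \<le> C0 * sqnorm f"
    by (rule energy_bound[OF B0])
  obtain R G where R: "R \<ge> 0" "G \<ge> 0" "\<forall>f u h z. eqn 0 a (\<lambda>x. z * f x + h x) f u \<longrightarrow> h \<in> L2 PM \<longrightarrow> energy u \<le> C0 * sqnorm f \<longrightarrow>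
     norm z * sqnorm f \<le> R * sqnorm f + G * (L2_norm PM h * L2_norm PM f)"
    by (rule spectral_parameter_bound[OF C0(1)])
  \<comment> \<open>For imaginary z the term z I drops out of the real part, and |z| = R + 1 exceeds
    what \<open>spectral_parameter_bound\<close> permits for h = 0.\<close>
  define z where "z = \<i> * complex_of_real (R + 1)"
  have "D z = \<rho> + 1 / \<rho>" using Dc \<rho> by simp
  then obtain f u where e0: "eqn 0 a (\<lambda>x. z * f x) f u" and bc: "f a = \<rho> * f 0" "u a = \<rho> * u 0" and nz: "f 0 \<noteq> 0 \<or> u 0 \<noteq> 0"
    using \<rho>0 by (rule floquet_solution_exists)
  have e: "eqn 0 a (\<lambda>x. z * f x + (\<lambda>_. 0) x) f u" using e0 by simp
  note c = eqn_continuous[OF e]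
  have wt: "continuous_on {0..a} \<omega>" by (rule test_function_continuous[OF t])
  define E where "E = integral {0..a} (\<lambda>x. \<bar>ip x\<bar> * (\<omega> x * (norm (u x))\<^sup>2))"
  define Q where "Q = integral {0..a} (\<lambda>x. q x * (\<omega> x * (norm (f x))\<^sup>2))"
  define Kt where "Kt = integral {0..a} (\<lambda>x. of_real (ip x) * (of_real \<kappa>' * (u x * cnj (f x))))"
  define I where "I = integral {0..a} (\<lambda>x. w x * (\<omega> x * (norm (f x))\<^sup>2))"
  have "of_real (\<omega> a) * (u a * cnj (f a)) = of_real (\<omega> 0) * (u 0 * cnj (f 0))"
  proof -
    have "of_real (\<omega> a) * (u a * cnj (f a)) = of_real m * (\<rho> * cnj \<rho>) * (u 0 * cnj (f 0))" using bc \<omega>0 by (simp add: algebra_simps)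
    also have "of_real m * (\<rho> * cnj \<rho>) = 1"
      unfolding complex_norm_square[symmetric] using \<rho>0 by (simp add: m_def)
    finally show ?thesis using \<omega>0 by simp
  qed
  then have "of_real E + of_real Q + Kt = z * of_real I + integral {0..a} (\<lambda>x. (of_real (\<omega> x) * cnj (f x)) * (of_real (w x) * (\<lambda>_. 0) x))"
    unfolding E_def Q_def Kt_def I_def by (rule energy_identity[OF e t']) simp
  then have "of_real E + of_real Q + Kt = z * of_real I" by simp
  from arg_cong[OF this, of Re] have id: "E + Q + Re Kt = 0" by (simp add: z_def)
  have cE: "continuous_on {0..a} (\<lambda>x. \<omega> x * (norm (u x))\<^sup>2)" by (intro continuous_intros wt c)
  have mE: "m * energy u \<le> E"
    unfolding energy_def E_def integral_mult_right[symmetric]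
  proof (rule integral_le)
    show "(\<lambda>x. m * (\<bar>ip x\<bar> * (norm (u x))\<^sup>2)) integrable_on {0..a}"
      by (rule integrable_on_mult_right[OF int_mult_cont(2)[OF abs_int_ip(2) sq_cont[OF c(2)]]])
    show "(\<lambda>x. \<bar>ip x\<bar> * (\<omega> x * (norm (u x))\<^sup>2)) integrable_on {0..a}" by (rule int_mult_cont(2)[OF abs_int_ip(2) cE])
    fix x assume "x \<in> {0..a}"
    from mult_right_mono[OF \<omega>b(1)[OF this], of "\<bar>ip x\<bar> * (norm (u x))\<^sup>2"]
    show "m * (\<bar>ip x\<bar> * (norm (u x))\<^sup>2) \<le> \<bar>ip x\<bar> * (\<omega> x * (norm (u x))\<^sup>2)" by (simp add: algebra_simps)
  qed
  have "energy u \<le> (2 / m) * (Iq + L) * (sqnorm f + S)" if S: "\<forall>x\<in>{0..a}. (norm (f x))\<^sup>2 \<le> S" for S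
  proof -
    have "\<bar>Q\<bar> \<le> 1 * Iq * S" unfolding Q_def using \<omega>b by (intro Q_bound[OF c(1) wt _ _ S]) auto
    moreover have "norm Kt \<le> (m / 2) * energy u + \<bar>\<kappa>'\<bar>\<^sup>2 / (m / 2) * Ip * S"
      unfolding Kt_def by (rule K_bound[OF c continuous_on_const _ S]) (use m in auto)
    moreover have "- Re Kt \<le> norm Kt" using abs_Re_le_cmod[of Kt] by linarith
    ultimately have "m * energy u \<le> Iq * S + ((m / 2) * energy u + L * S)" using mE id unfolding L_def by linarith
    then have "energy u \<le> (2 / m) * (Iq + L) * S" using m by (simp add: field_simps)
    also have "\<dots> \<le> (2 / m) * (Iq + L) * (sqnorm f + S)" using B0 sqnorm_nonneg[OF c(1)] by (intro mult_left_mono) auto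
    finally show ?thesis .
  qed
  then have "energy u \<le> C0 * sqnorm f" using C0(2) e by blast
  then have "norm z * sqnorm f \<le> R * sqnorm f + G * (L2_norm PM (\<lambda>_. 0) * L2_norm PM f)"
    using R(3)[rule_format, OF e] continuous_L2'[OF continuous_on_const, of 0] by blast
  then have "norm z * sqnorm f \<le> R * sqnorm f" by (simp add: L2_norm_def)
  moreover have "norm z = R + 1" using R(1) by (simp add: z_def norm_mult)
  ultimately have "sqnorm f \<le> 0" by (simp add: algebra_simps)
  then have "L2_norm PM f = 0" using sqnorm_L2[OF c(1)] by simp
  then show False using norm_zero_imp_zero[OF e] nz by blast
qed

end

section \<open>Spectral projections of the fibre operators\<close>

text \<open>
  On the circle \<open>\<bar>z - p\<bar> = e\<close> the factor \<open>(z - p)\<^sup>2 - e\<^sup>2 = 2 \<i> (z - p) Im z\<close> cancels the growth of \<open>f\<close>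
  near the real line.
\<close>

lemma residue_bound:
  assumes "r > 0" and holo: "f holomorphic_on ball p r - {p}" and p: "Im p = 0" and M0: "M \<ge> 0"
    and M: "\<And>z. z \<in> ball p r \<Longrightarrow> Im z \<noteq> 0 \<Longrightarrow> \<bar>Im z\<bar> * norm (f z) \<le> M"
  shows "norm (residue f p) \<le> 2 * M"
proof -
  let ?A = "residue f p"
  define h where "h z = f z * (z - p)\<^sup>2" for z
  let ?B = "residue h p"
  have hh: "h holomorphic_on ball p r - {p}" unfolding h_def by (intro holomorphic_intros holo)
  have bound: "norm (?B - of_real (e\<^sup>2) * ?A) \<le> 2 * M * e\<^sup>2" if e: "0 < e" "e < r" for e
  proof -
    have cb: "cball p e \<subseteq> ball p r" using e by auto
    \<comment> \<open>The integral of f(z) ((z - p)^2 - e^2) over the circle, expressed by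
      residues.\<close>
    have "((\<lambda>z. h z - of_real (e\<^sup>2) * f z) has_contour_integral (2 * of_real pi * \<i> * ?B - of_real (e\<^sup>2) * (2 * of_real pi * \<i> * ?A))) (circlepath p e)"
      using base_residue[OF open_ball _ _ hh cb] base_residue[OF open_ball _ _ holo cb] e assms(1)
      by (intro has_contour_integral_diff has_contour_integral_lmul) auto
    then have "norm (2 * of_real pi * \<i> * ?B - of_real (e\<^sup>2) * (2 * of_real pi * \<i> * ?A)) \<le> (2 * e * M) * (2 * pi * e)"
    proof (rule has_contour_integral_bound_circlepath)
      fix z assume z: "norm (z - p) = e"
      define \<zeta> where "\<zeta> = z - p"
      have "of_real (e\<^sup>2) = \<zeta> * cnj \<zeta>" unfolding \<zeta>_def complex_norm_square[symmetric] z ..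
      moreover have "h z = f z * (\<zeta> * \<zeta>)" by (simp add: h_def \<zeta>_def power2_eq_square)
      ultimately have "h z - of_real (e\<^sup>2) * f z = f z * (\<zeta> * (\<zeta> - cnj \<zeta>))"
        by (simp only:) (simp add: algebra_simps)
      also have "\<zeta> - cnj \<zeta> = of_real (2 * Im z) * \<i>" using p by (simp add: complex_eq_iff \<zeta>_def)
      finally have "norm (h z - of_real (e\<^sup>2) * f z) = norm (f z) * (e * (2 * \<bar>Im z\<bar>))"
        using z by (simp add: norm_mult \<zeta>_def)
      also have "\<dots> = 2 * e * (\<bar>Im z\<bar> * norm (f z))" by simp
      also have "\<dots> \<le> 2 * e * M"
      proof (cases "Im z = 0")
        case False
        have "z \<in> ball p r" using z e by (simp add: dist_norm norm_minus_commute)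
        from mult_left_mono[OF M[OF this False], of "2 * e"] e show ?thesis by simp
      qed (use e M0 in simp)
      finally show "norm (h z - of_real (e\<^sup>2) * f z) \<le> 2 * e * M" .
    qed (use e M0 in auto)
    also have "2 * of_real pi * \<i> * ?B - of_real (e\<^sup>2) * (2 * of_real pi * \<i> * ?A) = (2 * of_real pi * \<i>) * (?B - of_real (e\<^sup>2) * ?A)"
      by (simp add: algebra_simps)
    also have "norm \<dots> = (2 * pi) * norm (?B - of_real (e\<^sup>2) * ?A)" by (simp add: norm_mult)
    finally have "(2 * pi) * norm (?B - of_real (e\<^sup>2) * ?A) \<le> (2 * pi) * (2 * M * e\<^sup>2)" by (simp add: power2_eq_square algebra_simps)
    then show ?thesis by (subst (asm) mult_le_cancel_left_pos) auto
  qed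
  \<comment> \<open>As e tends to 0, only \<open>?B\<close> survives in the estimate; once it is
    known to vanish, e^2 cancels from both sides.\<close>
  have "?B = 0"
  proof -
    have ev: "\<forall>\<^sub>F e in at_right 0. norm ?B \<le> (2 * M + norm ?A) * e\<^sup>2"
      unfolding eventually_at_right_field
    proof (intro exI[of _ r] conjI allI impI)
      fix e :: real assume "0 < e" "e < r"
      have "norm ?B \<le> norm (?B - of_real (e\<^sup>2) * ?A) + norm (of_real (e\<^sup>2) * ?A)" using norm_triangle_sub by (metis add.commute)
      also have "norm (of_real (e\<^sup>2) * ?A) = e\<^sup>2 * norm ?A" by (simp add: norm_mult norm_power)
      finally show "norm ?B \<le> (2 * M + norm ?A) * e\<^sup>2" using bound[OF \<open>0 < e\<close> \<open>e < r\<close>] by (simp add: algebra_simps)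
    qed (rule assms(1))
    have "((\<lambda>e. (2 * M + norm ?A) * e\<^sup>2) \<longlongrightarrow> (2 * M + norm ?A) * 0\<^sup>2) (at_right 0)" by (intro tendsto_intros)
    then have "norm ?B \<le> (2 * M + norm ?A) * 0\<^sup>2"
      by (rule tendsto_lowerbound[OF _ ev]) simp
    then show ?thesis by simp
  qed
  then have "(r / 2)\<^sup>2 * norm ?A \<le> (r / 2)\<^sup>2 * (2 * M)"
    using bound[of "r / 2"] assms(1) by (simp add: norm_mult norm_power power_divide algebra_simps)
  then show ?thesis using assms(1) by (subst (asm) mult_le_cancel_left_pos) auto
qed

text \<open>Near z0 the function f - f z0 is the n-th power of an injective function h. Distinct
  solutions of f z = v thus give distinct roots of y^n + f z0 - v, whose degree does not depend on
  v. For \<open>D\<close> and v = 2 cos t this is the uniformity in t of the eigenvalue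
  count.\<close>

lemma nonconstant_value_count:
  fixes f :: "complex \<Rightarrow> complex"
  assumes f: "f holomorphic_on UNIV" and nc: "f z1 \<noteq> f z0"
  obtains r n where "r > 0" "\<forall>v. finite {z \<in> ball z0 r. f z = v} \<and> card {z \<in> ball z0 r. f z = v} \<le> n"
proof -
  have "\<exists>n>0. (deriv ^^ n) f z0 \<noteq> 0"
  proof (rule ccontr)
    assume "\<not> ?thesis"
    then have "f z1 = f z0"
      using holomorphic_fun_eq_const_on_connected[OF f open_UNIV connected_UNIV, of z0 z1] by blast
    then show False using nc by simp
  qed
  \<comment> \<open>The order of the zero of f - f z0 at z0.\<close>
  define n where "n = (LEAST n. 0 < n \<and> (deriv ^^ n) f z0 \<noteq> 0)"
  have n: "0 < n" "(deriv ^^ n) f z0 \<noteq> 0"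
    using LeastI_ex[OF \<open>\<exists>n>0. (deriv ^^ n) f z0 \<noteq> 0\<close>] by (simp_all add: n_def)
  have lt: "(deriv ^^ i) f z0 = 0" if "0 < i" "i < n" for i
    using not_less_Least[of i "\<lambda>n. 0 < n \<and> (deriv ^^ n) f z0 \<noteq> 0"] that by (auto simp: n_def)
  have "\<exists>g r. 0 < r \<and> g holomorphic_on ball z0 r \<and> (\<forall>w\<in>ball z0 r. f w - f z0 = ((w - z0) * g w) ^ n \<and> g w \<noteq> 0)"
  proof (rule holomorphic_factor_order_of_zero_strong[OF f open_UNIV UNIV_I n lt])
    fix g r assume "0 < r" "g holomorphic_on ball z0 r" "\<And>w. w \<in> ball z0 r \<Longrightarrow> f w - f z0 = ((w - z0) * g w) ^ n"
      "\<And>w. w \<in> ball z0 r \<Longrightarrow> g w \<noteq> 0"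
    then show ?thesis by blast
  qed
  then obtain g r where g: "0 < r" "g holomorphic_on ball z0 r" "\<And>w. w \<in> ball z0 r \<Longrightarrow> f w - f z0 = ((w - z0) * g w) ^ n"
     "\<And>w. w \<in> ball z0 r \<Longrightarrow> g w \<noteq> 0" by blast
  define h where "h w = (w - z0) * g w" for w
  have h: "h holomorphic_on ball z0 r" unfolding h_def by (intro holomorphic_intros g)
  have "(g has_field_derivative deriv g z0) (at z0)"
    by (rule holomorphic_derivI[OF g(2) open_ball]) (use g(1) in simp)
  then have "(h has_field_derivative g z0) (at z0)"
    unfolding h_def by (auto intro!: derivative_eq_intros)
  then have "deriv h z0 \<noteq> 0" using g(4)[of z0] g(1) by (simp add: DERIV_imp_deriv)
  then obtain s where s: "s > 0" "ball z0 s \<subseteq> ball z0 r" "inj_on h (ball z0 s)"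
    using has_complex_derivative_locally_injective[OF h _ open_ball, of z0] g(1) by (metis centre_in_ball)
  have "finite {z \<in> ball z0 s. f z = v} \<and> card {z \<in> ball z0 s. f z = v} \<le> n" for v
  proof -
    let ?Z = "{z \<in> ball z0 s. f z = v}"
    define pl where "pl = monom 1 n + [:f z0 - v:]"
    have deg: "degree pl = n"
      unfolding pl_def using n(1) by (simp add: degree_add_eq_left degree_monom_eq)
    have pl0: "pl \<noteq> 0" using deg n(1) by auto
    have sub: "h ` ?Z \<subseteq> {y. poly pl y = 0}"
    proof (intro subsetI, elim imageE)
      fix y z assume "y = h z" "z \<in> ?Z"
      then have "z \<in> ball z0 r" "f z = v" "y = h z" using s(2) by auto
      then have "f z - f z0 = y ^ n" using g(3)[of z] by (simp only: h_def)
      then show "y \<in> {y. poly pl y = 0}" using \<open>f z = v\<close>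
        by (simp add: pl_def poly_monom algebra_simps)
    qed
    have fin: "finite {y. poly pl y = 0}" by (rule poly_roots_finite[OF pl0])
    have inj: "inj_on h ?Z" using s(3) by (rule inj_on_subset) auto
    have "finite ?Z" using finite_imageD[OF finite_subset[OF sub fin] inj] .
    moreover have "card ?Z = card (h ` ?Z)" using card_image[OF inj] by simp
    moreover have "card (h ` ?Z) \<le> card {y. poly pl y = 0}" by (rule card_mono[OF fin sub])
    moreover have "card {y. poly pl y = 0} \<le> n" using card_poly_roots_bound[OF pl0] deg by simp
    ultimately show ?thesis by simp
  qed
  then show thesis using that[of s n] s(1) by blast
qed

context hill begin

lemma zeros_finite: "finite {z \<in> cball 0 \<rho>. D z = v}"
proof -
  have "\<not> (\<lambda>z. D z - v) constant_on UNIV"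
  proof
    assume "(\<lambda>z. D z - v) constant_on UNIV"
    then obtain c where "\<And>z. D z - v = c" unfolding constant_on_def by auto
    then have "\<And>z. D z = c + v" by (simp add: algebra_simps)
    then show False using D_not_constant by blast
  qed
  moreover have "(\<lambda>z. D z - v) holomorphic_on UNIV" by (intro holomorphic_intros D_holomorphic)
  ultimately have "finite {z \<in> cball 0 \<rho>. D z - v = 0}"
    by (intro holomorphic_compact_finite_zeros[where S=UNIV]) auto
  then show ?thesis by simp
qed

text \<open>Zeros of a nonconstant entire function are isolated. If the derivative is a constant,
  this constant is nonzero since \<open>D\<close> is not constant.\<close>

lemma critical_zeros_finite: "finite {z \<in> cball 0 \<rho>. deriv D z = 0}"
proof (cases "deriv D constant_on UNIV")
  case False
  have "deriv D holomorphic_on UNIV" by (intro holomorphic_deriv D_holomorphic) auto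
  then show ?thesis using False by (intro holomorphic_compact_finite_zeros[where S=UNIV]) auto
next
  case True
  then obtain c where c: "\<And>z. deriv D z = c" unfolding constant_on_def by auto
  have "c \<noteq> 0"
  proof
    assume "c = 0"
    have "(D has_field_derivative 0) (at z)" for z
      using holomorphic_derivI[OF D_holomorphic open_UNIV UNIV_I, of z] c \<open>c = 0\<close> by simp
    then have "\<exists>c. \<forall>x\<in>UNIV. D x = c" by (intro has_field_derivative_zero_constant) auto
    then show False using D_not_constant by blast
  qed
  then show ?thesis using c by simp
qed

section \<open>Resolvents and Riesz projections of the fibres\<close>

abbreviation "FT t \<equiv> fibre_op a w p q t"

lemma fibre_L2: "(f, g) \<in> FT t \<Longrightarrow> f \<in> L2 PM" "(f, g) \<in> FT t \<Longrightarrow> g \<in> L2 PM"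
  by (auto simp: fibre_iff)

lemma fibre_combine:
  assumes "(f1, g1) \<in> FT t" "(f2, g2) \<in> FT t"
  shows "(\<lambda>x. k * f1 x + l * f2 x, \<lambda>x. k * g1 x + l * g2 x) \<in> FT t"
proof -
  let ?e = "exp (\<i> * of_real t)"
  obtain u1 u2 where u: "eqn 0 a g1 f1 u1" "eqn 0 a g2 f2 u2" "f1 a = ?e * f1 0" "u1 a = ?e * u1 0" "f2 a = ?e * f2 0" "u2 a = ?e * u2 0"
    using assms unfolding fibre_iff by blast
  show ?thesis
    unfolding fibre_iff
  proof (intro conjI exI)
    show "(\<lambda>x. k * f1 x + l * f2 x) \<in> L2 PM" "(\<lambda>x. k * g1 x + l * g2 x) \<in> L2 PM"
      using assms fibre_L2 by (auto intro!: L2_add L2_cmult)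
    show "eqn 0 a (\<lambda>x. k * g1 x + l * g2 x) (\<lambda>x. k * f1 x + l * f2 x) (\<lambda>x. k * u1 x + l * u2 x)" by (rule eqn_combine[OF u(1,2)])
  qed (simp_all add: u algebra_simps)
qed

definition Rz :: "real \<Rightarrow> complex \<Rightarrow> (real \<Rightarrow> complex) \<Rightarrow> real \<Rightarrow> complex" where
  "Rz t z f = op_resolvent PM (FT t) z f"

lemma Rz:
  assumes "D z \<noteq> complex_of_real (2 * cos t)" "f \<in> L2 PM"
  obtains g where "(Rz t z f, g) \<in> FT t" "AE x in PM. g x - z * Rz t z f x = f x"
proof -
  have "\<exists>(r, g)\<in>FT t. AE x in PM. g x - z * r x = f x"
    using assms fibre_resolvent_iff[of z t] unfolding resolvent_set_def by blast
  then have "\<exists>r g. (r, g) \<in> FT t \<and> (AE x in PM. g x - z * r x = f x)" by blast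
  from someI_ex[OF this] show thesis using that unfolding Rz_def op_resolvent_def by blast
qed

lemma Rz_L2: "D z \<noteq> complex_of_real (2 * cos t) \<Longrightarrow> f \<in> L2 PM \<Longrightarrow> Rz t z f \<in> L2 PM"
  by (meson Rz fibre_L2)

lemma fibre_diff_norm:
  assumes "(r, g) \<in> FT t" "AE x in PM. g x - z * r x = f x" "f \<in> L2 PM"
  shows "L2_norm PM (\<lambda>x. g x - z * r x) = L2_norm PM f"
  by (rule L2_norm_cong_AE[OF L2_measurable L2_measurable assms(2)])
     (use assms fibre_L2[OF assms(1)] in \<open>auto intro!: L2_diff L2_cmult\<close>)

text \<open>The Riesz projection is characterised through these scalar matrix elements of the
  resolvent, so that complex analysis for scalar functions suffices.\<close>

definition RF :: "real \<Rightarrow> (real \<Rightarrow> complex) \<Rightarrow> (real \<Rightarrow> complex) \<Rightarrow> complex \<Rightarrow> complex" where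
  "RF t f h z = L2_inner PM (Rz t z f) h"

lemma L2_inner_combine3:
  assumes "f \<in> L2 M" "g \<in> L2 M" "s \<in> L2 M" "h \<in> L2 M"
  shows "L2_inner M (\<lambda>x. f x - g x - k * s x) h = L2_inner M f h - L2_inner M g h - k * L2_inner M s h"
proof -
  have "L2_inner M (\<lambda>x. f x - g x - k * s x) h = (\<integral>x. f x * cnj (h x) - g x * cnj (h x) - k * (s x * cnj (h x)) \<partial>M)"
    unfolding L2_inner_def by (simp add: algebra_simps)
  also have "\<dots> = L2_inner M f h - L2_inner M g h - k * L2_inner M s h"
    unfolding L2_inner_def
    using L2_inner_integrable[OF assms(1,4)] L2_inner_integrable[OF assms(2,4)] L2_inner_integrable[OF assms(3,4)]
    by simp
  finally show ?thesis .
qed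

text \<open>The derivative comes from the square of the resolvent R at z0. The error E of the linear
  approximation satisfies (A(t) - z) E = (z - z0)^2 R(z0)^2 f, and the resolvents are bounded
  uniformly near z0. Since \<open>Rz\<close> is picked by Hilbert choice, its equation holds only
  almost everywhere.\<close>

lemma RF_differentiable:
  assumes z0: "D z0 \<noteq> complex_of_real (2 * cos t)" and f: "f \<in> L2 PM" and h: "h \<in> L2 PM"
  shows "RF t f h field_differentiable (at z0)"
proof -
  have "z0 \<in> resolvent_set PM (FT t)" using z0 by (simp only: fibre_resolvent_iff not_False_eq_True)
  then obtain C0 where C0: "\<forall>(f, g)\<in>FT t. L2_norm PM f \<le> C0 * L2_norm PM (\<lambda>x. g x - z0 * f x)"
    unfolding resolvent_set_def by blast
  define C where "C = max C0 1"
  have C: "C > 0" "\<And>f g. (f, g) \<in> FT t \<Longrightarrow> L2_norm PM f \<le> C * L2_norm PM (\<lambda>x. g x - z0 * f x)"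
  proof -
    fix f g assume "(f, g) \<in> FT t"
    then have "L2_norm PM f \<le> C0 * L2_norm PM (\<lambda>x. g x - z0 * f x)" using C0 by blast
    also have "\<dots> \<le> C * L2_norm PM (\<lambda>x. g x - z0 * f x)" by (intro mult_right_mono L2_norm_nonneg) (simp add: C_def)
    finally show "L2_norm PM f \<le> C * L2_norm PM (\<lambda>x. g x - z0 * f x)" .
  qed (simp add: C_def)
  \<comment> \<open>Perturbation of the bound at z0: for C |z - z0| \<le> 1/2, half of the norm of f
    is absorbed on the left.\<close>
  have Cz: "L2_norm PM f \<le> 2 * C * L2_norm PM (\<lambda>x. g x - z * f x)"
    if z: "norm (z - z0) \<le> 1 / (2 * C)" and fg: "(f, g) \<in> FT t" for f g z
  proof -
    note l = fibre_L2[OF fg]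
    have "L2_norm PM (\<lambda>x. g x - z0 * f x) = L2_norm PM (\<lambda>x. (g x - z * f x) + (z - z0) * f x)" by (simp add: algebra_simps)
    also have "\<dots> \<le> L2_norm PM (\<lambda>x. g x - z * f x) + norm (z - z0) * L2_norm PM f"
      using L2_norm_triangle[OF L2_diff[OF l(2) L2_cmult[OF l(1)]] L2_cmult[OF l(1)], of z "z - z0"] by (simp add: L2_norm_cmult)
    finally have "C * L2_norm PM (\<lambda>x. g x - z0 * f x) \<le> C * (L2_norm PM (\<lambda>x. g x - z * f x) + norm (z - z0) * L2_norm PM f)"
      using C(1) by (intro mult_left_mono) auto
    also have "\<dots> = C * L2_norm PM (\<lambda>x. g x - z * f x) + (C * norm (z - z0)) * L2_norm PM f" by (simp add: algebra_simps)
    also have "\<dots> \<le> C * L2_norm PM (\<lambda>x. g x - z * f x) + (1 / 2) * L2_norm PM f"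
      using z C(1) by (intro add_left_mono mult_right_mono L2_norm_nonneg) (simp add: field_simps)
    finally show ?thesis using C(2)[OF fg] by linarith
  qed
  let ?d = "min 1 (1 / (2 * C))"
  have "open {z. D z \<noteq> complex_of_real (2 * cos t)}"
    by (intro open_Collect_neq holomorphic_on_imp_continuous_on D_holomorphic continuous_intros)
  then obtain d0 where d0: "d0 > 0" "\<And>z. dist z z0 < d0 \<Longrightarrow> D z \<noteq> complex_of_real (2 * cos t)"
    using z0 unfolding open_dist by blast
  define d where "d = min (d0 / 2) (1 / (2 * C))"
  have d: "d > 0" "d < d0" "d \<le> 1 / (2 * C)" using d0(1) C(1) by (auto simp: d_def)
  let ?rr = "Rz t z0 f"
  have r0: "?rr \<in> L2 PM" by (rule Rz_L2[OF z0 f])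
  let ?s = "Rz t z0 ?rr"
  have s: "?s \<in> L2 PM" by (rule Rz_L2[OF z0 r0])
  obtain g0 where g0: "(?rr, g0) \<in> FT t" "AE x in PM. g0 x - z0 * ?rr x = f x" by (rule Rz[OF z0 f])
  obtain gs where gs: "(?s, gs) \<in> FT t" "AE x in PM. gs x - z0 * ?s x = ?rr x" by (rule Rz[OF z0 r0])
  have "(RF t f h has_field_derivative L2_inner PM ?s h) (at z0)"
  proof (rule quadratic_remainder_derivative[OF d(1)])
    fix z assume z: "norm (z - z0) \<le> d"
    have Dz: "D z \<noteq> complex_of_real (2 * cos t)" using z d by (intro d0(2)) (simp add: dist_norm)
    let ?r = "Rz t z f"
    have r: "?r \<in> L2 PM" by (rule Rz_L2[OF Dz f])
    obtain g where g: "(?r, g) \<in> FT t" "AE x in PM. g x - z * ?r x = f x" by (rule Rz[OF Dz f])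
    \<comment> \<open>The error of the linear approximation, nested in the shape in which
      \<open>fibre_combine\<close> yields it.\<close>
    let ?E = "\<lambda>x. 1 * (1 * ?r x + (-1) * ?rr x) + (- (z - z0)) * ?s x"
    let ?GE = "\<lambda>x. 1 * (1 * g x + (-1) * g0 x) + (- (z - z0)) * gs x"
    have E: "(?E, ?GE) \<in> FT t" by (rule fibre_combine[OF fibre_combine[OF g(1) g0(1)] gs(1)])
    have "AE x in PM. ?GE x - z * ?E x = (z - z0)\<^sup>2 * ?s x"
      using g(2) g0(2) gs(2)
    proof eventually_elim
      case (elim x)
      have "?GE x - z * ?E x = (g x - z * ?r x) - (g0 x - z0 * ?rr x) + (z - z0) * ?rr x - (z - z0) * (gs x - z0 * ?s x) + (z - z0)\<^sup>2 * ?s x"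
        by (simp add: power2_eq_square algebra_simps)
      then show ?case unfolding elim by (simp only: diff_self add_0 diff_add_cancel add_diff_cancel_left' add_diff_cancel_right')
    qed
    then have "L2_norm PM (\<lambda>x. ?GE x - z * ?E x) = L2_norm PM (\<lambda>x. (z - z0)\<^sup>2 * ?s x)"
      by (rule fibre_diff_norm[OF E _ L2_cmult[OF s]])
    then have nE: "L2_norm PM ?E \<le> 2 * C * ((norm (z - z0))\<^sup>2 * L2_norm PM ?s)"
      using Cz[OF _ E, of z] z d by (simp add: L2_norm_cmult norm_power)
    have E2: "(\<lambda>x. ?r x - ?rr x - (z - z0) * ?s x) = ?E" by (simp add: fun_eq_iff algebra_simps)
    have eq: "RF t f h z - RF t f h z0 - (z - z0) * L2_inner PM ?s h = L2_inner PM ?E h"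
      unfolding RF_def E2[symmetric] by (rule L2_inner_combine3[OF r r0 s h, symmetric])
    have "norm (L2_inner PM ?E h) \<le> L2_norm PM ?E * L2_norm PM h"
      by (rule L2_inner_norm_le[OF fibre_L2(1)[OF E] h])
    also have "\<dots> \<le> (2 * C * ((norm (z - z0))\<^sup>2 * L2_norm PM ?s)) * L2_norm PM h"
      by (rule mult_right_mono[OF nE L2_norm_nonneg])
    finally have "norm (L2_inner PM ?E h) \<le> (2 * C * ((norm (z - z0))\<^sup>2 * L2_norm PM ?s)) * L2_norm PM h" .
    then show "norm (RF t f h z - RF t f h z0 - (z - z0) * L2_inner PM ?s h) \<le> (2 * C * L2_norm PM ?s * L2_norm PM h) * norm (z - z0) ^ 2"
      unfolding eq by (simp add: ac_simps)
  qed
  then show ?thesis by (auto simp: field_differentiable_def)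
qed

lemma fibre_spectrum: "op_spectrum PM (FT t) = {z. D z = complex_of_real (2 * cos t)}"
  unfolding op_spectrum_def by (auto simp: fibre_resolvent_iff simp del: of_real_mult)

lemma sum_list_sum_swap: "(\<Sum>\<gamma>\<leftarrow>\<Gamma>. \<Sum>p\<in>A. F \<gamma> p) = (\<Sum>p\<in>A. \<Sum>\<gamma>\<leftarrow>\<Gamma>. F \<gamma> p)" for F :: "'x \<Rightarrow> 'y \<Rightarrow> complex"
  by (induction \<Gamma>) (auto simp: sum.distrib)

lemma sum_list_mult_left: "(\<Sum>\<gamma>\<leftarrow>\<Gamma>. c * F \<gamma>) = c * (\<Sum>\<gamma>\<leftarrow>\<Gamma>. F \<gamma>)" for c :: complex
  by (induction \<Gamma>) (auto simp: distrib_left)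

text \<open>A disc around the cycle contains only finitely many points of the spectrum, so the
  residue theorem applies there. Summed over the paths, the winding numbers are 1 at points of
  \<open>S\<close> and 0 at the others, which leaves a plain sum of residues.\<close>

lemma cycle_residues:
  assumes \<Gamma>: "separating_cycle PM (FT t) S \<Gamma>" and S: "S \<subseteq> op_spectrum PM (FT t)" and f: "f \<in> L2 PM" and h: "h \<in> L2 PM"
  obtains A where "finite A" "A \<subseteq> S" "(\<Sum>\<gamma>\<leftarrow>\<Gamma>. contour_integral \<gamma> (RF t f h)) = 2 * of_real pi * \<i> * (\<Sum>p\<in>A. residue (RF t f h) p)"
proof -
  let ?\<sigma> = "{z. D z = complex_of_real (2 * cos t)}"
  have \<Gamma>1: "valid_path \<gamma>" "pathfinish \<gamma> = pathstart \<gamma>" "path_image \<gamma> \<inter> ?\<sigma> = {}" if "\<gamma> \<in> set \<Gamma>" for \<gamma>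
    using \<Gamma> that fibre_spectrum[of t] unfolding separating_cycle_def op_spectrum_def by blast+
  have \<Gamma>2: "(\<Sum>\<gamma>\<leftarrow>\<Gamma>. winding_number \<gamma> z) = (if z \<in> S then 1 else 0)" if "z \<in> ?\<sigma>" for z
    using \<Gamma> that unfolding separating_cycle_def fibre_spectrum by simp
  have "bounded (\<Union>\<gamma>\<in>set \<Gamma>. path_image \<gamma>)"
    using \<Gamma>1 by (intro bounded_UN) (auto intro: bounded_path_image valid_path_imp_path)
  then obtain \<rho> where \<rho>: "(\<Union>\<gamma>\<in>set \<Gamma>. path_image \<gamma>) \<subseteq> ball 0 \<rho>" by (metis bounded_subset_ballD)
  define pts where "pts = ?\<sigma> \<inter> ball 0 \<rho>"
  have fin: "finite pts" unfolding pts_def by (rule finite_subset[OF _ zeros_finite[of \<rho>]]) auto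
  have ci: "contour_integral \<gamma> (RF t f h) = 2 * of_real pi * \<i> * (\<Sum>p\<in>pts. winding_number \<gamma> p * residue (RF t f h) p)"
    if \<gamma>: "\<gamma> \<in> set \<Gamma>" for \<gamma>
  proof -
    have holo: "RF t f h holomorphic_on ball 0 \<rho> - pts"
      unfolding holomorphic_on_def
      using RF_differentiable[OF _ f h] by (auto simp: pts_def intro: field_differentiable_at_within)
    have im: "path_image \<gamma> \<subseteq> ball 0 \<rho> - pts" using \<rho> \<gamma> \<Gamma>1(3)[OF \<gamma>] by (auto simp: pts_def)
    have "path_image \<gamma> \<subseteq> ball 0 \<rho>" using im by blast
    then have wn: "\<forall>z. z \<notin> ball 0 \<rho> \<longrightarrow> winding_number \<gamma> z = 0"
      using winding_number_zero_outside[OF valid_path_imp_path[OF \<Gamma>1(1)[OF \<gamma>]] convex_ball \<Gamma>1(2)[OF \<gamma>]] by blast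
    show ?thesis
      using Residue_theorem[OF open_ball connected_ball fin holo \<Gamma>1(1,2)[OF \<gamma>] im wn] by simp
  qed
  have "(\<Sum>\<gamma>\<leftarrow>\<Gamma>. contour_integral \<gamma> (RF t f h)) = (\<Sum>\<gamma>\<leftarrow>\<Gamma>. 2 * of_real pi * \<i> * (\<Sum>p\<in>pts. winding_number \<gamma> p * residue (RF t f h) p))"
    by (intro arg_cong[where f=sum_list] map_cong refl ci)
  also have "\<dots> = 2 * of_real pi * \<i> * (\<Sum>p\<in>pts. (\<Sum>\<gamma>\<leftarrow>\<Gamma>. winding_number \<gamma> p * residue (RF t f h) p))"
    by (simp only: sum_list_mult_left sum_list_sum_swap)
  also have "(\<Sum>p\<in>pts. (\<Sum>\<gamma>\<leftarrow>\<Gamma>. winding_number \<gamma> p * residue (RF t f h) p)) = (\<Sum>p\<in>pts. (if p \<in> S then residue (RF t f h) p else 0))"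
  proof (rule sum.cong[OF refl])
    fix p assume "p \<in> pts"
    then have w: "(\<Sum>\<gamma>\<leftarrow>\<Gamma>. winding_number \<gamma> p) = (if p \<in> S then 1 else 0)" by (intro \<Gamma>2) (auto simp: pts_def)
    have "(\<Sum>\<gamma>\<leftarrow>\<Gamma>. winding_number \<gamma> p * residue (RF t f h) p) = (\<Sum>\<gamma>\<leftarrow>\<Gamma>. winding_number \<gamma> p) * residue (RF t f h) p"
      by (induction \<Gamma>) (auto simp: algebra_simps)
    then show "(\<Sum>\<gamma>\<leftarrow>\<Gamma>. winding_number \<gamma> p * residue (RF t f h) p) = (if p \<in> S then residue (RF t f h) p else 0)" by (simp add: w)
  qed
  also have "\<dots> = (\<Sum>p\<in>pts \<inter> S. residue (RF t f h) p)" using fin by (simp add: sum.inter_restrict)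
  finally show thesis by (intro that[of "pts \<inter> S"]) (use fin in auto)
qed

text \<open>The projection g of f is paired with itself: \<parallel>g\<parallel>^2 is minus a sum of
  residues, each at most a multiple of \<parallel>f\<parallel> \<parallel>g\<parallel>, and their
  number is bounded uniformly in t; dividing by \<parallel>g\<parallel> gives the bound. It is
  stated for square integrable \<phi> that agree with the projection almost everywhere, as the
  inverse Gelfand transform supplies these. \<open>K\<close> covers the arbitrary value chosen when
  no projection exists.\<close>

theorem fibre_projection_bound:
  obtains R where "R > 0" "\<forall>z0. norm z0 > R \<longrightarrow> (\<exists>r>0. \<exists>C\<ge>0. \<exists>K. \<forall>\<Delta> t f \<phi>. \<Delta> \<subseteq> ball z0 r \<longrightarrow> f \<in> L2 PM \<longrightarrow> \<phi> \<in> L2 PM \<longrightarrow>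
     (AE x in PM. \<phi> x = fibre_projection a w p q \<Delta> t f x) \<longrightarrow> L2_norm PM \<phi> \<le> max K (C * L2_norm PM f))"
proof -
  obtain R where R: "R > 0" "\<forall>t z f g. norm z > R \<longrightarrow> Im z \<noteq> 0 \<longrightarrow> (f, g) \<in> fibre_op a w p q t \<longrightarrow>
     \<bar>Im z\<bar> * L2_norm PM f \<le> 2 * norm z * L2_norm PM (\<lambda>x. g x - z * f x)" by (rule resolvent_estimate)
  \<comment> \<open>A nonreal eigenvalue outside the disc would have an eigenfunction, that is h =
    0, against the resolvent estimate.\<close>
  have real: "Im z = 0" if z: "norm z > R" "D z = complex_of_real (2 * cos t)" for z t
  proof (rule ccontr)
    assume im: "Im z \<noteq> 0"
    have "D z = exp (\<i> * of_real t) + 1 / exp (\<i> * of_real t)" using z(2) by (simp only: exp_floquet)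
    then obtain y u where yu: "eqn 0 a (\<lambda>x. z * y x) y u" "y a = exp (\<i> * of_real t) * y 0" "u a = exp (\<i> * of_real t) * u 0" "y 0 \<noteq> 0 \<or> u 0 \<noteq> 0"
      using exp_floquet(1) by (rule floquet_solution_exists)
    have "y \<in> L2 PM" by (rule continuous_L2'[OF eqn_continuous(1)[OF yu(1)]])
    then have "(y, \<lambda>x. z * y x) \<in> FT t" unfolding fibre_iff using yu L2_cmult by blast
    then have "\<bar>Im z\<bar> * L2_norm PM y \<le> 2 * norm z * L2_norm PM (\<lambda>x. z * y x - z * y x)" using R(2) z(1) im by blast
    also have "L2_norm PM (\<lambda>x. z * y x - z * y x) = 0" by (simp add: L2_norm_def)
    finally have "L2_norm PM y = 0" using im L2_norm_nonneg[of PM y] by (simp add: mult_le_0_iff)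
    then show False using norm_zero_imp_zero[OF yu(1)] yu(4) by blast
  qed
  have main: "\<exists>r>0. \<exists>C\<ge>0. \<exists>K. \<forall>\<Delta> t f \<phi>. \<Delta> \<subseteq> ball z0 r \<longrightarrow> f \<in> L2 PM \<longrightarrow> \<phi> \<in> L2 PM \<longrightarrow>
     (AE x in PM. \<phi> x = fibre_projection a w p q \<Delta> t f x) \<longrightarrow> L2_norm PM \<phi> \<le> max K (C * L2_norm PM f)" if z0: "norm z0 > R" for z0
  proof -
    obtain z1 where "D z1 \<noteq> D z0" using D_not_constant by blast
    then obtain r0 n where r0: "r0 > 0" "\<forall>v. finite {z \<in> ball z0 r0. D z = v} \<and> card {z \<in> ball z0 r0. D z = v} \<le> n"
      by (rule nonconstant_value_count[OF D_holomorphic])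
    \<comment> \<open>Small enough for the eigenvalue count and for staying outside the disc of
      radius \<open>R\<close>.\<close>
    define r where "r = min r0 (norm z0 - R)"
    have r: "r > 0" "r \<le> r0" using r0 z0 by (auto simp: r_def)
    have bR: "norm z > R" if "z \<in> ball z0 r" for z
    proof -
      have "norm (z0 - z) < norm z0 - R" using that by (simp add: r_def dist_norm)
      then show ?thesis using norm_triangle_sub[of z0 z] by linarith
    qed
    define B where "B = norm z0 + r"
    have bB: "norm z \<le> B" if "z \<in> ball z0 r" for z
      using that norm_triangle_sub[of z z0] by (simp add: B_def dist_norm norm_minus_commute)
    have B0: "B \<ge> 0" using r by (simp add: B_def)
    \<comment> \<open>At most n residues, each at most 2 M by \<open>residue_bound\<close>, where M
      = 2 B \<parallel>f\<parallel> \<parallel>g\<parallel> comes from the resolvent estimate with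
      |z| \<le> B.\<close>
    define C where "C = real n * (2 * (2 * B))"
    \<comment> \<open>\<open>J\<close> is the value of the Riesz projection when no separating cycle exists\<close>
    define J :: "real \<Rightarrow> complex" where "J = (SOME g. False)"
    \<comment> \<open>All square integrable functions that equal \<open>J\<close> almost everywhere
      have the same norm, so any one of them fixes \<open>K\<close>; if there is none, the case
      without projection cannot arise for \<phi>.\<close>
    define K where "K = L2_norm PM (SOME \<phi>. \<phi> \<in> L2 PM \<and> (AE x in PM. \<phi> x = J x))"
    have "L2_norm PM \<phi> \<le> max K (C * L2_norm PM f)"
      if \<Delta>: "\<Delta> \<subseteq> ball z0 r" and f: "f \<in> L2 PM" and \<phi>: "\<phi> \<in> L2 PM" "AE x in PM. \<phi> x = fibre_projection a w p q \<Delta> t f x"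
      for \<Delta> t f \<phi>
    proof -
      define S where "S = op_spectrum PM (FT t) \<inter> \<Delta>"
      define Pr where "Pr g \<longleftrightarrow> g \<in> L2 PM \<and> (\<exists>\<Gamma>. separating_cycle PM (FT t) S \<Gamma> \<and>
          (\<forall>h\<in>L2 PM. L2_inner PM g h = - 1 / (2 * of_real pi * \<i>) * (\<Sum>\<gamma>\<leftarrow>\<Gamma>. contour_integral \<gamma> (RF t f h))))" for g
      have fp: "fibre_projection a w p q \<Delta> t f = (SOME g. Pr g)"
        unfolding fibre_projection_def riesz_projection_def Pr_def RF_def[abs_def] Rz_def S_def ..
      show ?thesis
      proof (cases "\<exists>g. Pr g")
        case False
        then have "Pr = (\<lambda>g. False)" by auto
        then have \<phi>J: "AE x in PM. \<phi> x = J x" using \<phi>(2) unfolding fp J_def by simp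
        then have "\<exists>\<phi>. \<phi> \<in> L2 PM \<and> (AE x in PM. \<phi> x = J x)" using \<phi>(1) by blast
        then obtain \<psi> where \<psi>: "\<psi> \<in> L2 PM" "AE x in PM. \<psi> x = J x" "K = L2_norm PM \<psi>"
          unfolding K_def using someI_ex[of "\<lambda>\<phi>. \<phi> \<in> L2 PM \<and> (AE x in PM. \<phi> x = J x)"] by blast
        have "AE x in PM. \<phi> x = \<psi> x" using \<phi>J \<psi>(2) by eventually_elim simp
        then have "L2_norm PM \<phi> = K"
          unfolding \<psi>(3) by (rule L2_norm_cong_AE[OF L2_measurable[OF \<phi>(1)] L2_measurable[OF \<psi>(1)]])
        then show ?thesis by simp
      next
        case True
        define g where "g = (SOME g. Pr g)"
        have "Pr g" unfolding g_def by (rule someI_ex[OF True])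
        then obtain \<Gamma> where g: "g \<in> L2 PM" and \<Gamma>: "separating_cycle PM (FT t) S \<Gamma>"
          and ip: "\<forall>h\<in>L2 PM. L2_inner PM g h = - 1 / (2 * of_real pi * \<i>) * (\<Sum>\<gamma>\<leftarrow>\<Gamma>. contour_integral \<gamma> (RF t f h))"
          unfolding Pr_def by blast
        obtain A where A: "finite A" "A \<subseteq> S" "(\<Sum>\<gamma>\<leftarrow>\<Gamma>. contour_integral \<gamma> (RF t f g)) = 2 * of_real pi * \<i> * (\<Sum>p\<in>A. residue (RF t f g) p)"
          by (rule cycle_residues[OF \<Gamma> _ f g]) (auto simp: S_def)
        let ?v = "complex_of_real (2 * cos t)"
        have AS: "A \<subseteq> {z \<in> ball z0 r. D z = ?v}" using A(2) \<Delta> unfolding S_def fibre_spectrum by auto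
        let ?M = "2 * B * L2_norm PM f * L2_norm PM g"
        have res: "norm (residue (RF t f g) c) \<le> 2 * ?M" if c: "c \<in> A" for c
        proof -
          have cb: "c \<in> ball z0 r" "D c = ?v" using AS c by auto
          have "open (ball z0 r)" by simp
          then obtain e1 where e1: "e1 > 0" "ball c e1 \<subseteq> ball z0 r" using cb(1) openE by blast
          have "finite {z \<in> ball z0 r0. D z = ?v}" using r0(2) by blast
          then obtain e2 where e2: "e2 > 0" "\<forall>x\<in>{z \<in> ball z0 r0. D z = ?v}. x \<noteq> c \<longrightarrow> e2 \<le> dist c x"
            using finite_set_avoid by blast
          \<comment> \<open>Within distance e of c there is no other eigenvalue, and the disc around
            z0 is not left.\<close>
          define e where "e = min e1 e2"
          have nz: "D z \<noteq> ?v" if "z \<in> ball c e - {c}" for z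
          proof
            assume "D z = ?v"
            moreover have "z \<in> ball z0 r0" using that e1(2) r by (auto simp: e_def)
            ultimately have "e2 \<le> dist c z" using e2(2) that by blast
            then show False using that by (simp add: e_def)
          qed
          show ?thesis
          proof (rule residue_bound)
            show "e > 0" using e1 e2 by (simp add: e_def)
            show "RF t f g holomorphic_on ball c e - {c}"
              unfolding holomorphic_on_def using RF_differentiable[OF nz f g] field_differentiable_at_within by blast
            show "Im c = 0" by (rule real[OF bR[OF cb(1)] cb(2)])
            show "0 \<le> ?M" using B0 L2_norm_nonneg[of PM f] L2_norm_nonneg[of PM g] by simp
            fix z assume z: "z \<in> ball c e" "Im z \<noteq> 0"
            have zb: "z \<in> ball z0 r" using z e1(2) by (auto simp: e_def)
            have Dz: "D z \<noteq> ?v" using real[OF bR[OF zb]] z(2) by blast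
            obtain g' where g': "(Rz t z f, g') \<in> FT t" "AE x in PM. g' x - z * Rz t z f x = f x" by (rule Rz[OF Dz f])
            have "\<bar>Im z\<bar> * norm (RF t f g z) \<le> \<bar>Im z\<bar> * (L2_norm PM (Rz t z f) * L2_norm PM g)"
              unfolding RF_def by (intro mult_left_mono L2_inner_norm_le g Rz_L2 Dz f) auto
            also have "\<dots> = (\<bar>Im z\<bar> * L2_norm PM (Rz t z f)) * L2_norm PM g" by simp
            also have "\<dots> \<le> (2 * norm z * L2_norm PM (\<lambda>x. g' x - z * Rz t z f x)) * L2_norm PM g"
              using R(2) bR[OF zb] z(2) g'(1) by (intro mult_right_mono L2_norm_nonneg) blast
            also have "L2_norm PM (\<lambda>x. g' x - z * Rz t z f x) = L2_norm PM f" by (rule fibre_diff_norm[OF g' f])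
            also have "(2 * norm z * L2_norm PM f) * L2_norm PM g \<le> ?M"
              using bB[OF zb] by (intro mult_right_mono mult_left_mono L2_norm_nonneg) auto
            finally show "\<bar>Im z\<bar> * norm (RF t f g z) \<le> ?M" .
          qed
        qed
        \<comment> \<open>The defining relation of the projection is used with h = g; its prefactor
          cancels 2 \<pi> i up to the sign.\<close>
        have "L2_inner PM g g = - (\<Sum>p\<in>A. residue (RF t f g) p)"
          using ip g A(3) by simp
        then have "(L2_norm PM g)\<^sup>2 = norm (\<Sum>p\<in>A. residue (RF t f g) p)"
          unfolding L2_inner_self[OF g] by (metis norm_minus_cancel norm_of_real abs_power2)
        also have "\<dots> \<le> real (card A) * (2 * ?M)" by (rule sum_norm_bound[OF res])
        also have "card A \<le> n"
        proof -
          have "A \<subseteq> {z \<in> ball z0 r0. D z = ?v}" using AS r(2) by auto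
          then have "card A \<le> card {z \<in> ball z0 r0. D z = ?v}" using r0(2) by (intro card_mono) auto
          then show ?thesis using r0(2) le_trans by blast
        qed
        then have "real (card A) * (2 * ?M) \<le> real n * (2 * ?M)"
          using B0 L2_norm_nonneg[of PM f] L2_norm_nonneg[of PM g] by (intro mult_right_mono) auto
        finally have "L2_norm PM g * L2_norm PM g \<le> (C * L2_norm PM f) * L2_norm PM g"
          by (simp add: C_def power2_eq_square algebra_simps)
        moreover have "0 \<le> C * L2_norm PM f" using B0 L2_norm_nonneg[of PM f] by (simp add: C_def)
        ultimately have "L2_norm PM g \<le> C * L2_norm PM f"
          using L2_norm_nonneg[of PM g] by (cases "L2_norm PM g = 0") auto
        moreover have "L2_norm PM \<phi> = L2_norm PM g"
          using \<phi>(2) unfolding fp g_def[symmetric] by (rule L2_norm_cong_AE[OF L2_measurable[OF \<phi>(1)] L2_measurable[OF g]])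
        ultimately show ?thesis by simp
      qed
    qed
    moreover have "C \<ge> 0" using B0 by (simp add: C_def)
    ultimately show ?thesis using r(1) by blast
  qed
  then show thesis using that[OF R(1)] by blast
qed

end

section \<open>Completeness\<close>

text \<open>The series of X k / r^k has finite integral, so it is finite almost everywhere, and its
  sum serves as \<open>B\<close>. Of the two factors r^k in the hypothesis one is used up by the
  division, the other makes the series of integrals converge.\<close>

lemma AE_geometric:
  fixes X :: "nat \<Rightarrow> 'a \<Rightarrow> real"
  assumes m: "\<And>k. X k \<in> borel_measurable M" and X0: "\<And>k x. 0 \<le> X k x"
    and r: "0 < r" "r < 1" and C: "C \<ge> 0"
    and le: "\<And>k. (\<integral>\<^sup>+x. ennreal (X k x) \<partial>M) \<le> ennreal (C * r ^ k * r ^ k)"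
  shows "AE x in M. \<exists>B\<ge>0. \<forall>k. X k x \<le> B * r ^ k"
proof -
  define Y where "Y k x = ennreal (X k x / r ^ k)" for k x
  have Ym: "Y k \<in> borel_measurable M" for k unfolding Y_def using m[of k] by measurable
  have Yk: "(\<integral>\<^sup>+x. Y k x \<partial>M) \<le> ennreal (C * r ^ k)" for k
  proof -
    have "(\<integral>\<^sup>+x. Y k x \<partial>M) = (\<integral>\<^sup>+x. ennreal (1 / r ^ k) * ennreal (X k x) \<partial>M)"
      unfolding Y_def using X0 r by (intro nn_integral_cong) (simp flip: ennreal_mult)
    also have "\<dots> = ennreal (1 / r ^ k) * (\<integral>\<^sup>+x. ennreal (X k x) \<partial>M)"
      using m[of k] by (intro nn_integral_cmult) measurable
    also have "\<dots> \<le> ennreal (1 / r ^ k) * ennreal (C * r ^ k * r ^ k)"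
      by (intro mult_left_mono le) simp
    also have "\<dots> = ennreal (C * r ^ k)"
      using r C by (simp flip: ennreal_mult)
    finally show ?thesis .
  qed
  have "(\<integral>\<^sup>+x. (\<Sum>k. Y k x) \<partial>M) = (\<Sum>k. \<integral>\<^sup>+x. Y k x \<partial>M)"
    by (rule nn_integral_suminf) (rule Ym)
  also have "\<dots> \<le> (\<Sum>k. ennreal (C * r ^ k))"
    by (intro suminf_le Yk) auto
  also have "\<dots> = ennreal (\<Sum>k. C * r ^ k)"
    using r C by (intro suminf_ennreal2) (auto intro!: summable_mult summable_geometric)
  finally have "(\<integral>\<^sup>+x. (\<Sum>k. Y k x) \<partial>M) < \<infinity>"
    unfolding infinity_ennreal_def by (rule le_less_trans[OF _ ennreal_less_top])
  then have "(\<integral>\<^sup>+x. (\<Sum>k. Y k x) \<partial>M) \<noteq> \<infinity>" by simp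
  then have "AE x in M. (\<Sum>k. Y k x) \<noteq> \<infinity>"
    by (intro nn_integral_noteq_infinite borel_measurable_suminf_order Ym)
  then show ?thesis
  proof eventually_elim
    case (elim x)
    define B where "B = enn2real (\<Sum>k. Y k x)"
    have "X k x \<le> B * r ^ k" for k
    proof -
      have "Y k x \<le> (\<Sum>k. Y k x)"
        using sum_le_suminf[of "\<lambda>k. Y k x" "{k}"] by simp
      also have "\<dots> = ennreal B" using elim by (simp add: B_def less_top)
      finally have "X k x / r ^ k \<le> B"
        unfolding Y_def by (subst (asm) ennreal_le_iff) (simp_all add: B_def)
      then show ?thesis using r by (simp add: field_simps)
    qed
    moreover have "B \<ge> 0" by (simp add: B_def)
    ultimately show ?case by blast
  qed
qed

text \<open>Fatou's lemma, with the lower limit replaced by a limit almost everywhere.\<close>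

lemma nn_integral_liminf_bound:
  fixes u :: "nat \<Rightarrow> 'a \<Rightarrow> real"
  assumes m: "\<And>k. u k \<in> borel_measurable M" and lim: "AE x in M. (\<lambda>k. u k x) \<longlonglongrightarrow> v x"
    and le: "\<And>k. (\<integral>\<^sup>+x. ennreal (u k x) \<partial>M) \<le> C"
  shows "(\<integral>\<^sup>+x. ennreal (v x) \<partial>M) \<le> C"
proof -
  have "(\<integral>\<^sup>+x. ennreal (v x) \<partial>M) = (\<integral>\<^sup>+x. liminf (\<lambda>k. ennreal (u k x)) \<partial>M)"
  proof (rule nn_integral_cong_AE)
    show "AE x in M. ennreal (v x) = liminf (\<lambda>k. ennreal (u k x))"
      using lim
    proof eventually_elim
      case (elim x)
      then have "(\<lambda>k. ennreal (u k x)) \<longlonglongrightarrow> ennreal (v x)" by (intro tendsto_intros)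
      from lim_imp_Liminf[OF trivial_limit_sequentially this] show ?case by (rule sym)
    qed
  qed
  also have "\<dots> \<le> liminf (\<lambda>k. \<integral>\<^sup>+x. ennreal (u k x) \<partial>M)"
    by (rule nn_integral_liminf) (use m in measurable)
  also have "\<dots> \<le> C"
    by (rule order_trans[OF Liminf_le_Limsup[OF trivial_limit_sequentially] Limsup_bounded])
       (intro always_eventually allI le)
  finally show ?thesis .
qed

lemma L2_nn_integral: "f \<in> L2 M \<Longrightarrow> (\<integral>\<^sup>+x. ennreal ((norm (f x))\<^sup>2) \<partial>M) = ennreal ((L2_norm M f)\<^sup>2)"
  unfolding L2_norm_sq by (rule nn_integral_eq_integral[OF L2_integrable]) auto

lemma L2_I:
  assumes "f \<in> borel_measurable M" "(\<integral>\<^sup>+x. ennreal ((norm (f x))\<^sup>2) \<partial>M) < \<infinity>"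
  shows "f \<in> L2 M"
proof -
  have "(\<lambda>x. (norm (f x))\<^sup>2) \<in> borel_measurable M" using assms(1) by measurable
  then have "integrable M (\<lambda>x. (norm (f x))\<^sup>2)" using assms(2) by (intro integrableI_nonneg) auto
  then show ?thesis using assms(1) by (simp add: L2_def)
qed

lemma summable_root_geometric: "summable (\<lambda>k. c * sqrt (1 / 2) ^ k)"
  by (intro summable_mult summable_geometric) (simp add: real_sqrt_lt_1_iff)

text \<open>Riesz-Fischer for geometrically small increments: by \<open>AE_geometric\<close> the
  sequence converges almost everywhere, and Fatou's lemma applied to f k - f (k + n) as n grows
  gives convergence in norm.\<close>

theorem L2_complete_geometric:
  assumes f: "\<And>k. f k \<in> L2 M" and C: "C \<ge> 0" and le: "\<And>k. L2_norm M (\<lambda>x. f (Suc k) x - f k x) \<le> C * (1 / 2) ^ k"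
  obtains g where "g \<in> L2 M" "(\<lambda>k. L2_norm M (\<lambda>x. f k x - g x)) \<longlonglongrightarrow> 0"
proof -
  define \<Delta> where "\<Delta> k x = f (Suc k) x - f k x" for k x
  have \<Delta>: "\<Delta> k \<in> L2 M" for k unfolding \<Delta>_def by (rule L2_diff[OF f f])
  have fm: "f k \<in> borel_measurable M" for k by (rule L2_measurable[OF f])
  have "AE x in M. \<exists>B\<ge>0. \<forall>k. (norm (\<Delta> k x))\<^sup>2 \<le> B * (1 / 2) ^ k"
  proof (rule AE_geometric[where C="C\<^sup>2"])
    show "(\<lambda>x. (norm (\<Delta> k x))\<^sup>2) \<in> borel_measurable M" for k using L2_integrable[OF \<Delta>] by blast
    fix k
    have "(L2_norm M (\<Delta> k))\<^sup>2 \<le> (C * (1 / 2) ^ k)\<^sup>2"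
      using le[of k] L2_norm_nonneg[of M "\<Delta> k"] by (intro power_mono) (simp_all add: \<Delta>_def[abs_def])
    also have "\<dots> = C\<^sup>2 * (1 / 2) ^ k * (1 / 2) ^ k" by (simp add: power2_eq_square)
    finally show "(\<integral>\<^sup>+x. ennreal ((norm (\<Delta> k x))\<^sup>2) \<partial>M) \<le> ennreal (C\<^sup>2 * (1 / 2) ^ k * (1 / 2) ^ k)"
      unfolding L2_nn_integral[OF \<Delta>] by (rule ennreal_leI)
  qed auto
  then have AEc: "AE x in M. convergent (\<lambda>k. f k x)"
  proof eventually_elim
    case (elim x)
    then obtain B where B: "B \<ge> 0" "\<And>k. (norm (\<Delta> k x))\<^sup>2 \<le> B * (1 / 2) ^ k" by blast
    \<comment> \<open>The squares decay like (1/2)^k, the increments themselves only like sqrt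
      (1/2)^k, which is still summable.\<close>
    have "norm (\<Delta> k x) \<le> sqrt B * sqrt (1 / 2) ^ k" for k
      using real_sqrt_le_mono[OF B(2)[of k]] by (simp add: real_sqrt_mult real_sqrt_power)
    then have "summable (\<lambda>k. \<Delta> k x)"
      by (intro summable_comparison_test'[OF summable_root_geometric[of "sqrt B"], of 0]) auto
    then have "convergent (\<lambda>n. \<Sum>k<n. \<Delta> k x)" by (simp add: summable_iff_convergent)
    moreover have "(\<Sum>k<n. \<Delta> k x) = f n x - f 0 x" for n by (induction n) (auto simp: \<Delta>_def)
    ultimately have "convergent (\<lambda>n. f n x - f 0 x)" by simp
    then show ?case using convergent_add[OF _ convergent_const[of "f 0 x"]] by fastforce
  qed
  define g where "g x = lim (\<lambda>k. f k x)" for x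
  have gm: "g \<in> borel_measurable M" unfolding g_def by (rule borel_measurable_lim_metric[OF fm])
  have lim: "AE x in M. (\<lambda>k. f k x) \<longlonglongrightarrow> g x"
    using AEc by eventually_elim (simp add: g_def convergent_LIMSEQ_iff)
  have cauchy: "L2_norm M (\<lambda>x. f k x - f (k + n) x) \<le> 2 * C * (1 / 2) ^ k" for k n
  proof -
    \<comment> \<open>2 - 2 (1/2)^n is the sum of the first n terms of the geometric series, in a
      form suited to induction.\<close>
    have "L2_norm M (\<lambda>x. f k x - f (k + n) x) \<le> C * (1 / 2) ^ k * (2 - 2 * (1 / 2) ^ n)"
    proof (induction n)
      case 0 then show ?case by (simp add: L2_norm_def)
    next
      case (Suc n)
      have "L2_norm M (\<lambda>x. f k x - f (k + Suc n) x) = L2_norm M (\<lambda>x. (f k x - f (k + n) x) + (-1) * \<Delta> (k + n) x)"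
        by (simp add: \<Delta>_def)
      also have "\<dots> \<le> L2_norm M (\<lambda>x. f k x - f (k + n) x) + L2_norm M (\<Delta> (k + n))"
        using L2_norm_triangle[OF L2_diff[OF f f] L2_cmult[OF \<Delta>], of k "k + n" "-1" "k + n"] unfolding L2_norm_cmult by simp
      also have "\<dots> \<le> C * (1 / 2) ^ k * (2 - 2 * (1 / 2) ^ n) + C * (1 / 2) ^ (k + n)"
        using Suc le[of "k + n"] by (intro add_mono) (simp_all add: \<Delta>_def[abs_def])
      also have "\<dots> = C * (1 / 2) ^ k * (2 - 2 * (1 / 2) ^ Suc n)" by (simp add: power_add algebra_simps)
      finally show ?case .
    qed
    also have "\<dots> \<le> C * (1 / 2) ^ k * 2" using C by (intro mult_left_mono) auto
    finally show ?thesis by simp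
  qed
  have bound: "(\<integral>\<^sup>+x. ennreal ((norm (f k x - g x))\<^sup>2) \<partial>M) \<le> ennreal ((2 * C * (1 / 2) ^ k)\<^sup>2)" for k
  proof (rule nn_integral_liminf_bound)
    show "(\<lambda>x. (norm (f k x - f (k + n) x))\<^sup>2) \<in> borel_measurable M" for n using fm by measurable
    show "AE x in M. (\<lambda>n. (norm (f k x - f (k + n) x))\<^sup>2) \<longlonglongrightarrow> (norm (f k x - g x))\<^sup>2"
      using lim
    proof eventually_elim
      case (elim x)
      have "(\<lambda>n. f (k + n) x) \<longlonglongrightarrow> g x" using LIMSEQ_ignore_initial_segment[OF elim, of k] by (simp add: add.commute)
      then show ?case by (intro tendsto_intros)
    qed
    show "(\<integral>\<^sup>+x. ennreal ((norm (f k x - f (k + n) x))\<^sup>2) \<partial>M) \<le> ennreal ((2 * C * (1 / 2) ^ k)\<^sup>2)" for n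
      unfolding L2_nn_integral[OF L2_diff[OF f f]] by (intro ennreal_leI power_mono cauchy L2_norm_nonneg)
  qed
  have d2: "(\<lambda>x. f k x - g x) \<in> L2 M" for k
    by (rule L2_I) (use fm gm le_less_trans[OF bound ennreal_less_top] in auto)
  have "g \<in> L2 M" using L2_diff[OF f d2, of 0 0] by simp
  moreover have "(\<lambda>k. L2_norm M (\<lambda>x. f k x - g x)) \<longlonglongrightarrow> 0"
  proof (rule Lim_null_comparison)
    have "L2_norm M (\<lambda>x. f k x - g x) \<le> 2 * C * (1 / 2) ^ k" for k
    proof (rule power2_le_imp_le)
      show "(L2_norm M (\<lambda>x. f k x - g x))\<^sup>2 \<le> (2 * C * (1 / 2) ^ k)\<^sup>2"
        using bound[of k] unfolding L2_nn_integral[OF d2] by (subst (asm) ennreal_le_iff) auto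
    qed (use C in simp)
    then show "\<forall>\<^sub>F k in sequentially. norm (L2_norm M (\<lambda>x. f k x - g x)) \<le> 2 * C * (1 / 2) ^ k"
      using L2_norm_nonneg by (intro always_eventually) simp
    have "(\<lambda>k. (2 * C) * (1 / 2 :: real) ^ k) \<longlonglongrightarrow> (2 * C) * 0" by (intro tendsto_intros) auto
    then show "(\<lambda>k. 2 * C * (1 / 2) ^ k) \<longlonglongrightarrow> 0" by simp
  qed
  ultimately show thesis by (rule that)
qed

section \<open>Limits of norms and of integrals of squares\<close>

lemma L2_norm_diff_triangle:
  assumes "f \<in> L2 M" "g \<in> L2 M" "h \<in> L2 M"
  shows "L2_norm M (\<lambda>x. f x - h x) \<le> L2_norm M (\<lambda>x. f x - g x) + L2_norm M (\<lambda>x. g x - h x)"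
  using L2_norm_triangle[OF L2_diff[OF assms(1,2)] L2_diff[OF assms(2,3)]] by simp

lemma L2_norm_diff_commute: "L2_norm M (\<lambda>x. f x - g x) = L2_norm M (\<lambda>x. g x - f x)"
  by (simp add: L2_norm_def norm_minus_commute)

lemma L2_norm_minus_le:
  assumes "f \<in> L2 M" "g \<in> L2 M"
  shows "\<bar>L2_norm M f - L2_norm M g\<bar> \<le> L2_norm M (\<lambda>x. f x - g x)"
  using L2_norm_triangle[OF L2_diff[OF assms] assms(2)] L2_norm_triangle[OF L2_diff[OF assms(2,1)] assms(1)]
    L2_norm_diff_commute[of M f g] by simp

lemma L2_norm_diff_tendsto:
  assumes h: "\<And>k. h k \<in> L2 M" "g \<in> L2 M" "c \<in> L2 M" and lim: "(\<lambda>k. L2_norm M (\<lambda>x. h k x - g x)) \<longlonglongrightarrow> 0"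
  shows "(\<lambda>k. L2_norm M (\<lambda>x. h k x - c x)) \<longlonglongrightarrow> L2_norm M (\<lambda>x. g x - c x)"
proof (rule LIM_zero_cancel, rule Lim_null_comparison[OF _ lim], rule always_eventually, rule allI)
  fix k
  show "norm (L2_norm M (\<lambda>x. h k x - c x) - L2_norm M (\<lambda>x. g x - c x)) \<le> L2_norm M (\<lambda>x. h k x - g x)"
    using L2_norm_minus_le[OF L2_diff[OF h(1,3)] L2_diff[OF h(2,3)]] by simp
qed

lemma zero_L2: "(\<lambda>x. 0) \<in> L2 M"
  by (simp add: L2_def)

lemma L2_norm_tendsto:
  assumes "\<And>k. h k \<in> L2 M" "g \<in> L2 M" "(\<lambda>k. L2_norm M (\<lambda>x. h k x - g x)) \<longlonglongrightarrow> 0"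
  shows "(\<lambda>k. L2_norm M (h k)) \<longlonglongrightarrow> L2_norm M g"
  using L2_norm_diff_tendsto[OF assms(1,2) zero_L2 assms(3)] by simp

lemma square_sum_le_weighted:
  fixes x y z e :: real
  assumes "e > 0" "0 \<le> x" "x \<le> y + z"
  shows "x\<^sup>2 \<le> (1 + e) * y\<^sup>2 + (1 + 1 / e) * z\<^sup>2"
proof -
  have "0 \<le> (e * y - z)\<^sup>2 / e" using assms(1) by simp
  also have "\<dots> = e * y\<^sup>2 - 2 * y * z + z\<^sup>2 / e" using assms(1) by (simp add: power2_eq_square field_simps)
  finally have "2 * y * z \<le> e * y\<^sup>2 + z\<^sup>2 / e" by simp
  moreover have "x\<^sup>2 \<le> (y + z)\<^sup>2" using assms by (intro power_mono)
  ultimately show ?thesis by (simp add: power2_eq_square algebra_simps)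
qed

text \<open>
  The function \<open>Z\<close> need not be measurable, so that additivity of the integral is applied to a
  measurable minorant of \<open>Z\<^sup>2\<close>.
\<close>

lemma nn_integral_square_le_weighted:
  fixes X Y Z :: "'a \<Rightarrow> real"
  assumes m: "X \<in> borel_measurable M" "Y \<in> borel_measurable M" and X0: "\<And>x. 0 \<le> X x"
    and le: "AE x in M. X x \<le> Y x + Z x" and e: "e > 0"
  shows "(\<integral>\<^sup>+x. ennreal ((X x)\<^sup>2) \<partial>M) \<le> ennreal (1 + e) * (\<integral>\<^sup>+x. ennreal ((Y x)\<^sup>2) \<partial>M) + ennreal (1 + 1 / e) * (\<integral>\<^sup>+x. ennreal ((Z x)\<^sup>2) \<partial>M)"
proof -
  \<comment> \<open>The least nonnegative solution of X^2 \<le> (1 + e) Y^2 + (1 + 1/e) U: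
    measurable along with X and Y, and below Z^2.\<close>
  define U where "U x = max 0 (((X x)\<^sup>2 - (1 + e) * (Y x)\<^sup>2) / (1 + 1 / e))" for x
  have Um: "U \<in> borel_measurable M" unfolding U_def using m by measurable
  have e1: "1 + 1 / e > 0" using e by (simp add: add_pos_pos)
  have "AE x in M. U x \<le> (Z x)\<^sup>2"
    using le
  proof eventually_elim
    case (elim x)
    have "(X x)\<^sup>2 \<le> (1 + e) * (Y x)\<^sup>2 + (1 + 1 / e) * (Z x)\<^sup>2" by (rule square_sum_le_weighted[OF e X0 elim])
    then have "((X x)\<^sup>2 - (1 + e) * (Y x)\<^sup>2) / (1 + 1 / e) \<le> (Z x)\<^sup>2"
      by (subst pos_divide_le_eq[OF e1]) (simp add: mult.commute)
    then show ?case by (simp add: U_def)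
  qed
  then have UZ: "(\<integral>\<^sup>+x. ennreal (U x) \<partial>M) \<le> (\<integral>\<^sup>+x. ennreal ((Z x)\<^sup>2) \<partial>M)"
    by (intro nn_integral_mono_AE) (auto elim!: eventually_mono intro: ennreal_leI)
  have "(\<integral>\<^sup>+x. ennreal ((X x)\<^sup>2) \<partial>M) \<le> (\<integral>\<^sup>+x. ennreal (1 + e) * ennreal ((Y x)\<^sup>2) + ennreal (1 + 1 / e) * ennreal (U x) \<partial>M)"
  proof (rule nn_integral_mono)
    fix x
    have "((X x)\<^sup>2 - (1 + e) * (Y x)\<^sup>2) / (1 + 1 / e) \<le> U x" by (simp add: U_def)
    then have "(X x)\<^sup>2 - (1 + e) * (Y x)\<^sup>2 \<le> U x * (1 + 1 / e)" by (subst (asm) pos_divide_le_eq[OF e1])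
    then have "(X x)\<^sup>2 \<le> (1 + e) * (Y x)\<^sup>2 + (1 + 1 / e) * U x" by (simp add: mult.commute)
    then have "ennreal ((X x)\<^sup>2) \<le> ennreal ((1 + e) * (Y x)\<^sup>2 + (1 + 1 / e) * U x)" by (rule ennreal_leI)
    also have "\<dots> = ennreal ((1 + e) * (Y x)\<^sup>2) + ennreal ((1 + 1 / e) * U x)"
    proof (rule ennreal_plus)
      show "0 \<le> (1 + 1 / e) * U x" using e1 by (intro mult_nonneg_nonneg) (simp_all add: U_def)
      show "0 \<le> (1 + e) * (Y x)\<^sup>2" using e by simp
    qed
    also have "\<dots> = ennreal (1 + e) * ennreal ((Y x)\<^sup>2) + ennreal (1 + 1 / e) * ennreal (U x)"
      using e e1 by (simp only: ennreal_mult' less_imp_le add_nonneg_nonneg zero_le_one)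
    finally show "ennreal ((X x)\<^sup>2) \<le> ennreal (1 + e) * ennreal ((Y x)\<^sup>2) + ennreal (1 + 1 / e) * ennreal (U x)" .
  qed
  also have "\<dots> = (\<integral>\<^sup>+x. ennreal (1 + e) * ennreal ((Y x)\<^sup>2) \<partial>M) + (\<integral>\<^sup>+x. ennreal (1 + 1 / e) * ennreal (U x) \<partial>M)"
    by (rule nn_integral_add) (use m Um in measurable)
  also have "(\<integral>\<^sup>+x. ennreal (1 + e) * ennreal ((Y x)\<^sup>2) \<partial>M) = ennreal (1 + e) * (\<integral>\<^sup>+x. ennreal ((Y x)\<^sup>2) \<partial>M)"
    by (rule nn_integral_cmult) (use m in measurable)
  also have "(\<integral>\<^sup>+x. ennreal (1 + 1 / e) * ennreal (U x) \<partial>M) = ennreal (1 + 1 / e) * (\<integral>\<^sup>+x. ennreal (U x) \<partial>M)"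
    by (rule nn_integral_cmult) (use Um in measurable)
  also have "\<dots> \<le> ennreal (1 + 1 / e) * (\<integral>\<^sup>+x. ennreal ((Z x)\<^sup>2) \<partial>M)"
    by (intro mult_left_mono UZ) simp
  finally show ?thesis by (simp add: add_left_mono)
qed

lemma ennreal_le_of_le_scaled:
  fixes u v :: ennreal
  assumes "\<And>e. e > 0 \<Longrightarrow> u \<le> ennreal (1 + e) * v"
  shows "u \<le> v"
proof (rule ennreal_le_epsilon)
  fix e :: real
  assume v: "v < top" and e: "e > 0"
  then obtain r where r: "v = ennreal r" "r \<ge> 0" by (cases v rule: ennreal_cases) auto
  define d where "d = e / (r + 1)"
  have d: "d > 0" "d * r \<le> e" using e r(2) by (auto simp: d_def field_simps)
  have "u \<le> ennreal (1 + d) * v" by (rule assms[OF d(1)])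
  also have "\<dots> = ennreal ((1 + d) * r)" using d(1) r by (simp add: ennreal_mult)
  also have "\<dots> \<le> ennreal (r + e)" using d(2) by (intro ennreal_leI) (simp add: algebra_simps)
  also have "\<dots> = v + ennreal e" using r e by simp
  finally show "u \<le> v + ennreal e" .
qed

text \<open>The inequality (y + z)^2 \<le> (1 + e) y^2 + (1 + 1/e) z^2 takes the place of
  Minkowski's and tolerates an error \<open>Z\<close> of unknown measurability. For fixed e the
  error term vanishes as n grows; then e tends to 0.\<close>

lemma nn_integral_square_limit:
  fixes X :: "'a \<Rightarrow> real" and Y Z :: "nat \<Rightarrow> 'a \<Rightarrow> real"
  assumes m: "X \<in> borel_measurable M" "\<And>n. Y n \<in> borel_measurable M"
    and nonneg: "\<And>x. 0 \<le> X x" "\<And>n x. 0 \<le> Y n x"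
    and le: "\<And>n. AE x in M. X x \<le> Y n x + Z n x" "\<And>n. AE x in M. Y n x \<le> X x + Z n x"
    and Z: "(\<lambda>n. \<integral>\<^sup>+x. ennreal ((Z n x)\<^sup>2) \<partial>M) \<longlonglongrightarrow> 0"
    and Y: "(\<lambda>n. \<integral>\<^sup>+x. ennreal ((Y n x)\<^sup>2) \<partial>M) \<longlonglongrightarrow> L"
  shows "(\<integral>\<^sup>+x. ennreal ((X x)\<^sup>2) \<partial>M) = L"
proof (rule antisym)
  have Ze: "(\<lambda>n. ennreal (1 + 1 / e) * (\<integral>\<^sup>+x. ennreal ((Z n x)\<^sup>2) \<partial>M)) \<longlonglongrightarrow> 0" for e
    using ennreal_tendsto_cmult[OF ennreal_less_top Z] by simp
  show "(\<integral>\<^sup>+x. ennreal ((X x)\<^sup>2) \<partial>M) \<le> L"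
  proof (rule ennreal_le_of_le_scaled)
    fix e :: real
    assume e: "e > 0"
    have "(\<lambda>n. ennreal (1 + e) * (\<integral>\<^sup>+x. ennreal ((Y n x)\<^sup>2) \<partial>M) + ennreal (1 + 1 / e) * (\<integral>\<^sup>+x. ennreal ((Z n x)\<^sup>2) \<partial>M)) \<longlonglongrightarrow> ennreal (1 + e) * L + 0"
      by (intro tendsto_add ennreal_tendsto_cmult[OF ennreal_less_top Y] Ze)
    then have "(\<integral>\<^sup>+x. ennreal ((X x)\<^sup>2) \<partial>M) \<le> ennreal (1 + e) * L + 0"
      by (rule LIMSEQ_le_const) (use nn_integral_square_le_weighted[OF m nonneg(1) le(1) e] in blast)
    then show "(\<integral>\<^sup>+x. ennreal ((X x)\<^sup>2) \<partial>M) \<le> ennreal (1 + e) * L" by simp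
  qed
  show "L \<le> (\<integral>\<^sup>+x. ennreal ((X x)\<^sup>2) \<partial>M)"
  proof (rule ennreal_le_of_le_scaled)
    fix e :: real
    assume e: "e > 0"
    have "(\<lambda>n. ennreal (1 + e) * (\<integral>\<^sup>+x. ennreal ((X x)\<^sup>2) \<partial>M) + ennreal (1 + 1 / e) * (\<integral>\<^sup>+x. ennreal ((Z n x)\<^sup>2) \<partial>M)) \<longlonglongrightarrow> ennreal (1 + e) * (\<integral>\<^sup>+x. ennreal ((X x)\<^sup>2) \<partial>M) + 0"
      by (intro tendsto_add tendsto_const Ze)
    from LIMSEQ_le[OF Y this] show "L \<le> ennreal (1 + e) * (\<integral>\<^sup>+x. ennreal ((X x)\<^sup>2) \<partial>M)"
      using nn_integral_square_le_weighted[OF m(2) m(1) nonneg(2) le(2) e] by auto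
  qed
qed

section \<open>The Gelfand transform\<close>

context hill begin

abbreviation "TM \<equiv> lebesgue_on {-pi..pi}"
abbreviation "LM \<equiv> line_measure w"

definition shifted :: "(real \<Rightarrow> complex) \<Rightarrow> int \<Rightarrow> real \<Rightarrow> complex" where
  "shifted f n x = f (x + of_int n * a)"

lemma line_L2:
  assumes "f \<in> L2 LM"
  shows "f \<in> borel_measurable lebesgue" "(\<lambda>x. \<bar>w x\<bar> * (norm (f x))\<^sup>2) absolutely_integrable_on UNIV"
    "(L2_norm LM f)\<^sup>2 = integral UNIV (\<lambda>x. \<bar>w x\<bar> * (norm (f x))\<^sup>2)"
proof -
  show fm: "f \<in> borel_measurable lebesgue" using assms by (simp add: L2_def line_measure_def)
  have m: "(\<lambda>x. (norm (f x))\<^sup>2) \<in> borel_measurable lebesgue" using fm by measurable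
  have "integrable lebesgue (\<lambda>x. \<bar>w x\<bar> *\<^sub>R (norm (f x))\<^sup>2)"
    using L2_integrable[OF assms] unfolding line_measure_def using m w_meas by (subst (asm) integrable_density) auto
  then show i: "(\<lambda>x. \<bar>w x\<bar> * (norm (f x))\<^sup>2) absolutely_integrable_on UNIV" by (simp add: set_integrable_def)
  have "(L2_norm LM f)\<^sup>2 = integral\<^sup>L lebesgue (\<lambda>x. \<bar>w x\<bar> *\<^sub>R (norm (f x))\<^sup>2)"
    unfolding L2_norm_sq line_measure_def using m w_meas by (subst integral_density) auto
  also have "\<dots> = integral UNIV (\<lambda>x. \<bar>w x\<bar> * (norm (f x))\<^sup>2)"
    using set_lebesgue_integral_eq_integral(2)[OF i] by (simp add: set_lebesgue_integral_def)
  finally show "(L2_norm LM f)\<^sup>2 = integral UNIV (\<lambda>x. \<bar>w x\<bar> * (norm (f x))\<^sup>2)" .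
qed

lemma w_per_int: "w (x + of_int n * a) = w x"
proof -
  have 1: "w (x + real k * a) = w x" for k x
  proof (induction k arbitrary: x)
    case (Suc k)
    have "w (x + real (Suc k) * a) = w ((x + real k * a) + a)" by (simp add: algebra_simps)
    then show ?case using Suc w_per by simp
  qed simp
  show ?thesis
  proof (cases "n \<ge> 0")
    case True then show ?thesis using 1[of x "nat n"] by simp
  next
    case False
    then have "w x = w ((x + of_int n * a) + real (nat (- n)) * a)" by simp
    then show ?thesis using 1[of "x + of_int n * a" "nat (- n)"] by simp
  qed
qed

lemma shifted_L2:
  assumes f: "f \<in> L2 LM"
  shows "shifted f n \<in> L2 PM" "(L2_norm PM (shifted f n))\<^sup>2 = integral {of_int n * a..of_int n * a + a} (\<lambda>x. \<bar>w x\<bar> * (norm (f x))\<^sup>2)"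
proof -
  let ?G = "\<lambda>x. \<bar>w x\<bar> * (norm (f x))\<^sup>2"
  have "(\<lambda>x. of_int n * a + (\<Sum>j\<in>Basis. (1 * (x \<bullet> j)) *\<^sub>R j)) \<in> lebesgue \<rightarrow>\<^sub>M (lebesgue :: real measure)"
    by (rule lebesgue_affine_measurable) auto
  then have "(\<lambda>x. x + of_int n * a) \<in> lebesgue \<rightarrow>\<^sub>M (lebesgue :: real measure)" by (simp add: add.commute)
  from measurable_compose[OF this line_L2(1)[OF f]] have "shifted f n \<in> borel_measurable lebesgue" by (simp add: shifted_def[abs_def])
  then have m: "shifted f n \<in> borel_measurable LA" by (rule measurable_restrict_space1)
  then have m2: "(\<lambda>x. (norm (shifted f n x))\<^sup>2) \<in> borel_measurable LA" by measurable
  have eq: "(\<lambda>x. \<bar>w x\<bar> *\<^sub>R (norm (shifted f n x))\<^sup>2) = (\<lambda>x. ?G (x + of_int n * a))"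
    by (simp add: shifted_def w_per_int)
  have "?G absolutely_integrable_on {of_int n * a..of_int n * a + a}"
    by (rule set_integrable_subset[OF line_L2(2)[OF f]]) auto
  from absolutely_integrable_shift[OF this, of "of_int n * a"]
  have "(\<lambda>x. \<bar>w x\<bar> *\<^sub>R (norm (shifted f n x))\<^sup>2) absolutely_integrable_on {0..a}" unfolding eq by simp
  then have I: "integrable PM (\<lambda>x. (norm (shifted f n x))\<^sup>2)" using PM_integrable_iff[OF m2] by simp
  then show "shifted f n \<in> L2 PM" using m by (simp add: L2_def)
  have "(L2_norm PM (shifted f n))\<^sup>2 = integral {0..a} (\<lambda>x. ?G (x + of_int n * a))"
    unfolding L2_norm_sq PM_integral[OF m2 I] eq ..
  also have "\<dots> = integral {of_int n * a..of_int n * a + a} ?G"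
    using integral_shift_real_ivl[of "of_int n * a" "of_int n * a" "of_int n * a + a" ?G] by simp
  finally show "(L2_norm PM (shifted f n))\<^sup>2 = integral {of_int n * a..of_int n * a + a} ?G" .
qed

text \<open>The translates of one period tile the line and w is periodic, so the sum over |n| \<le>
  N is the integral over [-N a, (N + 1) a].\<close>

lemma shifted_sums:
  assumes f: "f \<in> L2 LM"
  shows "(\<Sum>n\<in>{- int N..int N}. (L2_norm PM (shifted f n))\<^sup>2) \<le> (L2_norm LM f)\<^sup>2"
    "(\<lambda>N. \<Sum>n\<in>{- int N..int N}. (L2_norm PM (shifted f n))\<^sup>2) \<longlonglongrightarrow> (L2_norm LM f)\<^sup>2"
proof -
  let ?G = "\<lambda>x. \<bar>w x\<bar> * (norm (f x))\<^sup>2"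
  have Gi: "?G integrable_on {c..d}" for c d
    using set_integrable_subset[OF line_L2(2)[OF f], of "{c..d}"] by (auto simp: absolutely_integrable_on_def)
  have GU: "?G integrable_on UNIV" using line_L2(2)[OF f] by (simp add: absolutely_integrable_on_def)
  have eq: "(\<Sum>n\<in>{- int N..int N}. (L2_norm PM (shifted f n))\<^sup>2) = integral {- real N * a..real N * a + a} ?G" for N
  proof (induction N)
    case 0 then show ?case using shifted_L2(2)[OF f, of 0] by simp
  next
    case (Suc N)
    have set: "{- int (Suc N)..int (Suc N)} = insert (int (Suc N)) (insert (- int (Suc N)) {- int N..int N})" by auto
    let ?l = "- real (Suc N) * a" and ?m = "- real N * a" and ?r = "real N * a + a"
    have "(\<Sum>n\<in>{- int (Suc N)..int (Suc N)}. (L2_norm PM (shifted f n))\<^sup>2)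
        = (L2_norm PM (shifted f (int (Suc N))))\<^sup>2 + ((L2_norm PM (shifted f (- int (Suc N))))\<^sup>2 + integral {?m..?r} ?G)"
      unfolding set Suc[symmetric] by (subst sum.insert; simp)+
    also have "(L2_norm PM (shifted f (int (Suc N))))\<^sup>2 = integral {?r..?r + a} ?G"
      using shifted_L2(2)[OF f, of "int (Suc N)"] by (simp add: algebra_simps)
    also have "(L2_norm PM (shifted f (- int (Suc N))))\<^sup>2 = integral {?l..?m} ?G"
      using shifted_L2(2)[OF f, of "- int (Suc N)"] by (simp add: algebra_simps)
    also have "integral {?l..?m} ?G + integral {?m..?r} ?G = integral {?l..?r} ?G"
    proof (rule Henstock_Kurzweil_Integration.integral_combine[OF _ _ Gi])
      show "?l \<le> ?m" using a_pos by (simp add: algebra_simps)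
      have "0 \<le> real N * a" using a_pos by simp
      then show "?m \<le> ?r" using a_pos by simp
    qed
    also have "integral {?r..?r + a} ?G + integral {?l..?r} ?G = integral {?l..?r + a} ?G"
    proof -
      have "0 \<le> real N * a" "0 \<le> real (Suc N) * a" using a_pos by simp_all
      then have "?l \<le> ?r" "?r \<le> ?r + a" using a_pos by (simp_all only: mult_minus_left)
      then have "integral {?l..?r} ?G + integral {?r..?r + a} ?G = integral {?l..?r + a} ?G"
        by (rule Henstock_Kurzweil_Integration.integral_combine[OF _ _ Gi])
      then show ?thesis by simp
    qed
    also have "?r + a = real (Suc N) * a + a" by (simp add: algebra_simps)
    finally show ?case .
  qed
  show "(\<Sum>n\<in>{- int N..int N}. (L2_norm PM (shifted f n))\<^sup>2) \<le> (L2_norm LM f)\<^sup>2"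
    unfolding eq line_L2(3)[OF f] by (rule integral_subset_le[OF _ Gi GU]) auto
  let ?H = "\<lambda>N x. if x \<in> {- real N * a..real N * a + a} then ?G x else 0"
  have "(\<lambda>N. integral UNIV (?H N)) \<longlonglongrightarrow> integral UNIV ?G"
  proof (rule dominated_convergence(2)[OF _ GU])
    show "?H N integrable_on UNIV" for N using Gi by (simp only: integrable_restrict_UNIV)
    show "norm (?H N x) \<le> ?G x" for N x by auto
    show "(\<lambda>N. ?H N x) \<longlonglongrightarrow> ?G x" for x
    proof (rule tendsto_eventually)
      obtain N0 where N0: "\<bar>x\<bar> / a < real N0" using reals_Archimedean2 by blast
      have "x \<in> {- real N * a..real N * a + a}" if "N \<ge> N0" for N
      proof -
        have "\<bar>x\<bar> / a < real N" using N0 that by (meson less_le_trans of_nat_le_iff)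
        then have "\<bar>x\<bar> < real N * a" using a_pos by (simp add: field_simps)
        then show ?thesis using a_pos by auto
      qed
      then show "\<forall>\<^sub>F N in sequentially. ?H N x = ?G x" by (intro eventually_sequentiallyI[of N0]) (simp only: if_True)
    qed
  qed
  then show "(\<lambda>N. \<Sum>n\<in>{- int N..int N}. (L2_norm PM (shifted f n))\<^sup>2) \<longlonglongrightarrow> (L2_norm LM f)\<^sup>2"
    unfolding eq line_L2(3)[OF f] by (simp only: integral_restrict_UNIV)
qed

text \<open>Partial sum of the Gelfand transform over an arbitrary finite index set; differences of
  partial sums then have the same form.\<close>

definition trig :: "(real \<Rightarrow> complex) \<Rightarrow> int set \<Rightarrow> real \<Rightarrow> real \<Rightarrow> complex" where
  "trig f A t x = 1 / of_real (sqrt (2 * pi)) * (\<Sum>n\<in>A. exp (- \<i> * of_int n * of_real t) * shifted f n x)"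

lemma gelfand_trig: "gelfand_partial_sum a N f t = trig f {- int N..int N} t"
  by (simp add: fun_eq_iff gelfand_partial_sum_def trig_def shifted_def)

lemma L2_sum:
  assumes "finite A" "\<And>n. n \<in> A \<Longrightarrow> g n \<in> L2 M"
  shows "(\<lambda>x. \<Sum>n\<in>A. g n x) \<in> L2 M"
  using assms
proof (induction A rule: finite_induct)
  case empty show ?case by (simp add: L2_def)
next
  case (insert n A)
  then have "(\<lambda>x. g n x + (\<Sum>n\<in>A. g n x)) \<in> L2 M" by (intro L2_add) auto
  then show ?case using insert by simp
qed

lemma trig_L2: "f \<in> L2 LM \<Longrightarrow> finite A \<Longrightarrow> trig f A t \<in> L2 PM"
  unfolding trig_def by (intro L2_cmult L2_sum shifted_L2)

lemma trig_diff: "finite A \<Longrightarrow> B \<subseteq> A \<Longrightarrow> trig f A t x - trig f B t x = trig f (A - B) t x"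
  by (simp add: trig_def sum_diff right_diff_distrib)

text \<open>Expanding the square gives a trigonometric polynomial in t. It is continuous, hence
  measurable, and orthogonality of the exponentials evaluates its integral.\<close>

lemma trig_norm:
  assumes f: "f \<in> L2 LM" and A: "finite A"
  shows "complex_of_real ((L2_norm PM (trig f A t))\<^sup>2) =
    (\<Sum>n\<in>A. \<Sum>m\<in>A. L2_inner PM (shifted f n) (shifted f m) / of_real (2 * pi) * exp (\<i> * of_int (m - n) * of_real t))"
proof -
  have i: "integrable PM (\<lambda>x. shifted f n x * cnj (shifted f m x))" for n m by (rule L2_inner_integrable[OF shifted_L2(1)[OF f] shifted_L2(1)[OF f]])
  have s: "(1 / complex_of_real (sqrt (2 * pi))) * (1 / complex_of_real (sqrt (2 * pi))) = 1 / of_real (2 * pi)"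
    by (simp flip: of_real_mult)
  have "trig f A t x * cnj (trig f A t x) =
      (\<Sum>n\<in>A. \<Sum>m\<in>A. (shifted f n x * cnj (shifted f m x)) * (1 / of_real (2 * pi) * exp (\<i> * of_int (m - n) * of_real t)))" for x
  proof -
    have "trig f A t x * cnj (trig f A t x) = (1 / complex_of_real (sqrt (2 * pi))) * (1 / complex_of_real (sqrt (2 * pi))) *
       ((\<Sum>n\<in>A. exp (- \<i> * of_int n * of_real t) * shifted f n x) * (\<Sum>m\<in>A. exp (\<i> * of_int m * of_real t) * cnj (shifted f m x)))"
      by (simp add: trig_def exp_cnj algebra_simps)
    also have "\<dots> = (\<Sum>n\<in>A. \<Sum>m\<in>A. 1 / of_real (2 * pi) * (exp (- \<i> * of_int n * of_real t) * shifted f n x * (exp (\<i> * of_int m * of_real t) * cnj (shifted f m x))))"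
      unfolding s sum_product by (simp only: sum_distrib_left)
    also have "\<dots> = (\<Sum>n\<in>A. \<Sum>m\<in>A. (shifted f n x * cnj (shifted f m x)) * (1 / of_real (2 * pi) * exp (\<i> * of_int (m - n) * of_real t)))"
    proof (intro sum.cong refl)
      fix n m
      have e: "exp (\<i> * of_int (m - n) * of_real t) = exp (- \<i> * of_int n * of_real t) * exp (\<i> * of_int m * of_real t)"
        by (simp add: algebra_simps flip: exp_add)
      show "1 / of_real (2 * pi) * (exp (- \<i> * of_int n * of_real t) * shifted f n x * (exp (\<i> * of_int m * of_real t) * cnj (shifted f m x)))
         = (shifted f n x * cnj (shifted f m x)) * (1 / of_real (2 * pi) * exp (\<i> * of_int (m - n) * of_real t))"
        unfolding e by (simp only: ac_simps)
    qed
    finally show ?thesis .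
  qed
  then have "L2_inner PM (trig f A t) (trig f A t) =
      (\<integral>x. (\<Sum>n\<in>A. \<Sum>m\<in>A. (shifted f n x * cnj (shifted f m x)) * (1 / of_real (2 * pi) * exp (\<i> * of_int (m - n) * of_real t))) \<partial>PM)"
    unfolding L2_inner_def by simp
  also have "\<dots> = (\<Sum>n\<in>A. \<Sum>m\<in>A. (\<integral>x. (shifted f n x * cnj (shifted f m x)) * (1 / of_real (2 * pi) * exp (\<i> * of_int (m - n) * of_real t)) \<partial>PM))"
    using i by (subst Bochner_Integration.integral_sum; (intro Bochner_Integration.integrable_sum integrable_mult_left)?)
      (auto intro!: sum.cong Bochner_Integration.integral_sum integrable_mult_left)
  also have "\<dots> = (\<Sum>n\<in>A. \<Sum>m\<in>A. L2_inner PM (shifted f n) (shifted f m) / of_real (2 * pi) * exp (\<i> * of_int (m - n) * of_real t))"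
    unfolding L2_inner_def by (intro sum.cong refl) (simp only: integral_mult_left_zero, simp)
  finally show ?thesis by (simp only: L2_inner_self[OF trig_L2[OF f A]])
qed

lemma exp_orthogonal: "((\<lambda>t. exp (\<i> * of_int k * complex_of_real t)) has_integral (if k = 0 then of_real (2 * pi) else 0)) {-pi..pi}"
proof (cases "k = 0")
  case True
  have "((\<lambda>t. 1::complex) has_integral (measure lborel {-pi..pi} *\<^sub>R 1)) {-pi..pi}" by (rule has_integral_const_real)
  then show ?thesis using True by (simp add: scaleR_conv_of_real)
next
  case False
  define F where "F t = exp (\<i> * of_int k * complex_of_real t) / (\<i> * of_int k)" for t
  have "((\<lambda>t. exp (\<i> * of_int k * complex_of_real t)) has_integral (F pi - F (- pi))) {-pi..pi}"
  proof (rule fundamental_theorem_of_calculus)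
    fix t :: real
    have "((\<lambda>z. exp (\<i> * of_int k * z) / (\<i> * of_int k)) has_field_derivative exp (\<i> * of_int k * complex_of_real t)) (at (complex_of_real t))"
      using False by (auto intro!: derivative_eq_intros)
    from has_vector_derivative_real_field[OF this] show "(F has_vector_derivative exp (\<i> * of_int k * complex_of_real t)) (at t within {-pi..pi})"
      unfolding F_def .
  qed simp
  moreover have "exp (\<i> * of_int k * complex_of_real pi) = exp (\<i> * of_int k * complex_of_real (- pi))"
  proof -
    have "exp (\<i> * of_int k * complex_of_real pi) = exp (\<i> * of_int k * complex_of_real (- pi) + of_int k * (2 * of_real pi * \<i>))"
      by (simp add: algebra_simps)
    moreover have "exp (of_int k * (2 * complex_of_real pi * \<i>)) = 1"
      using exp_integer_2pi[of "of_int k"] by (simp add: algebra_simps)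
    ultimately show ?thesis by (simp only: exp_add mult_1_right)
  qed
  ultimately show ?thesis using False by (simp add: F_def)
qed

lemma trig_continuous:
  assumes "f \<in> L2 LM" "finite A"
  shows "continuous_on UNIV (\<lambda>t. (L2_norm PM (trig f A t))\<^sup>2)"
proof -
  have "continuous_on UNIV (\<lambda>t. Re (complex_of_real ((L2_norm PM (trig f A t))\<^sup>2)))"
    unfolding trig_norm[OF assms] by (intro continuous_intros)
  then show ?thesis by simp
qed

lemma trig_measurable:
  assumes "f \<in> L2 LM" "finite A"
  shows "(\<lambda>t. (L2_norm PM (trig f A t))\<^sup>2) \<in> borel_measurable TM"
  by (rule continuous_imp_measurable_on_sets_lebesgue[OF continuous_on_subset[OF trig_continuous[OF assms]]]) auto

lemma trig_parseval:
  assumes f: "f \<in> L2 LM" and A: "finite A"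
  shows "(\<integral>\<^sup>+t. ennreal ((L2_norm PM (trig f A t))\<^sup>2) \<partial>TM) = ennreal (\<Sum>n\<in>A. (L2_norm PM (shifted f n))\<^sup>2)"
proof -
  let ?IP = "\<lambda>n m. L2_inner PM (shifted f n) (shifted f m)"
  have "((\<lambda>t. complex_of_real ((L2_norm PM (trig f A t))\<^sup>2)) has_integral
     (\<Sum>n\<in>A. \<Sum>m\<in>A. ?IP n m / of_real (2 * pi) * (if m - n = 0 then of_real (2 * pi) else 0))) {-pi..pi}"
    unfolding trig_norm[OF f A] by (intro has_integral_sum A has_integral_mult_right exp_orthogonal)
  also have "(\<Sum>n\<in>A. \<Sum>m\<in>A. ?IP n m / of_real (2 * pi) * (if m - n = 0 then of_real (2 * pi) else 0)) = (\<Sum>n\<in>A. complex_of_real ((L2_norm PM (shifted f n))\<^sup>2))"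
  proof (rule sum.cong[OF refl])
    fix n assume n: "n \<in> A"
    have "(\<Sum>m\<in>A. ?IP n m / of_real (2 * pi) * (if m - n = 0 then of_real (2 * pi) else 0)) = (\<Sum>m\<in>A. if m = n then ?IP n n else 0)"
      by (intro sum.cong refl) auto
    also have "\<dots> = complex_of_real ((L2_norm PM (shifted f n))\<^sup>2)" using n A by (simp add: L2_inner_self[OF shifted_L2(1)[OF f]])
    finally show "(\<Sum>m\<in>A. ?IP n m / of_real (2 * pi) * (if m - n = 0 then of_real (2 * pi) else 0)) = complex_of_real ((L2_norm PM (shifted f n))\<^sup>2)" .
  qed
  finally have "((\<lambda>t. complex_of_real ((L2_norm PM (trig f A t))\<^sup>2)) has_integral (\<Sum>n\<in>A. complex_of_real ((L2_norm PM (shifted f n))\<^sup>2))) {-pi..pi}" .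
  from has_integral_Re[OF this] have "((\<lambda>t. (L2_norm PM (trig f A t))\<^sup>2) has_integral (\<Sum>n\<in>A. (L2_norm PM (shifted f n))\<^sup>2)) {-pi..pi}"
    by simp
  from nn_integral_has_integral_lebesgue[OF _ this] 
  show ?thesis
    by (subst nn_integral_restrict_space)
       (simp_all add: nn_integral_completion ennreal_mult' ennreal_indicator mult.commute)
qed

section \<open>Convergence of the partial sums of the Gelfand transform\<close>

definition tail :: "(real \<Rightarrow> complex) \<Rightarrow> nat \<Rightarrow> real" where
  "tail f N = (L2_norm LM f)\<^sup>2 - (\<Sum>n\<in>{- int N..int N}. (L2_norm PM (shifted f n))\<^sup>2)"

lemma tail: "f \<in> L2 LM \<Longrightarrow> tail f N \<ge> 0" "f \<in> L2 LM \<Longrightarrow> tail f \<longlonglongrightarrow> 0" "N \<le> M \<Longrightarrow> tail f M \<le> tail f N"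
proof -
  show "f \<in> L2 LM \<Longrightarrow> tail f N \<ge> 0" using shifted_sums(1) by (simp add: tail_def)
  assume f: "f \<in> L2 LM"
  have "(\<lambda>N. (L2_norm LM f)\<^sup>2 - (\<Sum>n\<in>{- int N..int N}. (L2_norm PM (shifted f n))\<^sup>2)) \<longlonglongrightarrow> (L2_norm LM f)\<^sup>2 - (L2_norm LM f)\<^sup>2"
    by (intro tendsto_intros shifted_sums(2)[OF f])
  then show "tail f \<longlonglongrightarrow> 0" by (simp add: tail_def[abs_def])
next
  assume "N \<le> M"
  then have "(\<Sum>n\<in>{- int N..int N}. (L2_norm PM (shifted f n))\<^sup>2) \<le> (\<Sum>n\<in>{- int M..int M}. (L2_norm PM (shifted f n))\<^sup>2)"
    by (intro sum_mono2) auto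
  then show "tail f M \<le> tail f N" by (simp add: tail_def)
qed

abbreviation "GS f N t \<equiv> gelfand_partial_sum a N f t"

lemma GS_diff:
  assumes f: "f \<in> L2 LM" and "N \<le> M"
  shows "(\<lambda>t. (L2_norm PM (\<lambda>x. GS f M t x - GS f N t x))\<^sup>2) \<in> borel_measurable TM"
    "(\<integral>\<^sup>+t. ennreal ((L2_norm PM (\<lambda>x. GS f M t x - GS f N t x))\<^sup>2) \<partial>TM) \<le> ennreal (tail f N)"
proof -
  let ?A = "{- int M..int M}" and ?B = "{- int N..int N}"
  have eq: "(\<lambda>x. GS f M t x - GS f N t x) = trig f (?A - ?B) t" for t
    unfolding gelfand_trig using \<open>N \<le> M\<close> by (intro ext trig_diff) auto
  show "(\<lambda>t. (L2_norm PM (\<lambda>x. GS f M t x - GS f N t x))\<^sup>2) \<in> borel_measurable TM"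
    unfolding eq by (rule trig_measurable[OF f]) simp
  have "(\<integral>\<^sup>+t. ennreal ((L2_norm PM (\<lambda>x. GS f M t x - GS f N t x))\<^sup>2) \<partial>TM) = ennreal (\<Sum>n\<in>?A - ?B. (L2_norm PM (shifted f n))\<^sup>2)"
    unfolding eq by (rule trig_parseval[OF f]) simp
  also have "(\<Sum>n\<in>?A - ?B. (L2_norm PM (shifted f n))\<^sup>2) = (\<Sum>n\<in>?A. (L2_norm PM (shifted f n))\<^sup>2) - (\<Sum>n\<in>?B. (L2_norm PM (shifted f n))\<^sup>2)"
    using \<open>N \<le> M\<close> by (intro sum_diff) auto
  also have "ennreal \<dots> \<le> ennreal (tail f N)" using shifted_sums(1)[OF f, of M] by (intro ennreal_leI) (simp add: tail_def)
  finally show "(\<integral>\<^sup>+t. ennreal ((L2_norm PM (\<lambda>x. GS f M t x - GS f N t x))\<^sup>2) \<partial>TM) \<le> ennreal (tail f N)" .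
qed

lemma GS_L2: "f \<in> L2 LM \<Longrightarrow> GS f N t \<in> L2 PM"
  unfolding gelfand_trig by (rule trig_L2) auto

text \<open>Continuity in t that is uniform lets a partial sum be approximated by sampling it on a
  grid, which yields the simple functions that strong measurability demands.\<close>

lemma GS_lipschitz:
  assumes f: "f \<in> L2 LM"
  obtains L where "L \<ge> 0" "\<forall>s t. L2_norm PM (\<lambda>x. GS f N s x - GS f N t x) \<le> L * \<bar>s - t\<bar>"
proof -
  have expl: "norm (exp (- \<i> * of_int n * of_real s) - exp (- \<i> * of_int n * complex_of_real t)) \<le> \<bar>of_int n\<bar> * \<bar>s - t\<bar>" for n s t
  proof -
    have "exp (- \<i> * of_int n * complex_of_real s) = cis (- of_int n * s)" "exp (- \<i> * of_int n * complex_of_real t) = cis (- of_int n * t)"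
      by (simp_all add: cis_conv_exp mult.assoc)
    moreover have "norm (cis u - cis v) \<le> \<bar>u - v\<bar>" for u v
    proof -
      have "cis u - cis v = cis v * (cis (u - v) - 1)" by (simp add: algebra_simps cis_mult)
      then have "norm (cis u - cis v) = norm (cis (u - v) - 1)" by (simp add: norm_mult)
      also have "\<dots> \<le> \<bar>u - v\<bar>" using dist_exp_i_1 [of "u - v"] abs_sin_x_le_abs_x[of "(u - v) / 2"] by (simp add: cis_conv_exp)
      finally show ?thesis .
    qed
    ultimately have "norm (exp (- \<i> * of_int n * of_real s) - exp (- \<i> * of_int n * complex_of_real t)) \<le> \<bar>- of_int n * s - - of_int n * t\<bar>"
      by (simp only:)
    also have "- of_int n * s - - of_int n * t = - of_int n * (s - t)" by (simp add: algebra_simps)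
    finally show ?thesis by (simp add: abs_mult)
  qed
  have sum: "L2_norm PM (\<lambda>x. \<Sum>n\<in>A. c n * shifted f n x) \<le> (\<Sum>n\<in>A. norm (c n) * L2_norm PM (shifted f n))" if "finite A" for A and c :: "int \<Rightarrow> complex"
    using that
  proof (induction A rule: finite_induct)
    case empty then show ?case by (simp add: L2_norm_def)
  next
    case (insert n A)
    have "L2_norm PM (\<lambda>x. c n * shifted f n x + (\<Sum>n\<in>A. c n * shifted f n x)) \<le> L2_norm PM (\<lambda>x. c n * shifted f n x) + L2_norm PM (\<lambda>x. \<Sum>n\<in>A. c n * shifted f n x)"
      by (intro L2_norm_triangle L2_cmult L2_sum shifted_L2 f insert)
    then show ?case using insert by (simp add: L2_norm_cmult)
  qed
  let ?A = "{- int N..int N}"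
  define L where "L = (\<Sum>n\<in>?A. \<bar>of_int n\<bar> * L2_norm PM (shifted f n)) / sqrt (2 * pi)"
  have "L2_norm PM (\<lambda>x. GS f N s x - GS f N t x) \<le> L * \<bar>s - t\<bar>" for s t
  proof -
    define c where "c n = exp (- \<i> * of_int n * of_real s) - exp (- \<i> * of_int n * complex_of_real t)" for n
    have "(\<lambda>x. GS f N s x - GS f N t x) = (\<lambda>x. 1 / of_real (sqrt (2 * pi)) * (\<Sum>n\<in>?A. c n * shifted f n x))"
      unfolding gelfand_trig trig_def c_def by (simp add: fun_eq_iff left_diff_distrib sum_subtractf right_diff_distrib)
    then have "L2_norm PM (\<lambda>x. GS f N s x - GS f N t x) = 1 / sqrt (2 * pi) * L2_norm PM (\<lambda>x. \<Sum>n\<in>?A. c n * shifted f n x)"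
      by (simp only: L2_norm_cmult) (simp add: norm_divide)
    also have "\<dots> \<le> 1 / sqrt (2 * pi) * (\<Sum>n\<in>?A. (\<bar>of_int n\<bar> * \<bar>s - t\<bar>) * L2_norm PM (shifted f n))"
    proof (intro mult_left_mono order_trans[OF sum] sum_mono mult_right_mono L2_norm_nonneg)
      show "norm (c n) \<le> \<bar>of_int n\<bar> * \<bar>s - t\<bar>" for n unfolding c_def by (rule expl)
    qed auto
    also have "(\<Sum>n\<in>?A. (\<bar>of_int n\<bar> * \<bar>s - t\<bar>) * L2_norm PM (shifted f n)) = (\<Sum>n\<in>?A. \<bar>of_int n\<bar> * L2_norm PM (shifted f n)) * \<bar>s - t\<bar>"
      unfolding sum_distrib_right by (intro sum.cong refl) (simp only: ac_simps)
    also have "1 / sqrt (2 * pi) * \<dots> = L * \<bar>s - t\<bar>" by (simp add: L_def)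
    finally show ?thesis .
  qed
  moreover have "L \<ge> 0" unfolding L_def by (intro divide_nonneg_nonneg sum_nonneg mult_nonneg_nonneg L2_norm_nonneg) auto
  ultimately show thesis using that by blast
qed

lemma GS_norm_measurable: "f \<in> L2 LM \<Longrightarrow> (\<lambda>t. L2_norm PM (GS f N t)) \<in> borel_measurable TM"
proof -
  assume f: "f \<in> L2 LM"
  have "(\<lambda>t. sqrt ((L2_norm PM (GS f N t))\<^sup>2)) \<in> borel_measurable TM"
    unfolding gelfand_trig using trig_measurable[OF f, of "{- int N..int N}"] by measurable
  then show ?thesis by (simp add: L2_norm_nonneg)
qed

lemma GS_norm_integral:
  "f \<in> L2 LM \<Longrightarrow> (\<integral>\<^sup>+t. ennreal ((L2_norm PM (GS f N t))\<^sup>2) \<partial>TM) = ennreal (\<Sum>n\<in>{- int N..int N}. (L2_norm PM (shifted f n))\<^sup>2)"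
  unfolding gelfand_trig by (rule trig_parseval) auto

lemma GS_simple_approximation:
  assumes f: "f \<in> L2 LM"
  obtains S where "simple_function TM S" "\<forall>t. S t \<in> L2 PM" "\<forall>t. L2_norm PM (\<lambda>x. S t x - GS f N t x) \<le> 1 / (real n + 1)"
proof -
  obtain L where L: "L \<ge> 0" "\<forall>s t. L2_norm PM (\<lambda>x. GS f N s x - GS f N t x) \<le> L * \<bar>s - t\<bar>"
    by (rule GS_lipschitz[OF f])
  \<comment> \<open>Grid points have distance 1 / m, so the sampling error is at most L / m \<le> 1
    / (n + 1); the summand 1 keeps \<open>m\<close> positive for L = 0.\<close>
  define m where "m = L * (real n + 1) + 1"
  have m: "m > 0" using L by (simp add: m_def add_nonneg_pos)
  define \<tau> where "\<tau> t = of_int \<lfloor>t * m\<rfloor> / m" for t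
  have \<tau>: "\<bar>\<tau> t - t\<bar> \<le> 1 / m" for t
  proof -
    have "\<bar>of_int \<lfloor>t * m\<rfloor> - t * m\<bar> \<le> 1" by linarith
    then have "\<bar>of_int \<lfloor>t * m\<rfloor> - t * m\<bar> / m \<le> 1 / m" using m by (intro divide_right_mono) auto
    moreover have "\<tau> t - t = (of_int \<lfloor>t * m\<rfloor> - t * m) / m" using m by (simp add: \<tau>_def field_simps)
    ultimately show ?thesis using m by (simp add: abs_div)
  qed
  have "simple_function TM \<tau>"
  proof (rule simple_function_borel_measurable)
    have "\<tau> \<in> borel_measurable lborel" unfolding \<tau>_def by measurable
    then have "\<tau> \<in> borel_measurable lebesgue" by (rule measurable_completion)
    then show "\<tau> \<in> borel_measurable TM" by (rule measurable_restrict_space1)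
    have "\<tau> ` space TM \<subseteq> (\<lambda>k. of_int k / m) ` {\<lfloor>- pi * m\<rfloor>..\<lfloor>pi * m\<rfloor>}"
    proof
      fix y assume "y \<in> \<tau> ` space TM"
      then obtain t where t: "- pi \<le> t" "t \<le> pi" "y = \<tau> t" by auto
      have "- pi * m \<le> t * m" "t * m \<le> pi * m" using t m by (simp_all only: mult_right_mono less_imp_le)
      then have "\<lfloor>t * m\<rfloor> \<in> {\<lfloor>- pi * m\<rfloor>..\<lfloor>pi * m\<rfloor>}" by (simp only: atLeastAtMost_iff floor_mono)
      then show "y \<in> (\<lambda>k. of_int k / m) ` {\<lfloor>- pi * m\<rfloor>..\<lfloor>pi * m\<rfloor>}" using t(3) by (auto simp: \<tau>_def)
    qed
    then show "finite (\<tau> ` space TM)" by (rule finite_subset) auto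
  qed
  then have "simple_function TM (\<lambda>t. GS f N (\<tau> t))" by (rule simple_function_compose1)
  moreover have "L2_norm PM (\<lambda>x. GS f N (\<tau> t) x - GS f N t x) \<le> 1 / (real n + 1)" for t
  proof -
    have "L2_norm PM (\<lambda>x. GS f N (\<tau> t) x - GS f N t x) \<le> L * \<bar>\<tau> t - t\<bar>" using L(2) by blast
    also have "\<dots> \<le> L * (1 / m)" by (intro mult_left_mono \<tau> L)
    also have "\<dots> \<le> 1 / (real n + 1)"
      using m by (simp add: divide_simps) (simp add: m_def algebra_simps)
    finally show ?thesis .
  qed
  moreover have "\<forall>t. GS f N (\<tau> t) \<in> L2 PM" using GS_L2[OF f] by blast
  ultimately show thesis using that by blast
qed

text \<open>
  The Gelfand transform is obtained from a subsequence of the partial sums which converges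
  almost everywhere; Fatou's lemma then yields the convergence of the whole sequence.
\<close>

lemma gelfand_exists:
  assumes f: "f \<in> L2 LM"
  shows "\<exists>F. F \<in> L2_fibres a w \<and> (\<lambda>N. \<integral>\<^sup>+t. ennreal ((L2_norm PM (\<lambda>x. GS f N t x - F t x))\<^sup>2) \<partial>TM) \<longlonglongrightarrow> 0"
proof -
  \<comment> \<open>The squared decay is what \<open>AE_geometric\<close> requires for r = 1/4; the
    norms of the increments then decay like (1/2)^k for almost every t.\<close>
  have "\<exists>N. tail f N \<le> (1 / 4) ^ k * (1 / 4) ^ k" for k
  proof -
    have "\<forall>\<^sub>F N in sequentially. tail f N < (1 / 4) ^ k * (1 / 4) ^ k"
      by (rule order_tendstoD(2)[OF tail(2)[OF f]]) simp
    then show ?thesis by (auto simp: eventually_sequentially intro: less_imp_le)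
  qed
  then obtain g0 where g0: "\<And>k. tail f (g0 k) \<le> (1 / 4) ^ k * (1 / 4) ^ k" by metis
  \<comment> \<open>Cumulative sums make the indices increasing and at least as large as both k and
    \<open>g0 k\<close>.\<close>
  define Nk where "Nk k = (\<Sum>j\<le>k. g0 j + 1)" for k
  have Nk_Suc: "Nk k \<le> Nk (Suc k)" for k by (simp add: Nk_def)
  have Nk_ge: "k \<le> Nk k" for k by (induction k) (auto simp: Nk_def)
  have g0_le: "g0 k \<le> Nk k" for k by (cases k) (auto simp: Nk_def)
  have Nk_tail: "tail f (Nk k) \<le> (1 / 4) ^ k * (1 / 4) ^ k" for k
    using tail(3)[OF g0_le] g0 by (rule order_trans)
  define \<Delta> where "\<Delta> k t = L2_norm PM (\<lambda>x. GS f (Nk (Suc k)) t x - GS f (Nk k) t x)" for k t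
  have "AE t in TM. \<exists>B\<ge>0. \<forall>k. (\<Delta> k t)\<^sup>2 \<le> B * (1 / 4) ^ k"
  proof (rule AE_geometric[where C=1])
    show "(\<lambda>t. (\<Delta> k t)\<^sup>2) \<in> borel_measurable TM" for k unfolding \<Delta>_def by (rule GS_diff(1)[OF f Nk_Suc])
    show "(\<integral>\<^sup>+t. ennreal ((\<Delta> k t)\<^sup>2) \<partial>TM) \<le> ennreal (1 * (1 / 4) ^ k * (1 / 4) ^ k)" for k
    proof -
      have "(\<integral>\<^sup>+t. ennreal ((\<Delta> k t)\<^sup>2) \<partial>TM) \<le> ennreal (tail f (Nk k))" unfolding \<Delta>_def by (rule GS_diff(2)[OF f Nk_Suc])
      also have "\<dots> \<le> ennreal (1 * (1 / 4) ^ k * (1 / 4) ^ k)" using Nk_tail[of k] by (intro ennreal_leI) simp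
      finally show ?thesis .
    qed
  qed auto
  then have AEc: "AE t in TM. \<exists>g\<in>L2 PM. (\<lambda>k. L2_norm PM (\<lambda>x. GS f (Nk k) t x - g x)) \<longlonglongrightarrow> 0"
  proof eventually_elim
    case (elim t)
    then obtain B where B: "B \<ge> 0" "\<And>k. (\<Delta> k t)\<^sup>2 \<le> B * (1 / 4) ^ k" by blast
    have "\<Delta> k t \<le> sqrt B * (1 / 2) ^ k" for k
    proof (rule power2_le_imp_le)
      have "(sqrt B * (1 / 2) ^ k)\<^sup>2 = B * ((1 / 2) ^ k)\<^sup>2" using B(1) by (simp add: power_mult_distrib)
      also have "((1 / 2) ^ k)\<^sup>2 = ((1 / 4) ^ k :: real)"
        by (simp add: power2_eq_square flip: power_mult_distrib)
      finally show "(\<Delta> k t)\<^sup>2 \<le> (sqrt B * (1 / 2) ^ k)\<^sup>2" using B(2)[of k] by simp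
    qed (use B in simp)
    then obtain g where "g \<in> L2 PM" "(\<lambda>k. L2_norm PM (\<lambda>x. GS f (Nk k) t x - g x)) \<longlonglongrightarrow> 0"
      using L2_complete_geometric[of "\<lambda>k. GS f (Nk k) t" PM "sqrt B"] GS_L2[OF f] B(1) unfolding \<Delta>_def by auto
    then show ?case by blast
  qed
  define P where "P t g \<longleftrightarrow> g \<in> L2 PM \<and> (\<lambda>k. L2_norm PM (\<lambda>x. GS f (Nk k) t x - g x)) \<longlonglongrightarrow> 0" for t g
  \<comment> \<open>Membership in \<open>L2_fibres\<close> concerns every t, so exceptional t
    receive the value 0.\<close>
  define F where "F t = (if \<exists>g. P t g then SOME g. P t g else (\<lambda>x. 0))" for t
  have PF: "P t (F t)" if "\<exists>g. P t g" for t using someI_ex[OF that] that by (simp add: F_def)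
  have F_L2: "F t \<in> L2 PM" for t
    using PF[of t] zero_L2[of PM] by (cases "\<exists>g. P t g") (auto simp: P_def[of t "F t"], simp add: F_def)
  have F_lim: "AE t in TM. (\<lambda>k. L2_norm PM (\<lambda>x. GS f (Nk k) t x - F t x)) \<longlonglongrightarrow> 0"
    using AEc
  proof eventually_elim
    case (elim t)
    then have "\<exists>g. P t g" by (auto simp: P_def)
    from PF[OF this] show ?case by (simp add: P_def)
  qed
  have bound: "(\<integral>\<^sup>+t. ennreal ((L2_norm PM (\<lambda>x. GS f N t x - F t x))\<^sup>2) \<partial>TM) \<le> ennreal (tail f N)" for N
  proof (rule nn_integral_liminf_bound)
    \<comment> \<open>The subsequence is shifted by N so that all of its indices are at least
      N.\<close>
    have N: "N \<le> Nk (k + N)" for k using Nk_ge[of "k + N"] by simp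
    show "(\<lambda>t. (L2_norm PM (\<lambda>x. GS f (Nk (k + N)) t x - GS f N t x))\<^sup>2) \<in> borel_measurable TM" for k
      by (rule GS_diff(1)[OF f N])
    show "(\<integral>\<^sup>+t. ennreal ((L2_norm PM (\<lambda>x. GS f (Nk (k + N)) t x - GS f N t x))\<^sup>2) \<partial>TM) \<le> ennreal (tail f N)" for k
      by (rule GS_diff(2)[OF f N])
    show "AE t in TM. (\<lambda>k. (L2_norm PM (\<lambda>x. GS f (Nk (k + N)) t x - GS f N t x))\<^sup>2) \<longlonglongrightarrow> (L2_norm PM (\<lambda>x. GS f N t x - F t x))\<^sup>2"
      using F_lim
    proof eventually_elim
      case (elim t)
      have "(\<lambda>k. L2_norm PM (\<lambda>x. GS f (Nk (k + N)) t x - F t x)) \<longlonglongrightarrow> 0"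
        by (rule LIMSEQ_ignore_initial_segment[OF elim])
      from L2_norm_diff_tendsto[OF GS_L2[OF f] F_L2 GS_L2[OF f] this, of N t]
      show ?case unfolding L2_norm_diff_commute[of PM "GS f N t" "F t"] by (intro tendsto_intros)
    qed
  qed
  have fin: "(\<integral>\<^sup>+t. ennreal ((L2_norm PM (F t))\<^sup>2) \<partial>TM) \<le> ennreal ((L2_norm LM f)\<^sup>2)"
  proof (rule nn_integral_liminf_bound)
    show "(\<lambda>t. (L2_norm PM (GS f (Nk k) t))\<^sup>2) \<in> borel_measurable TM" for k
      using GS_norm_measurable[OF f] by measurable
    show "(\<integral>\<^sup>+t. ennreal ((L2_norm PM (GS f (Nk k) t))\<^sup>2) \<partial>TM) \<le> ennreal ((L2_norm LM f)\<^sup>2)" for k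
      unfolding GS_norm_integral[OF f] by (intro ennreal_leI shifted_sums f)
    show "AE t in TM. (\<lambda>k. (L2_norm PM (GS f (Nk k) t))\<^sup>2) \<longlonglongrightarrow> (L2_norm PM (F t))\<^sup>2"
      using F_lim by eventually_elim (intro tendsto_power L2_norm_tendsto[OF GS_L2[OF f] F_L2])
  qed
  have "\<exists>S. simple_function TM S \<and> (\<forall>t. S t \<in> L2 PM) \<and> (\<forall>t. L2_norm PM (\<lambda>x. S t x - GS f (Nk n) t x) \<le> 1 / (real n + 1))" for n
    by (rule GS_simple_approximation[OF f, of "Nk n" n]) blast
  then obtain S where S: "\<And>n. simple_function TM (S n)" "\<And>n t. S n t \<in> L2 PM"
      "\<And>n t. L2_norm PM (\<lambda>x. S n t x - GS f (Nk n) t x) \<le> 1 / (real n + 1)" by metis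
  have S_lim: "AE t in TM. (\<lambda>n. L2_norm PM (\<lambda>x. S n t x - F t x)) \<longlonglongrightarrow> 0"
    using F_lim
  proof eventually_elim
    case (elim t)
    show ?case
    proof (rule Lim_null_comparison)
      have "L2_norm PM (\<lambda>x. S n t x - F t x) \<le> 1 / (real n + 1) + L2_norm PM (\<lambda>x. GS f (Nk n) t x - F t x)" for n
        using L2_norm_diff_triangle[OF S(2)[of n t] GS_L2[OF f, of "Nk n" t] F_L2[of t]] S(3)[of n t] by linarith
      then show "\<forall>\<^sub>F n in sequentially. norm (L2_norm PM (\<lambda>x. S n t x - F t x)) \<le> 1 / (real n + 1) + L2_norm PM (\<lambda>x. GS f (Nk n) t x - F t x)"
        by (simp add: L2_norm_nonneg)
      have "(\<lambda>n. 1 / (real n + 1)) \<longlonglongrightarrow> 0" using LIMSEQ_inverse_real_of_nat by (simp add: inverse_eq_divide add.commute)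
      from tendsto_add[OF this elim] show "(\<lambda>n. 1 / (real n + 1) + L2_norm PM (\<lambda>x. GS f (Nk n) t x - F t x)) \<longlonglongrightarrow> 0" by simp
    qed
  qed
  have "F \<in> L2_fibres a w"
    unfolding L2_fibres_def using F_L2 S(1,2) S_lim le_less_trans[OF fin ennreal_less_top] by (auto intro!: exI[of _ S])
  moreover have "(\<lambda>N. \<integral>\<^sup>+t. ennreal ((L2_norm PM (\<lambda>x. GS f N t x - F t x))\<^sup>2) \<partial>TM) \<longlonglongrightarrow> 0"
  proof (rule tendsto_sandwich[OF _ _ tendsto_const])
    show "(\<lambda>N. ennreal (tail f N)) \<longlonglongrightarrow> 0" using tendsto_ennrealI[OF tail(2)[OF f]] by simp
  qed (auto intro: always_eventually bound)
  ultimately show ?thesis by blast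
qed

lemma gelfand:
  assumes "f \<in> L2 LM"
  shows "gelfand a w f \<in> L2_fibres a w"
    "(\<lambda>N. \<integral>\<^sup>+t. ennreal ((L2_norm PM (\<lambda>x. GS f N t x - gelfand a w f t x))\<^sup>2) \<partial>TM) \<longlonglongrightarrow> 0"
  using someI_ex[OF gelfand_exists[OF assms]] unfolding gelfand_def by auto

lemma gelfand_L2: "f \<in> L2 LM \<Longrightarrow> t \<in> {-pi..pi} \<Longrightarrow> gelfand a w f t \<in> L2 PM"
  using gelfand(1) by (auto simp: L2_fibres_def)

text \<open>By strong measurability, the norms of the approximating simple functions are measurable
  and converge to the norm of \<open>F\<close> almost everywhere.\<close>

lemma fibre_norm_measurable_version:
  assumes "F \<in> L2_fibres a w"
  obtains X where "X \<in> borel_measurable TM" "\<And>t. 0 \<le> X t" "AE t in TM. L2_norm PM (F t) = X t"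
proof -
  obtain S where S: "\<And>n. simple_function TM (S n)" "\<And>n t. t \<in> {-pi..pi} \<Longrightarrow> S n t \<in> L2 PM"
      "AE t in TM. (\<lambda>n. L2_norm PM (\<lambda>x. S n t x - F t x)) \<longlonglongrightarrow> 0"
    using assms unfolding L2_fibres_def by blast
  have F: "t \<in> {-pi..pi} \<Longrightarrow> F t \<in> L2 PM" for t using assms by (auto simp: L2_fibres_def)
  define X where "X t = \<bar>lim (\<lambda>n. L2_norm PM (S n t))\<bar>" for t
  have "(\<lambda>t. lim (\<lambda>n. L2_norm PM (S n t))) \<in> borel_measurable TM"
    by (intro borel_measurable_lim_metric borel_measurable_simple_function simple_function_compose1[OF S(1)])
  then have "X \<in> borel_measurable TM" unfolding X_def by measurable
  moreover have "AE t in TM. L2_norm PM (F t) = X t"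
    using S(3) AE_space
  proof eventually_elim
    case (elim t)
    then have t: "t \<in> {-pi..pi}" by simp
    have "(\<lambda>n. L2_norm PM (S n t)) \<longlonglongrightarrow> L2_norm PM (F t)"
      by (rule L2_norm_tendsto[OF S(2)[OF t] F[OF t] elim(1)])
    then show ?case by (simp add: X_def limI L2_norm_nonneg)
  qed
  ultimately show thesis using that by (simp add: X_def)
qed

text \<open>Parseval's identity holds for the partial sums, and their norms differ from that of the
  transform by at most the norm of the difference. Measurability of this last norm is not
  established, hence the limit by \<open>nn_integral_square_limit\<close>.\<close>

lemma gelfand_isometry:
  assumes f: "f \<in> L2 LM" and X: "X \<in> borel_measurable TM" "\<And>t. 0 \<le> X t" "AE t in TM. L2_norm PM (gelfand a w f t) = X t"
  shows "(\<integral>\<^sup>+t. ennreal ((X t)\<^sup>2) \<partial>TM) = ennreal ((L2_norm LM f)\<^sup>2)"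
proof (rule nn_integral_square_limit[OF X(1) GS_norm_measurable[OF f] X(2) L2_norm_nonneg _ _ gelfand(2)[OF f]])
  have est: "\<bar>L2_norm PM (GS f N t) - L2_norm PM (gelfand a w f t)\<bar> \<le> L2_norm PM (\<lambda>x. GS f N t x - gelfand a w f t x)"
    if "t \<in> {-pi..pi}" for N t by (rule L2_norm_minus_le[OF GS_L2[OF f] gelfand_L2[OF f that]])
  fix N
  show "AE t in TM. X t \<le> L2_norm PM (GS f N t) + L2_norm PM (\<lambda>x. GS f N t x - gelfand a w f t x)"
    using X(3) AE_space
  proof eventually_elim
    case (elim t) then show ?case using est[of t N] by simp
  qed
  show "AE t in TM. L2_norm PM (GS f N t) \<le> X t + L2_norm PM (\<lambda>x. GS f N t x - gelfand a w f t x)"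
    using X(3) AE_space
  proof eventually_elim
    case (elim t) then show ?case using est[of t N] by simp
  qed
next
  show "(\<lambda>N. \<integral>\<^sup>+t. ennreal ((L2_norm PM (GS f N t))\<^sup>2) \<partial>TM) \<longlonglongrightarrow> ennreal ((L2_norm LM f)\<^sup>2)"
    unfolding GS_norm_integral[OF f] by (intro tendsto_ennrealI shifted_sums f)
qed

section \<open>Critical points\<close>

text \<open>The isometry is applied to f and to g = E(\<Delta>) f, with the fibrewise bound in
  between; over [-\<pi>, \<pi>] the constant K contributes 2 \<pi> K^2. If no g has the prescribed
  transform, the choice operator returns a fixed function, whose norm is the first term of the
  maximum.\<close>

lemma spectral_function_norm_le:
  assumes fp: "\<And>t f \<phi>. f \<in> L2 PM \<Longrightarrow> \<phi> \<in> L2 PM \<Longrightarrow> (AE x in PM. \<phi> x = fibre_projection a w p q \<Delta> t f x)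
      \<Longrightarrow> L2_norm PM \<phi> \<le> max K (C * L2_norm PM f)"
    and C: "C \<ge> 0" and f: "f \<in> L2 LM" "L2_norm LM f \<le> 1"
  shows "L2_norm LM (spectral_function a w p q \<Delta> f) \<le> max (L2_norm LM (SOME g. False)) (sqrt (2 * pi * K\<^sup>2 + C\<^sup>2))"
proof -
  define P where "P g \<longleftrightarrow> g \<in> L2 LM \<and> (AE t in TM. AE x in PM. gelfand a w g t x = fibre_projection a w p q \<Delta> t (gelfand a w f t) x)" for g
  have eq: "spectral_function a w p q \<Delta> f = (SOME g. P g)"
    by (simp add: spectral_function_def gelfand_inv_def P_def)
  show ?thesis
  proof (cases "\<exists>g. P g")
    case False
    then have "P = (\<lambda>g. False)" by auto
    then show ?thesis unfolding eq by simp
  next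
    case True
    define g where "g = (SOME g. P g)"
    have "P g" unfolding g_def by (rule someI_ex[OF True])
    then have g: "g \<in> L2 LM" "AE t in TM. AE x in PM. gelfand a w g t x = fibre_projection a w p q \<Delta> t (gelfand a w f t) x"
      by (auto simp: P_def)
    obtain X where X: "X \<in> borel_measurable TM" "\<And>t. 0 \<le> X t" "AE t in TM. L2_norm PM (gelfand a w f t) = X t"
      by (rule fibre_norm_measurable_version[OF gelfand(1)[OF f(1)]]) blast
    obtain Y where Y: "Y \<in> borel_measurable TM" "\<And>t. 0 \<le> Y t" "AE t in TM. L2_norm PM (gelfand a w g t) = Y t"
      by (rule fibre_norm_measurable_version[OF gelfand(1)[OF g(1)]]) blast
    have YX: "AE t in TM. ennreal ((Y t)\<^sup>2) \<le> ennreal (K\<^sup>2) + ennreal (C\<^sup>2) * ennreal ((X t)\<^sup>2)"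
      using g(2) X(3) Y(3) AE_space
    proof eventually_elim
      case (elim t)
      then have t: "t \<in> {-pi..pi}" by simp
      have "Y t \<le> max K (C * X t)"
        using fp[OF gelfand_L2[OF f(1) t] gelfand_L2[OF g(1) t] elim(1)] elim(2,3) by simp
      then consider "Y t \<le> K" | "Y t \<le> C * X t" by fastforce
      \<comment> \<open>The maximum is replaced by a sum of squares, which can be integrated
        termwise.\<close>
      then have "(Y t)\<^sup>2 \<le> K\<^sup>2 + (C * X t)\<^sup>2"
      proof cases
        case 1 then show ?thesis using power_mono[OF 1 Y(2), of 2] by (simp add: add_increasing2)
      next
        case 2 then show ?thesis using power_mono[OF 2 Y(2), of 2] by (simp add: add_increasing)
      qed
      then have "ennreal ((Y t)\<^sup>2) \<le> ennreal (K\<^sup>2 + C\<^sup>2 * (X t)\<^sup>2)" by (intro ennreal_leI) (simp add: power_mult_distrib)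
      then show ?case by (simp add: ennreal_mult)
    qed
    have "ennreal ((L2_norm LM g)\<^sup>2) = (\<integral>\<^sup>+t. ennreal ((Y t)\<^sup>2) \<partial>TM)"
      by (rule gelfand_isometry[OF g(1) Y, symmetric])
    also have "\<dots> \<le> (\<integral>\<^sup>+t. ennreal (K\<^sup>2) + ennreal (C\<^sup>2) * ennreal ((X t)\<^sup>2) \<partial>TM)"
      by (rule nn_integral_mono_AE[OF YX])
    also have "\<dots> = (\<integral>\<^sup>+t. ennreal (K\<^sup>2) \<partial>TM) + (\<integral>\<^sup>+t. ennreal (C\<^sup>2) * ennreal ((X t)\<^sup>2) \<partial>TM)"
      using X(1) by (intro nn_integral_add) measurable
    also have "(\<integral>\<^sup>+t. ennreal (K\<^sup>2) \<partial>TM) = ennreal (K\<^sup>2) * emeasure lebesgue {-pi..pi}"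
      by (simp add: emeasure_restrict_space)
    also have "\<dots> = ennreal (2 * pi * K\<^sup>2)" by (simp add: mult.commute flip: ennreal_mult)
    also have "(\<integral>\<^sup>+t. ennreal (C\<^sup>2) * ennreal ((X t)\<^sup>2) \<partial>TM) = ennreal (C\<^sup>2) * (\<integral>\<^sup>+t. ennreal ((X t)\<^sup>2) \<partial>TM)"
      using X(1) by (intro nn_integral_cmult) measurable
    also have "\<dots> = ennreal (C\<^sup>2) * ennreal ((L2_norm LM f)\<^sup>2)"
      by (simp only: gelfand_isometry[OF f(1) X])
    also have "\<dots> \<le> ennreal (C\<^sup>2)"
      using f(2) by (simp add: ennreal_mult[symmetric] ennreal_leI mult_left_le power_le_one L2_norm_nonneg)
    finally have "ennreal ((L2_norm LM g)\<^sup>2) \<le> ennreal (2 * pi * K\<^sup>2) + ennreal (C\<^sup>2)" by simp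
    then have "ennreal ((L2_norm LM g)\<^sup>2) \<le> ennreal (2 * pi * K\<^sup>2 + C\<^sup>2)" by simp
    then have "(L2_norm LM g)\<^sup>2 \<le> 2 * pi * K\<^sup>2 + C\<^sup>2" by (subst (asm) ennreal_le_iff) auto
    then have "L2_norm LM g \<le> sqrt (2 * pi * K\<^sup>2 + C\<^sup>2)" by (rule real_le_rsqrt)
    then show ?thesis unfolding eq g_def by simp
  qed
qed

lemma spectral_function_bound:
  obtains R where "R > 0" "\<forall>z0. norm z0 > R \<longrightarrow> (\<exists>r>0. \<exists>B. \<forall>\<Delta>. \<Delta> \<subseteq> ball z0 r \<longrightarrow> L2_opnorm LM (spectral_function a w p q \<Delta>) \<le> ennreal B)"
proof -
  obtain R where R: "R > 0" "\<forall>z0. norm z0 > R \<longrightarrow> (\<exists>r>0. \<exists>C\<ge>0. \<exists>K. \<forall>\<Delta> t f \<phi>. \<Delta> \<subseteq> ball z0 r \<longrightarrow> f \<in> L2 PM \<longrightarrow> \<phi> \<in> L2 PM \<longrightarrow>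
     (AE x in PM. \<phi> x = fibre_projection a w p q \<Delta> t f x) \<longrightarrow> L2_norm PM \<phi> \<le> max K (C * L2_norm PM f))"
    by (rule fibre_projection_bound)
  have "\<exists>r>0. \<exists>B. \<forall>\<Delta>. \<Delta> \<subseteq> ball z0 r \<longrightarrow> L2_opnorm LM (spectral_function a w p q \<Delta>) \<le> ennreal B" if z0: "norm z0 > R" for z0
  proof -
    obtain r C K where r: "r > 0" and C: "C \<ge> 0" and fp: "\<forall>\<Delta> t f \<phi>. \<Delta> \<subseteq> ball z0 r \<longrightarrow> f \<in> L2 PM \<longrightarrow> \<phi> \<in> L2 PM \<longrightarrow>
       (AE x in PM. \<phi> x = fibre_projection a w p q \<Delta> t f x) \<longrightarrow> L2_norm PM \<phi> \<le> max K (C * L2_norm PM f)"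
      using R(2) z0 by meson
    have "L2_opnorm LM (spectral_function a w p q \<Delta>) \<le> ennreal (max (L2_norm LM (SOME g. False)) (sqrt (2 * pi * K\<^sup>2 + C\<^sup>2)))"
      if "\<Delta> \<subseteq> ball z0 r" for \<Delta>
      unfolding L2_opnorm_def
      by (rule SUP_least, rule ennreal_leI, rule spectral_function_norm_le[OF _ C]) (use fp that in blast, auto)
    then show ?thesis using r by blast
  qed
  then show thesis using R(1) that by blast
qed

lemma critical_point_zero: "z \<in> critical_points a w p q \<Longrightarrow> deriv D z = 0"
  by (simp add: critical_points_def D_discriminant)

theorem singular_critical_points_finite: "finite (singular_critical_points a w p q)"
proof -
  obtain R where R: "R > 0" "\<forall>z0. norm z0 > R \<longrightarrow> (\<exists>r>0. \<exists>B. \<forall>\<Delta>. \<Delta> \<subseteq> ball z0 r \<longrightarrow> L2_opnorm LM (spectral_function a w p q \<Delta>) \<le> ennreal B)"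
    by (rule spectral_function_bound)
  have "regular_critical_point a w p q z0" if z0: "z0 \<in> critical_points a w p q" "norm z0 > R" for z0
  proof -
    obtain r B where r: "r > 0" and B: "\<forall>\<Delta>. \<Delta> \<subseteq> ball z0 r \<longrightarrow> L2_opnorm LM (spectral_function a w p q \<Delta>) \<le> ennreal B"
      using R(2) z0(2) by meson
    \<comment> \<open>Critical points are zeros of the derivative of \<open>D\<close>, of which this
      disc, containing the unit disc around z0, has only finitely many.\<close>
    obtain d where d: "d > 0" "\<forall>z\<in>{z \<in> cball 0 (norm z0 + 1). deriv D z = 0}. z \<noteq> z0 \<longrightarrow> d \<le> dist z0 z"
      using finite_set_avoid[OF critical_zeros_finite[of "norm z0 + 1"], of z0] by auto
    \<comment> \<open>d / 2 keeps the closed disc away from the other critical points, and 1 keeps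
      it inside the region where \<open>d\<close> was determined.\<close>
    define s where "s = min r (min (d / 2) 1)"
    have s: "s > 0" "s \<le> r" "s < d" "s \<le> 1" using r d(1) by (auto simp: s_def)
    have "z = z0" if "z \<in> closure (ball z0 s)" "z \<in> critical_points a w p q" for z
    proof (rule ccontr)
      assume ne: "z \<noteq> z0"
      have z: "dist z0 z \<le> s" using that(1) s(1) by simp
      then have "norm (z - z0) \<le> 1" using s(4) by (simp add: dist_norm norm_minus_commute)
      then have "norm z \<le> norm z0 + 1" using norm_triangle_sub[of z z0] by linarith
      then have "d \<le> dist z0 z" using d(2) ne critical_point_zero[OF that(2)] by (simp add: dist_norm)
      then show False using z s(3) by simp
    qed
    then have cl: "closure (ball z0 s) \<inter> critical_points a w p q = {z0}" using z0(1) s(1) by auto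
    have "\<Delta> \<subseteq> ball z0 s \<Longrightarrow> L2_opnorm LM (spectral_function a w p q \<Delta>) \<le> ennreal B" for \<Delta>
      using B subset_ball[OF s(2)] by blast
    then have "(SUP (J, \<gamma>)\<in>{(J, \<gamma>). regular_spectral_curve a w p q J \<gamma> \<and> z0 \<in> top_of_set (op_spectrum LM (maximal_op w p q)) frontier_of (\<gamma> ` J)}.
           SUP \<Delta>\<in>{\<Delta> \<in> borel_subsets0 (\<gamma> ` J). \<Delta> \<subseteq> ball z0 s}. L2_opnorm LM (spectral_function a w p q \<Delta>)) \<le> ennreal B"
      by (auto intro!: SUP_least)
    then have "(SUP (J, \<gamma>)\<in>{(J, \<gamma>). regular_spectral_curve a w p q J \<gamma> \<and> z0 \<in> top_of_set (op_spectrum LM (maximal_op w p q)) frontier_of (\<gamma> ` J)}.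
           SUP \<Delta>\<in>{\<Delta> \<in> borel_subsets0 (\<gamma> ` J). \<Delta> \<subseteq> ball z0 s}. L2_opnorm LM (spectral_function a w p q \<Delta>)) < \<infinity>"
      unfolding infinity_ennreal_def by (rule le_less_trans[OF _ ennreal_less_top])
    moreover have "open (ball z0 s)" "connected (ball z0 s)" "z0 \<in> ball z0 s" using s(1) by auto
    ultimately show ?thesis unfolding regular_critical_point_def using z0(1) cl by blast
  qed
  then have "singular_critical_points a w p q \<subseteq> {z \<in> cball 0 R. deriv D z = 0}"
    by (auto simp: singular_critical_points_def critical_point_zero not_less[symmetric] dist_norm)
  then show ?thesis by (rule finite_subset[OF _ critical_zeros_finite])
qed

end

theorem corollary4p8:
  fixes a :: real and w p q :: "real \<Rightarrow> real"
  assumes "a > 0"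
    and "w \<in> borel_measurable lebesgue"
    and "p \<in> borel_measurable lebesgue"
    and "q \<in> borel_measurable lebesgue"
    and "\<forall>x. w (x + a) = w x"
    and "\<forall>x. p (x + a) = p x"
    and "\<forall>x. q (x + a) = q x"
    and "set_integrable lebesgue {0<..<a} w"
    and "set_integrable lebesgue {0<..<a} q"
    and "set_integrable lebesgue {0<..<a} (\<lambda>x. inverse (p x))"
    and "AE x in lebesgue. w x \<noteq> 0"
    and "AE x in lebesgue. p x > 0"
  shows "finite (singular_critical_points a w p q)"
proof -
  interpret hill a w p q by unfold_locales (use assms in auto)
  show ?thesis by (rule singular_critical_points_finite)
qed

end
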